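(* Let $a>0$ be a constant. For each $\varepsilon>0$ let $u^{\varepsilon}$ be the Leray solution, with initial condition $u^\varepsilon_0\in L^2_\sigma(\Omega)$, of the Navier-Stokes system on the half-plane $\Omega=\mathbb{R}\times(0,+\infty)$ with viscosity $\varepsilon$, the non-penetration condition $u^\varepsilon_2|_{y=0}=0$ and the Navier condition $\frac12\partial_y u_1^\varepsilon|_{y=0}=\frac{a}{\sqrt{\varepsilon}}u_1^\varepsilon|_{y=0}$. Let $v$ be the solution of the incompressible Euler equation on $\Omega$ with initial condition $v_0$ and $v_2|_{y=0}=0$. Assume that $v_0\in H^s(\Omega)$ for some $s>2$. If $u^\varepsilon_0$ converges to $v_0$ in $L^2(\Omega)$ as $\varepsilon\to0$, then for every $T>0$, $$\sup_{t\in[0,T]}\|u^\varepsilon(t)-v(t)\|_{L^2(\Omega)}\longrightarrow 0\quad\text{as }\varepsilon\to0.$$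
   Context: $\Omega=\mathbb{R}\times(0,+\infty)$ with points $(x,y)$, and $\mathbb{R}^+=[0,+\infty)$. For a functional space $E(\Omega)$, $E_\sigma$ denotes the space of divergence-free vector fields, tangent to the boundary, belonging to $E(\Omega)$. $Su=\frac12(\nabla u+{}^t\nabla u)$, and $A:B=\sum_{i,j}A_{i,j}B_{i,j}$. The Navier-Stokes system is $\partial_t u^\varepsilon+u^\varepsilon\cdot\nabla u^\varepsilon-\varepsilon\Delta u^\varepsilon+\nabla p^\varepsilon=0$, $\mathrm{div}\,u^\varepsilon=0$ in $\mathbb{R}^+\times\Omega$, $u^\varepsilon|_{t=0}=u_0^\varepsilon$, with boundary conditions $u_2^\varepsilon(t,x,0)=0$ and $\frac12\partial_y u_1^\varepsilon(t,x,0)=\frac{a}{\sqrt\varepsilon}u_1^\varepsilon(t,x,0)$. A Leray solution of this system is $u^\varepsilon:\mathbb{R}^+\times\Omega\to\mathbb{R}^2$ such that: (1) $u^\varepsilon\in C_w(\mathbb{R}^+,L^2_\sigma)\cap L^2([0,T],H^1_\sigma)$ for every $T>0$ ($C_w$: weakly continuous in time); (2) for every $\varphi\in H^1(\mathbb{R}^+,H^1_\sigma)$, $$-\int_{\mathbb{R}^+}\int_\Omega u^\varepsilon\cdot\partial_t\varphi+2a\sqrt\varepsilon\int_{\mathbb{R}^+}\int_{\partial\Omega}u^\varepsilon\cdot\varphi+2\varepsilon\int_{\mathbb{R}^+}\int_\Omega Su^\varepsilon:S\varphi-\int_{\mathbb{R}^+}\int_\Omega(u^\varepsilon\cdot\nabla\varphi)\cdot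 u^\varepsilon=\int_\Omega u^\varepsilon(0)\cdot\varphi(0),$$ with $u^\varepsilon(0)=u^\varepsilon_0$; (3) for every $t\ge0$, $$\|u^\varepsilon(t)\|_{L^2}^2+4a\sqrt\varepsilon\int_0^t\int_{\partial\Omega}|u^\varepsilon|^2+4\varepsilon\int_0^t\int_\Omega|Su^\varepsilon|^2\le\|u^\varepsilon(0)\|_{L^2}^2.$$ For fixed $\varepsilon>0$ such solutions are known to exist globally in time and to be unique in two dimensions. The Euler equation is $\partial_t v+v\cdot\nabla v+\nabla q=0$, $\mathrm{div}\,v=0$, $v|_{t=0}=v_0$, $v_2|_{y=0}=0$ (so $v_0$ is divergence-free and tangent to the boundary). For $v_0\in H^s(\Omega)$, $s>2$, the classical global-in-time solution $v$ is known to exist and be unique, with $v\in L^\infty([0,T],H^s(\Omega))$ for every $T>0$. *)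

theory Defs
  imports "HOL-Analysis.Analysis"
begin

type_synonym point = "real \<times> real"

type_synonym field = "point \<Rightarrow> real \<times> real"

definition half_plane :: "point set"  (\<open>\<Omega>\<close>)
  where "\<Omega> = UNIV \<times> {0<..}"

subsection \<open>Square-integrable functions\<close>

text \<open>
  Functions are not quotiented by almost-everywhere equality; every notion below depends only on
  the almost-everywhere class of its arguments, unless it is explicitly pointwise.
\<close>

definition L2 :: "'x measure \<Rightarrow> ('x \<Rightarrow> 'b::euclidean_space) set"
  where "L2 M = {f \<in> borel_measurable M. integrable M (\<lambda>z. (norm (f z))\<^sup>2)}"

definition L2_inner :: "'x measure \<Rightarrow> ('x \<Rightarrow> 'b::euclidean_space) \<Rightarrow> ('x \<Rightarrow> 'b) \<Rightarrow> real"
  where "L2_inner M f g = (LINT z|M. f z \<bullet> g z)"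

definition L2_norm :: "'x measure \<Rightarrow> ('x \<Rightarrow> 'b::euclidean_space) \<Rightarrow> real"
  where "L2_norm M f = sqrt (LINT z|M. (norm (f z))\<^sup>2)"

subsection \<open>Test functions and weak derivatives\<close>

definition partial :: "'a::euclidean_space \<Rightarrow> ('a \<Rightarrow> 'b::real_normed_vector) \<Rightarrow> 'a \<Rightarrow> 'b"
  where "partial i f z = frechet_derivative f (at z) i"

text \<open>
  A list of basis vectors plays the role of a multi-index: \<open>partials [i, j] f\<close> is the iterated
  partial derivative of \<open>f\<close> in direction \<open>j\<close> and then \<open>i\<close>.
\<close>

definition partials :: "'a::euclidean_space list \<Rightarrow> ('a \<Rightarrow> 'b::real_normed_vector) \<Rightarrow> 'a \<Rightarrow> 'b"
  where "partials ds f = foldr partial ds f"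

definition smooth :: "('a::euclidean_space \<Rightarrow> 'b::real_normed_vector) \<Rightarrow> bool"
  where "smooth f \<longleftrightarrow> (\<forall>ds. set ds \<subseteq> Basis \<longrightarrow> partials ds f differentiable_on UNIV)"

definition test_functions :: "'a::euclidean_space set \<Rightarrow> ('a \<Rightarrow> 'b::real_normed_vector) set"
  where "test_functions U =
    {\<psi>. smooth \<psi> \<and> compact (closure {z. \<psi> z \<noteq> 0}) \<and> closure {z. \<psi> z \<noteq> 0} \<subseteq> U}"

definition has_weak_deriv ::
    "point list \<Rightarrow> (point \<Rightarrow> 'b::euclidean_space) \<Rightarrow> (point \<Rightarrow> 'b) \<Rightarrow> bool"
  where "has_weak_deriv ds f g \<longleftrightarrow>
    f \<in> L2 (lebesgue_on \<Omega>) \<and> g \<in> L2 (lebesgue_on \<Omega>) \<and>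
    (\<forall>\<psi> \<in> test_functions \<Omega>.
       (LINT z|lebesgue_on \<Omega>. partials ds \<psi> z *\<^sub>R f z) =
       (-1) ^ length ds *\<^sub>R (LINT z|lebesgue_on \<Omega>. (\<psi> z :: real) *\<^sub>R g z))"

definition weak_deriv :: "point list \<Rightarrow> (point \<Rightarrow> 'b::euclidean_space) \<Rightarrow> point \<Rightarrow> 'b"
  where "weak_deriv ds f = (SOME g. has_weak_deriv ds f g)"

subsection \<open>Sobolev spaces\<close>

text \<open>
  For real \<open>s = k + \<theta>\<close> with \<open>k\<close> a natural number and \<open>0 \<le> \<theta> < 1\<close>, \<open>Hs s\<close> is the
  Sobolev-Slobodeckij space: weak derivatives up to order \<open>k\<close> are in \<open>L\<^sup>2\<close> and, if
  \<open>\<theta> > 0\<close>, those of order \<open>k\<close> have a finite Gagliardo seminorm, whose kernel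
  exponent is \<open>d + 2 \<theta>\<close> in dimension \<open>d = 2\<close>.
\<close>

definition gagliardo :: "real \<Rightarrow> (point \<Rightarrow> 'b::euclidean_space) \<Rightarrow> ennreal"
  where "gagliardo \<theta> g =
    (\<integral>\<^sup>+z. (\<integral>\<^sup>+w. ennreal ((norm (g z - g w))\<^sup>2 / dist z w powr (2 + 2 * \<theta>))
       \<partial>lebesgue_on \<Omega>) \<partial>lebesgue_on \<Omega>)"

definition multi_indices :: "nat \<Rightarrow> point list set"
  where "multi_indices k = {ds. set ds \<subseteq> Basis \<and> length ds = k}"

definition Hs :: "real \<Rightarrow> (point \<Rightarrow> 'b::euclidean_space) set"
  where "Hs s = {f \<in> L2 (lebesgue_on \<Omega>).
    (\<forall>k \<le> nat \<lfloor>s\<rfloor>. \<forall>ds \<in> multi_indices k. \<exists>g. has_weak_deriv ds f g) \<and>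
    (frac s > 0 \<longrightarrow>
      (\<forall>ds \<in> multi_indices (nat \<lfloor>s\<rfloor>). gagliardo (frac s) (weak_deriv ds f) < \<infinity>))}"

definition Hs_norm :: "real \<Rightarrow> (point \<Rightarrow> 'b::euclidean_space) \<Rightarrow> real"
  where "Hs_norm s f = sqrt (
    (\<Sum>k \<le> nat \<lfloor>s\<rfloor>. \<Sum>ds \<in> multi_indices k. (L2_norm (lebesgue_on \<Omega>) (weak_deriv ds f))\<^sup>2) +
    (if frac s > 0
     then \<Sum>ds \<in> multi_indices (nat \<lfloor>s\<rfloor>). enn2real (gagliardo (frac s) (weak_deriv ds f))
     else 0))"

text \<open>
  The trace on the line \<open>y = 0\<close>: the continuous extension to \<open>Hs 1\<close> of the restriction of
  smooth functions.
\<close>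

definition has_trace :: "(point \<Rightarrow> 'b::euclidean_space) \<Rightarrow> (real \<Rightarrow> 'b) \<Rightarrow> bool"
  where "has_trace f g \<longleftrightarrow> g \<in> L2 lebesgue \<and>
    (\<exists>F :: nat \<Rightarrow> point \<Rightarrow> 'b. (\<forall>n. F n \<in> test_functions UNIV) \<and>
       (\<lambda>n. Hs_norm 1 (\<lambda>z. F n z - f z)) \<longlonglongrightarrow> 0 \<and>
       (\<lambda>n. L2_norm lebesgue (\<lambda>x. F n (x, 0) - g x)) \<longlonglongrightarrow> 0)"

definition trace_bd :: "(point \<Rightarrow> 'b::euclidean_space) \<Rightarrow> real \<Rightarrow> 'b"
  where "trace_bd f = (SOME g. has_trace f g)"

subsection \<open>Divergence-free fields tangent to the boundary\<close>

text \<open>Note that \<open>frechet_derivative \<psi> (at z) (u z)\<close> is \<open>u z \<bullet> \<nabla>\<psi> z\<close>.\<close>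

definition divergence_free :: "field \<Rightarrow> bool"
  where "divergence_free u \<longleftrightarrow>
    (\<forall>\<psi> \<in> test_functions \<Omega>.
       (LINT z|lebesgue_on \<Omega>. (frechet_derivative \<psi> (at z) (u z) :: real)) = 0)"

text \<open>
  By Green's formula the normal trace of a divergence-free field in \<open>L\<^sup>2\<close> is the functional
  sending the restriction of \<open>\<psi>\<close> to the boundary to the integral of \<open>u \<bullet> \<nabla>\<psi>\<close> over
  the domain, where \<open>\<psi>\<close> need not vanish on the boundary.
\<close>

definition tangent_to_boundary :: "field \<Rightarrow> bool"
  where "tangent_to_boundary u \<longleftrightarrow>
    (\<forall>\<psi> \<in> test_functions UNIV.
       (LINT z|lebesgue_on \<Omega>. (frechet_derivative \<psi> (at z) (u z) :: real)) = 0)"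

definition solenoidal :: "field set \<Rightarrow> field set"
  where "solenoidal E = {u \<in> E. divergence_free u \<and> tangent_to_boundary u}"

abbreviation L2_sigma :: "field set"
  where "L2_sigma \<equiv> solenoidal (L2 (lebesgue_on \<Omega>))"

abbreviation H1_sigma :: "field set"
  where "H1_sigma \<equiv> solenoidal (Hs 1)"

subsection \<open>Functions of time with values in a function space\<close>

text \<open>
  In this subsection, \<open>X\<close> is a function space with norm \<open>N\<close>, and \<open>I\<close> is a time interval.
  Strong (Bochner) measurability is almost-everywhere approximability by simple functions.
\<close>

definition strongly_measurable ::
    "real set \<Rightarrow> ('x \<Rightarrow> 'b) set \<Rightarrow> (('x \<Rightarrow> 'b) \<Rightarrow> real) \<Rightarrow> (real \<Rightarrow> 'x \<Rightarrow> 'b::euclidean_space) \<Rightarrow> bool"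
  where "strongly_measurable I X N f \<longleftrightarrow>
    (\<exists>S :: nat \<Rightarrow> real \<Rightarrow> 'x \<Rightarrow> 'b.
       (\<forall>n. simple_function (lebesgue_on I) (S n) \<and> S n ` I \<subseteq> X) \<and>
       (AE t in lebesgue_on I. f t \<in> X \<and> (\<lambda>n. N (\<lambda>z. S n t z - f t z)) \<longlonglongrightarrow> 0))"

definition time_L2 ::
    "real set \<Rightarrow> ('x \<Rightarrow> 'b) set \<Rightarrow> (('x \<Rightarrow> 'b) \<Rightarrow> real) \<Rightarrow> (real \<Rightarrow> 'x \<Rightarrow> 'b::euclidean_space) set"
  where "time_L2 I X N =
    {f. strongly_measurable I X N f \<and> integrable (lebesgue_on I) (\<lambda>t. (N (f t))\<^sup>2)}"

definition time_Linf ::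
    "real set \<Rightarrow> ('x \<Rightarrow> 'b) set \<Rightarrow> (('x \<Rightarrow> 'b) \<Rightarrow> real) \<Rightarrow> (real \<Rightarrow> 'x \<Rightarrow> 'b::euclidean_space) set"
  where "time_Linf I X N =
    {f. strongly_measurable I X N f \<and> (\<exists>C. AE t in lebesgue_on I. N (f t) \<le> C)}"

text \<open>
  \<open>has_time_deriv \<phi> \<phi>'\<close> says that \<open>\<phi>\<close> belongs to \<open>H\<^sup>1(\<real>\<^sup>+, H\<^sup>1\<^sub>\<sigma>)\<close>, is the representative
  that is continuous in time (so that \<open>\<phi> 0\<close> makes sense), and has weak time derivative
  \<open>\<phi>'\<close>. The identity between vector-valued integrals defining \<open>\<phi>'\<close> is tested against
  elements of \<open>L\<^sup>2\<close>.
\<close>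

definition has_time_deriv :: "(real \<Rightarrow> field) \<Rightarrow> (real \<Rightarrow> field) \<Rightarrow> bool"
  where "has_time_deriv \<phi> \<phi>' \<longleftrightarrow>
    \<phi> \<in> time_L2 {0..} H1_sigma (Hs_norm 1) \<and>
    \<phi>' \<in> time_L2 {0..} H1_sigma (Hs_norm 1) \<and>
    (\<forall>t \<ge> 0. \<phi> t \<in> H1_sigma \<and>
       ((\<lambda>r. Hs_norm 1 (\<lambda>z. \<phi> r z - \<phi> t z)) \<longlongrightarrow> 0) (at t within {0..})) \<and>
    (\<forall>\<eta> \<in> test_functions {0<..}. \<forall>g \<in> L2 (lebesgue_on \<Omega>).
       (LINT t|lebesgue_on {0..}. deriv \<eta> t * L2_inner (lebesgue_on \<Omega>) (\<phi> t) g) =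
       - (LINT t|lebesgue_on {0..}. \<eta> t * L2_inner (lebesgue_on \<Omega>) (\<phi>' t) g))"

definition weakly_continuous :: "(real \<Rightarrow> field) \<Rightarrow> bool"
  where "weakly_continuous u \<longleftrightarrow>
    (\<forall>g \<in> L2 (lebesgue_on \<Omega>). continuous_on {0..} (\<lambda>t. L2_inner (lebesgue_on \<Omega>) (u t) g))"

subsection \<open>Leray solutions of the Navier-Stokes system\<close>

definition strain :: "field \<Rightarrow> point \<Rightarrow> point \<Rightarrow> point \<Rightarrow> real"
  where "strain u i j z = (weak_deriv [i] u z \<bullet> j + weak_deriv [j] u z \<bullet> i) / 2"

definition strain_inner :: "field \<Rightarrow> field \<Rightarrow> real"
  where "strain_inner u w =
    (LINT z|lebesgue_on \<Omega>. (\<Sum>i\<in>Basis. \<Sum>j\<in>Basis. strain u i j z * strain w i j z))"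

definition boundary_inner :: "field \<Rightarrow> field \<Rightarrow> real"
  where "boundary_inner u w = L2_inner lebesgue (trace_bd u) (trace_bd w)"

definition trilinear :: "field \<Rightarrow> field \<Rightarrow> field \<Rightarrow> real"
  where "trilinear u w u' =
    (LINT z|lebesgue_on \<Omega>. (\<Sum>i\<in>Basis. (u z \<bullet> i) *\<^sub>R weak_deriv [i] w z) \<bullet> u' z)"

text \<open>
  In the weak formulation the integrals over \<open>\<real>\<^sup>+\<close> are limits of integrals over \<open>[0,T]\<close>: for
  \<open>u\<close> bounded in \<open>L\<^sup>2\<close> and \<open>\<phi>\<close> in \<open>H\<^sup>1(\<real>\<^sup>+, H\<^sup>1\<^sub>\<sigma>)\<close>, the integrand of the first term need
  not be absolutely integrable in time. The limit agrees with the integral whenever it is.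
\<close>

definition leray_solution :: "real \<Rightarrow> real \<Rightarrow> field \<Rightarrow> (real \<Rightarrow> field) \<Rightarrow> bool"
  where "leray_solution a \<epsilon> u0 u \<longleftrightarrow>
    (\<forall>t \<ge> 0. u t \<in> L2_sigma) \<and> weakly_continuous u \<and>
    (\<forall>T > 0. u \<in> time_L2 {0..T} H1_sigma (Hs_norm 1)) \<and>
    (AE z in lebesgue_on \<Omega>. u 0 z = u0 z) \<and>
    (\<forall>\<phi> \<phi>'. has_time_deriv \<phi> \<phi>' \<longrightarrow>
      ((\<lambda>T. - (LINT t|lebesgue_on {0..T}. L2_inner (lebesgue_on \<Omega>) (u t) (\<phi>' t))
            + 2 * a * sqrt \<epsilon> * (LINT t|lebesgue_on {0..T}. boundary_inner (u t) (\<phi> t))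
            + 2 * \<epsilon> * (LINT t|lebesgue_on {0..T}. strain_inner (u t) (\<phi> t))
            - (LINT t|lebesgue_on {0..T}. trilinear (u t) (\<phi> t) (u t)))
         \<longlongrightarrow> L2_inner (lebesgue_on \<Omega>) (u 0) (\<phi> 0)) at_top) \<and>
    (\<forall>t \<ge> 0.
      (L2_norm (lebesgue_on \<Omega>) (u t))\<^sup>2
        + 4 * a * sqrt \<epsilon> * (LINT r|lebesgue_on {0..t}. boundary_inner (u r) (u r))
        + 4 * \<epsilon> * (LINT r|lebesgue_on {0..t}. strain_inner (u r) (u r))
      \<le> (L2_norm (lebesgue_on \<Omega>) (u 0))\<^sup>2)"

subsection \<open>Classical solutions of the Euler equation\<close>

text \<open>
  Classical means that \<open>v\<close> is continuously differentiable in time and space up to the boundary,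
  with a pressure \<open>q\<close> whose gradient is continuous, so that the equations hold pointwise.
\<close>

definition euler_solution :: "real \<Rightarrow> field \<Rightarrow> (real \<Rightarrow> field) \<Rightarrow> bool"
  where "euler_solution s v0 v \<longleftrightarrow>
    (\<forall>T > 0. v \<in> time_Linf {0..T} (Hs s) (Hs_norm s)) \<and>
    (AE z in lebesgue_on \<Omega>. v 0 z = v0 z) \<and>
    (\<exists>(vt :: real \<Rightarrow> field) (Dv :: real \<Rightarrow> point \<Rightarrow> point \<Rightarrow>\<^sub>L (real \<times> real))
       (q :: real \<Rightarrow> point \<Rightarrow> real) (grad_q :: real \<Rightarrow> field).
       continuous_on ({0..} \<times> closure \<Omega>) (\<lambda>(t, z). v t z) \<and>
       continuous_on ({0..} \<times> closure \<Omega>) (\<lambda>(t, z). vt t z) \<and>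
       continuous_on ({0..} \<times> closure \<Omega>) (\<lambda>(t, z). Dv t z) \<and>
       continuous_on ({0..} \<times> closure \<Omega>) (\<lambda>(t, z). grad_q t z) \<and>
       (\<forall>t \<ge> 0. \<forall>z \<in> closure \<Omega>.
          ((\<lambda>r. v r z) has_vector_derivative vt t z) (at t within {0..}) \<and>
          (v t has_derivative blinfun_apply (Dv t z)) (at z within closure \<Omega>) \<and>
          (q t has_derivative (\<lambda>h. grad_q t z \<bullet> h)) (at z within closure \<Omega>) \<and>
          vt t z + blinfun_apply (Dv t z) (v t z) + grad_q t z = 0 \<and>
          (\<Sum>i\<in>Basis. blinfun_apply (Dv t z) i \<bullet> i) = 0) \<and>
       (\<forall>t \<ge> 0. \<forall>x. snd (v t (x, 0)) = 0))"

end

theory Submission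
  imports Defs
begin

text \<open>
 The proof compares the two flows through the energy of their difference,
 \<open>y(t) = \<parallel>u(t) - v(t)\<parallel>\<^sup>2 = \<parallel>u(t)\<parallel>\<^sup>2 - 2 \<langle>u(t), v(t)\<rangle> + \<parallel>v(t)\<parallel>\<^sup>2\<close>. The first term is controlled by the energy inequality
 of the Leray solution, the last one by conservation of energy for the Euler flow, and the middle one by
 using \<open>v\<close> as a test function in the weak formulation. No boundary layer has to be described: with the
 Navier condition the boundary term of the weak formulation carries the factor \<open>\<surd>\<epsilon>\<close>, so that Young's inequality
 absorbs the boundary and viscous terms that contain \<open>u\<close> in the dissipation, and leaves terms in \<open>v\<close>
 alone, of size \<open>\<surd>\<epsilon> + \<epsilon>\<close>. The convective terms add up to
 \<open>\<integral> ((u - v) \<bullet> \<nabla>v) \<bullet> (u - v)\<close>, because \<open>w \<bullet> \<nabla>(|v|\<^sup>2/2)\<close> has integral zero for every solenoidal \<open>w\<close>; this is at most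
 a multiple of \<open>y(t)\<close> as soon as \<open>\<nabla>v\<close> is bounded. Gronwall's inequality gives
 \<open>y(t) \<le> C (y(0) + \<surd>\<epsilon> + \<epsilon>)\<close> on \<open>[0, T]\<close>, with \<open>C\<close> independent of \<open>\<epsilon>\<close>. The lemmas \<open>relative_energy_inequality\<close>,
 \<open>flow_convective_error\<close> and \<open>inviscid_error_bound\<close> contain this argument.

 Most of the work makes these formal steps rigorous. The bound on \<open>\<nabla>v\<close>, uniform on \<open>[0, T]\<close>, is the Sobolev
 embedding for \<open>s > 2\<close> (\<open>gradient_bound\<close>). It is obtained for mollifications of \<open>v(t)\<close>, by a two-variable
 fundamental theorem of calculus or, if only a fractional derivative is available beyond the second order,
 by interpolating between scales. The mollifiers are
 supported above the origin, which makes the mollified fields smooth up to the boundary. The pressure drops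
 out because a gradient in \<open>L\<^sup>2\<close> is orthogonal to solenoidal fields even if its potential is not square
 integrable (\<open>gradient_orthogonal\<close>, by a Poincare inequality on large rectangles).

 Finally, \<open>v\<close> is not known to be an admissible time-dependent test function, since its time derivative is not
 known to be in \<open>H\<^sup>1\<close>. Instead, only stationary fields are tested (\<open>leray_stationary_test\<close>): \<open>v\<close> is
 replaced on each interval of a subdivision of \<open>[0, t]\<close> by its value at the left end, the increments of
 \<open>\<langle>u, v\<rangle>\<close> are summed, and the subdivision is refined (\<open>telescoping_limit\<close>).
\<close>

text \<open>
 Short forms: \<open>\<mu>\<close> is Lebesgue measure on the half-plane, \<open>nrm\<close> and \<open>ip\<close> are the norm and the inner product of
 \<open>L\<^sup>2(\<Omega>)\<close>, and \<open>NN\<close> binds the variable of a nonnegative integral over a whole Euclidean space.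
\<close>

abbreviation (input) half_plane_measure :: "point measure"  (\<open>\<mu>\<close>)
  where "\<mu> \<equiv> lebesgue_on \<Omega>"

abbreviation (input) nrm :: "(point \<Rightarrow> 'b::euclidean_space) \<Rightarrow> real"
  where "nrm \<equiv> L2_norm \<mu>"

abbreviation (input) ip :: "(point \<Rightarrow> 'b::euclidean_space) \<Rightarrow> (point \<Rightarrow> 'b) \<Rightarrow> real"
  where "ip \<equiv> L2_inner \<mu>"

abbreviation (input) nn_lborel :: "('a::euclidean_space \<Rightarrow> ennreal) \<Rightarrow> ennreal"  (binder \<open>NN \<close> 10)
  where "nn_lborel f \<equiv> integral\<^sup>N lborel f"

abbreviation (input) tends_to :: "(nat \<Rightarrow> 'a::topological_space) \<Rightarrow> 'a \<Rightarrow> bool"  (infixr \<open>~~>\<close> 60)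
  where "X ~~> l \<equiv> (X \<longlongrightarrow> l) sequentially"

notation (input) scaleR  (infixr \<open>*.\<close> 75)

lemmas bochner_cong = Bochner_Integration.integral_cong

lemmas time_subinterval = Equivalence_Lebesgue_Henstock_Integration.integrable_subinterval

section \<open>Square-integrable functions\<close>

lemma L2_measurable [measurable_dest]: "f : L2 M ==> f : borel_measurable M"
 by (simp add: L2_def)

lemma L2_integrable_sq: "f : L2 M ==> integrable M (%z. (norm (f z))^2)"
 by (simp add: L2_def)

lemma L2_norm_nonneg [simp]: "0 <= L2_norm M f"
 by (simp add: L2_norm_def)

lemma L2_norm_sq: "(L2_norm M f)^2 = (LINT z|M. (norm (f z))^2)"
 by (simp add: L2_norm_def)

lemma L2_dominated:
 assumes "f : borel_measurable M" "integrable M h" "AE z in M. (norm (f z))^2 <= h z"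
 shows "f : L2 M"
 unfolding L2_def
 using assms by (auto intro!: Bochner_Integration.integrable_bound[OF assms(2)] elim!: AE_mp)

lemma norm_add_sq_le: "(norm (a + b))^2 <= 2 * (norm a)^2 + 2 * (norm (b::'a::real_normed_vector))^2"
proof -
 have "(norm (a + b))^2 <= (norm a + norm b)^2"
  by (intro power_mono norm_triangle_ineq) auto
 also have "... <= 2 * (norm a)^2 + 2 * (norm b)^2"
  using sum_squares_bound[of "norm a" "norm b"] by (simp add: power2_sum)
 finally show ?thesis .
qed

lemma L2_add:
 assumes "f : L2 M" "g : L2 M"
 shows "(%z. f z + g z) : L2 M"
proof (rule L2_dominated)
 show "integrable M (%z. 2 * (norm (f z))^2 + 2 * (norm (g z))^2)"
  using assms by (auto simp: L2_def)
qed (use assms norm_add_sq_le in \<open>auto simp: L2_def\<close>)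

lemma L2_scaleR: "f : L2 M ==> (%z. c *. f z) : L2 M"
 by (auto simp: L2_def power_mult_distrib)

lemma L2_uminus: "f : L2 M ==> (%z. - f z) : L2 M"
 using L2_scaleR[of f M "-1"] by simp

lemma L2_diff: "f : L2 M ==> g : L2 M ==> (%z. f z - g z) : L2 M"
 using L2_add[of f M "%z. - g z"] L2_uminus[of g M] by simp

lemma L2_zero [simp]: "(%z. 0) : L2 M"
 by (simp add: L2_def)

lemma L2_norm_integrand: "f : L2 M ==> (%z. norm (f z)) : L2 M"
 by (auto simp: L2_def)

lemma L2_norm_norm [simp]: "L2_norm M (%z. norm (f z)) = L2_norm M f"
 by (simp add: L2_norm_def)

lemma L2_bounded_mult:
 fixes a :: "'x => real"
 assumes "f : L2 M" "a : borel_measurable M" "!!z. z : space M ==> \<bar>a z\<bar> <= C"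
 shows "(%z. a z *. f z) : L2 M"
proof (rule L2_dominated)
 show "integrable M (%z. C\<^sup>2 * (norm (f z))^2)" using assms by (auto simp: L2_def)
 show "AE z in M. (norm (a z *. f z))^2 <= C\<^sup>2 * (norm (f z))^2"
 proof (rule AE_I2)
  fix z assume "z : space M"
  then have "\<bar>a z\<bar>\<^sup>2 <= C\<^sup>2" using assms(3) by (intro power_mono) auto
  then show "(norm (a z *. f z))^2 <= C\<^sup>2 * (norm (f z))^2"
   by (simp add: power_mult_distrib mult_right_mono)
 qed
qed (use assms in \<open>auto simp: L2_def\<close>)

lemma L2_inner_component: "f : L2 M ==> (%z. f z \<bullet> i) : L2 M"
proof (rule L2_dominated)
 assume "f : L2 M"
 then show "integrable M (%z. (norm i)^2 * (norm (f z))^2)" by (auto simp: L2_def)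
 show "AE z in M. (norm (f z \<bullet> i))^2 <= (norm i)^2 * (norm (f z))^2"
 proof (rule AE_I2)
  fix z
  have "(norm (f z \<bullet> i))^2 <= (norm (f z) * norm i)^2"
   using Cauchy_Schwarz_ineq2[of "f z" i] by (metis norm_ge_zero power_mono real_norm_def)
  then show "(norm (f z \<bullet> i))^2 <= (norm i)^2 * (norm (f z))^2"
   by (simp add: power_mult_distrib mult.commute)
 qed
qed (auto simp: L2_def)

lemma L2_norm_mult_integrable:
 assumes "f : L2 M" "g : L2 M"
 shows "integrable M (%z. norm (f z) * norm (g z))"
proof (rule Bochner_Integration.integrable_bound)
 show "integrable M (%z. (norm (f z))^2 + (norm (g z))^2)"
  using assms by (auto simp: L2_def)
 show "AE z in M. norm (norm (f z) * norm (g z)) <= norm ((norm (f z))^2 + (norm (g z))^2)"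
 proof (rule AE_I2)
  fix z
  have "norm (f z) * norm (g z) <= (norm (f z))^2 + (norm (g z))^2"
   using sum_squares_bound[of "norm (f z)" "norm (g z)"]
    mult_nonneg_nonneg[OF norm_ge_zero[of "f z"] norm_ge_zero[of "g z"]]
   by linarith
  then show "norm (norm (f z) * norm (g z)) <= norm ((norm (f z))^2 + (norm (g z))^2)"
   by (simp add: abs_mult)
 qed
qed (use assms in \<open>auto simp: L2_def\<close>)

lemma L2_bilinear_integrable:
 fixes h :: "'x => 'c::euclidean_space"
 assumes "f : L2 M" "g : L2 M" "h : borel_measurable M"
  and "!!z. z : space M ==> norm (h z) <= C * (norm (f z) * norm (g z))"
 shows "integrable M h"
proof (rule Bochner_Integration.integrable_bound)
 show "integrable M (%z. C * (norm (f z) * norm (g z)))"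
  by (intro integrable_mult_right L2_norm_mult_integrable assms)
 show "AE z in M. norm (h z) <= norm (C * (norm (f z) * norm (g z)))"
  using assms(4) by (intro AE_I2) (smt (verit) real_norm_def)
qed (rule assms(3))

lemma L2_inner_integrable:
 assumes "f : L2 M" "g : L2 M"
 shows "integrable M (%z. f z \<bullet> g z)"
 by (rule L2_bilinear_integrable[OF assms, where C=1])
   (use assms in \<open>auto simp: L2_def Cauchy_Schwarz_ineq2\<close>)

lemma L2_scaleR_integrable:
 fixes f :: "'x => real"
 assumes "f : L2 M" "g : L2 M"
 shows "integrable M (%z. f z *. g z)"
 by (rule L2_bilinear_integrable[OF assms, where C=1])
   (use assms in \<open>auto simp: L2_def\<close>)

lemma L2_norm_mult_le:
 assumes f: "f : L2 M" and g: "g : L2 M"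
 shows "(LINT z|M. norm (f z) * norm (g z)) <= L2_norm M f * L2_norm M g"
proof -
 let ?I = "LINT z|M. norm (f z) * norm (g z)"
 have [measurable]: "f : borel_measurable M" "g : borel_measurable M"
  using assms by (auto simp: L2_def)
 have int: "integrable M (%z. norm (f z) * norm (g z))" by (rule L2_norm_mult_integrable[OF f g])
 have "(\<integral>\<^sup>+z. ennreal (norm (f z)) * ennreal (norm (g z)) \<partial>M)^2
   <= (\<integral>\<^sup>+z. ennreal (norm (f z)) ^ 2 \<partial>M) * (\<integral>\<^sup>+z. ennreal (norm (g z)) ^ 2 \<partial>M)"
  by (rule Cauchy_Schwarz_nn_integral) auto
 moreover have "(\<integral>\<^sup>+z. ennreal (norm (f z)) * ennreal (norm (g z)) \<partial>M) = ennreal ?I"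
  by (subst nn_integral_eq_integral[OF int, symmetric]) (auto simp: ennreal_mult)
 moreover have "(\<integral>\<^sup>+z. ennreal (norm (f z)) ^ 2 \<partial>M) = ennreal ((L2_norm M f)^2)"
  by (subst L2_norm_sq, subst nn_integral_eq_integral[OF L2_integrable_sq[OF f], symmetric])
    (auto simp: ennreal_power)
 moreover have "(\<integral>\<^sup>+z. ennreal (norm (g z)) ^ 2 \<partial>M) = ennreal ((L2_norm M g)^2)"
  by (subst L2_norm_sq, subst nn_integral_eq_integral[OF L2_integrable_sq[OF g], symmetric])
    (auto simp: ennreal_power)
 ultimately have "ennreal (?I\<^sup>2) <= ennreal ((L2_norm M f)^2 * (L2_norm M g)^2)"
  by (simp add: ennreal_power ennreal_mult integral_nonneg_AE)
 then have "?I\<^sup>2 <= (L2_norm M f * L2_norm M g)^2"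
  by (simp add: power_mult_distrib)
 then show ?thesis by (rule power2_le_imp_le) simp
qed

lemma L2_bilinear_bound:
 fixes h :: "'x => 'c::euclidean_space"
 assumes f: "f : L2 M" and g: "g : L2 M"
  and "!!z. z : space M ==> norm (h z) <= C * (norm (f z) * norm (g z))"
  and "0 <= C"
 shows "norm (LINT z|M. h z) <= C * (L2_norm M f * L2_norm M g)"
proof -
 have "norm (LINT z|M. h z) <= (LINT z|M. C * (norm (f z) * norm (g z)))"
 proof (cases "integrable M h")
  case True
  have "norm (LINT z|M. h z) <= (LINT z|M. norm (h z))" by (rule integral_norm_bound)
  also have "... <= (LINT z|M. C * (norm (f z) * norm (g z)))"
   using L2_norm_mult_integrable[OF f g] True assms(3) by (intro integral_mono) auto
  finally show ?thesis .
 next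
  case False
  then show ?thesis using assms(4) by (simp add: not_integrable_integral_eq integral_nonneg_AE)
 qed
 also have "... = C * (LINT z|M. norm (f z) * norm (g z))" by simp
 also have "... <= C * (L2_norm M f * L2_norm M g)"
  using L2_norm_mult_le[OF f g] assms(4) by (rule mult_left_mono)
 finally show ?thesis .
qed

lemma L2_inner_bound:
 assumes f: "f : L2 M" and g: "g : L2 M"
 shows "\<bar>L2_inner M f g\<bar> <= L2_norm M f * L2_norm M g"
 using L2_bilinear_bound[OF f g, of "%z. f z \<bullet> g z" 1]
 by (simp add: L2_inner_def Cauchy_Schwarz_ineq2)

lemma L2_inner_commute: "L2_inner M f g = L2_inner M g f"
 by (simp add: L2_inner_def inner_commute)

lemma L2_inner_diff_left:
 assumes "f : L2 M" "g : L2 M" "h : L2 M"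
 shows "L2_inner M (%z. f z - g z) h = L2_inner M f h - L2_inner M g h"
 using assms by (simp add: L2_inner_def inner_diff_left L2_inner_integrable)

lemma L2_inner_diff_right:
 assumes "f : L2 M" "g : L2 M" "h : L2 M"
 shows "L2_inner M h (%z. f z - g z) = L2_inner M h f - L2_inner M h g"
 using assms by (simp add: L2_inner_def inner_diff_right L2_inner_integrable)

lemma L2_inner_self: "L2_inner M f f = (L2_norm M f)^2"
 by (simp add: L2_inner_def L2_norm_sq power2_norm_eq_inner)

lemma L2_norm_diff_sq:
 assumes "f : L2 M" "g : L2 M"
 shows "(L2_norm M (%z. f z - g z))^2 = (L2_norm M f)^2 - 2 * L2_inner M f g + (L2_norm M g)^2"
 using assms L2_diff[OF assms]
 by (simp add: L2_inner_self[symmetric] L2_inner_diff_left L2_inner_diff_right L2_inner_commute[of M g f])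

lemma L2_norm_scaleR: "L2_norm M (%z. c *. f z) = \<bar>c\<bar> * L2_norm M f"
 by (simp add: L2_norm_def power_mult_distrib real_sqrt_mult)

lemma L2_norm_minus: "L2_norm M (%z. f z - g z) = L2_norm M (%z. g z - f z)"
 by (simp add: L2_norm_def norm_minus_commute)

lemma L2_norm_triangle:
 assumes f: "f : L2 M" and g: "g : L2 M"
 shows "L2_norm M (%z. f z + g z) <= L2_norm M f + L2_norm M g"
proof (rule power2_le_imp_le)
 have g': "(%z. - g z) : L2 M" by (rule L2_uminus[OF g])
 have "(L2_norm M (%z. f z + g z))^2 = (L2_norm M f)^2 + 2 * L2_inner M f g + (L2_norm M g)^2"
  using L2_norm_diff_sq[OF f g'] L2_norm_scaleR[of M "-1" g]
  by (simp add: L2_inner_def)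
 also have "... <= (L2_norm M f + L2_norm M g)^2"
  using L2_inner_bound[OF f g] by (simp add: power2_sum)
 finally show "(L2_norm M (%z. f z + g z))^2 <= (L2_norm M f + L2_norm M g)^2" .
qed simp

lemma L2_norm_triangle_diff:
 assumes "f : L2 M" "g : L2 M" "h : L2 M"
 shows "L2_norm M (%z. f z - h z) <= L2_norm M (%z. f z - g z) + L2_norm M (%z. g z - h z)"
 using L2_norm_triangle[OF L2_diff[OF assms(1,2)] L2_diff[OF assms(2,3)]] by simp

lemma L2_norm_cong_AE:
 assumes "f : borel_measurable M" "g : borel_measurable M" "AE z in M. f z = g z"
 shows "L2_norm M f = L2_norm M g"
 unfolding L2_norm_def
 by (intro arg_cong[where f=sqrt] integral_cong_AE) (use assms in auto)

lemma L2_inner_cong_AE: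
 assumes "f : borel_measurable M" "g : borel_measurable M" "f' : borel_measurable M" "g' : borel_measurable M"
  and "AE z in M. f z = f' z" "AE z in M. g z = g' z"
 shows "L2_inner M f g = L2_inner M f' g'"
 unfolding L2_inner_def
 by (intro integral_cong_AE) (use assms in auto)

lemma L2_norm_mono:
 assumes "f : borel_measurable M" "g : L2 M" "AE z in M. norm (f z) <= norm (g z)"
 shows "L2_norm M f <= L2_norm M g"
proof -
 have le: "AE z in M. (norm (f z))^2 <= (norm (g z))^2"
  using assms(3) by eventually_elim (auto intro: power_mono)
 have "f : L2 M"
  by (rule L2_dominated[OF assms(1) L2_integrable_sq[OF assms(2)] le])
 then show ?thesis
  unfolding L2_norm_def using assms le
  by (intro real_sqrt_le_mono integral_mono_AE) (auto simp: L2_def)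
qed

text \<open>
 The form of dominated convergence used throughout: the dominating function bounds the squares.
\<close>

lemma L2_dominated_convergence:
 assumes F: "!!n. F n : borel_measurable M" and f: "f : borel_measurable M"
  and h: "integrable M h"
  and bound: "!!n. AE z in M. (norm (F n z - f z))^2 <= h z"
  and lim: "AE z in M. (%n. F n z) ~~> f z"
 shows "(%n. L2_norm M (%z. F n z - f z)) ~~> 0"
proof -
 have "(%n. LINT z|M. (norm (F n z - f z))^2) ~~> (LINT z|M. 0)"
 proof (rule integral_dominated_convergence)
  show "AE z in M. (%n. (norm (F n z - f z))^2) ~~> 0"
   using lim
  proof eventually_elim
   case (elim z)
   then have "(%n. (norm (F n z - f z))^2) ~~> (norm (f z - f z))^2"
    by (intro tendsto_intros)
   then show ?case by simp
  qed
  show "AE z in M. norm ((norm (F n z - f z))^2) <= h z" for n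
   using bound[of n] by simp
 qed (use F f h in measurable)
 then have "(%n. sqrt (LINT z|M. (norm (F n z - f z))^2)) ~~> sqrt 0"
  by (intro tendsto_real_sqrt) simp
 then show ?thesis by (simp add: L2_norm_def)
qed

lemma L2_norm_limit_zero:
 assumes "f : L2 M" "!!n. F n : L2 M" "(%n. L2_norm M (%z. F n z - f z)) ~~> 0"
  "(%n. L2_norm M (%z. F n z - g z)) ~~> 0" "g : L2 M"
 shows "AE z in M. f z = g z"
proof -
 have "L2_norm M (%z. f z - g z) <= 0"
 proof (rule LIMSEQ_le_const)
  show "(%n. L2_norm M (%z. F n z - f z) + L2_norm M (%z. F n z - g z)) ~~> 0"
   using tendsto_add[OF assms(3,4)] by simp
  show "\<exists>N. \<forall>n\<ge>N. L2_norm M (%z. f z - g z)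
    <= L2_norm M (%z. F n z - f z) + L2_norm M (%z. F n z - g z)"
   using L2_norm_triangle_diff[OF assms(1) assms(2) assms(5)] by (auto simp: L2_norm_minus[of M f])
 qed
 then have "(L2_norm M (%z. f z - g z))^2 = 0"
  using L2_norm_nonneg[of M "%z. f z - g z"] by simp
 then have "AE z in M. (norm (f z - g z))^2 = 0"
  unfolding L2_norm_sq
  using L2_integrable_sq[OF L2_diff[OF assms(1,5)]] integral_nonneg_eq_0_iff_AE[of M "%z. (norm (f z - g z))^2"] by auto
 then show ?thesis by auto
qed

section \<open>The half-plane and Borel representatives\<close>

lemma half_plane_borel [measurable]: "\<Omega> : sets borel"
 by (simp add: half_plane_def borel_open open_Times)

lemma open_half_plane: "open \<Omega>"
 by (simp add: half_plane_def open_Times)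

lemma half_plane_lebesgue [simp]: "\<Omega> : sets lebesgue"
 using half_plane_borel by (simp add: sets_completionI_sets)

lemma closure_half_plane: "closure \<Omega> = UNIV \<times> {0..}"
 by (simp add: half_plane_def closure_Times)

lemma convex_closure_half_plane: "convex (closure \<Omega>)"
 unfolding closure_half_plane by (intro convex_Times convex_UNIV convex_real_interval)

lemma mem_half_plane: "z : \<Omega> \<longleftrightarrow> snd z > 0"
 by (cases z) (simp add: half_plane_def)

lemma mem_closure_half_plane: "z : closure \<Omega> \<longleftrightarrow> snd z \<ge> 0"
 by (cases z) (simp add: closure_half_plane)

lemma AE_lebesgue_on_half_plane:
 "(AE z in \<mu>. P z) \<longleftrightarrow> (AE z in lborel. z : \<Omega> \<longrightarrow> P z)"
proof -
 have "(AE z in \<mu>. P z) \<longleftrightarrow> (AE z in lebesgue. z : \<Omega> \<longrightarrow> P z)"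
  using half_plane_lebesgue by (subst AE_restrict_space_iff) auto
 then show ?thesis by (simp add: AE_completion_iff)
qed

lemma measurable_lborel_imp_lebesgue_on:
 assumes "f : borel_measurable (borel::'a::euclidean_space measure)"
 shows "f : borel_measurable (lebesgue_on S)"
 using assms by (simp add: measurable_completion measurable_restrict_space1)

lemma integrable_half_plane_iff:
 fixes f :: "point => 'b::euclidean_space"
 assumes [measurable]: "f : borel_measurable borel"
 shows "integrable \<mu> f \<longleftrightarrow> integrable lborel (%z. indicator \<Omega> z *. f z)"
 by (subst integrable_restrict_space, simp, subst integrable_completion) auto

lemma integral_half_plane:
 fixes f :: "point => 'b::euclidean_space"
 assumes [measurable]: "f : borel_measurable borel"
 shows "(LINT z|\<mu>. f z) = (LINT z|lborel. indicator \<Omega> z *. f z)"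
 by (subst integral_restrict_space, simp, subst integral_completion) auto

lemma ex_borel_representative:
 fixes f :: "'a::euclidean_space => 'b::euclidean_space"
 assumes "f : borel_measurable lebesgue"
 shows "\<exists>g. g : borel_measurable borel \<and> (AE z in lborel. f z = g z)"
proof -
 have "\<forall>i. \<exists>g. g : borel_measurable borel \<and> (AE z in lborel. f z \<bullet> i = g z)"
 proof
  fix i
  have "(%z. f z \<bullet> i) : borel_measurable lebesgue" using assms by measurable
  from completion_ex_borel_measurable_real[OF this]
  show "\<exists>g. g : borel_measurable borel \<and> (AE z in lborel. f z \<bullet> i = g z)" by auto
 qed
 then obtain g where g: "!!i. g i : borel_measurable borel" "!!i. AE z in lborel. f z \<bullet> i = g i z"
  by metis
 have [measurable]: "(%z. \<Sum>i\<in>Basis. g i z *. i) : borel_measurable borel" using g(1) by measurable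
 have "AE z in lborel. \<forall>i\<in>Basis. f z \<bullet> i = g i z"
  using g(2) by (intro AE_finite_allI) auto
 then have "AE z in lborel. f z = (\<Sum>i\<in>Basis. g i z *. i)"
 proof eventually_elim
  case (elim z)
  have "f z = (\<Sum>i\<in>Basis. (f z \<bullet> i) *. i)" by (simp add: euclidean_representation)
  with elim show ?case by simp
 qed
 with g show ?thesis by (intro exI[of _ "%z. \<Sum>i\<in>Basis. g i z *. i"]) auto
qed

text \<open>
 Fubini's theorem and translations are available for the Borel product measure, so an element
 of \<open>L\<^sup>2(\<Omega>)\<close> is replaced by a Borel representative, extended by zero to the whole plane.
\<close>

lemma L2_half_plane_representative:
 fixes f :: "point => 'b::euclidean_space"
 assumes f: "f : L2 \<mu>"
 obtains g where "g : borel_measurable borel" "g : L2 lborel" "!!z. z \<notin> \<Omega> ==> g z = 0"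
  "AE z in \<mu>. f z = g z"
proof -
 have "(%z. if z : \<Omega> then f z else 0) : borel_measurable lebesgue"
  using f half_plane_lebesgue by (intro borel_measurable_if_I) (auto simp: L2_def)
 from ex_borel_representative[OF this] obtain g0 where
  g0 [measurable]: "g0 : borel_measurable borel"
  and ae: "AE z in lborel. (if z : \<Omega> then f z else 0) = g0 z" by auto
 let ?g = "%z. indicator \<Omega> z *. g0 z"
 have m: "?g : borel_measurable borel" by measurable
 have e: "AE z in \<mu>. f z = ?g z"
  unfolding AE_lebesgue_on_half_plane using ae by eventually_elim auto
 have "integrable \<mu> (%z. (norm (?g z))^2)"
  using L2_integrable_sq[OF f]
  by (rule integrable_cong_AE_imp)
    (use e m in \<open>auto intro!: measurable_lborel_imp_lebesgue_on elim: AE_mp\<close>)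
 then have "integrable lborel (%z. indicator \<Omega> z *. (norm (?g z))^2)"
  by (subst (asm) integrable_half_plane_iff) (use m in auto)
 moreover have "(%z. indicator \<Omega> z *. (norm (?g z))^2) = (%z. (norm (?g z))^2)"
  by (auto simp: indicator_def)
 ultimately have "?g : L2 lborel" using m by (simp add: L2_def)
 with m e show ?thesis by (intro that[of ?g]) auto
qed

lemma L2_lborel_imp_half_plane:
 fixes f :: "point => 'b::euclidean_space"
 assumes "f : L2 lborel"
 shows "f : L2 \<mu>"
proof -
 have [measurable]: "f : borel_measurable borel" using assms by (auto simp: L2_def)
 have "integrable lborel (%z. indicator \<Omega> z *. (norm (f z))^2)"
  by (rule Bochner_Integration.integrable_bound[OF L2_integrable_sq[OF assms]]) (auto simp: indicator_def)
 then show ?thesis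
  by (auto simp: L2_def integrable_half_plane_iff intro!: measurable_lborel_imp_lebesgue_on)
qed

lemma L2_norm_half_plane_le:
 fixes f :: "point => 'b::euclidean_space"
 assumes "f : L2 lborel"
 shows "nrm f <= L2_norm lborel f"
proof -
 have [measurable]: "f : borel_measurable borel" using assms by (auto simp: L2_def)
 have "(LINT z|lborel. indicator \<Omega> z *. (norm (f z))^2) <= (LINT z|lborel. (norm (f z))^2)"
  by (rule integral_mono_AE')
    (use L2_integrable_sq[OF assms] in \<open>auto simp: indicator_def\<close>)
 then show ?thesis
  unfolding L2_norm_def by (subst integral_half_plane) auto
qed

lemma L2_norm_half_plane_eq:
 fixes f :: "point => 'b::euclidean_space"
 assumes "f : L2 lborel" "!!z. z \<notin> \<Omega> ==> f z = 0"
 shows "nrm f = L2_norm lborel f"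
proof -
 have [measurable]: "f : borel_measurable borel" using assms by (auto simp: L2_def)
 have "(%z. indicator \<Omega> z *. (norm (f z))^2) = (%z. (norm (f z))^2)"
  using assms(2) by (auto simp: indicator_def fun_eq_iff)
 then show ?thesis
  unfolding L2_norm_def by (subst integral_half_plane) auto
qed

section \<open>Continuity of translations in the square-integrable functions\<close>

lemma lborel_integral_translate:
 fixes f :: "'a::euclidean_space => 'b::euclidean_space"
 assumes [measurable]: "f : borel_measurable borel"
 shows "(LINT z|lborel. f (z + h)) = (LINT z|lborel. f z)"
 by (subst (2) lborel_distr_plus[of h, symmetric], subst integral_distr) (auto simp: add.commute)

lemma lborel_integrable_translate:
 fixes f :: "'a::euclidean_space => 'b::euclidean_space"
 assumes [measurable]: "f : borel_measurable borel"
 shows "integrable lborel (%z. f (z + h)) \<longleftrightarrow> integrable lborel f"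
 by (subst (2) lborel_distr_plus[of h, symmetric], subst integrable_distr_eq) (auto simp: add.commute)

lemma lborel_nn_integral_translate:
 fixes f :: "'a::euclidean_space => ennreal"
 assumes [measurable]: "f : borel_measurable borel"
 shows "(NN z. f (z + h)) = (NN z. f z)"
 by (subst (2) lborel_distr_plus[of h, symmetric], subst nn_integral_distr) (auto simp: add.commute)

lemma L2_translate:
 fixes f :: "'a::euclidean_space => 'b::euclidean_space"
 assumes "f : L2 lborel"
 shows "(%z. f (z + h)) : L2 lborel"
proof -
 have [measurable]: "f : borel_measurable borel" using assms by (auto simp: L2_def)
 show ?thesis
  using assms lborel_integrable_translate[of "%z. (norm (f z))^2" h] by (auto simp: L2_def)
qed

lemma L2_norm_translate:
 fixes f :: "'a::euclidean_space => 'b::euclidean_space"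
 assumes "f : L2 lborel"
 shows "L2_norm lborel (%z. f (z + h)) = L2_norm lborel f"
proof -
 have [measurable]: "f : borel_measurable borel" using assms by (auto simp: L2_def)
 show ?thesis
  using lborel_integral_translate[of "%z. (norm (f z))^2" h] by (auto simp: L2_norm_def)
qed

text \<open>
 Continuous functions that vanish outside a ball are dense in \<open>L\<^sup>2\<close>. They are found by
 truncating twice: the function itself, in space and in size, and then the continuous functions
 that converge to it almost everywhere, so that dominated convergence applies both times.
\<close>

lemma continuous_dense_L2:
 fixes f :: "'a::euclidean_space => 'b::euclidean_space"
 assumes f: "f : L2 lborel" and e: "e > 0"
 obtains g R where "continuous_on UNIV g" "!!z. norm z > R ==> g z = 0" "g : L2 lborel"
  "L2_norm lborel (%z. f z - g z) < e"
proof -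
 have [measurable]: "f : borel_measurable borel" using f by (auto simp: L2_def)
 define B :: "nat => 'a set" where "B k = cball 0 (real k)" for k
 have [measurable]: "B k : sets borel" for k by (simp add: B_def)
 define F where "F k z = (if z : B k \<and> norm (f z) <= real k then f z else 0)" for k z
 have F [measurable]: "F k : borel_measurable borel" for k
  unfolding F_def by measurable
 have "(%k. L2_norm lborel (%z. F k z - f z)) ~~> 0"
 proof (rule L2_dominated_convergence[OF _ _ L2_integrable_sq[OF f]])
  show "AE z in lborel. (%k. F k z) ~~> f z"
  proof (rule AE_I2)
   fix z
   obtain K where K: "norm z <= real K" "norm (f z) <= real K"
    using real_arch_simple[of "max (norm z) (norm (f z))"] by auto
   have "F k z = f z" if "k \<ge> K" for k
    using K that by (auto simp: F_def B_def)
   then show "(%k. F k z) ~~> f z"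
    by (intro tendsto_eventually eventually_sequentiallyI)
  qed
 qed (auto simp: F_def)
 from LIMSEQ_D[OF this, of "e/2"] e obtain k where k: "L2_norm lborel (%z. F k z - f z) < e/2"
  by auto
 have Fk2: "F k : L2 lborel"
  by (rule L2_dominated[OF _ L2_integrable_sq[OF f]]) (auto simp: F_def)
 have "F k measurable_on UNIV"
  by (subst measurable_on_iff_borel_measurable) (auto simp: lebesgue_on_UNIV_eq intro: measurable_completion)
 then obtain N g where N: "negligible N" and g: "!!n. continuous_on UNIV (g n)"
  and lim: "!!z. z \<notin> N ==> (%n. g n z) ~~> F k z"
  by (auto simp: measurable_on_def)
 \<comment> \<open>the radial retraction onto the ball of radius \<open>k + 1\<close>, and a cutoff equal to 1 on \<open>B k\<close>\<close>
 define r :: "'b => 'b" where "r y = ((real k + 1) / max (real k + 1) (norm y)) *. y" for y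
 define c :: "'a => real" where "c z = max 0 (min 1 (k + 1 - norm z))" for z
 define G where "G n z = c z *. r (g n z)" for n z
 have contr: "continuous_on UNIV r" unfolding r_def by (intro continuous_intros) auto
 have norm_r: "norm (r y) <= real k + 1" for y
 proof -
  have "norm (r y) = (real k + 1) * (norm y / max (real k + 1) (norm y))" by (simp add: r_def)
  also have "... <= (real k + 1) * 1" by (intro mult_left_mono) (auto simp: divide_le_eq)
  finally show ?thesis by simp
 qed
 have r_id: "r y = y" if "norm y <= k" for y
  using that by (simp add: r_def max_def)
 have contG: "continuous_on UNIV (G n)" for n
  unfolding G_def c_def
  by (intro continuous_intros continuous_on_compose2[OF contr g]) auto
 have [measurable]: "G n : borel_measurable borel" for n
  by (rule borel_measurable_continuous_onI[OF contG])
 have c0: "c z = 0" if "norm z > real k + 1" for z using that by (simp add: c_def)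
 have G0: "G n z = 0" if "norm z > real k + 1" for n z using c0[OF that] by (simp add: G_def)
 have c1: "0 <= c z" "c z <= 1" for z by (auto simp: c_def)
 have normG: "norm (G n z) <= (real k + 1) * indicat_real (cball 0 (real k + 1)) z" for n z
 proof (cases "norm z > real k + 1")
  case True then show ?thesis by (simp add: G0)
 next
  case False
  have "norm (G n z) <= 1 * (real k + 1)"
   unfolding G_def norm_scaleR using c1[of z] norm_r by (intro mult_mono) auto
  with False show ?thesis by simp
 qed
 have intB: "integrable lborel (%z. C * indicat_real (cball 0 (real k + 1)) (z::'a))" for C :: real
  using emeasure_lborel_cball_finite[of "0::'a" "real k+1"] by simp
 have sq_ind: "(norm (G n z))^2 <= (real k + 1)^2 * indicat_real (cball 0 (real k + 1)) z" for n z
  using power_mono[OF normG[of n z], of 2] by (auto simp: indicator_def split: if_splits)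
 have G2: "G n : L2 lborel" for n
  by (rule L2_dominated[OF _ intB[of "(real k+1)^2"]]) (use sq_ind in auto)
 have "(%n. L2_norm lborel (%z. G n z - F k z)) ~~> 0"
 proof (rule L2_dominated_convergence)
  show "integrable lborel (%z. 2 * ((real k + 1)^2 * indicat_real (cball 0 (real k + 1)) z) + 2 * (norm (F k z))^2)"
   using intB[of "(real k+1)^2"] L2_integrable_sq[OF Fk2] by (intro Bochner_Integration.integrable_add integrable_mult_right) auto
  show "AE z in lborel. (norm (G n z - F k z))^2
    <= 2 * ((real k + 1)^2 * indicat_real (cball 0 (real k + 1)) z) + 2 * (norm (F k z))^2" for n
  proof (rule AE_I2)
   fix z
   show "(norm (G n z - F k z))^2
    <= 2 * ((real k + 1)^2 * indicat_real (cball 0 (real k + 1)) z) + 2 * (norm (F k z))^2"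
    using norm_add_sq_le[of "G n z" "- F k z"] sq_ind[of n z] by simp
  qed
  have "AE z in lborel. z \<notin> N"
   using N AE_not_in[of N lebesgue] AE_completion_iff[where M=lborel and P="%z. z \<notin> N"]
   by (auto simp: negligible_iff_null_sets)
  then show "AE z in lborel. (%n. G n z) ~~> F k z"
  proof eventually_elim
   case (elim z)
   have "(%n. c z *. r (g n z)) ~~> c z *. r (F k z)"
    by (intro tendsto_intros continuous_on_tendsto_compose[OF contr lim[OF elim]]) auto
   moreover have "c z *. r (F k z) = F k z"
    using r_id[of "F k z"] by (auto simp: F_def B_def c_def r_def)
   ultimately show ?case by (simp add: G_def)
  qed
 qed auto
 from LIMSEQ_D[OF this, of "e/2"] e obtain n where n: "L2_norm lborel (%z. G n z - F k z) < e/2"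
  by auto
 have "L2_norm lborel (%z. f z - G n z) < e"
  using L2_norm_triangle_diff[OF f Fk2 G2, of n] n k
   L2_norm_minus[of lborel "F k" f] L2_norm_minus[of lborel "G n" "F k"] by linarith
 with contG G0 G2 show ?thesis by (intro that[of "G n" "real k + 1"]) auto
qed

text \<open>
 By density it suffices to translate continuous functions with bounded support, which are uniformly continuous.
\<close>

lemma L2_translation_continuous:
 fixes f :: "'a::euclidean_space => 'b::euclidean_space"
 assumes f: "f : L2 lborel" and e: "e > 0"
 obtains d where "d > 0" "!!h. norm h < d ==> L2_norm lborel (%z. f (z + h) - f z) < e"
proof -
 obtain g R where g: "continuous_on UNIV g" "!!z. norm z > R ==> g z = 0" "g : L2 lborel"
  and fg: "L2_norm lborel (%z. f z - g z) < e/3"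
  using continuous_dense_L2[OF f, of "e/3"] e by auto
 have [measurable]: "g : borel_measurable borel"
  by (rule borel_measurable_continuous_onI[OF g(1)])
 let ?K = "cball (0::'a) (\<bar>R\<bar> + 1)"
 have fin: "emeasure lborel ?K < \<infinity>" by (rule emeasure_lborel_cball_finite)
 define m where "m = measure lborel ?K"
 define e' where "e' = e / (3 * (sqrt m + 1))"
 have m0: "m \<ge> 0" by (simp add: m_def)
 have e': "e' > 0" using e m0 by (auto simp: e'_def intro!: divide_pos_pos add_nonneg_pos)
 have "uniformly_continuous_on (cball 0 (\<bar>R\<bar> + 2)) g"
  by (rule compact_uniformly_continuous) (auto intro: continuous_on_subset[OF g(1)])
 from uniformly_continuous_onE[OF this e'] obtain d where d: "d > 0"
  "!!x x'. x : cball 0 (\<bar>R\<bar> + 2) ==> x' : cball 0 (\<bar>R\<bar> + 2) ==> dist x' x < d ==> dist (g x') (g x) < e'"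
  by metis
 show ?thesis
 proof (rule that[of "min d 1"])
  fix h :: 'a assume h: "norm h < min d 1"
  have sq: "(norm (g (z + h) - g z))^2 <= e'\<^sup>2 * indicator ?K z" for z
  proof (cases "norm z <= \<bar>R\<bar> + 1")
   case True
   have "norm (z + h) <= \<bar>R\<bar> + 2" using True h norm_triangle_ineq[of z h] by simp
   then have "dist (g (z + h)) (g z) < e'" using True h by (intro d(2)) (simp_all add: dist_norm mem_cball_0 del: mem_cball)
   then have "(norm (g (z + h) - g z))^2 <= e'\<^sup>2" by (intro power_mono) (auto simp: dist_norm)
   then show ?thesis using True by simp
  next
   case False
   have "norm (z + h) > R" using False h norm_triangle_ineq2[of z "-h"]
    by (simp add: not_le) (smt (verit))
   then show ?thesis using False g(2) by simp
  qed
  have "(LINT z|lborel. (norm (g (z + h) - g z))^2) <= (LINT z|lborel. e'\<^sup>2 * indicator ?K z)"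
   using sq fin by (intro integral_mono_AE' AE_I2) auto
  also have "... = e'\<^sup>2 * m" by (simp add: m_def)
  finally have "L2_norm lborel (%z. g (z + h) - g z) <= sqrt (e'\<^sup>2 * m)"
   unfolding L2_norm_def by (rule real_sqrt_le_mono)
  also have "... = e' * sqrt m" using e' by (simp add: real_sqrt_mult)
  also have "... < e / 3"
  proof -
   have "e' * sqrt m < e' * (sqrt m + 1)" using e' by simp
   also have "... = e / 3" using m0 by (simp add: e'_def field_simps add_nonneg_eq_0_iff)
   finally show ?thesis .
  qed
  finally have gg: "L2_norm lborel (%z. g (z + h) - g z) < e / 3" .
  have "L2_norm lborel (%z. f (z + h) - f z) <= L2_norm lborel (%z. f (z + h) - g (z + h)) + L2_norm lborel (%z. g (z + h) - f z)"
   by (intro L2_norm_triangle_diff L2_translate f g)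
  also have "... <= L2_norm lborel (%z. f (z + h) - g (z + h))
    + (L2_norm lborel (%z. g (z + h) - g z) + L2_norm lborel (%z. g z - f z))"
   using L2_norm_triangle_diff[OF L2_translate[OF g(3)] g(3) f] by simp
  also have "... < e"
   using fg gg L2_norm_translate[OF L2_diff[OF f g(3)], of h] by (simp add: L2_norm_minus[of _ g])
  finally show "L2_norm lborel (%z. f (z + h) - f z) < e" .
 qed (use d in auto)
qed

section \<open>Calculus of smooth functions\<close>

lemma partial_eq: "(f has_derivative D) (at z) ==> partial i f z = D i"
 by (simp add: partial_def frechet_derivative_at[symmetric])

text \<open>
 Smoothness speaks about all iterated partial derivatives. It therefore follows from membership in any class of
 differentiable functions that is closed under partial derivatives.
\<close>

lemma smooth_coinduct:
 assumes "P f" and diff: "!!f. P f ==> f differentiable_on UNIV"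
  and step: "!!f i. P f ==> i : Basis ==> P (partial i f)"
 shows "smooth f"
proof -
 have "set ds \<subseteq> Basis ==> P (partials ds f)" for ds
  by (induction ds) (auto simp: partials_def \<open>P f\<close> step)
 then show ?thesis by (auto simp: smooth_def diff)
qed

lemma smooth_partial: "smooth f ==> i : Basis ==> smooth (partial i f)"
 unfolding smooth_def
proof (intro allI impI)
 fix ds :: "'a list"
 assume "\<forall>ds. set ds \<subseteq> Basis \<longrightarrow> partials ds f differentiable_on UNIV" "i : Basis" "set ds \<subseteq> Basis"
 then have "partials (ds @ [i]) f differentiable_on UNIV" by auto
 then show "partials ds (partial i f) differentiable_on UNIV" by (simp add: partials_def)
qed

lemma smooth_differentiable_on: "smooth f ==> f differentiable_on UNIV"
 unfolding smooth_def by (drule spec[of _ "[]"]) (simp add: partials_def)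

lemma smooth_differentiable: "smooth f ==> f differentiable (at z)"
 using smooth_differentiable_on[of f] by (simp add: differentiable_on_def)

lemma smooth_has_derivative: "smooth f ==> (f has_derivative frechet_derivative f (at z)) (at z)"
 using smooth_differentiable frechet_derivative_works by blast

lemma smooth_continuous: "smooth f ==> continuous_on S f"
 using smooth_differentiable_on continuous_on_subset differentiable_imp_continuous_on by blast

lemma frechet_derivative_partial:
 assumes "f differentiable (at z)"
 shows "frechet_derivative f (at z) h = (\<Sum>i\<in>Basis. (h \<bullet> i) *. partial i f z)"
proof -
 interpret linear "frechet_derivative f (at z)" using assms by (rule linear_frechet_derivative)
 have "frechet_derivative f (at z) (\<Sum>i\<in>Basis. (h \<bullet> i) *. i) = (\<Sum>i\<in>Basis. (h \<bullet> i) *. partial i f z)"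
  by (simp only: sum scaleR partial_def)
 then show ?thesis by (simp add: euclidean_representation)
qed

lemma partial_const: "partial i (%z. c) = (%z. 0)"
 by (rule ext, subst partial_eq[OF has_derivative_const]) simp

lemma smooth_const [simp]: "smooth (%z. c)"
 by (rule smooth_coinduct[where P="%f. \<exists>c. f = (%z. c)"]) (auto simp: partial_const)

lemma partial_add:
 assumes "f differentiable_on UNIV" "g differentiable_on UNIV"
 shows "partial i (%z. f z + g z) = (%z. partial i f z + partial i g z)"
proof
 fix z
 have "((%z. f z + g z) has_derivative (%h. frechet_derivative f (at z) h + frechet_derivative g (at z) h)) (at z)"
  using assms by (intro has_derivative_add) (auto simp: differentiable_on_def frechet_derivative_works[symmetric])
 from partial_eq[OF this] show "partial i (%z. f z + g z) z = partial i f z + partial i g z"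
  by (simp add: partial_def)
qed

lemma partial_scaleR:
 fixes a :: "'a::euclidean_space => real"
 assumes "a differentiable_on UNIV" "g differentiable_on UNIV"
 shows "partial i (%z. a z *. g z) = (%z. a z *. partial i g z + partial i a z *. g z)"
proof
 fix z
 have "((%z. a z *. g z) has_derivative (%h. a z *. frechet_derivative g (at z) h + frechet_derivative a (at z) h *. g z)) (at z)"
  using assms by (intro has_derivative_scaleR) (auto simp: differentiable_on_def frechet_derivative_works[symmetric])
 from partial_eq[OF this] show "partial i (%z. a z *. g z) z = a z *. partial i g z + partial i a z *. g z"
  by (simp add: partial_def)
qed

text \<open>
 The class that witnesses smoothness of a product: the Leibniz rule turns a product into a sum of two products.
\<close>

inductive product_sum :: "('a::euclidean_space => 'b::real_normed_vector) => bool" where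
 product: "smooth (a :: 'a => real) ==> smooth g ==> product_sum (%z. a z *. g z)"
| sum: "product_sum f ==> product_sum g ==> product_sum (%z. f z + g z)"

lemma product_sum_partial:
 "product_sum f ==> f differentiable_on UNIV \<and> (\<forall>i\<in>Basis. product_sum (partial i f))"
proof (induction rule: product_sum.induct)
 case (product a g)
 then have "product_sum (%z. a z *. partial i g z + partial i a z *. g z)" if "i : Basis" for i
  using that by (intro product_sum.intros smooth_partial)
 with product show ?case
  by (auto simp: partial_scaleR smooth_differentiable_on
    intro!: differentiable_on_scaleR)
next
 case (sum f g)
 then show ?case by (auto simp: partial_add intro: product_sum.intros)
qed

lemma smooth_scaleR:
 "smooth (a :: 'a::euclidean_space => real) ==> smooth f ==> smooth (%z. a z *. f z)"
 by (rule smooth_coinduct[where P=product_sum]) (auto simp: product_sum_partial product_sum.product)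

lemma smooth_mult:
 "smooth (a :: 'a::euclidean_space => real) ==> smooth b ==> smooth (%z. a z * b z)"
 using smooth_scaleR[of a b] by simp

lemma partial_affine:
 assumes "f differentiable_on UNIV"
 shows "partial i (%z. f (c *. z + b)) = (%z. c *. partial i f (c *. z + b))"
proof
 fix z
 have f: "(f has_derivative frechet_derivative f (at (c *. z + b))) (at (c *. z + b))"
  using assms by (auto simp: differentiable_on_def frechet_derivative_works[symmetric])
 have "((%z. c *. z + b) has_derivative (%h. c *. h)) (at z)"
  by (auto intro!: derivative_eq_intros)
 from partial_eq[OF has_derivative_compose[OF this f], of i]
 have "partial i (%z. f (c *. z + b)) z = frechet_derivative f (at (c *. z + b)) (c *. i)" .
 also have "... = c *. partial i f (c *. z + b)"
  using has_derivative_linear[OF f] by (simp add: partial_def linear_cmul)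
 finally show "partial i (%z. f (c *. z + b)) z = c *. partial i f (c *. z + b)" .
qed

lemma differentiable_on_affine:
 "f differentiable_on UNIV ==> (%z. f (c *. z + b)) differentiable_on UNIV"
 unfolding differentiable_on_def
proof safe
 fix z assume "\<forall>x\<in>UNIV. f differentiable at x within UNIV"
 then have f: "(f has_derivative frechet_derivative f (at (c *. z + b))) (at (c *. z + b))"
  by (auto simp: frechet_derivative_works[symmetric])
 have "((%z. c *. z + b) has_derivative (%h. c *. h)) (at z)"
  by (auto intro!: derivative_eq_intros)
 from has_derivative_compose[OF this f] show "(%z. f (c *. z + b)) differentiable at z"
  by (auto simp: differentiable_def)
qed

lemma smooth_affine:
 fixes f :: "'a::euclidean_space => 'b::real_normed_vector"
 assumes "smooth f"
 shows "smooth (%z. f (c *. z + b))"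
proof (rule smooth_coinduct[where P="%h. \<exists>f k. smooth f \<and> h = (%z. k *. f (c *. z + b))"])
 fix h :: "'a => 'b" and i :: 'a
 assume "\<exists>f k. smooth f \<and> h = (%z. k *. f (c *. z + b))" and i: "i : Basis"
 then obtain f k where f: "smooth f" and h: "h = (%z. k *. f (c *. z + b))" by auto
 have "partial i h = (%z. (k * c) *. partial i f (c *. z + b))"
  unfolding h by (subst partial_scaleR) 
   (auto simp: partial_const partial_affine smooth_differentiable_on f
    differentiable_on_affine[OF smooth_differentiable_on[OF f]])
 then show "\<exists>f k. smooth f \<and> partial i h = (%z. k *. f (c *. z + b))"
  using smooth_partial[OF f i] by blast
next
 show "\<exists>g k. smooth g \<and> (%z. f (c *. z + b)) = (%z. k *. g (c *. z + b))"
  using assms by (intro exI[of _ f] exI[of _ 1]) simp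
next
 fix h :: "'a => 'b"
 assume "\<exists>f k. smooth f \<and> h = (%z. k *. f (c *. z + b))"
 then obtain f k where f: "smooth f" and h: "h = (%z. k *. f (c *. z + b))" by auto
 show "h differentiable_on UNIV"
  unfolding h
  by (rule differentiable_on_scaleR[OF differentiable_on_const
     differentiable_on_affine[OF smooth_differentiable_on[OF f]]])
qed

lemma smooth_compose_linear:
 fixes f :: "real => real" and l :: "'a::euclidean_space => real"
 assumes l: "bounded_linear l" and f: "smooth f"
 shows "smooth (%z. f (l z))"
proof (rule smooth_coinduct[where P="%h. \<exists>f k. smooth f \<and> h = (%z. k * f (l z))"])
 show "\<exists>g k. smooth g \<and> (%z. f (l z)) = (%z. k * g (l z))" using f by (intro exI[of _ f] exI[of _ 1]) auto
next
 fix h :: "'a => real"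
 assume "\<exists>f k. smooth f \<and> h = (%z. k * f (l z))"
 then obtain f k where f: "smooth f" and h: "h = (%z. k * f (l z))" by auto
 have D: "(h has_derivative (%y. k * frechet_derivative f (at (l z)) (l y))) (at z)" for z
  unfolding h
  by (intro has_derivative_mult_right)
    (rule has_derivative_compose[OF bounded_linear_imp_has_derivative[OF l] smooth_has_derivative[OF f]])
 then show "h differentiable_on UNIV" by (auto simp: differentiable_on_def differentiable_def)
 show "\<exists>f k. smooth f \<and> partial i h = (%z. k * f (l z))" if "i : Basis" for i
 proof (intro exI conjI)
  show "partial i h = (%z. (k * l i) * partial 1 f (l z))"
  proof
   fix z
   have "frechet_derivative f (at (l z)) (l i *. 1) = l i *. frechet_derivative f (at (l z)) 1"
    using smooth_has_derivative[OF f] has_derivative_linear linear_cmul by metis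
   then show "partial i h z = (k * l i) * partial 1 f (l z)"
    using partial_eq[OF D, of i z] by (simp add: partial_def)
  qed
  show "smooth (partial 1 f)" using smooth_partial[OF f, of 1] by simp
 qed
qed

subsection \<open>A bump\<close>

text \<open>
 The functions \<open>p(1/x) exp(-1/x)\<close> on the positive axis, with \<open>p\<close> a polynomial, extended by
 zero, form a class that is closed under differentiation.
\<close>

definition flat :: "real poly => real => real"
 where "flat p x = (if x > 0 then poly p (1 / x) * exp (- 1 / x) else 0)"

lemma poly_exp_tendsto_0: "((%t::real. poly p t * exp (- t)) \<longlongrightarrow> 0) at_top"
proof -
 have "((%t. \<Sum>i\<le>degree p. coeff p i * (t ^ i / exp t)) \<longlongrightarrow> (\<Sum>i\<le>degree p. coeff p i * 0)) at_top"
  by (intro tendsto_intros tendsto_power_div_exp_0)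
 moreover have "(%t. \<Sum>i\<le>degree p. coeff p i * (t ^ i / exp t)) = (%t. poly p t * exp (- t))"
  by (auto simp: poly_altdef sum_distrib_right exp_minus sum_divide_distrib field_simps)
 ultimately show ?thesis by simp
qed

lemma flat_derivative: "(flat p has_real_derivative flat ([:0, 0, 1:] * (p - pderiv p)) x) (at x)"
proof -
 let ?q = "[:0, 0, 1:] * (p - pderiv p)"
 consider "x > 0" | "x < 0" | "x = 0" by linarith
 then show ?thesis
 proof cases
  case 1
  have i: "((%x. 1 / x) has_real_derivative - 1 / x\<^sup>2) (at x)"
   using 1 by (auto intro!: derivative_eq_intros simp: power2_eq_square)
  have d: "((%x. poly p (1 / x) * exp (- (1 / x))) has_real_derivative
    poly (pderiv p) (1 / x) * (- 1 / x\<^sup>2) * exp (- (1 / x)) + exp (- (1 / x)) * - (- 1 / x\<^sup>2) * poly p (1 / x)) (at x)"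
   by (intro DERIV_mult DERIV_chain2[OF poly_DERIV i] DERIV_chain2[OF DERIV_exp] DERIV_minus i)
  have "((%x. poly p (1 / x) * exp (- 1 / x)) has_real_derivative flat ?q x) (at x)"
  proof -
   have "poly (pderiv p) (1 / x) * (- 1 / x\<^sup>2) * exp (- (1 / x)) + exp (- (1 / x)) * - (- 1 / x\<^sup>2) * poly p (1 / x)
     = flat ?q x"
    using 1 by (simp add: flat_def field_simps power2_eq_square)
   then show ?thesis using d by simp
  qed
  then show ?thesis
   by (rule DERIV_cong_ev[THEN iffD1, rotated 3])
    (use 1 eventually_nhds_in_open[of "{0<..}" x] in \<open>auto simp: flat_def elim!: eventually_mono\<close>)
 next
  case 2
  have "((%x. 0) has_real_derivative flat ?q x) (at x)" using 2 by (auto simp: flat_def)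
  then show ?thesis
   by (rule DERIV_cong_ev[THEN iffD1, rotated 3])
    (use 2 eventually_nhds_in_open[of "{..<0}" x] in \<open>auto simp: flat_def elim!: eventually_mono\<close>)
 next
  case 3
  have "((%x. poly (pCons 0 p) (inverse x) * exp (- inverse x)) \<longlongrightarrow> 0) (at_right 0)"
   by (rule filterlim_compose[OF poly_exp_tendsto_0 filterlim_inverse_at_top_right])
  then have "((%x. flat p x / x) \<longlongrightarrow> 0) (at_right 0)"
   by (rule Lim_transform_eventually)
     (auto simp: eventually_at_filter flat_def inverse_eq_divide)
  moreover have "((%x. flat p x / x) \<longlongrightarrow> 0) (at_left 0)"
   by (rule Lim_transform_eventually[of "%x. 0"]) (auto simp: eventually_at_filter flat_def)
  ultimately have "((%x. flat p x / x) \<longlongrightarrow> 0) (at 0)"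
   by (simp add: filterlim_at_split)
  then show ?thesis using 3 by (simp add: DERIV_def flat_def)
 qed
qed

lemma smooth_flat: "smooth (flat p)"
proof (rule smooth_coinduct[where P="%f. \<exists>p. f = flat p"])
 fix f assume "\<exists>p. f = flat p"
 then obtain p where f: "f = flat p" by auto
 have D: "(f has_derivative (%h. flat ([:0, 0, 1:] * (p - pderiv p)) x * h)) (at x)" for x
  unfolding f using flat_derivative by (simp add: has_field_derivative_def)
 then show "f differentiable_on UNIV" by (auto simp: differentiable_on_def differentiable_def)
 show "\<exists>p. partial i f = flat p" if "i : Basis" for i
  using that partial_eq[OF D] by (intro exI[of _ "[:0, 0, 1:] * (p - pderiv p)"]) auto
qed auto

text \<open>
 A bump function on the square \<open>(-1, 1) \<times> (-1, 1)\<close>, normalised to have its maximal value \<open>1\<close> at the origin.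
\<close>

definition cutoff :: "point => real"
 where "cutoff z = exp 4 * (flat 1 (1 + fst z) * flat 1 (1 - fst z) * (flat 1 (1 + snd z) * flat 1 (1 - snd z)))"

lemma flat_1_bounds: "0 <= flat 1 x" "flat 1 x = 0 \<longleftrightarrow> x <= 0"
 by (auto simp: flat_def)

lemma flat_product_le: "flat 1 (1 + x) * flat 1 (1 - x) <= exp (-2)"
proof (cases "\<bar>x\<bar> < 1")
 case True
 then have "1 + x > 0" "1 - x > 0" by auto
 moreover have "2 <= 1 / (1 + x) + 1 / (1 - x)"
 proof -
  have "1 / (1 + x) + 1 / (1 - x) = 2 / (1 - x\<^sup>2)"
   using True by (simp add: field_simps power2_eq_square)
  moreover have "1 - x\<^sup>2 > 0" using True by (simp add: abs_square_less_1)
  then have "2 / 1 <= 2 / (1 - x\<^sup>2)" by (intro divide_left_mono) auto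
  ultimately show ?thesis by simp
 qed
 ultimately show ?thesis by (simp add: flat_def exp_add[symmetric])
next
 case False
 then have "flat 1 (1 + x) = 0 \<or> flat 1 (1 - x) = 0" by (auto simp: flat_1_bounds)
 then show ?thesis by auto
qed

lemma smooth_cutoff: "smooth cutoff"
proof -
 have 1: "smooth (%x. flat 1 (1 + x))" "smooth (%x. flat 1 (1 - x))"
  using smooth_affine[OF smooth_flat, of 1 1 1] smooth_affine[OF smooth_flat, of 1 "-1" 1]
  by (simp_all add: add.commute)
 show ?thesis
  unfolding cutoff_def
  by (intro smooth_mult smooth_const smooth_compose_linear[OF bounded_linear_fst]
    smooth_compose_linear[OF bounded_linear_snd] smooth_flat
    smooth_compose_linear[OF bounded_linear_fst 1(1)] smooth_compose_linear[OF bounded_linear_fst 1(2)]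
    smooth_compose_linear[OF bounded_linear_snd 1(1)] smooth_compose_linear[OF bounded_linear_snd 1(2)])
qed

lemma cutoff_nonneg: "0 <= cutoff z"
 by (simp add: cutoff_def flat_1_bounds)

lemma cutoff_le_1: "cutoff z <= 1"
proof -
 have "cutoff z <= exp 4 * (exp (-2) * exp (-2))"
  unfolding cutoff_def by (intro mult_left_mono mult_mono flat_product_le) (auto simp: flat_1_bounds)
 also have "... = 1" by (simp add: exp_add[symmetric])
 finally show ?thesis .
qed

lemma cutoff_0: "cutoff 0 = 1"
 by (simp add: cutoff_def flat_def exp_add[symmetric])

lemma cutoff_nonzero: "cutoff z \<noteq> 0 \<longleftrightarrow> \<bar>fst z\<bar> < 1 \<and> \<bar>snd z\<bar> < 1"
 by (auto simp: cutoff_def flat_1_bounds)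

text \<open>The derivative at the origin vanishes because the cutoff is maximal there.\<close>

lemma cutoff_derivative_0: "frechet_derivative cutoff (at 0) = (%h. 0)"
 by (rule differential_zero_maxmin[OF _ open_UNIV smooth_has_derivative[OF smooth_cutoff]])
   (auto simp: cutoff_0 cutoff_le_1)

subsection \<open>Test functions\<close>

lemma test_functionsI:
 assumes "smooth f" "compact K" "K \<subseteq> U" "!!z. z \<notin> K ==> f z = 0"
 shows "f : test_functions U"
proof -
 have "closure {z. f z \<noteq> 0} \<subseteq> K"
  using assms by (intro closure_minimal compact_imp_closed) auto
 moreover have "compact (closure {z. f z \<noteq> 0})"
  using calculation assms(2) by (metis closed_closure compact_Int_closed inf.absorb_iff2)
 ultimately show ?thesis using assms by (auto simp: test_functions_def)
qed

lemma test_smooth: "f : test_functions U ==> smooth f"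
 by (simp add: test_functions_def)

lemma test_bounded_support:
 assumes "f : test_functions U"
 obtains R where "R > 0" "!!z. norm z > R ==> f z = 0"
proof -
 have "bounded (closure {z. f z \<noteq> 0})" using assms by (auto simp: test_functions_def compact_imp_bounded)
 then obtain R where "R > 0" "!!z. z : closure {z. f z \<noteq> 0} ==> norm z <= R"
  by (auto simp: bounded_pos)
 then show ?thesis using closure_subset[of "{z. f z \<noteq> 0}"] by (intro that[of R]) force+
qed

lemma partial_zero_off_support:
 assumes "z \<notin> closure {z. f z \<noteq> 0}"
 shows "partial i f z = 0"
proof -
 have ev: "\<forall>\<^sub>F w in nhds z. f w = 0"
 proof (rule eventually_mono)
  show "\<forall>\<^sub>F w in nhds z. w : - closure {z. f z \<noteq> 0}"
   using assms by (intro eventually_nhds_in_open) auto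
  show "f w = 0" if "w : - closure {z. f z \<noteq> 0}" for w
   using that closure_subset[of "{z. f z \<noteq> 0}"] by auto
 qed
 have "(f has_derivative (%h. 0)) (at z)"
  by (rule has_derivative_transform_eventually[of "%z. 0"])
    (use ev eventually_nhds_x_imp_x[OF ev] in \<open>auto simp: eventually_at_filter elim!: eventually_mono\<close>)
 then show ?thesis by (rule partial_eq)
qed

lemma test_partial:
 assumes "f : test_functions U" "i : Basis"
 shows "partial i f : test_functions U"
 by (rule test_functionsI[of _ "closure {z. f z \<noteq> 0}"])
   (use assms partial_zero_off_support in \<open>auto simp: test_functions_def smooth_partial\<close>)

lemma test_partials:
 assumes "f : test_functions U" "set ds \<subseteq> Basis"
 shows "partials ds f : test_functions U"
 using assms(2) by (induction ds) (auto simp: partials_def assms(1) test_partial)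

lemma test_scaleR:
 assumes "smooth a" "f : test_functions U"
 shows "(%z. a z *. f z) : test_functions U"
 by (rule test_functionsI[of _ "closure {z. f z \<noteq> 0}"])
   (use assms closure_subset[of "{z. f z \<noteq> 0}"] in \<open>auto simp: test_functions_def smooth_scaleR\<close>)

lemma test_scaleR_left:
 assumes "a : test_functions U" "smooth f"
 shows "(%z. a z *. f z) : test_functions U"
 by (rule test_functionsI[of _ "closure {z. a z \<noteq> 0}"])
   (use assms closure_subset[of "{z. a z \<noteq> 0}"] in \<open>auto simp: test_functions_def smooth_scaleR\<close>)

lemma compact_support_uniformly_continuous:
 fixes g :: "'a::euclidean_space => 'b::real_normed_vector"
 assumes g: "continuous_on UNIV g" "!!z. norm z > R ==> g z = 0" and e: "e > 0"
 obtains d where "d > 0" "!!x y. dist x y < d ==> dist (g x) (g y) < e"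
proof -
 have "uniformly_continuous_on (cball 0 (\<bar>R\<bar> + 1)) g"
  by (rule compact_uniformly_continuous) (auto intro: continuous_on_subset[OF g(1)])
 from uniformly_continuous_onE[OF this e] obtain d where d: "d > 0"
  "!!x x'. x : cball 0 (\<bar>R\<bar> + 1) ==> x' : cball 0 (\<bar>R\<bar> + 1) ==> dist x' x < d ==> dist (g x') (g x) < e"
  by metis
 show ?thesis
 proof (rule that[of "min d 1"])
  fix x y :: 'a assume xy: "dist x y < min d 1"
  then have "\<bar>norm x - norm y\<bar> < 1" by (metis dist_norm min_less_iff_conj norm_triangle_ineq3 order_le_less_trans)
  then consider "norm x <= \<bar>R\<bar> + 1 \<and> norm y <= \<bar>R\<bar> + 1" | "norm x > R \<and> norm y > R" by linarith
  then show "dist (g x) (g y) < e"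
   using d(2)[of y x] xy g(2) e by cases auto
 qed (use d in auto)
qed

lemma test_bounded:
 assumes "f : test_functions U"
 obtains C where "C > 0" "!!z. norm (f z) <= C"
proof -
 obtain R where R: "R > 0" "!!z. norm z > R ==> f z = 0" using test_bounded_support[OF assms] by auto
 have "compact (f ` cball 0 R)"
  by (intro compact_continuous_image smooth_continuous test_smooth[OF assms]) auto
 then obtain C where "C > 0" "!!z. norm z <= R ==> norm (f z) <= C"
  using compact_imp_bounded[of "f ` cball 0 R"] by (auto simp: bounded_pos)
 then show ?thesis using R by (intro that[of C]) (metis linorder_not_le norm_zero order.strict_implies_order)+
qed

lemma smooth_measurable: "smooth f ==> f : borel_measurable borel"
 using smooth_continuous borel_measurable_continuous_onI by blast

lemma test_measurable [measurable_dest]: "f : test_functions U ==> f : borel_measurable borel"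
 using smooth_measurable test_smooth by blast

lemma compact_support_integrable:
 fixes f :: "'a::euclidean_space => 'b::euclidean_space"
 assumes "continuous_on UNIV f" "!!z. norm z > R ==> f z = 0"
 shows "integrable lborel f"
proof -
 have "integrable lborel (%z. indicator (cball 0 R) z *. f z)"
  by (rule borel_integrable_compact) (auto intro: continuous_on_subset[OF assms(1)])
 moreover have "(%z. indicator (cball 0 R) z *. f z) = f"
  using assms(2) by (force simp: indicator_def)
 ultimately show ?thesis by simp
qed

lemma compact_support_L2:
 fixes f :: "'a::euclidean_space => 'b::euclidean_space"
 assumes "continuous_on UNIV f" "!!z. norm z > R ==> f z = 0"
 shows "f : L2 lborel"
 unfolding L2_def
 using assms borel_measurable_continuous_onI[OF assms(1)]
 by (auto intro!: compact_support_integrable[where R=R] continuous_intros)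

lemma test_integrable:
 fixes f :: "'a::euclidean_space => 'b::euclidean_space"
 assumes "f : test_functions U" shows "integrable lborel f"
 using test_bounded_support[OF assms] compact_support_integrable[OF smooth_continuous[OF test_smooth[OF assms]]] by metis

lemma test_L2:
 fixes f :: "'a::euclidean_space => 'b::euclidean_space"
 assumes "f : test_functions U" shows "f : L2 lborel"
 using test_bounded_support[OF assms] compact_support_L2[OF smooth_continuous[OF test_smooth[OF assms]]] by metis

lemma test_cutoff:
 fixes b :: point
 assumes "c \<noteq> 0"
 shows "(%z. cutoff (c *. z + b)) : test_functions UNIV"
proof (rule test_functionsI[of _ "cball 0 ((2 + norm b) / \<bar>c\<bar>)"])
 fix z :: point assume "z \<notin> cball 0 ((2 + norm b) / \<bar>c\<bar>)"
 then have "2 + norm b < norm (c *. z)" using assms by (simp add: field_simps)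
 then have n: "norm (c *. z + b) > 2" using norm_diff_ineq[of "c *. z" b] by linarith
 have "norm w <= \<bar>fst w\<bar> + \<bar>snd w\<bar>" for w :: point
  by (cases w) (simp add: norm_Pair sqrt_sum_squares_le_sum_abs)
 from this[of "c *. z + b"] n cutoff_nonzero[of "c *. z + b"] show "cutoff (c *. z + b) = 0" by linarith
qed (auto intro: smooth_affine smooth_cutoff)

section \<open>Mollification\<close>

definition mollify :: "('a::euclidean_space => real) => ('a => 'b::euclidean_space) => 'a => 'b"
 where "mollify \<psi> f z = (LINT w|lborel. \<psi> (w - z) *. f w)"

lemma test_translate:
 assumes "\<psi> : test_functions UNIV"
 shows "(%w. \<psi> (w - z)) : test_functions UNIV"
proof -
 obtain R where R: "!!z. norm z > R ==> \<psi> z = 0" using test_bounded_support[OF assms] by auto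
 show ?thesis
 proof (rule test_functionsI[of _ "cball z R"])
  show "smooth (%w. \<psi> (w - z))" using smooth_affine[OF test_smooth[OF assms], of 1 "-z"] by simp
  fix w assume "w \<notin> cball z R"
  then show "\<psi> (w - z) = 0" by (intro R) (simp add: dist_norm norm_minus_commute)
 qed auto
qed

lemma mollify_integrable:
 assumes "\<psi> : test_functions UNIV" "f : L2 lborel"
 shows "integrable lborel (%w. \<psi> (w - z) *. f w)"
 by (rule L2_scaleR_integrable[OF test_L2[OF test_translate[OF assms(1)]] assms(2)])

lemma mollify_shift:
 assumes "\<psi> : test_functions UNIV" "f : L2 lborel"
 shows "mollify \<psi> f z = (LINT w|lborel. \<psi> w *. f (z + w))"
  and "integrable lborel (%w. \<psi> w *. f (z + w))"
proof -
 have [measurable]: "f : borel_measurable borel" using assms(2) by (auto simp: L2_def)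
 have [measurable]: "\<psi> : borel_measurable borel" using assms(1) by (rule test_measurable)
 show "mollify \<psi> f z = (LINT w|lborel. \<psi> w *. f (z + w))"
  unfolding mollify_def
  using lborel_integral_translate[of "%w. \<psi> (w - z) *. f w" z] by (simp add: add.commute)
 show "integrable lborel (%w. \<psi> w *. f (z + w))"
  using lborel_integrable_translate[of "%w. \<psi> (w - z) *. f w" z] mollify_integrable[OF assms, of z]
  by (simp add: add.commute)
qed

lemma support_subset_cball:
 fixes f :: "'a::real_normed_vector => 'b::zero"
 assumes "!!z. norm z > R ==> f z = 0"
 shows "closure {z. f z \<noteq> 0} \<subseteq> cball 0 R"
proof (rule closure_minimal)
 show "{z. f z \<noteq> 0} \<subseteq> cball 0 R"
 proof
  fix z assume "z : {z. f z \<noteq> 0}"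
  then have "\<not> norm z > R" using assms by auto
  then show "z : cball 0 R" by simp
 qed
qed simp

text \<open>
 The difference quotients of the kernel converge uniformly to its derivative, by uniform continuity of the
 partial derivatives, and \<open>f\<close> is integrable on the bounded set where they do not vanish.
\<close>

lemma mollify_has_derivative:
 fixes f :: "'a::euclidean_space => 'b::euclidean_space"
 assumes \<psi>: "\<psi> : test_functions UNIV" and f: "f : L2 lborel"
 shows "(mollify \<psi> f has_derivative (%h. \<Sum>i\<in>Basis. (h \<bullet> i) *. - mollify (partial i \<psi>) f z)) (at z)"
  (is "(_ has_derivative ?D) _")
proof -
 have [measurable]: "f : borel_measurable borel" using f by (auto simp: L2_def)
 obtain R where R: "R > 0" "!!z. norm z > R ==> \<psi> z = 0" using test_bounded_support[OF \<psi>] by auto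
 have pt: "partial i \<psi> : test_functions UNIV" if "i : Basis" for i by (rule test_partial[OF \<psi> that])
 let ?B = "cball z (R + 1)"
 have ball2: "indicat_real ?B : L2 lborel"
 proof (rule L2_dominated)
  show "integrable lborel (indicat_real ?B)"
   using emeasure_lborel_cball_finite[of z "R + 1"] by simp
  show "AE w in lborel. (norm (indicat_real ?B w))^2 <= indicat_real ?B w"
   by (intro AE_I2) (simp add: indicator_def)
 qed (simp add: borel_measurable_indicator)
 define I where "I = (LINT w|lborel. indicat_real ?B w *. norm (f w))"
 have intI: "integrable lborel (%w. indicat_real ?B w *. norm (f w))"
  by (rule L2_scaleR_integrable[OF ball2 L2_norm_integrand[OF f]])
 have I0: "I \<ge> 0" unfolding I_def by (rule integral_nonneg_AE) auto
 show ?thesis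
  unfolding has_derivative_at_alt
 proof (intro conjI allI impI)
  show "bounded_linear ?D"
   by (intro bounded_linear_sum bounded_linear_scaleR_const[OF bounded_linear_inner_left])
  fix e :: real assume e: "e > 0"
  define e' where "e' = e / (DIM('a) * (I + 1))"
  have e': "e' > 0" using e I0 by (auto simp: e'_def intro!: divide_pos_pos mult_pos_pos)
  have "\<exists>d>0. \<forall>x y. dist x y < d \<longrightarrow> dist (partial i \<psi> x) (partial i \<psi> y) < e'" if i: "i : Basis" for i
  proof -
   obtain R' where R': "!!z. norm z > R' ==> partial i \<psi> z = 0"
    using test_bounded_support[OF pt[OF i]] by auto
   show ?thesis
    using compact_support_uniformly_continuous[OF smooth_continuous[OF test_smooth[OF pt[OF i]]] R' e'] by metis
  qed
  then obtain d0 where d0: "!!i. i : Basis ==> d0 i > 0"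
   "!!i x y. i : Basis ==> dist x y < d0 i ==> dist (partial i \<psi> x) (partial i \<psi> y) < e'"
   by metis
  define d where "d = min 1 (Min (d0 ` Basis))"
  have d: "d > 0" "d <= 1" "!!i. i : Basis ==> d <= d0 i"
   by (auto simp: d_def d0(1) min.coboundedI2)
  have taylor: "\<bar>\<psi> (x - h) - \<psi> x - (\<Sum>i\<in>Basis. (h \<bullet> i) * - partial i \<psi> x)\<bar> <= norm h * (DIM('a) * e')"
   if h: "norm h < d" for x h
  proof -
   have "norm (\<psi> (x - h) - \<psi> x - frechet_derivative \<psi> (at x) ((x - h) - x)) <= norm ((x - h) - x) * (DIM('a) * e')"
   proof (rule differentiable_bound_linearization[where S="ball x d" and f'="%y. frechet_derivative \<psi> (at y)"])
    show "x + t *. (x - h - x) : ball x d" if "t : {0..1}" for t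
    proof -
     have "norm (t *. h) <= 1 * norm h" unfolding norm_scaleR using that by (intro mult_right_mono) auto
     then show ?thesis using h by (simp add: dist_norm)
    qed
    show "(\<psi> has_derivative frechet_derivative \<psi> (at y)) (at y within ball x d)" for y
     using smooth_has_derivative[OF test_smooth[OF \<psi>]] has_derivative_at_withinI by blast
    show "onorm (frechet_derivative \<psi> (at y) - frechet_derivative \<psi> (at x)) <= DIM('a) * e'"
     if y: "y : ball x d" for y
     unfolding fun_diff_def
    proof (rule onorm_bound)
     fix v
     have "frechet_derivative \<psi> (at y) v - frechet_derivative \<psi> (at x) v
       = (\<Sum>i\<in>Basis. (v \<bullet> i) * (partial i \<psi> y - partial i \<psi> x))"
      using smooth_differentiable[OF test_smooth[OF \<psi>]]
      by (simp add: frechet_derivative_partial sum_subtractf right_diff_distrib)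
     also have "norm ... <= (\<Sum>i\<in>(Basis::'a set). norm v * e')"
     proof (rule sum_norm_le)
      fix i :: 'a assume i: "i : Basis"
      have "dist y x < d0 i" using y d(3)[OF i] by (simp add: dist_commute)
      then have "\<bar>partial i \<psi> y - partial i \<psi> x\<bar> <= e'" using d0(2)[OF i] by (force simp: dist_real_def)
      then show "norm ((v \<bullet> i) * (partial i \<psi> y - partial i \<psi> x)) <= norm v * e'"
       unfolding real_norm_def abs_mult using Basis_le_norm[OF i, of v] by (intro mult_mono) auto
     qed
     finally show "norm (frechet_derivative \<psi> (at y) v - frechet_derivative \<psi> (at x) v) <= DIM('a) * e' * norm v"
      by (simp add: mult_ac)
    qed (use e' in auto)
   qed (use d in auto)
   then show ?thesis
    using smooth_differentiable[OF test_smooth[OF \<psi>], of x]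
    by (simp add: frechet_derivative_partial sum_negf)
  qed
  show "\<exists>d>0. \<forall>y. norm (y - z) < d \<longrightarrow> norm (mollify \<psi> f y - mollify \<psi> f z - ?D (y - z)) <= e * norm (y - z)"
  proof (intro exI[of _ d] conjI allI impI)
   fix y assume y: "norm (y - z) < d"
   define h where "h = y - z"
   define q where "q w = \<psi> (w - z - h) - \<psi> (w - z) - (\<Sum>i\<in>Basis. (h \<bullet> i) * - partial i \<psi> (w - z))" for w
   have q: "norm (q w *. f w) <= norm h * (DIM('a) * e') * (indicat_real ?B w *. norm (f w))" for w
   proof (cases "w : ?B")
    case True
    then show ?thesis
     using taylor[of h "w - z"] y by (auto simp: q_def h_def intro!: mult_right_mono)
   next
    case False
    then have far: "norm (w - z) > R + 1" by (simp add: dist_norm norm_minus_commute)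
    have "norm (w - z - h) > R"
     using far norm_triangle_ineq2[of "w - z" h] y d(2) by (simp add: h_def)
    moreover have "partial i \<psi> (w - z) = 0" if "i : Basis" for i
    proof (rule partial_zero_off_support)
     have "closure {z. \<psi> z \<noteq> 0} \<subseteq> cball 0 R"
      by (rule support_subset_cball[OF R(2)])
     then show "w - z \<notin> closure {z. \<psi> z \<noteq> 0}" using far by (auto simp: subset_eq)
    qed
    ultimately show ?thesis using False far R(2)[of "w - z"] R(2)[of "w - z - h"] by (simp add: q_def)
   qed
   have "mollify \<psi> f y - mollify \<psi> f z - ?D h
     = (LINT w|lborel. \<psi> (w - y) *. f w - \<psi> (w - z) *. f w - (\<Sum>i\<in>Basis. (h \<bullet> i) *. - (partial i \<psi> (w - z) *. f w)))"
    unfolding mollify_def using mollify_integrable[OF \<psi> f] mollify_integrable[OF pt f]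
    by (simp add: Bochner_Integration.integral_diff Bochner_Integration.integral_sum del: scaleR_scaleR)
   also have "... = (LINT w|lborel. q w *. f w)"
    by (intro bochner_cong refl)
      (simp add: q_def h_def scaleR_diff_left scaleR_sum_left sum_negf algebra_simps)
   also have "norm ... <= (LINT w|lborel. norm h * (DIM('a) * e') * (indicat_real ?B w *. norm (f w)))"
   proof (rule Bochner_Integration.integral_norm_bound_integral)
    have [measurable]: "\<psi> : borel_measurable borel" using \<psi> by (rule test_measurable)
    have [measurable]: "partial i \<psi> : borel_measurable borel" if "i : Basis" for i
     using pt[OF that] by (rule test_measurable)
    have [measurable]: "q : borel_measurable borel" unfolding q_def by measurable
    show "integrable lborel (%w. norm h * (DIM('a) * e') * (indicat_real ?B w *. norm (f w)))"
     by (intro integrable_mult_right intI)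
    then show "integrable lborel (%w. q w *. f w)"
    proof (rule Bochner_Integration.integrable_bound)
     show "AE w in lborel. norm (q w *. f w) <= norm (norm h * (DIM('a) * e') * (indicat_real ?B w *. norm (f w)))"
      using q by (intro AE_I2) (metis abs_ge_self order_trans real_norm_def)
    qed measurable
   qed (rule q)
   also have "... = norm h * (DIM('a) * e') * I" by (simp add: I_def)
   also have "... <= e * norm h"
   proof -
    have "DIM('a) * e' * I <= DIM('a) * e' * (I + 1)" using e' by (intro mult_left_mono) auto
    also have "... = e"
    proof -
     have "I + 1 \<noteq> 0" "real DIM('a) \<noteq> 0" using I0 by auto
     then show ?thesis by (simp add: e'_def)
    qed
    finally show ?thesis by (metis mult.assoc mult.commute mult_left_mono norm_ge_zero)
   qed
   finally show "norm (mollify \<psi> f y - mollify \<psi> f z - ?D (y - z)) <= e * norm (y - z)"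
    by (simp add: h_def)
  qed (use d in auto)
 qed
qed

lemma partial_mollify:
 assumes "\<psi> : test_functions UNIV" "f : L2 lborel" "i : Basis"
 shows "partial i (mollify \<psi> f) = (%z. - mollify (partial i \<psi>) f z)"
proof
 fix z
 have "partial i (mollify \<psi> f) z = (\<Sum>j\<in>Basis. (i \<bullet> j) *. - mollify (partial j \<psi>) f z)"
  by (rule partial_eq[OF mollify_has_derivative[OF assms(1,2)]])
 also have "... = (\<Sum>j\<in>Basis. if j = i then - mollify (partial i \<psi>) f z else 0)"
  using assms(3) by (intro sum.cong) (auto simp: inner_Basis)
 also have "... = - mollify (partial i \<psi>) f z" using assms(3) by simp
 finally show "partial i (mollify \<psi> f) z = - mollify (partial i \<psi>) f z" .
qed

lemma smooth_mollify:
 fixes f :: "'a::euclidean_space => 'b::euclidean_space"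
 assumes "\<psi> : test_functions UNIV" "f : L2 lborel"
 shows "smooth (mollify \<psi> f)"
proof (rule smooth_coinduct[where P="%h. \<exists>\<psi>\<in>test_functions UNIV. h = mollify \<psi> f"])
 fix h :: "'a => 'b" assume "\<exists>\<psi>\<in>test_functions UNIV. h = mollify \<psi> f"
 then obtain \<psi> where \<psi>: "\<psi> : test_functions UNIV" and h: "h = mollify \<psi> f" by auto
 show "h differentiable_on UNIV"
  using mollify_has_derivative[OF \<psi> assms(2)] unfolding h
  by (auto simp: differentiable_on_def differentiable_def)
 show "\<exists>\<psi>\<in>test_functions UNIV. partial i h = mollify \<psi> f" if "i : Basis" for i
 proof (rule bexI)
  show "partial i h = mollify (%w. -1 *. partial i \<psi> w) f"
   unfolding h partial_mollify[OF \<psi> assms(2) that] by (simp add: mollify_def fun_eq_iff)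
  show "(%w. -1 *. partial i \<psi> w) : test_functions UNIV"
   by (intro test_scaleR test_partial \<psi> that smooth_const)
 qed
qed (use assms in auto)

lemma partials_mollify:
 assumes "\<psi> : test_functions UNIV" "f : L2 lborel" "set ds \<subseteq> Basis"
 shows "partials ds (mollify \<psi> f) = (%z. (-1) ^ length ds *. mollify (partials ds \<psi>) f z)"
 using assms(3)
proof (induction ds)
 case (Cons i ds)
 have t: "partials ds \<psi> : test_functions UNIV" using Cons.prems by (intro test_partials assms(1)) auto
 have "partials (i # ds) (mollify \<psi> f) = partial i (%z. (-1) ^ length ds *. mollify (partials ds \<psi>) f z)"
  using Cons by (simp add: partials_def)
 also have "... = (%z. (-1) ^ length ds *. partial i (mollify (partials ds \<psi>) f) z)"
  by (subst partial_scaleR) (auto simp: partial_const smooth_differentiable_on smooth_mollify[OF t assms(2)])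
 also have "... = (%z. (-1) ^ length (i # ds) *. mollify (partials (i # ds) \<psi>) f z)"
  using Cons.prems by (subst partial_mollify[OF t assms(2)]) (auto simp: partials_def)
 finally show ?case .
qed (simp add: partials_def)

lemma partials_translate:
 assumes "smooth \<psi>" "set ds \<subseteq> Basis"
 shows "partials ds (%w. \<psi> (w - z)) = (%w. partials ds \<psi> (w - z))"
 using assms(2)
proof (induction ds)
 case (Cons i ds)
 have sm: "smooth (partials ds \<psi>)"
  using assms(1) Cons.prems by (induction ds) (auto simp: partials_def smooth_partial)
 have "partials (i # ds) (%w. \<psi> (w - z)) = partial i (%w. partials ds \<psi> (1 *. w + - z))"
  using Cons by (simp add: partials_def)
 also have "... = (%w. 1 *. partial i (partials ds \<psi>) (1 *. w + - z))"
  by (rule partial_affine[OF smooth_differentiable_on[OF sm]])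
 finally show ?case by (simp add: partials_def)
qed (simp add: partials_def)

subsection \<open>Averages\<close>

text \<open>Jensen's inequality for the square and a probability density, by Cauchy-Schwarz.\<close>

lemma average_square_le:
 fixes F :: "'a::euclidean_space => 'b::euclidean_space"
 assumes [measurable]: "k : borel_measurable lborel" "F : borel_measurable lborel"
  and k: "!!w. 0 <= k w" "(NN w. ennreal (k w)) = 1"
 shows "ennreal ((norm (LINT w|lborel. k w *. F w))^2) <= (NN w. ennreal (k w) * ennreal ((norm (F w))^2))"
proof -
 have "ennreal (norm (LINT w|lborel. k w *. F w)) <= (NN w. ennreal (norm (k w *. F w)))"
 proof (cases "integrable lborel (%w. k w *. F w)")
  case True
  then show ?thesis by (rule integral_norm_bound_ennreal)
 next
  case False
  then show ?thesis by (simp add: not_integrable_integral_eq)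
 qed
 also have "... = (NN w. ennreal (sqrt (k w)) * ennreal (sqrt (k w) * norm (F w)))"
  using k(1) by (intro nn_integral_cong) (simp add: ennreal_mult'[symmetric] mult.assoc[symmetric])
 finally have "(ennreal (norm (LINT w|lborel. k w *. F w)))^2
   <= (NN w. ennreal (sqrt (k w)) * ennreal (sqrt (k w) * norm (F w)))^2"
  by (rule power_mono) simp
 also have "... <= (NN w. ennreal (sqrt (k w)) ^ 2) * (NN w. ennreal (sqrt (k w) * norm (F w)) ^ 2)"
  by (rule Cauchy_Schwarz_nn_integral) auto
 also have "(NN w. ennreal (sqrt (k w)) ^ 2) = 1"
  using k by (simp add: ennreal_power)
 also have "(NN w. ennreal (sqrt (k w) * norm (F w)) ^ 2) = (NN w. ennreal (k w) * ennreal ((norm (F w))^2))"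
  using k by (simp add: ennreal_power power_mult_distrib ennreal_mult)
 finally show ?thesis by (simp add: ennreal_power)
qed

lemma nn_integral_sq_L2:
 assumes "f : L2 M"
 shows "(\<integral>\<^sup>+z. ennreal ((norm (f z))^2) \<partial>M) = ennreal ((L2_norm M f)^2)"
 unfolding L2_norm_sq by (rule nn_integral_eq_integral[OF L2_integrable_sq[OF assms]]) auto

lemma L2_nn_integral_bound:
 assumes "f : borel_measurable M" "(\<integral>\<^sup>+z. ennreal ((norm (f z))^2) \<partial>M) <= ennreal (c\<^sup>2)" "0 <= c"
 shows "f : L2 M" "L2_norm M f <= c"
proof -
 have "(\<integral>\<^sup>+z. ennreal (norm ((norm (f z))^2)) \<partial>M) < \<infinity>"
  using assms(2) by (simp add: order_le_less_trans[OF _ ennreal_less_top])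
 then show f: "f : L2 M" using assms(1) by (simp add: L2_def integrableI_bounded)
 have "ennreal ((L2_norm M f)^2) <= ennreal (c\<^sup>2)" using assms(2) nn_integral_sq_L2[OF f] by simp
 then show "L2_norm M f <= c" using assms(3) by (simp add: power2_le_iff_abs_le) 
qed

definition averaging_kernel :: "('a::euclidean_space => real) => bool"
 where "averaging_kernel k \<longleftrightarrow>
  k : test_functions UNIV \<and> (\<forall>w. 0 <= k w) \<and> (NN w. ennreal (k w)) = 1"

lemma averaging_kernelD:
 assumes "averaging_kernel k"
 shows "k : test_functions UNIV" "0 <= k w" "(NN w. ennreal (k w)) = 1" "(LINT w|lborel. k w) = 1"
  "k : borel_measurable borel"
proof -
 show *: "k : test_functions UNIV" "0 <= k w" "(NN w. ennreal (k w)) = 1" for w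
  using assms by (auto simp: averaging_kernel_def)
 show "k : borel_measurable borel" by (rule test_measurable[OF *(1)])
 then show "(LINT w|lborel. k w) = 1" using * by (subst integral_eq_nn_integral) auto
qed

lemma mollify_L2:
 fixes f :: "'a::euclidean_space => 'b::euclidean_space"
 assumes k: "averaging_kernel k" and f: "f : L2 lborel"
 shows "mollify k f : L2 lborel" "L2_norm lborel (mollify k f) <= L2_norm lborel f"
proof -
 note k' [measurable] = averaging_kernelD[OF k]
 have [measurable]: "f : borel_measurable borel" using f by (auto simp: L2_def)
 have m: "mollify k f : borel_measurable lborel"
  using smooth_measurable[OF smooth_mollify[OF k'(1) f]] by simp
 have "(NN z. ennreal ((norm (mollify k f z))^2))
   <= (NN z. (NN w. ennreal (k w) * ennreal ((norm (f (z + w)))^2)))"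
  unfolding mollify_shift(1)[OF k'(1) f] by (intro nn_integral_mono average_square_le k') auto
 also have "... = (NN w. (NN z. ennreal (k w) * ennreal ((norm (f (z + w)))^2)))"
  by (rule lborel_pair.Fubini') measurable
 also have "... = (NN w. ennreal (k w) * (NN z. ennreal ((norm (f z))^2)))"
  by (intro nn_integral_cong) (simp add: nn_integral_cmult lborel_nn_integral_translate[of "%z. ennreal ((norm (f z))^2)"])
 also have "... = ennreal ((L2_norm lborel f)^2)"
  by (simp add: nn_integral_multc k'(3) nn_integral_sq_L2[OF f])
 finally have "(NN z. ennreal ((norm (mollify k f z))^2)) <= ennreal ((L2_norm lborel f)^2)" .
 from L2_nn_integral_bound[OF m this] show "mollify k f : L2 lborel" "L2_norm lborel (mollify k f) <= L2_norm lborel f"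
  by auto
qed

text \<open>
 The error is an average of translation errors, over translations in the support of the kernel.
\<close>

lemma mollify_close:
 fixes f :: "'a::euclidean_space => 'b::euclidean_space"
 assumes k: "averaging_kernel k" and f: "f : L2 lborel" and e: "0 <= e"
  and close: "!!w. k w \<noteq> 0 ==> L2_norm lborel (%z. f (z + w) - f z) <= e"
 shows "L2_norm lborel (%z. mollify k f z - f z) <= e"
proof -
 note k' [measurable] = averaging_kernelD[OF k]
 have [measurable]: "f : borel_measurable borel" using f by (auto simp: L2_def)
 have m: "(%z. mollify k f z - f z) : borel_measurable lborel"
  using smooth_measurable[OF smooth_mollify[OF k'(1) f]] by simp
 have diff: "mollify k f z - f z = (LINT w|lborel. k w *. (f (z + w) - f z))" for z
  using mollify_shift[OF k'(1) f] test_integrable[OF k'(1)] k'(4)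
  by (simp add: scaleR_diff_right)
 have "(NN z. ennreal ((norm (mollify k f z - f z))^2))
   <= (NN z. (NN w. ennreal (k w) * ennreal ((norm (f (z + w) - f z))^2)))"
  unfolding diff by (intro nn_integral_mono average_square_le k') auto
 also have "... = (NN w. (NN z. ennreal (k w) * ennreal ((norm (f (z + w) - f z))^2)))"
  by (rule lborel_pair.Fubini') measurable
 also have "... <= (NN w. ennreal (k w) * ennreal (e\<^sup>2))"
 proof (rule nn_integral_mono)
  fix w
  have "(NN z. ennreal (k w) * ennreal ((norm (f (z + w) - f z))^2))
    = ennreal (k w) * ennreal ((L2_norm lborel (%z. f (z + w) - f z))^2)"
   using nn_integral_sq_L2[OF L2_diff[OF L2_translate[OF f, of w] f]] by (simp add: nn_integral_cmult)
  also have "... <= ennreal (k w) * ennreal (e\<^sup>2)"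
   using close[of w] by (cases "k w = 0") (auto intro!: mult_left_mono ennreal_leI power_mono)
  finally show "(NN z. ennreal (k w) * ennreal ((norm (f (z + w) - f z))^2)) <= ennreal (k w) * ennreal (e\<^sup>2)" .
 qed
 also have "... = ennreal (e\<^sup>2)" by (simp add: nn_integral_multc k'(3))
 finally show ?thesis using L2_nn_integral_bound(2)[OF m _ e] by auto
qed

text \<open>
 The kernels live strictly above the origin, so that averaging at a point of the closed
 half-plane only sees values inside the open one. This is what gives smoothness up to the boundary.
\<close>

definition upward_kernel :: "nat => point => real"
 where "upward_kernel n w =
  cutoff (real (Suc n) *. w + (0, -2)) / (LINT w|lborel. cutoff (real (Suc n) *. w + (0, -2)))"

lemma upward_kernel_support:
 assumes "upward_kernel n w \<noteq> 0"
 shows "snd w > 1 / real (Suc n)" "norm w <= 4 / real (Suc n)"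
proof -
 have c: "cutoff (real (Suc n) *. w + (0, -2)) \<noteq> 0" using assms by (auto simp: upward_kernel_def)
 then have b: "\<bar>real (Suc n) * fst w\<bar> < 1" "\<bar>real (Suc n) * snd w - 2\<bar> < 1"
  by (auto simp: cutoff_nonzero)
 then have "1 < real (Suc n) * snd w" by linarith
 then show "snd w > 1 / real (Suc n)" by (simp add: field_simps)
 have "norm (real (Suc n) *. w) <= \<bar>real (Suc n) * fst w\<bar> + \<bar>real (Suc n) * snd w\<bar>"
  by (cases w) (simp add: norm_Pair del: of_nat_Suc, metis sqrt_sum_squares_le_sum_abs)
 also have "... <= 4" using b by linarith
 finally have "real (Suc n) * norm w <= 4" unfolding norm_scaleR by simp
 then show "norm w <= 4 / real (Suc n)" by (simp add: field_simps)
qed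

lemma averaging_upward_kernel: "averaging_kernel (upward_kernel n)"
proof -
 let ?c = "%w::point. cutoff (real (Suc n) *. w + (0, -2))"
 have t: "?c : test_functions UNIV" by (rule test_cutoff) simp
 note [measurable] = test_measurable[OF t]
 have int: "integrable lborel ?c" by (rule test_integrable[OF t])
 have ne: "(LINT w|lborel. ?c w) \<noteq> 0"
 proof
  assume "(LINT w|lborel. ?c w) = 0"
  then have "AE w in lborel. ?c w = 0"
   using integral_nonneg_eq_0_iff_AE[OF int] cutoff_nonneg by auto
  then have "AE w in lborel. w : {w. ?c w = 0}" by simp
  moreover have "closed {w. ?c w = 0}"
   by (intro closed_Collect_eq smooth_continuous[OF test_smooth[OF t]] continuous_on_const)
  ultimately have "(0, 2 / real (Suc n)) : {w. ?c w = 0}"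
   using mem_closed_if_AE_lebesgue AE_completion by blast
  then show False using cutoff_0 by (simp add: zero_prod_def del: of_nat_Suc)
 qed
 have pos: "(LINT w|lborel. ?c w) > 0"
  using ne integral_nonneg_AE[of ?c lborel] cutoff_nonneg by (auto simp: less_le)
 have "(NN w. ennreal (upward_kernel n w)) = ennreal (LINT w|lborel. upward_kernel n w)"
  by (rule nn_integral_eq_integral)
    (use int pos cutoff_nonneg in \<open>auto simp: upward_kernel_def\<close>)
 also have "(LINT w|lborel. upward_kernel n w) = 1" using ne by (simp add: upward_kernel_def)
 finally have "(NN w. ennreal (upward_kernel n w)) = 1" by simp
 moreover have "upward_kernel n = (%w. (1 / (LINT w|lborel. ?c w)) *. ?c w)"
  by (auto simp: upward_kernel_def)
 then have "upward_kernel n : test_functions UNIV" using test_scaleR[OF smooth_const t] by metis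
 ultimately show ?thesis using pos cutoff_nonneg by (auto simp: averaging_kernel_def upward_kernel_def)
qed

lemma mollify_converges:
 fixes f :: "point => 'b::euclidean_space"
 assumes f: "f : L2 lborel"
 shows "(%n. L2_norm lborel (%z. mollify (upward_kernel n) f z - f z)) ~~> 0"
proof (rule LIMSEQ_I)
 fix e :: real assume "e > 0"
 then have "e / 2 > 0" by simp
 from L2_translation_continuous[OF f this] obtain d where d: "d > 0"
  "!!h. norm h < d ==> L2_norm lborel (%z. f (z + h) - f z) < e / 2" by auto
 obtain N where N: "4 / d < real N" using reals_Archimedean2 by blast
 show "\<exists>N. \<forall>n\<ge>N. norm (L2_norm lborel (%z. mollify (upward_kernel n) f z - f z) - 0) < e"
 proof (intro exI allI impI)
  fix n assume n: "N <= n"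
  have "L2_norm lborel (%z. mollify (upward_kernel n) f z - f z) <= e / 2"
  proof (rule mollify_close[OF averaging_upward_kernel f])
   fix w assume "upward_kernel n w \<noteq> 0"
   then have "norm w <= 4 / real (Suc n)" by (rule upward_kernel_support)
   also have "... < d"
   proof -
    have "4 / d < real (Suc n)" using N n by linarith
    then show ?thesis using d(1) by (simp add: field_simps)
   qed
   finally show "L2_norm lborel (%z. f (z + w) - f z) <= e / 2" using d(2) less_imp_le by blast
  qed (use \<open>e > 0\<close> in auto)
  then show "norm (L2_norm lborel (%z. mollify (upward_kernel n) f z - f z) - 0) < e"
   using \<open>e > 0\<close> by simp
 qed
qed

section \<open>Weak derivatives\<close>

definition rep :: "(point => 'b::euclidean_space) => point => 'b"
 where "rep f = (SOME g. g : L2 lborel \<and> (\<forall>z. z \<notin> \<Omega> \<longrightarrow> g z = 0) \<and> (AE z in \<mu>. f z = g z))"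

lemma rep:
 assumes "f : L2 \<mu>"
 shows "rep f : L2 lborel" "z \<notin> \<Omega> ==> rep f z = 0" "AE z in \<mu>. f z = rep f z"
  "rep f : borel_measurable borel" "rep f : L2 \<mu>"
proof -
 obtain g where "g : L2 lborel \<and> (\<forall>z. z \<notin> \<Omega> \<longrightarrow> g z = 0) \<and> (AE z in \<mu>. f z = g z)"
  using L2_half_plane_representative[OF assms] by metis
 from someI[of "%g. g : L2 lborel \<and> (\<forall>z. z \<notin> \<Omega> \<longrightarrow> g z = 0) \<and> (AE z in \<mu>. f z = g z)", OF this]
 show *: "rep f : L2 lborel" "z \<notin> \<Omega> ==> rep f z = 0" "AE z in \<mu>. f z = rep f z"
  unfolding rep_def by blast+
 show "rep f : borel_measurable borel" using *(1) by (auto simp: L2_def)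
 show "rep f : L2 \<mu>" by (rule L2_lborel_imp_half_plane[OF *(1)])
qed

lemma rep_L2_norm:
 assumes "f : L2 \<mu>"
 shows "L2_norm lborel (rep f) = nrm f"
proof -
 have "nrm f = nrm (rep f)"
  by (rule L2_norm_cong_AE) (use rep[OF assms] assms in \<open>auto simp: L2_def\<close>)
 also have "... = L2_norm lborel (rep f)"
  by (rule L2_norm_half_plane_eq[OF rep(1,2)[OF assms]])
 finally show ?thesis by simp
qed

lemma integral_rep:
 fixes f :: "point => 'b::euclidean_space" and \<psi> :: "point => real"
 assumes f: "f : L2 \<mu>" and [measurable]: "\<psi> : borel_measurable borel"
 shows "(LINT z|\<mu>. \<psi> z *. f z) = (LINT z|lborel. \<psi> z *. rep f z)"
proof -
 note [measurable] = rep(4)[OF f]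
 have [measurable]: "f : borel_measurable \<mu>" using f by (auto simp: L2_def)
 have [measurable]: "\<psi> : borel_measurable \<mu>" "rep f : borel_measurable \<mu>"
  by (auto intro!: measurable_lborel_imp_lebesgue_on)
 have "(LINT z|\<mu>. \<psi> z *. f z) = (LINT z|\<mu>. \<psi> z *. rep f z)"
  by (rule integral_cong_AE) (use rep(3)[OF f] in \<open>auto elim: AE_mp\<close>)
 also have "... = (LINT z|lborel. indicator \<Omega> z *. (\<psi> z *. rep f z))"
  by (rule integral_half_plane) measurable
 also have "... = (LINT z|lborel. \<psi> z *. rep f z)"
  by (intro bochner_cong refl) (use rep(2)[OF f] in \<open>auto simp: indicator_def\<close>)
 finally show ?thesis .
qed

lemma upward_kernel_translate_test:
 assumes "z : closure \<Omega>"
 shows "(%w. upward_kernel n (w - z)) : test_functions \<Omega>"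
proof (rule test_functionsI)
 let ?K = "{w. norm (w - z) <= 4 / real (Suc n)} \<inter> {w. 1 / real (Suc n) <= snd (w - z)}"
 show "smooth (%w. upward_kernel n (w - z))"
  using test_smooth[OF test_translate[OF averaging_kernelD(1)[OF averaging_upward_kernel]]] .
 have "closed ?K"
  by (intro closed_Int closed_Collect_le continuous_intros)
 moreover have "?K \<subseteq> cball z (4 / real (Suc n))" by (auto simp: dist_norm norm_minus_commute)
 ultimately show "compact ?K" using compact_cball compact_Int_closed bounded_cball bounded_subset compact_eq_bounded_closed by metis
 show "?K \<subseteq> \<Omega>"
 proof
  fix w assume "w : ?K"
  then have 1: "1 / real (Suc n) + snd z <= snd w" by simp
  have 2: "0 < 1 / real (Suc n)" by simp
  have 3: "0 <= snd z" using assms by (simp add: mem_closure_half_plane)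
  have "0 < snd w" using 1 2 3 by linarith
  then show "w : \<Omega>" by (simp add: mem_half_plane)
 qed
 show "upward_kernel n (w - z) = 0" if "w \<notin> ?K" for w
  using upward_kernel_support[of n "w - z"] that by force
qed

text \<open>
 Differentiating a mollification moves the derivatives onto the kernel, and the translated kernel
 is a test function of the open half-plane even at boundary points.
\<close>

lemma mollify_weak_deriv:
 assumes wd: "has_weak_deriv ds f g" and ds: "set ds \<subseteq> Basis" and z: "z : closure \<Omega>"
 shows "partials ds (mollify (upward_kernel n) (rep f)) z = mollify (upward_kernel n) (rep g) z"
proof -
 let ?k = "upward_kernel n"
 have f: "f : L2 \<mu>" and g: "g : L2 \<mu>" using wd by (auto simp: has_weak_deriv_def)
 have k: "?k : test_functions UNIV" using averaging_kernelD(1)[OF averaging_upward_kernel] .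
 have kz: "(%w. ?k (w - z)) : test_functions \<Omega>" by (rule upward_kernel_translate_test[OF z])
 have pkz: "partials ds (%w. ?k (w - z)) : test_functions \<Omega>" by (rule test_partials[OF kz ds])
 have "partials ds (mollify ?k (rep f)) z = (-1) ^ length ds *. mollify (partials ds ?k) (rep f) z"
  by (simp add: partials_mollify[OF k rep(1)[OF f] ds])
 also have "mollify (partials ds ?k) (rep f) z = (LINT w|lborel. partials ds (%w. ?k (w - z)) w *. rep f w)"
  by (simp add: mollify_def partials_translate[OF test_smooth[OF k] ds])
 also have "... = (LINT w|\<mu>. partials ds (%w. ?k (w - z)) w *. f w)"
  by (rule integral_rep[OF f test_measurable[OF pkz], symmetric])
 also have "... = (-1) ^ length ds *. (LINT w|\<mu>. ?k (w - z) *. g w)"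
  using wd kz by (auto simp: has_weak_deriv_def)
 also have "(LINT w|\<mu>. ?k (w - z) *. g w) = mollify ?k (rep g) z"
  unfolding mollify_def by (rule integral_rep[OF g test_measurable[OF kz]])
 finally show ?thesis by (simp add: power_mult_distrib[symmetric])
qed

lemma mollify_rep_converges:
 assumes "f : L2 \<mu>"
 shows "(%n. nrm (%z. mollify (upward_kernel n) (rep f) z - rep f z)) ~~> 0"
proof (rule tendsto_sandwich[OF _ _ tendsto_const mollify_converges[OF rep(1)[OF assms]]])
 show "\<forall>\<^sub>F n in sequentially. nrm (%z. mollify (upward_kernel n) (rep f) z - rep f z)
   <= L2_norm lborel (%z. mollify (upward_kernel n) (rep f) z - rep f z)"
  by (intro always_eventually allI L2_norm_half_plane_le L2_diff mollify_L2(1) averaging_upward_kernel rep(1) assms)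
qed auto

lemma mollify_rep_L2:
 assumes "f : L2 \<mu>"
 shows "mollify (upward_kernel n) (rep f) : L2 \<mu>"
 by (intro L2_lborel_imp_half_plane mollify_L2(1) averaging_upward_kernel rep(1) assms)

text \<open>
 Mollifying any weak derivative of \<open>f\<close> gives the classical derivative of the mollified \<open>f\<close>, so two weak
 derivatives have the same mollifications and hence the same limit.
\<close>

lemma weak_deriv_unique:
 assumes g: "has_weak_deriv ds f g" and g': "has_weak_deriv ds f g'" and ds: "set ds \<subseteq> Basis"
 shows "AE z in \<mu>. g z = g' z"
proof -
 have L: "g : L2 \<mu>" "g' : L2 \<mu>"
  using g g' by (auto simp: has_weak_deriv_def)
 let ?F = "%n. mollify (upward_kernel n) (rep g)"
 have eq: "?F n z = mollify (upward_kernel n) (rep g') z" if "z : \<Omega>" for n z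
  using mollify_weak_deriv[OF g ds, of z] mollify_weak_deriv[OF g' ds, of z] closure_subset[of \<Omega>] that by auto
 have "(%n. nrm (%z. ?F n z - rep g' z)) ~~> 0"
 proof -
  have "nrm (%z. ?F n z - rep g' z)
    = nrm (%z. mollify (upward_kernel n) (rep g') z - rep g' z)" for n
   unfolding L2_norm_def
   by (intro arg_cong[where f=sqrt] bochner_cong) (auto simp: eq)
  then show ?thesis using mollify_rep_converges[OF L(2)] by simp
 qed
 then have "AE z in \<mu>. rep g z = rep g' z"
  by (intro L2_norm_limit_zero[of "rep g" _ ?F] mollify_rep_L2 mollify_rep_converges L rep)
 then show ?thesis using rep(3)[OF L(1)] rep(3)[OF L(2)] by eventually_elim simp
qed

lemma weak_deriv_works:
 "has_weak_deriv ds f g ==> has_weak_deriv ds f (weak_deriv ds f)"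
 unfolding weak_deriv_def by (rule someI[where P="has_weak_deriv ds f"])

lemma weak_deriv_eq:
 assumes "has_weak_deriv ds f g" "set ds \<subseteq> Basis"
 shows "AE z in \<mu>. weak_deriv ds f z = g z"
 using weak_deriv_unique[OF weak_deriv_works assms] assms by blast

lemma test_integrable_weak:
 assumes "f : L2 \<mu>" "\<psi> : test_functions U"
 shows "integrable \<mu> (%z. \<psi> z *. f z)"
 by (rule L2_scaleR_integrable[OF L2_lborel_imp_half_plane[OF test_L2[OF assms(2)]] assms(1)])

lemma has_weak_deriv_diff:
 assumes "has_weak_deriv ds f g" "has_weak_deriv ds f' g'" "set ds \<subseteq> Basis"
 shows "has_weak_deriv ds (%z. f z - f' z) (%z. g z - g' z)"
 using assms unfolding has_weak_deriv_def
 by (auto intro!: L2_diff simp: scaleR_diff_right test_integrable_weak test_integrable_weak[OF _ test_partials])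

lemma has_weak_deriv_scaleR:
 assumes "has_weak_deriv ds f g"
 shows "has_weak_deriv ds (%z. c *. f z) (%z. c *. g z)"
 unfolding has_weak_deriv_def
proof (intro conjI ballI)
 fix \<psi> :: "point => real" assume "\<psi> : test_functions \<Omega>"
 then have "c *. (LINT z|\<mu>. partials ds \<psi> z *. f z) =
   c *. (-1) ^ length ds *. (LINT z|\<mu>. \<psi> z *. g z)"
  using assms by (simp add: has_weak_deriv_def)
 then show "(LINT z|\<mu>. partials ds \<psi> z *. c *. f z) =
   (-1) ^ length ds *. (LINT z|\<mu>. \<psi> z *. c *. g z)"
  by (simp only: scaleR_left_commute[of _ c] integral_scaleR_right)
qed (use assms in \<open>auto simp: has_weak_deriv_def intro!: L2_scaleR\<close>)

lemma has_weak_deriv_Nil: "f : L2 \<mu> ==> has_weak_deriv [] f f"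
 by (simp add: has_weak_deriv_def partials_def)

subsection \<open>The space of functions with one weak derivative\<close>

lemma Basis_point: "Basis = {(1, 0), (0, 1) :: point}"
 by (auto simp: Basis_prod_def)

lemma sum_Basis_point:
 fixes F :: "point => 'b::comm_monoid_add"
 shows "(\<Sum>i\<in>Basis. F i) = F (1, 0) + F (0, 1)"
 unfolding Basis_point by simp

lemma multi_indices_0: "multi_indices 0 = {[]}"
 by (auto simp: multi_indices_def)

lemma multi_indices_1: "multi_indices (Suc 0) = (%i. [i]) ` Basis"
 by (auto simp: multi_indices_def length_Suc_conv)

lemma Hs_1_iff:
 "f : Hs 1 \<longleftrightarrow> f : L2 \<mu> \<and> (\<forall>i\<in>Basis. \<exists>g. has_weak_deriv [i] f g)"
proof -
 have "nat \<lfloor>1::real\<rfloor> = Suc 0" by simp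
 moreover have "(\<forall>k\<le>Suc 0. P k) \<longleftrightarrow> P 0 \<and> P (Suc 0)" for P by (metis le_Suc_eq le_zero_eq)
 ultimately show ?thesis
  by (auto simp: Hs_def multi_indices_0 multi_indices_1 intro: has_weak_deriv_Nil)
qed

lemma Hs_1_L2: "f : Hs 1 ==> f : L2 \<mu>"
 by (simp add: Hs_1_iff)

lemma Hs_1_weak_deriv:
 assumes "f : Hs 1" "i : Basis"
 shows "has_weak_deriv [i] f (weak_deriv [i] f)" "weak_deriv [i] f : L2 \<mu>"
proof -
 show "has_weak_deriv [i] f (weak_deriv [i] f)" using assms Hs_1_iff weak_deriv_works by blast
 then show "weak_deriv [i] f : L2 \<mu>" by (simp add: has_weak_deriv_def)
qed

lemma Hs_norm_1_sq:
 assumes "f : Hs 1"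
 shows "(Hs_norm 1 f)^2 = (nrm f)^2 + (\<Sum>i\<in>Basis. (nrm (weak_deriv [i] f))^2)"
proof -
 have "nat \<lfloor>1::real\<rfloor> = Suc 0" by simp
 moreover have "(\<Sum>ds\<in>(%i. [i]) ` Basis. P ds) = (\<Sum>i\<in>Basis. P [i])" for P :: "point list => real"
  by (subst sum.reindex) (auto simp: inj_on_def)
 moreover have "nrm (weak_deriv [] f) = nrm f"
  using weak_deriv_eq[OF has_weak_deriv_Nil[OF Hs_1_L2[OF assms]]] weak_deriv_works[OF has_weak_deriv_Nil[OF Hs_1_L2[OF assms]]] Hs_1_L2[OF assms]
  by (intro L2_norm_cong_AE) (auto simp: has_weak_deriv_def L2_def)
 ultimately have "Hs_norm 1 f = sqrt ((nrm f)^2 + (\<Sum>i\<in>Basis. (nrm (weak_deriv [i] f))^2))"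
  by (simp add: Hs_norm_def multi_indices_0 multi_indices_1 frac_def)
 then show ?thesis by (simp add: sum_nonneg)
qed

lemma Hs_norm_1_nonneg: "f : Hs 1 ==> 0 <= Hs_norm 1 f"
 by (auto simp: Hs_norm_def intro!: add_nonneg_nonneg sum_nonneg)

lemma Hs_norm_1_ge:
 assumes "f : Hs 1"
 shows "nrm f <= Hs_norm 1 f" "i : Basis ==> nrm (weak_deriv [i] f) <= Hs_norm 1 f"
proof -
 show "nrm f <= Hs_norm 1 f"
  by (rule power2_le_imp_le[OF _ Hs_norm_1_nonneg[OF assms]]) (simp add: Hs_norm_1_sq[OF assms] sum_nonneg)
 assume i: "i : Basis"
 show "nrm (weak_deriv [i] f) <= Hs_norm 1 f"
  using i by (intro power2_le_imp_le[OF _ Hs_norm_1_nonneg[OF assms]])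
   (auto simp add: Hs_norm_1_sq[OF assms] intro!: add_increasing member_le_sum)
qed

lemma Hs_1_diff: "f : Hs 1 ==> g : Hs 1 ==> (%z. f z - g z) : Hs 1"
proof (subst Hs_1_iff, intro conjI ballI exI)
 assume f: "f : Hs 1" and g: "g : Hs 1"
 show "(%z. f z - g z) : L2 \<mu>" by (intro L2_diff Hs_1_L2 f g)
 fix i :: point assume i: "i : Basis"
 show "has_weak_deriv [i] (%z. f z - g z) (%z. weak_deriv [i] f z - weak_deriv [i] g z)"
  by (rule has_weak_deriv_diff[OF Hs_1_weak_deriv(1)[OF f i] Hs_1_weak_deriv(1)[OF g i]]) (use i in simp)
qed

lemma Hs_1_scaleR: "f : Hs 1 ==> (%z. c *. f z) : Hs 1"
proof (subst Hs_1_iff, intro conjI ballI exI)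
 assume f: "f : Hs 1"
 show "(%z. c *. f z) : L2 \<mu>" by (intro L2_scaleR Hs_1_L2 f)
 fix i :: point assume i: "i : Basis"
 show "has_weak_deriv [i] (%z. c *. f z) (%z. c *. weak_deriv [i] f z)"
  by (rule has_weak_deriv_scaleR[OF Hs_1_weak_deriv(1)[OF f i]])
qed

lemma weak_deriv_diff:
 assumes "f : Hs 1" "g : Hs 1" "i : Basis"
 shows "AE z in \<mu>. weak_deriv [i] (%z. f z - g z) z = weak_deriv [i] f z - weak_deriv [i] g z"
 by (rule weak_deriv_eq[OF has_weak_deriv_diff[OF Hs_1_weak_deriv(1)[OF assms(1,3)] Hs_1_weak_deriv(1)[OF assms(2,3)]]])
   (use assms in auto)

lemma weak_deriv_scaleR:
 assumes "f : Hs 1" "i : Basis"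
 shows "AE z in \<mu>. weak_deriv [i] (%z. c *. f z) z = c *. weak_deriv [i] f z"
 by (rule weak_deriv_eq[OF has_weak_deriv_scaleR[OF Hs_1_weak_deriv(1)[OF assms]]]) (use assms in auto)

lemma Hs_norm_1_scaleR:
 assumes "f : Hs 1"
 shows "Hs_norm 1 (%z. c *. f z) = \<bar>c\<bar> * Hs_norm 1 f"
proof (rule power2_eq_imp_eq)
 have "nrm (weak_deriv [i] (%z. c *. f z)) = \<bar>c\<bar> * nrm (weak_deriv [i] f)"
  if "i : Basis" for i
  unfolding L2_norm_scaleR[symmetric]
  by (rule L2_norm_cong_AE)
    (use weak_deriv_scaleR[OF assms that] Hs_1_weak_deriv(2)[OF assms that] Hs_1_weak_deriv(2)[OF Hs_1_scaleR[OF assms] that]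
    in \<open>auto simp: L2_def\<close>)
 then show "(Hs_norm 1 (%z. c *. f z))^2 = (\<bar>c\<bar> * Hs_norm 1 f)^2"
  by (simp add: Hs_norm_1_sq assms Hs_1_scaleR L2_norm_scaleR power_mult_distrib distrib_left sum_distrib_left)
qed (auto simp: Hs_norm_1_nonneg assms Hs_1_scaleR)

section \<open>Fields that are continuously differentiable up to the boundary\<close>

text \<open>
 The derivatives are taken within the closed half-plane, so that they are one-sided on the boundary. Their
 continuity is required direction by direction.
\<close>

definition C1_up :: "(point => 'b::euclidean_space) => (point => point => 'b) => bool"
 where "C1_up f D \<longleftrightarrow>
  (\<forall>z\<in>closure \<Omega>. (f has_derivative D z) (at z within closure \<Omega>)) \<and>
  (\<forall>i. continuous_on (closure \<Omega>) (%z. D z i))"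

lemma C1_up_continuous: "C1_up f D ==> continuous_on (closure \<Omega>) f"
 unfolding C1_up_def by (meson continuous_on_eq_continuous_within has_derivative_continuous)

lemma C1_up_smooth:
 assumes "smooth \<psi>"
 shows "C1_up \<psi> (%z. frechet_derivative \<psi> (at z))"
 unfolding C1_up_def
proof (intro conjI ballI allI)
 fix i
 have "(%z. frechet_derivative \<psi> (at z) i) = (%z. \<Sum>j\<in>Basis. (i \<bullet> j) *. partial j \<psi> z)"
  using smooth_differentiable[OF assms] by (simp add: frechet_derivative_partial)
 then show "continuous_on (closure \<Omega>) (%z. frechet_derivative \<psi> (at z) i)"
  by (simp only:) (intro continuous_intros smooth_continuous smooth_partial assms)
qed (use smooth_has_derivative[OF assms] has_derivative_at_withinI in blast)

lemma C1_up_scaleR: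
 fixes a :: "point => real"
 assumes a: "C1_up a A" and f: "C1_up f D"
 shows "C1_up (%z. a z *. f z) (%z h. a z *. D z h + A z h *. f z)"
 using assms C1_up_continuous[OF a] C1_up_continuous[OF f] unfolding C1_up_def
 by (auto intro!: has_derivative_scaleR continuous_intros)

lemma C1_up_inner:
 assumes f: "C1_up f D" and g: "C1_up g E"
 shows "C1_up (%z. f z \<bullet> g z) (%z h. f z \<bullet> E z h + D z h \<bullet> g z)"
 using assms C1_up_continuous[OF f] C1_up_continuous[OF g] unfolding C1_up_def
 by (auto intro!: has_derivative_inner continuous_intros)

lemma C1_up_inner_const:
 assumes f: "C1_up f D"
 shows "C1_up (%z. f z \<bullet> c) (%z h. D z h \<bullet> c)"
 using assms unfolding C1_up_def
 by (auto intro!: has_derivative_inner_left continuous_intros)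

lemma C1_up_diff_const:
 assumes f: "C1_up f D"
 shows "C1_up (%z. f z - c) D"
 using assms unfolding C1_up_def
 by (auto intro!: derivative_eq_intros)

lemma C1_up_line:
 assumes f: "C1_up f D" and l: "!!t. t : S ==> b + t *. h : closure \<Omega>" and t: "t : S"
 shows "((%t. f (b + t *. h)) has_vector_derivative D (b + t *. h) h) (at t within S)"
proof -
 have D: "(f has_derivative D (b + t *. h)) (at (b + t *. h) within closure \<Omega>)"
  using f l[OF t] by (auto simp: C1_up_def)
 have 1: "((%t. b + t *. h) has_derivative (%s. s *. h)) (at t within S)"
  by (auto intro!: derivative_eq_intros)
 have 2: "(f has_derivative D (b + t *. h)) (at (b + t *. h) within (%t. b + t *. h) ` S)"
  by (rule has_derivative_subset[OF D]) (use l in auto)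
 from has_derivative_in_compose[OF 1 2]
 show ?thesis
  by (simp add: has_vector_derivative_def linear_cmul[OF has_derivative_linear[OF D]])
qed

lemma continuous_closure_measurable:
 fixes f :: "point => 'b::euclidean_space"
 assumes "continuous_on (closure \<Omega>) f"
 shows "(%z. indicator \<Omega> z *. f z) : borel_measurable borel" "f : borel_measurable \<mu>"
proof -
 have c: "continuous_on \<Omega> f" using assms closure_subset continuous_on_subset by blast
 show "(%z. indicator \<Omega> z *. f z) : borel_measurable borel"
  by (rule borel_measurable_continuous_on_indicator[OF half_plane_borel c])
 show "f : borel_measurable \<mu>"
  by (rule continuous_imp_measurable_on_sets_lebesgue[OF c]) simp
qed

lemma compact_support_half_plane_integrable:
 fixes f :: "point => 'b::euclidean_space"
 assumes "continuous_on (closure \<Omega>) f" "!!z. z : closure \<Omega> ==> norm z > R ==> f z = 0"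
 shows "integrable lborel (%z. indicator \<Omega> z *. f z)"
proof -
 have "integrable lborel (%z. indicator (closure \<Omega> \<inter> cball 0 R) z *. f z)"
  by (rule borel_integrable_compact) (auto intro: continuous_on_subset[OF assms(1)])
 then show ?thesis
 proof (rule Bochner_Integration.integrable_bound)
  show "AE z in lborel. norm (indicator \<Omega> z *. f z) <= norm (indicator (closure \<Omega> \<inter> cball 0 R) z *. f z)"
  proof (rule AE_I2)
   fix z show "norm (indicator \<Omega> z *. f z) <= norm (indicator (closure \<Omega> \<inter> cball 0 R) z *. f z)"
    using assms(2)[of z] closure_subset[of \<Omega>] by (cases "norm z > R") (auto simp: indicator_def)
  qed
 qed (use continuous_closure_measurable(1)[OF assms(1)] in simp)
qed

text \<open>The two components of the divergence theorem, each by Fubini and the fundamental theorem.\<close>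

lemma integral_partial_zero:
 fixes f :: "point => 'b::euclidean_space"
 assumes f: "C1_up f D" and supp: "!!z. z : closure \<Omega> ==> norm z > R ==> f z = 0 \<and> D z = (%h. 0)"
 shows "(LINT z|\<mu>. D z (1, 0)) = 0"
  and "(!!x. f (x, 0) = 0) ==> (LINT z|\<mu>. D z (0, 1)) = 0"
proof -
 have cont: "continuous_on (closure \<Omega>) (%z. D z i)" for i using f unfolding C1_up_def by blast
 have meas: "(%z. D z i) : borel_measurable \<mu>" for i by (rule continuous_closure_measurable[OF cont])
 have int: "integrable lborel (%z. indicator \<Omega> z *. D z i)" for i
  by (rule compact_support_half_plane_integrable[OF cont, of R]) (use supp in simp)
 have int': "integrable (lborel \<Otimes>\<^sub>M lborel) (%(x, y). indicator \<Omega> (x, y) *. D (x, y) i)" for i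
  using int[of i] by (simp add: lborel_prod split_beta')
 have eq: "(LINT z|\<mu>. D z i) = (LINT z|lborel. indicator \<Omega> z *. D z i)" for i
  by (subst integral_restrict_space, simp, subst integral_completion) 
    (use continuous_closure_measurable[OF cont[of i]] in auto)
 let ?R = "\<bar>R\<bar> + 1"
 have R: "norm (x, y) > R" if "\<bar>x\<bar> \<ge> ?R \<or> \<bar>y\<bar> \<ge> ?R" for x y :: real
  using that norm_fst_le[of x y] norm_snd_le[of y x] by auto
 show "(LINT z|\<mu>. D z (1, 0)) = 0"
 proof -
  have "(LINT x|lborel. indicator \<Omega> (x, y) *. D (x, y) (1, 0)) = 0" for y
  proof (cases "y > 0")
   case True
   have l: "(0, y) + t *. (1, 0) : closure \<Omega>" for t using True by (simp add: mem_closure_half_plane)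
   have "has_bochner_integral lborel (%x. indicator {- ?R..?R} x *. D (x, y) (1, 0)) (f (?R, y) - f (- ?R, y))"
   proof (rule has_bochner_integral_FTC_Icc)
    show "((%x. f (x, y)) has_vector_derivative D (x, y) (1, 0)) (at x within {- ?R..?R})" if "- ?R <= x" "x <= ?R" for x
     using C1_up_line[OF f l, of x "{- ?R..?R}"] that by simp
    show "continuous_on {- ?R..?R} (%x. D (x, y) (1, 0))"
     by (rule continuous_on_compose2[OF cont[of "(1,0)"], of _ "%x. (x, y)"]) 
       (use True in \<open>auto simp: mem_closure_half_plane intro!: continuous_intros\<close>)
   qed auto
   moreover have "f (?R, y) = 0" "f (- ?R, y) = 0"
    using supp R[of ?R y] R[of "- ?R" y] True by (auto simp: mem_closure_half_plane)
   moreover have "(%x. indicator {- ?R..?R} x *. D (x, y) (1, 0)) = (%x. indicator \<Omega> (x, y) *. D (x, y) (1, 0))"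
   proof
    fix x
    show "indicator {- ?R..?R} x *. D (x, y) (1, 0) = indicator \<Omega> (x, y) *. D (x, y) (1, 0)"
     using supp[of "(x, y)"] R[of x y] True by (auto simp: indicator_def mem_half_plane mem_closure_half_plane)
   qed
   ultimately show ?thesis by (simp add: has_bochner_integral_iff)
  next
   case False
   then show ?thesis by (simp add: indicator_def mem_half_plane)
  qed
  then show ?thesis
   using lborel_pair.integral_snd[OF int'[of "(1, 0)"]] by (simp add: eq lborel_prod split_beta')
 qed
 assume bd: "!!x. f (x, 0) = 0"
 show "(LINT z|\<mu>. D z (0, 1)) = 0"
 proof -
  have "(LINT y|lborel. indicator \<Omega> (x, y) *. D (x, y) (0, 1)) = 0" for x
  proof -
   have l: "(x, 0) + t *. (0, 1) : closure \<Omega>" if "t : {0..?R}" for t using that by (simp add: mem_closure_half_plane)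
   have "has_bochner_integral lborel (%y. indicator {0..?R} y *. D (x, y) (0, 1)) (f (x, ?R) - f (x, 0))"
   proof (rule has_bochner_integral_FTC_Icc)
    show "((%y. f (x, y)) has_vector_derivative D (x, y) (0, 1)) (at y within {0..?R})" if "0 <= y" "y <= ?R" for y
     using C1_up_line[OF f l, of "{0..?R}" y] that by simp
    show "continuous_on {0..?R} (%y. D (x, y) (0, 1))"
     by (rule continuous_on_compose2[OF cont[of "(0,1)"], of _ "%y. (x, y)"]) 
       (auto simp: mem_closure_half_plane intro!: continuous_intros)
   qed auto
   moreover have "f (x, ?R) = 0"
    using supp R[of x ?R] by (auto simp: mem_closure_half_plane)
   moreover have "(LINT y|lborel. indicator {0..?R} y *. D (x, y) (0, 1)) = (LINT y|lborel. indicator \<Omega> (x, y) *. D (x, y) (0, 1))"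
   proof (rule integral_cong_AE)
    show "AE y in lborel. indicator {0..?R} y *. D (x, y) (0, 1) = indicator \<Omega> (x, y) *. D (x, y) (0, 1)"
     using AE_lborel_singleton[of "0::real"]
    proof eventually_elim
     case (elim y)
     show ?case
     proof (cases "norm (x, y) > R")
      case True
      then show ?thesis using supp[of "(x, y)"] elim by (auto simp: indicator_def mem_half_plane mem_closure_half_plane)
     next
      case False
      then have "\<not> \<bar>y\<bar> \<ge> ?R" using R by blast
      then show ?thesis using elim by (auto simp: indicator_def mem_half_plane)
     qed
    qed
    have [measurable]: "(%z. indicator \<Omega> z *. D z (0, 1)) : borel_measurable borel"
     by (rule continuous_closure_measurable[OF cont])
    have "(%y. (%z. indicator \<Omega> z *. D z (0, 1)) (x, y)) : borel_measurable lborel" by measurable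
    then show "(%y. indicator \<Omega> (x, y) *. D (x, y) (0, 1)) : borel_measurable lborel" by simp
   qed (use calculation(1) in \<open>auto simp: has_bochner_integral_iff\<close>)
   ultimately show ?thesis using bd by (simp add: has_bochner_integral_iff)
  qed
  then show ?thesis
   using lborel_pair.integral_fst[OF int'[of "(0, 1)"]] by (simp add: eq lborel_prod split_beta')
 qed
qed

lemma C1_up_test_product:
 assumes \<psi>: "\<psi> : test_functions U" and f: "C1_up f D"
 obtains R where "C1_up (%z. \<psi> z *. f z) (%z h. \<psi> z *. D z h + frechet_derivative \<psi> (at z) h *. f z)"
  "!!z. norm z > R ==> \<psi> z *. f z = 0 \<and> (%h. \<psi> z *. D z h + frechet_derivative \<psi> (at z) h *. f z) = (%h. 0)"
proof -
 obtain R where R: "R > 0" "!!z. norm z > R ==> \<psi> z = 0" using test_bounded_support[OF \<psi>] by auto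
 have "closure {z. \<psi> z \<noteq> 0} \<subseteq> cball 0 R"
  by (rule support_subset_cball[OF R(2)])
 then have "z \<notin> closure {z. \<psi> z \<noteq> 0}" if "norm z > R" for z
  using that by (auto simp: subset_eq)
 then have "frechet_derivative \<psi> (at z) h = 0" if "norm z > R" for z h
  using partial_zero_off_support[of z \<psi> h] that by (simp add: partial_def)
 with R show ?thesis
  by (intro that[of R] C1_up_scaleR C1_up_smooth test_smooth[OF \<psi>] f) (auto simp: fun_eq_iff)
qed

text \<open>
 The product with a test function has bounded support, so that its partial derivatives have integral zero.
\<close>

lemma classical_weak_deriv:
 fixes f :: "point => 'b::euclidean_space"
 assumes f: "C1_up f D" and L: "f : L2 \<mu>" "(%z. D z i) : L2 \<mu>" and i: "i : Basis"
 shows "has_weak_deriv [i] f (%z. D z i)"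
 unfolding has_weak_deriv_def
proof (intro conjI ballI L)
 fix \<psi> :: "point => real" assume \<psi>: "\<psi> : test_functions \<Omega>"
 obtain R where C: "C1_up (%z. \<psi> z *. f z) (%z h. \<psi> z *. D z h + frechet_derivative \<psi> (at z) h *. f z)"
  "!!z. norm z > R ==> \<psi> z *. f z = 0 \<and> (%h. \<psi> z *. D z h + frechet_derivative \<psi> (at z) h *. f z) = (%h. 0)"
  using C1_up_test_product[OF \<psi> f] by auto
 have "\<psi> (x, 0) = 0" for x
  using \<psi> closure_subset[of "{z. \<psi> z \<noteq> 0}"] by (force simp: test_functions_def mem_half_plane)
 then have "(LINT z|\<mu>. \<psi> z *. D z i + frechet_derivative \<psi> (at z) i *. f z) = 0"
  using integral_partial_zero[OF C(1), of R] C(2) i unfolding Basis_point by auto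
 moreover have "integrable \<mu> (%z. \<psi> z *. D z i)" by (rule test_integrable_weak[OF L(2) \<psi>])
 moreover have "integrable \<mu> (%z. frechet_derivative \<psi> (at z) i *. f z)"
  using test_integrable_weak[OF L(1) test_partial[OF \<psi> i]] by (simp add: partial_def)
 ultimately show "(LINT z|\<mu>. partials [i] \<psi> z *. f z) = (-1) ^ length [i] *. (LINT z|\<mu>. \<psi> z *. D z i)"
  by (simp add: partials_def partial_def[abs_def] add_eq_0_iff)
qed

text \<open>
 The divergence theorem for \<open>\<psi> v\<close>: on the boundary only the vertical component of \<open>v\<close> could contribute.
\<close>

lemma classical_tangent:
 fixes v :: field
 assumes v: "C1_up v D" and div: "!!z. z : \<Omega> ==> (\<Sum>i\<in>Basis. D z i \<bullet> i) = 0" and bd: "!!x. snd (v (x, 0)) = 0"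
  and L: "v : L2 \<mu>" "!!i. (%z. D z i) : L2 \<mu>"
 shows "tangent_to_boundary v"
 unfolding tangent_to_boundary_def
proof
 fix \<psi> :: "point => real" assume \<psi>: "\<psi> : test_functions UNIV"
 have zero: "(LINT z|\<mu>. \<psi> z * (D z i \<bullet> i) + frechet_derivative \<psi> (at z) i * (v z \<bullet> i)) = 0"
  if i: "i : Basis" for i
 proof -
  obtain R where C: "C1_up (%z. \<psi> z *. (v z \<bullet> i)) (%z h. \<psi> z *. (D z h \<bullet> i) + frechet_derivative \<psi> (at z) h *. (v z \<bullet> i))"
   "!!z. norm z > R ==> \<psi> z *. (v z \<bullet> i) = 0 \<and> (%h. \<psi> z *. (D z h \<bullet> i) + frechet_derivative \<psi> (at z) h *. (v z \<bullet> i)) = (%h. 0)"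
   using C1_up_test_product[OF \<psi> C1_up_inner_const[OF v, of i]] by auto
  have "v (x, 0) \<bullet> (0, 1) = 0" for x using bd[of x] by (simp add: inner_prod_def)
  then show ?thesis
   using integral_partial_zero[OF C(1), of R] C(2) i unfolding Basis_point by auto
 qed
 have int: "integrable \<mu> (%z. \<psi> z * (D z i \<bullet> i))"
   "integrable \<mu> (%z. frechet_derivative \<psi> (at z) i * (v z \<bullet> i))" if i: "i : Basis" for i
  using test_integrable_weak[OF L2_inner_component[OF L(2)] \<psi>, of i i]
   test_integrable_weak[OF L2_inner_component[OF L(1)] test_partial[OF \<psi> i], of i] by (simp_all add: partial_def)
 have "(LINT z|\<mu>. frechet_derivative \<psi> (at z) (v z))
   = (LINT z|\<mu>. (\<Sum>i\<in>Basis. \<psi> z * (D z i \<bullet> i) + frechet_derivative \<psi> (at z) i * (v z \<bullet> i)))"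
 proof (rule bochner_cong[OF refl])
  fix z assume "z : space \<mu>"
  then have "(\<Sum>i\<in>Basis. \<psi> z * (D z i \<bullet> i)) = 0" using div[of z] by (simp add: sum_distrib_left[symmetric])
  then show "frechet_derivative \<psi> (at z) (v z) = (\<Sum>i\<in>Basis. \<psi> z * (D z i \<bullet> i) + frechet_derivative \<psi> (at z) i * (v z \<bullet> i))"
   using frechet_derivative_partial[OF smooth_differentiable[OF test_smooth[OF \<psi>]], of z "v z"]
   by (simp add: sum.distrib partial_def mult.commute)
 qed
 also have "... = 0"
  using zero int by (subst Bochner_Integration.integral_sum) auto
 finally show "(LINT z|\<mu>. frechet_derivative \<psi> (at z) (v z)) = 0" .
qed

section \<open>Density of smooth functions and the trace\<close>

definition cutoff_at :: "nat => point => real"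
 where "cutoff_at n z = cutoff ((1 / real (Suc n)) *. z + 0)"

lemma cutoff_at_test: "cutoff_at n : test_functions UNIV"
 using test_cutoff[of "1 / real (Suc n)" 0] by (simp add: cutoff_at_def[abs_def])

lemma cutoff_at_bounds: "0 <= cutoff_at n z" "cutoff_at n z <= 1" "\<bar>cutoff_at n z\<bar> <= 1"
 using cutoff_nonneg cutoff_le_1 by (auto simp: cutoff_at_def)

lemma inverse_Suc_tendsto: "(%n. 1 / real (Suc n)) ~~> 0"
 using LIMSEQ_inverse_real_of_nat by (simp add: inverse_eq_divide)

lemma cutoff_at_tendsto: "(%n. cutoff_at n z) ~~> 1"
proof -
 have "(%n. (1 / real (Suc n)) *. z + 0) ~~> 0 *. z + 0"
  by (intro tendsto_intros inverse_Suc_tendsto)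
 then have "(%n. cutoff ((1 / real (Suc n)) *. z + 0)) ~~> cutoff 0"
  by (intro continuous_on_tendsto_compose[OF smooth_continuous[OF smooth_cutoff, of UNIV]]) auto
 then show ?thesis by (simp add: cutoff_at_def cutoff_0)
qed

lemma partial_cutoff_at: "partial i (cutoff_at n) z = (1 / real (Suc n)) * partial i cutoff ((1 / real (Suc n)) *. z + 0)"
 using partial_affine[OF smooth_differentiable_on[OF smooth_cutoff], of i "1 / real (Suc n)" 0]
 by (simp add: cutoff_at_def[abs_def])

lemma ex_partial_cutoff_bound: "\<exists>C>0. \<forall>i\<in>Basis. \<forall>z. \<bar>partial i cutoff z\<bar> <= C"
proof -
 have t: "cutoff : test_functions UNIV" using test_cutoff[of 1 0] by simp
 have "\<exists>C>0. \<forall>z. \<bar>partial i cutoff z\<bar> <= C" if "i : Basis" for i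
  using test_bounded[OF test_partial[OF t that]] by (metis real_norm_def)
 then obtain C where C: "!!i. i : Basis ==> C i > 0" "!!i z. i : Basis ==> \<bar>partial i cutoff z\<bar> <= C i" by metis
 show ?thesis
 proof (intro exI[of _ "\<Sum>i\<in>Basis. C i"] conjI ballI allI)
  show "0 < (\<Sum>i\<in>Basis. C i)" using C(1) by (intro sum_pos) auto
  fix i :: point and z assume i: "i : Basis"
  have "C i <= (\<Sum>i\<in>Basis. C i)" using C(1) i by (intro member_le_sum) (auto intro: less_imp_le)
  then show "\<bar>partial i cutoff z\<bar> <= (\<Sum>i\<in>Basis. C i)" using C(2)[OF i, of z] by linarith
 qed
qed

lemma cutoff_mollify_converges:
 assumes h: "h : L2 \<mu>"
 shows "(%n. nrm (%z. cutoff_at n z *. mollify (upward_kernel n) (rep h) z - h z)) ~~> 0"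
proof -
 let ?M = "\<mu>" and ?m = "%n. mollify (upward_kernel n) (rep h)"
 have c [measurable]: "cutoff_at n : borel_measurable ?M" for n
  by (rule measurable_lborel_imp_lebesgue_on[OF test_measurable[OF cutoff_at_test]])
 have hm [measurable]: "h : borel_measurable ?M" using h by (auto simp: L2_def)
 have r: "rep h : L2 ?M" by (rule rep(5)[OF h])
 have rm [measurable]: "rep h : borel_measurable ?M" using r by (auto simp: L2_def)
 have mm: "?m n : L2 ?M" for n by (rule mollify_rep_L2[OF h])
 note d = L2_diff[OF mm r]
 have cL: "(%z. cutoff_at n z *. g z) : L2 ?M" if "g : L2 ?M" for g :: "point => 'a" and n
  by (rule L2_bounded_mult[OF that c, where C=1]) (rule cutoff_at_bounds)
 have 1: "L2_norm ?M (%z. cutoff_at n z *. ?m n z - cutoff_at n z *. rep h z) <= L2_norm ?M (%z. ?m n z - rep h z)" for n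
 proof (rule L2_norm_mono[OF _ d])
  show "(%z. cutoff_at n z *. ?m n z - cutoff_at n z *. rep h z) : borel_measurable ?M"
   using L2_diff[OF cL[OF mm] cL[OF r], of n n] by (auto simp: L2_def)
  show "AE z in ?M. norm (cutoff_at n z *. ?m n z - cutoff_at n z *. rep h z) <= norm (?m n z - rep h z)"
   using cutoff_at_bounds(3) by (intro AE_I2) (simp add: scaleR_diff_right[symmetric] mult_left_le_one_le)
 qed
 have 2: "(%n. L2_norm ?M (%z. cutoff_at n z *. rep h z - rep h z)) ~~> 0"
 proof (rule L2_dominated_convergence[OF _ rm L2_integrable_sq[OF r]])
  show "AE z in ?M. (norm (cutoff_at n z *. rep h z - rep h z))^2 <= (norm (rep h z))^2" for n
  proof (intro AE_I2 power_mono)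
   fix z
   have "cutoff_at n z *. rep h z - rep h z = (cutoff_at n z - 1) *. rep h z" by (simp add: algebra_simps)
   then show "norm (cutoff_at n z *. rep h z - rep h z) <= norm (rep h z)"
    using cutoff_at_bounds[of n z] by (simp add: mult_left_le_one_le)
  qed simp
  show "AE z in ?M. (%n. cutoff_at n z *. rep h z) ~~> rep h z"
  proof (rule AE_I2)
   fix z have "(%n. cutoff_at n z *. rep h z) ~~> 1 *. rep h z"
    by (intro tendsto_intros cutoff_at_tendsto)
   then show "(%n. cutoff_at n z *. rep h z) ~~> rep h z" by simp
  qed
 qed measurable
 have eq: "L2_norm ?M (%z. cutoff_at n z *. ?m n z - h z) = L2_norm ?M (%z. cutoff_at n z *. ?m n z - rep h z)" for n
 proof (rule L2_norm_cong_AE)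
  show "AE z in ?M. cutoff_at n z *. ?m n z - h z = cutoff_at n z *. ?m n z - rep h z"
   using rep(3)[OF h] by eventually_elim simp
 qed (use L2_diff[OF cL[OF mm] r, of n n] L2_diff[OF cL[OF mm] h, of n n] in \<open>auto simp: L2_def\<close>)
 show ?thesis
 proof (rule tendsto_sandwich[OF _ _ tendsto_const])
  show "\<forall>\<^sub>F n in sequentially. L2_norm ?M (%z. cutoff_at n z *. ?m n z - h z)
    <= L2_norm ?M (%z. ?m n z - rep h z) + L2_norm ?M (%z. cutoff_at n z *. rep h z - rep h z)"
   unfolding eq
   using 1 L2_norm_triangle_diff[OF cL[OF mm] cL[OF r] r] by (intro always_eventually allI) (meson add_mono order_refl order_trans)
  show "(%n. L2_norm ?M (%z. ?m n z - rep h z) + L2_norm ?M (%z. cutoff_at n z *. rep h z - rep h z)) ~~> 0"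
   using tendsto_add[OF mollify_rep_converges[OF h] 2] by simp
 qed auto
qed

text \<open>
 Smooth functions with compact support in the closed half-plane are dense in \<open>H\<^sup>1(\<Omega>)\<close>: mollify
 upwards, which yields functions that are smooth across the boundary, and cut off at infinity.
\<close>

lemma H1_density:
 fixes f :: "point => 'b::euclidean_space"
 assumes f: "f : Hs 1"
 obtains F :: "nat => point => 'b" where "!!n. F n : test_functions UNIV"
  "(%n. nrm (%z. F n z - f z)) ~~> 0"
  "!!i. i : Basis ==> (%n. nrm (%z. partial i (F n) z - weak_deriv [i] f z)) ~~> 0"
proof -
 let ?M = "\<mu>" and ?m = "%n. mollify (upward_kernel n) (rep f)"
 define F where "F n z = cutoff_at n z *. ?m n z" for n z
 have fL: "f : L2 ?M" by (rule Hs_1_L2[OF f])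
 have sm: "smooth (?m n)" for n
  by (rule smooth_mollify[OF averaging_kernelD(1)[OF averaging_upward_kernel] rep(1)[OF fL]])
 have sc: "smooth (cutoff_at n)" for n by (rule test_smooth[OF cutoff_at_test])
 have "F n : test_functions UNIV" for n
  unfolding F_def by (rule test_scaleR_left[OF cutoff_at_test sm])
 moreover have "(%n. L2_norm ?M (%z. F n z - f z)) ~~> 0"
  unfolding F_def by (rule cutoff_mollify_converges[OF fL])
 moreover have "(%n. L2_norm ?M (%z. partial i (F n) z - weak_deriv [i] f z)) ~~> 0" if i: "i : Basis" for i
 proof -
  let ?g = "weak_deriv [i] f"
  have g: "?g : L2 ?M" and wd: "has_weak_deriv [i] f ?g" using Hs_1_weak_deriv[OF f i] by auto
  obtain C where C: "C > 0" "!!z. \<bar>partial i cutoff z\<bar> <= C" using ex_partial_cutoff_bound i by blast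
  have c [measurable]: "cutoff_at n : borel_measurable ?M" "partial i (cutoff_at n) : borel_measurable ?M" for n
   by (auto intro!: measurable_lborel_imp_lebesgue_on test_measurable[OF cutoff_at_test] test_measurable[OF test_partial[OF cutoff_at_test i]])
  have cb: "\<bar>partial i (cutoff_at n) z\<bar> <= C / real (Suc n)" for n z
   unfolding partial_cutoff_at abs_mult using C(2) by (simp add: divide_right_mono del: of_nat_Suc)
  let ?G = "%n z. cutoff_at n z *. mollify (upward_kernel n) (rep ?g) z"
  let ?E = "%n z. partial i (cutoff_at n) z *. ?m n z"
  have GL: "?G n : L2 ?M" for n
   by (rule L2_bounded_mult[OF mollify_rep_L2[OF g] c(1), where C=1]) (rule cutoff_at_bounds)
  have EL: "?E n : L2 ?M" for n
   by (rule L2_bounded_mult[OF mollify_rep_L2[OF fL] c(2), where C="C / real (Suc n)"]) (rule cb)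
  have E: "L2_norm ?M (?E n) <= C / real (Suc n) * L2_norm ?M f" for n
  proof -
   have "L2_norm ?M (?E n) <= L2_norm ?M (%z. (C / real (Suc n)) *. ?m n z)"
   proof (rule L2_norm_mono)
    show "AE z in ?M. norm (?E n z) <= norm ((C / real (Suc n)) *. ?m n z)"
    proof (rule AE_I2)
     fix z
     have "norm (?E n z) <= C / real (Suc n) * norm (?m n z)"
      unfolding norm_scaleR real_norm_def by (rule mult_right_mono[OF cb norm_ge_zero])
     then show "norm (?E n z) <= norm ((C / real (Suc n)) *. ?m n z)"
      using C(1) by (simp del: of_nat_Suc)
    qed
   qed (rule L2_measurable[OF EL], rule L2_scaleR[OF mollify_rep_L2[OF fL]])
   also have "... = C / real (Suc n) * L2_norm ?M (?m n)" using C(1) by (simp add: L2_norm_scaleR del: of_nat_Suc)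
   also have "... <= C / real (Suc n) * L2_norm ?M f"
    using L2_norm_half_plane_le[OF mollify_L2(1)[OF averaging_upward_kernel[of n] rep(1)[OF fL]]]
     mollify_L2(2)[OF averaging_upward_kernel[of n] rep(1)[OF fL]] rep_L2_norm[OF fL] C(1)
    by (intro mult_left_mono) auto
   finally show ?thesis .
  qed
  have eq: "partial i (F n) z = ?G n z + ?E n z" if "z : \<Omega>" for n z
  proof -
   have "partial i (F n) z = cutoff_at n z *. partial i (?m n) z + ?E n z"
    unfolding F_def[abs_def] by (subst partial_scaleR) (auto intro: smooth_differentiable_on sc sm)
   moreover have "partial i (?m n) z = mollify (upward_kernel n) (rep ?g) z"
    using mollify_weak_deriv[OF wd, of z n] i that closure_subset[of \<Omega>] by (auto simp: partials_def)
   ultimately show ?thesis by simp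
  qed
  have le: "L2_norm ?M (%z. partial i (F n) z - ?g z) <= L2_norm ?M (%z. ?G n z - ?g z) + C / real (Suc n) * L2_norm ?M f" for n
  proof -
   have "L2_norm ?M (%z. partial i (F n) z - ?g z) = L2_norm ?M (%z. (?G n z - ?g z) + ?E n z)"
    unfolding L2_norm_def
    by (intro arg_cong[where f=sqrt] bochner_cong) (auto simp: eq algebra_simps)
   also have "... <= L2_norm ?M (%z. ?G n z - ?g z) + L2_norm ?M (?E n)"
    by (rule L2_norm_triangle[OF L2_diff[OF GL g] EL])
   finally show ?thesis using E[of n] by simp
  qed
  have lim: "(%n. L2_norm ?M (%z. ?G n z - ?g z) + C / real (Suc n) * L2_norm ?M f) ~~> 0"
  proof -
   have "(%n. C * (1 / real (Suc n)) * L2_norm ?M f) ~~> C * 0 * L2_norm ?M f"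
    by (intro tendsto_intros inverse_Suc_tendsto)
   then show ?thesis using tendsto_add[OF cutoff_mollify_converges[OF g]] by fastforce
  qed
  show ?thesis
   by (rule tendsto_sandwich[OF _ _ tendsto_const lim]; intro always_eventually allI L2_norm_nonneg le)
 qed
 ultimately show ?thesis by (rule that)
qed

lemma test_Hs_1:
 assumes F: "F : test_functions UNIV"
 shows "F : Hs 1" "i : Basis ==> has_weak_deriv [i] F (partial i F)"
proof -
 have FL: "F : L2 \<mu>" by (rule L2_lborel_imp_half_plane[OF test_L2[OF F]])
 have *: "has_weak_deriv [i] F (partial i F)" if "i : Basis" for i
 proof -
  have eq: "(%z. frechet_derivative F (at z) i) = partial i F" by (simp add: partial_def fun_eq_iff)
  have "partial i F : L2 \<mu>"
   by (rule L2_lborel_imp_half_plane[OF test_L2[OF test_partial[OF F that]]])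
  then show ?thesis
   using classical_weak_deriv[OF C1_up_smooth[OF test_smooth[OF F]] FL _ that] unfolding eq by blast
 qed
 then show "i : Basis ==> has_weak_deriv [i] F (partial i F)" .
 show "F : Hs 1" unfolding Hs_1_iff using FL * by blast
qed

subsection \<open>Averages over the strip of width one\<close>

text \<open>
 The identity \<open>\<phi>(0) = \<integral> (\<phi>(y) - (1 - y) \<phi>'(y)) dy\<close> over the unit interval expresses the trace
 by the function and its normal derivative, through an operator that is bounded in \<open>L\<^sup>2\<close>.
\<close>

definition strip_average :: "(point => 'b::euclidean_space) => real => 'b"
 where "strip_average H x = (LINT y|lborel. indicat_real {0<..1} y *. H (x, y))"

text \<open>
 The integrand that represents the trace, with the unit interval as the range of heights.
\<close>

definition trace_density :: "(point => 'b::euclidean_space) => (point => 'b) => point => 'b"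
 where "trace_density f g z = indicat_real {0<..1} (snd z) *. (f z - (1 - snd z) *. g z)"

lemma strip_average_L2:
 fixes H :: "point => 'b::euclidean_space"
 assumes H: "H : L2 lborel"
 shows "strip_average H : L2 lborel" "L2_norm lborel (strip_average H) <= L2_norm lborel H"
  "AE x in lborel. integrable lborel (%y. indicat_real {0<..1} y *. H (x, y))"
proof -
 have [measurable]: "H : borel_measurable (borel \<Otimes>\<^sub>M borel)" using H by (auto simp: L2_def borel_prod)
 have m: "strip_average H : borel_measurable lborel"
  unfolding strip_average_def by measurable
 have one: "(NN y. ennreal (indicat_real {0<..1::real} y)) = 1"
  by (simp add: ennreal_indicator)
 have "(NN x. ennreal ((norm (strip_average H x))^2))
   <= (NN x. (NN y. ennreal (indicat_real {0<..1} y) * ennreal ((norm (H (x, y)))^2)))"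
  unfolding strip_average_def by (intro nn_integral_mono average_square_le one) auto
 also have le: "... <= (NN x. (NN y. ennreal ((norm (H (x, y)))^2)))"
  by (intro nn_integral_mono) (auto simp: indicator_def)
 also have eq: "... = (NN z. ennreal ((norm (H z))^2))"
  unfolding lborel_prod[symmetric] by (subst lborel.nn_integral_fst[symmetric]) auto
 also have "... = ennreal ((L2_norm lborel H)^2)" by (rule nn_integral_sq_L2[OF H])
 finally have "(NN x. ennreal ((norm (strip_average H x))^2)) <= ennreal ((L2_norm lborel H)^2)" .
 from L2_nn_integral_bound[OF m this] show "strip_average H : L2 lborel" "L2_norm lborel (strip_average H) <= L2_norm lborel H"
  by auto
 have "(NN x. (NN y. ennreal ((norm (H (x, y)))^2))) \<noteq> \<infinity>"
  unfolding eq nn_integral_sq_L2[OF H] by simp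
 then have "AE x in lborel. (NN y. ennreal ((norm (H (x, y)))^2)) \<noteq> \<infinity>"
  by (intro nn_integral_PInf_AE) auto
 then show "AE x in lborel. integrable lborel (%y. indicat_real {0<..1} y *. H (x, y))"
 proof eventually_elim
  case (elim x)
  have "(%y. H (x, y)) : L2 lborel"
   using elim by (auto simp: L2_def integrable_iff_bounded less_top)
  moreover have "indicat_real {0<..1::real} : L2 lborel"
  proof (rule L2_dominated)
   show "AE y in lborel. (norm (indicat_real {0<..1::real} y))^2 <= indicat_real {0<..1} y"
    by (intro AE_I2) (simp add: indicator_def)
  qed simp_all
  ultimately show ?case by (intro L2_scaleR_integrable)
 qed
qed

lemma strip_average_diff:
 assumes "H : L2 lborel" "K : L2 lborel"
 shows "AE x in lborel. strip_average (%z. H z - K z) x = strip_average H x - strip_average K x"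
 using strip_average_L2(3)[OF assms(1)] strip_average_L2(3)[OF assms(2)]
 by eventually_elim (simp add: strip_average_def scaleR_diff_right)

lemma strip_average_diff_norm:
 assumes "H : L2 lborel" "K : L2 lborel"
 shows "L2_norm lborel (%x. strip_average H x - strip_average K x) <= L2_norm lborel (%z. H z - K z)"
proof -
 have "L2_norm lborel (%x. strip_average H x - strip_average K x) = L2_norm lborel (strip_average (%z. H z - K z))"
  by (rule L2_norm_cong_AE)
    (use strip_average_diff[OF assms] strip_average_L2(1)[OF L2_diff[OF assms]]
     L2_diff[OF strip_average_L2(1)[OF assms(1)] strip_average_L2(1)[OF assms(2)]] in \<open>auto simp: L2_def\<close>)
 also have "... <= L2_norm lborel (%z. H z - K z)" by (rule strip_average_L2(2)[OF L2_diff[OF assms]])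
 finally show ?thesis .
qed

lemma trace_density_L2:
 fixes f g :: "point => 'b::euclidean_space"
 assumes "f : L2 lborel" "g : L2 lborel"
 shows "trace_density f g : L2 lborel"
proof (rule L2_dominated)
 have [measurable]: "f : borel_measurable borel" "g : borel_measurable borel" using assms by (auto simp: L2_def)
 have [measurable]: "snd : borel_measurable (borel :: point measure)"
  by (intro borel_measurable_continuous_onI continuous_intros)
 have "(%z::point. indicat_real {0<..1} (snd z)) : borel_measurable borel" by measurable
 moreover have "(%z. f z - (1 - snd z) *. g z) : borel_measurable borel"
  by (intro borel_measurable_diff borel_measurable_scaleR borel_measurable_const) measurable
 ultimately show "trace_density f g : borel_measurable lborel"
  unfolding trace_density_def[abs_def] by (simp add: borel_measurable_scaleR)
 show "integrable lborel (%z. 2 * (norm (f z))^2 + 2 * (norm (g z))^2)" using assms by (auto simp: L2_def)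
 show "AE z in lborel. (norm (trace_density f g z))^2 <= 2 * (norm (f z))^2 + 2 * (norm (g z))^2"
 proof (rule AE_I2)
  fix z
  show "(norm (trace_density f g z))^2 <= 2 * (norm (f z))^2 + 2 * (norm (g z))^2"
  proof (cases "snd z : {0<..1}")
   case True
   then have "(norm ((1 - snd z) *. g z))^2 <= (norm (g z))^2"
    by (intro power_mono) (auto intro!: mult_left_le_one_le)
   moreover have "(norm (f z - (1 - snd z) *. g z))^2 <= 2 * (norm (f z))^2 + 2 * (norm ((1 - snd z) *. g z))^2"
    using norm_add_sq_le[of "f z" "- ((1 - snd z) *. g z)"] by simp
   ultimately have "(norm (f z - (1 - snd z) *. g z))^2 <= 2 * (norm (f z))^2 + 2 * (norm (g z))^2"
    by linarith
   then show ?thesis using True by (simp add: trace_density_def)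
  next
   case False
   then show ?thesis by (simp add: trace_density_def)
  qed
 qed
qed

lemma trace_density_norm:
 fixes f g :: "point => 'b::euclidean_space"
 assumes fg: "f : L2 lborel" "g : L2 lborel"
 shows "L2_norm lborel (trace_density f g) <= nrm f + nrm g"
proof -
 let ?M = "\<mu>"
 have fg': "f : L2 ?M" "g : L2 ?M" "(%z. norm (f z)) : L2 ?M" "(%z. norm (g z)) : L2 ?M"
  using L2_lborel_imp_half_plane fg L2_norm_integrand by auto
 have T: "trace_density f g : L2 lborel" by (rule trace_density_L2[OF fg])
 have "L2_norm lborel (trace_density f g) = L2_norm ?M (trace_density f g)"
  by (rule L2_norm_half_plane_eq[symmetric, OF T]) (auto simp: trace_density_def mem_half_plane indicator_def)
 also have "... <= L2_norm ?M (%z. norm (f z) + norm (g z))"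
 proof (rule L2_norm_mono)
  show "AE z in ?M. norm (trace_density f g z) <= norm (norm (f z) + norm (g z))"
  proof (rule AE_I2)
   fix z
   show "norm (trace_density f g z) <= norm (norm (f z) + norm (g z))"
   proof (cases "snd z : {0<..1}")
    case True
    then have "norm ((1 - snd z) *. g z) <= norm (g z)" by (auto intro!: mult_left_le_one_le)
    then show ?thesis
     using True norm_triangle_ineq4[of "f z" "(1 - snd z) *. g z"] by (simp add: trace_density_def)
   next
    case False
    then show ?thesis by (simp add: trace_density_def)
   qed
  qed
  show "trace_density f g : borel_measurable ?M"
   using L2_lborel_imp_half_plane[OF T] by (auto simp: L2_def)
 qed (rule L2_add[OF fg'(3,4)])
 also have "... <= L2_norm ?M (%z. norm (f z)) + L2_norm ?M (%z. norm (g z))"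
  by (rule L2_norm_triangle[OF fg'(3,4)])
 finally show ?thesis by simp
qed

lemma trace_density_diff:
 "trace_density f g z - trace_density f' g' z = trace_density (%z. f z - f' z) (%z. g z - g' z) z"
 by (simp add: trace_density_def algebra_simps)

lemma strip_average_test:
 fixes F :: "point => 'b::euclidean_space"
 assumes F: "smooth F"
 shows "strip_average (trace_density F (partial (0, 1) F)) x = F (x, 0)"
proof -
 have i: "((0::real), (1::real)) : Basis" by (simp add: Basis_point)
 have l: "(x, 0) + y *. (0, 1) : closure \<Omega>" if "y : {0..1}" for y
  using that by (simp add: mem_closure_half_plane)
 have der: "((%y. F (x, y)) has_vector_derivative partial (0, 1) F (x, y)) (at y within {0..1})" if "y : {0..1}" for y
  using C1_up_line[OF C1_up_smooth[OF F] l that] by (simp add: partial_def)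
 have "has_bochner_integral lborel
   (%y. indicator {0..1} y *. (F (x, y) - (1 - y) *. partial (0, 1) F (x, y)))
   (- ((1 - 1) *. F (x, 1)) - - ((1 - 0) *. F (x, 0)))"
 proof (rule has_bochner_integral_FTC_Icc)
  fix y :: real assume y: "0 <= y" "y <= 1"
  have "((%y. - ((1 - y) *. F (x, y))) has_vector_derivative
    - ((1 - y) *. partial (0, 1) F (x, y) + (0 - 1) *. F (x, y))) (at y within {0..1})"
   using y by (intro has_vector_derivative_minus has_vector_derivative_scaleR der DERIV_diff DERIV_const DERIV_ident) auto
  then show "((%y. - ((1 - y) *. F (x, y))) has_vector_derivative
    F (x, y) - (1 - y) *. partial (0, 1) F (x, y)) (at y within {0..1})" by simp
 next
  have c: "continuous_on {0..1} (%y. h (x, y))" if "smooth h" for h :: "point => 'b"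
   by (rule continuous_on_compose2[OF smooth_continuous[OF that, of UNIV]]) (auto intro!: continuous_intros)
  show "continuous_on {0..1} (%y. F (x, y) - (1 - y) *. partial (0, 1) F (x, y))"
   by (intro continuous_intros c F smooth_partial i)
 qed simp
 then have B: "has_bochner_integral lborel
   (%y. indicator {0..1} y *. (F (x, y) - (1 - y) *. partial (0, 1) F (x, y))) (F (x, 0))" by simp
 have "strip_average (trace_density F (partial (0, 1) F)) x
   = (LINT y|lborel. indicator {0..1} y *. (F (x, y) - (1 - y) *. partial (0, 1) F (x, y)))"
  unfolding strip_average_def
 proof (rule integral_cong_AE)
  have [measurable]: "F : borel_measurable (borel \<Otimes>\<^sub>M borel)" "partial (0, 1) F : borel_measurable (borel \<Otimes>\<^sub>M borel)"
   using smooth_measurable[OF F] smooth_measurable[OF smooth_partial[OF F i]] by (simp_all add: borel_prod)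
  show "(%y. indicat_real {0<..1} y *. trace_density F (partial (0, 1) F) (x, y)) : borel_measurable lborel"
   unfolding trace_density_def snd_conv by measurable
  show "AE y in lborel. indicat_real {0<..1} y *. trace_density F (partial (0, 1) F) (x, y) =
    indicat_real {0..1} y *. (F (x, y) - (1 - y) *. partial (0, 1) F (x, y))"
   using AE_lborel_singleton[of "0::real"]
   by eventually_elim (auto simp: trace_density_def indicator_def)
 qed (use B in \<open>auto simp: has_bochner_integral_iff\<close>)
 then show ?thesis using B by (simp add: has_bochner_integral_iff)
qed

definition tr :: "(point => 'b::euclidean_space) => real => 'b"
 where "tr f = strip_average (trace_density (rep f) (rep (weak_deriv [(0, 1)] f)))"

lemma vertical_Basis: "((0::real), (1::real)) : Basis"
 by (simp add: Basis_point)

lemma tr_L2: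
 assumes f: "f : Hs 1"
 shows "tr f : L2 lborel" "L2_norm lborel (tr f) <= 2 * Hs_norm 1 f"
proof -
 have fL: "f : L2 \<mu>" by (rule Hs_1_L2[OF f])
 have gL: "weak_deriv [(0, 1)] f : L2 \<mu>" by (rule Hs_1_weak_deriv(2)[OF f vertical_Basis])
 note T = trace_density_L2[OF rep(1)[OF fL] rep(1)[OF gL]]
 show "tr f : L2 lborel" unfolding tr_def by (rule strip_average_L2(1)[OF T])
 have "L2_norm lborel (tr f) <= nrm (rep f) + nrm (rep (weak_deriv [(0, 1)] f))"
  unfolding tr_def
  using strip_average_L2(2)[OF T] trace_density_norm[OF rep(1)[OF fL] rep(1)[OF gL]] by linarith
 also have "... = nrm f + nrm (weak_deriv [(0, 1)] f)"
  using rep_L2_norm[OF fL] rep_L2_norm[OF gL] L2_norm_half_plane_eq[OF rep(1)[OF fL] rep(2)[OF fL]]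
   L2_norm_half_plane_eq[OF rep(1)[OF gL] rep(2)[OF gL]] by simp
 also have "... <= 2 * Hs_norm 1 f"
  using Hs_norm_1_ge(1)[OF f] Hs_norm_1_ge(2)[OF f vertical_Basis] by simp
 finally show "L2_norm lborel (tr f) <= 2 * Hs_norm 1 f" .
qed

text \<open>
 The restriction of a smooth function is given by the same integral as the trace of \<open>f\<close>, applied to the smooth
 function, so that the difference is an average of differences.
\<close>

lemma tr_approx:
 assumes f: "f : Hs 1" and F: "F : test_functions UNIV"
 shows "L2_norm lborel (%x. F (x, 0) - tr f x)
  <= nrm (%z. F z - f z) + nrm (%z. partial (0, 1) F z - weak_deriv [(0, 1)] f z)"
proof -
 let ?M = "\<mu>" and ?g = "weak_deriv [(0, 1)] f"
 have fL: "f : L2 ?M" by (rule Hs_1_L2[OF f])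
 have gL: "?g : L2 ?M" by (rule Hs_1_weak_deriv(2)[OF f vertical_Basis])
 have F2: "F : L2 lborel" "partial (0, 1) F : L2 lborel"
  using test_L2[OF F] test_L2[OF test_partial[OF F vertical_Basis]] by auto
 have cong: "L2_norm ?M (%z. G z - rep h z) = L2_norm ?M (%z. G z - h z)"
  if "G : L2 lborel" "h : L2 ?M" for G h :: "point => 'a"
 proof (rule L2_norm_cong_AE)
  show "AE z in ?M. G z - rep h z = G z - h z" using rep(3)[OF that(2)] by eventually_elim simp
 qed (use L2_diff[OF L2_lborel_imp_half_plane[OF that(1)] that(2)]
    L2_diff[OF L2_lborel_imp_half_plane[OF that(1)] rep(5)[OF that(2)]] in \<open>auto simp: L2_def\<close>)
 have "L2_norm lborel (%x. F (x, 0) - tr f x)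
   = L2_norm lborel (%x. strip_average (trace_density F (partial (0, 1) F)) x - tr f x)"
  by (simp add: strip_average_test[OF test_smooth[OF F]])
 also have "... <= L2_norm lborel (%z. trace_density F (partial (0, 1) F) z - trace_density (rep f) (rep ?g) z)"
  unfolding tr_def by (intro strip_average_diff_norm trace_density_L2 F2 rep(1) fL gL)
 also have "... <= L2_norm ?M (%z. F z - rep f z) + L2_norm ?M (%z. partial (0, 1) F z - rep ?g z)"
  unfolding trace_density_diff by (intro trace_density_norm L2_diff F2 rep(1) fL gL)
 finally show ?thesis by (simp only: cong[OF F2(1) fL] cong[OF F2(2) gL])
qed

lemma L2_lebesgue_lborel:
 assumes "f : L2 lborel"
 shows "f : L2 lebesgue" "L2_norm lebesgue f = L2_norm lborel f"
proof -
 have [measurable]: "f : borel_measurable lborel" using assms by (auto simp: L2_def)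
 show "L2_norm lebesgue f = L2_norm lborel f"
  unfolding L2_norm_def by (subst integral_completion) auto
 show "f : L2 lebesgue" 
  using assms by (auto simp: L2_def integrable_completion measurable_completion)
qed

lemma restriction_L2:
 fixes F :: "point => 'b::euclidean_space"
 assumes "F : test_functions UNIV"
 shows "(%x. F (x, 0)) : L2 lborel"
proof -
 obtain R where R: "!!z. norm z > R ==> F z = 0" using test_bounded_support[OF assms] by metis
 show ?thesis
 proof (rule compact_support_L2)
  show "continuous_on UNIV (%x. F (x, 0))"
   by (rule continuous_on_compose2[OF smooth_continuous[OF test_smooth[OF assms], of UNIV]])
     (auto intro!: continuous_intros)
  show "F (x, 0) = 0" if "norm x > R" for x :: real
   using that norm_fst_le[of x "0::real"] by (intro R) (simp add: order_less_le_trans)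
 qed
qed

lemma Hs_norm_1_converges_iff:
 fixes f :: "point => 'b::euclidean_space"
 assumes f: "f : Hs 1" and F: "!!n. F n : Hs 1"
 shows "(%n. Hs_norm 1 (%z. F n z - f z)) ~~> 0 \<longleftrightarrow>
  (%n. nrm (%z. F n z - f z)) ~~> 0 \<and>
  (\<forall>i\<in>Basis. (%n. nrm (%z. weak_deriv [i] (F n) z - weak_deriv [i] f z)) ~~> 0)"
  (is "?L \<longleftrightarrow> ?R")
proof -
 let ?M = "\<mu>"
 have d: "(%z. F n z - f z) : Hs 1" for n by (rule Hs_1_diff[OF F f])
 have eq: "L2_norm ?M (weak_deriv [i] (%z. F n z - f z)) = L2_norm ?M (%z. weak_deriv [i] (F n) z - weak_deriv [i] f z)"
  if i: "i : Basis" for i n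
  by (rule L2_norm_cong_AE) (use weak_deriv_diff[OF F f i, of n] Hs_1_weak_deriv(2)[OF d i]
    L2_diff[OF Hs_1_weak_deriv(2)[OF F i] Hs_1_weak_deriv(2)[OF f i]] in \<open>auto simp: L2_def\<close>)
 show ?thesis
 proof
  assume L: ?L
  show ?R
  proof (intro conjI ballI)
   show "(%n. L2_norm ?M (%z. F n z - f z)) ~~> 0"
    by (rule tendsto_sandwich[OF _ _ tendsto_const L]) (auto intro!: always_eventually Hs_norm_1_ge d)
   show "(%n. L2_norm ?M (%z. weak_deriv [i] (F n) z - weak_deriv [i] f z)) ~~> 0" if i: "i : Basis" for i
   proof (rule tendsto_sandwich[OF _ _ tendsto_const L])
    show "\<forall>\<^sub>F n in sequentially. L2_norm ?M (%z. weak_deriv [i] (F n) z - weak_deriv [i] f z) <= Hs_norm 1 (%z. F n z - f z)"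
     unfolding eq[OF i, symmetric] by (intro always_eventually allI Hs_norm_1_ge(2)[OF d i])
   qed auto
  qed
 next
  assume R: ?R
  have "(%n. sqrt ((L2_norm ?M (%z. F n z - f z))^2 + (\<Sum>i\<in>Basis. (L2_norm ?M (%z. weak_deriv [i] (F n) z - weak_deriv [i] f z))^2)))
    ~~> sqrt (0\<^sup>2 + (\<Sum>i\<in>(Basis::point set). 0\<^sup>2))"
   using R by (intro tendsto_intros) auto
  moreover have "sqrt ((L2_norm ?M (%z. F n z - f z))^2 + (\<Sum>i\<in>Basis. (L2_norm ?M (%z. weak_deriv [i] (F n) z - weak_deriv [i] f z))^2))
    = Hs_norm 1 (%z. F n z - f z)" for n
   by (rule real_sqrt_unique) (simp_all add: Hs_norm_1_sq[OF d] eq Hs_norm_1_nonneg[OF d])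
  ultimately show ?L by simp
 qed
qed

text \<open>Hence traces exist, are unique, and are given by a linear formula.\<close>

lemma trace_bd:
 fixes f :: "point => 'b::euclidean_space"
 assumes f: "f : Hs 1"
 shows "trace_bd f : L2 lebesgue" "AE x in lebesgue. trace_bd f x = tr f x"
proof -
 let ?M = "\<mu>"
 have trL: "tr f : L2 lebesgue" by (rule L2_lebesgue_lborel[OF tr_L2(1)[OF f]])
 have weq: "L2_norm ?M (%z. partial i (F n) z - weak_deriv [i] f z) = L2_norm ?M (%z. weak_deriv [i] (F n) z - weak_deriv [i] f z)"
  if F: "!!n. F n : test_functions UNIV" and i: "i : Basis" for F :: "nat => point => 'b" and i n
 proof (rule L2_norm_cong_AE)
  have "AE z in ?M. weak_deriv [i] (F n) z = partial i (F n) z"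
   by (rule weak_deriv_eq[OF test_Hs_1(2)[OF F i]]) (use i in auto)
  then show "AE z in ?M. partial i (F n) z - weak_deriv [i] f z = weak_deriv [i] (F n) z - weak_deriv [i] f z"
   by eventually_elim simp
 qed (use L2_diff[OF L2_lborel_imp_half_plane[OF test_L2[OF test_partial[OF F i]]] Hs_1_weak_deriv(2)[OF f i]]
    L2_diff[OF Hs_1_weak_deriv(2)[OF test_Hs_1(1)[OF F] i] Hs_1_weak_deriv(2)[OF f i]] in \<open>auto simp: L2_def\<close>)
 have conv: "(%n. L2_norm lebesgue (%x. F n (x, 0) - tr f x)) ~~> 0"
  if F: "!!n. F n : test_functions UNIV" and 0: "(%n. L2_norm ?M (%z. F n z - f z)) ~~> 0"
   and 1: "(%n. L2_norm ?M (%z. partial (0, 1) (F n) z - weak_deriv [(0, 1)] f z)) ~~> 0"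
  for F :: "nat => point => 'b"
 proof (rule tendsto_sandwich[OF _ _ tendsto_const])
  show "\<forall>\<^sub>F n in sequentially. L2_norm lebesgue (%x. F n (x, 0) - tr f x)
   <= L2_norm ?M (%z. F n z - f z) + L2_norm ?M (%z. partial (0, 1) (F n) z - weak_deriv [(0, 1)] f z)"
   using tr_approx[OF f F] L2_lebesgue_lborel(2)[OF L2_diff[OF restriction_L2[OF F] tr_L2(1)[OF f]]]
   by (intro always_eventually allI) simp
  show "(%n. L2_norm ?M (%z. F n z - f z) + L2_norm ?M (%z. partial (0, 1) (F n) z - weak_deriv [(0, 1)] f z)) ~~> 0"
   using tendsto_add[OF 0 1] by simp
 qed auto
 obtain F :: "nat => point => 'b" where F: "!!n. F n : test_functions UNIV" "(%n. L2_norm ?M (%z. F n z - f z)) ~~> 0"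
  "!!i. i : Basis ==> (%n. L2_norm ?M (%z. partial i (F n) z - weak_deriv [i] f z)) ~~> 0"
  by (rule H1_density[OF f]) blast
 have "(%n. Hs_norm 1 (%z. F n z - f z)) ~~> 0"
  unfolding Hs_norm_1_converges_iff[OF f test_Hs_1(1)[OF F(1)]]
 proof (intro conjI ballI F(2))
  fix i :: point assume i: "i : Basis"
  show "(%n. L2_norm ?M (%z. weak_deriv [i] (F n) z - weak_deriv [i] f z)) ~~> 0"
   using F(3)[OF i] by (simp only: weq[where F=F, OF F(1) i])
 qed
 then have ex: "has_trace f (tr f)"
  unfolding has_trace_def using F conv[OF F(1,2) F(3)[OF vertical_Basis]] trL by blast
 then have "has_trace f (trace_bd f)" unfolding trace_bd_def by (rule someI[where P="has_trace f"])
 then obtain G where g: "trace_bd f : L2 lebesgue" and G: "!!n. G n : test_functions UNIV"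
  "(%n. Hs_norm 1 (%z. G n z - f z)) ~~> 0" "(%n. L2_norm lebesgue (%x. G n (x, 0) - trace_bd f x)) ~~> 0"
  unfolding has_trace_def by auto
 show "trace_bd f : L2 lebesgue" by (rule g)
 have "(%n. L2_norm lebesgue (%x. G n (x, 0) - tr f x)) ~~> 0"
  using G(2) vertical_Basis by (intro conv[OF G(1)]) (simp_all add: Hs_norm_1_converges_iff[OF f test_Hs_1(1)[OF G(1)]] weq[where F=G, OF G(1) vertical_Basis])
 then show "AE x in lebesgue. trace_bd f x = tr f x"
  by (intro L2_norm_limit_zero[OF g _ G(3) _ trL] L2_lebesgue_lborel(1) restriction_L2 G(1))
qed

lemma trace_bd_norm:
 assumes f: "f : Hs 1"
 shows "L2_norm lebesgue (trace_bd f) <= 2 * Hs_norm 1 f"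
proof -
 have "L2_norm lebesgue (trace_bd f) = L2_norm lebesgue (tr f)"
  by (rule L2_norm_cong_AE) (use trace_bd[OF f] L2_lebesgue_lborel(1)[OF tr_L2(1)[OF f]] in \<open>auto simp: L2_def\<close>)
 then show ?thesis using tr_L2[OF f] L2_lebesgue_lborel(2)[OF tr_L2(1)[OF f]] by simp
qed

lemma L2_norm_zero_AE:
 fixes f :: "'a => 'b::euclidean_space"
 assumes "f : L2 M" "L2_norm M f <= 0"
 shows "AE z in M. f z = 0"
proof -
 have 0: "L2_norm M (%z. 0 :: 'b) = 0" by (simp add: L2_norm_def)
 have "L2_norm M f = 0" using assms(2) L2_norm_nonneg[of M f] by linarith
 then show ?thesis using L2_norm_limit_zero[of f M "%n. f" "%z. 0"] assms(1) 0 by simp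
qed

lemma L2_norm_AE_zero:
 assumes "f : borel_measurable M" "AE z in M. f z = 0"
 shows "L2_norm M f = 0"
 using L2_norm_cong_AE[of f M "%z. 0"] assms by (simp add: L2_norm_def)

lemma rep_lincomb:
 assumes f: "f : L2 \<mu>" and g: "g : L2 \<mu>" and h: "h : L2 \<mu>"
  and eq: "AE z in \<mu>. h z = a *. f z - b *. g z"
 shows "nrm (%z. rep h z - (a *. rep f z - b *. rep g z)) = 0"
proof (rule L2_norm_AE_zero)
 show "AE z in \<mu>. rep h z - (a *. rep f z - b *. rep g z) = 0"
  using rep(3)[OF f] rep(3)[OF g] rep(3)[OF h] eq by eventually_elim simp
qed (use L2_diff[OF rep(5)[OF h] L2_diff[OF L2_scaleR[OF rep(5)[OF f]] L2_scaleR[OF rep(5)[OF g]]], of a b] in \<open>auto simp: L2_def\<close>)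

lemma tr_lincomb:
 assumes f: "f : Hs 1" and g: "g : Hs 1"
 shows "AE x in lborel. tr (%z. a *. f z - b *. g z) x = a *. tr f x - b *. tr g x"
proof -
 let ?M = "\<mu>" and ?d = "%f. weak_deriv [(0, 1)] f" and ?h = "%z. a *. f z - b *. g z"
 have h: "?h : Hs 1" by (intro Hs_1_diff Hs_1_scaleR f g)
 note L = Hs_1_L2[OF f] Hs_1_L2[OF g] Hs_1_L2[OF h]
 note D = Hs_1_weak_deriv(2)[OF f vertical_Basis] Hs_1_weak_deriv(2)[OF g vertical_Basis] Hs_1_weak_deriv(2)[OF h vertical_Basis]
 let ?H = "%f. trace_density (rep f) (rep (?d f))"
 have HL: "?H f : L2 lborel" "?H g : L2 lborel" "?H ?h : L2 lborel"
  by (intro trace_density_L2 rep(1) L D)+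
 let ?K = "%z. a *. ?H f z - b *. ?H g z"
 have KL: "?K : L2 lborel" by (intro L2_diff L2_scaleR HL)
 have d: "AE z in ?M. ?d ?h z = a *. ?d f z - b *. ?d g z"
  using weak_deriv_diff[OF Hs_1_scaleR[OF f, of a] Hs_1_scaleR[OF g, of b] vertical_Basis]
   weak_deriv_scaleR[OF f vertical_Basis, of a] weak_deriv_scaleR[OF g vertical_Basis, of b]
  by eventually_elim simp
 have "L2_norm lborel (%x. strip_average (?H ?h) x - strip_average ?K x) <= L2_norm lborel (%z. ?H ?h z - ?K z)"
  by (rule strip_average_diff_norm[OF HL(3) KL])
 also have "(%z. ?H ?h z - ?K z) = trace_density (%z. rep ?h z - (a *. rep f z - b *. rep g z))
   (%z. rep (?d ?h) z - (a *. rep (?d f) z - b *. rep (?d g) z))"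
  by (simp add: trace_density_def fun_eq_iff indicator_def algebra_simps)
 also have "L2_norm lborel ... <= L2_norm ?M (%z. rep ?h z - (a *. rep f z - b *. rep g z))
   + L2_norm ?M (%z. rep (?d ?h) z - (a *. rep (?d f) z - b *. rep (?d g) z))"
  by (intro trace_density_norm L2_diff L2_scaleR rep(1) L D)
 also have "... = 0" using rep_lincomb[OF L] rep_lincomb[OF D d] by simp
 finally have "AE x in lborel. strip_average (?H ?h) x - strip_average ?K x = 0"
  by (intro L2_norm_zero_AE L2_diff strip_average_L2(1) HL KL)
 then show ?thesis
  using strip_average_L2(3)[OF HL(1)] strip_average_L2(3)[OF HL(2)]
 proof eventually_elim
  case (elim x)
  have "strip_average ?K x = a *. strip_average (?H f) x - b *. strip_average (?H g) x"
   using elim(2,3) by (simp add: strip_average_def scaleR_diff_right scaleR_left_commute[of _ a] scaleR_left_commute[of _ b] del: scaleR_scaleR)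
  with elim(1) show ?case by (simp add: tr_def)
 qed
qed

lemma trace_bd_lincomb:
 assumes f: "f : Hs 1" and g: "g : Hs 1"
 shows "AE x in lebesgue. trace_bd (%z. a *. f z - b *. g z) x = a *. trace_bd f x - b *. trace_bd g x"
 using trace_bd(2)[OF f] trace_bd(2)[OF g] trace_bd(2)[OF Hs_1_diff[OF Hs_1_scaleR[OF f, of a] Hs_1_scaleR[OF g, of b]]]
  AE_completion[OF tr_lincomb[OF f g, of a b]]
 by eventually_elim simp

section \<open>Gradients are orthogonal to divergence-free fields\<close>

text \<open>
 Tangency to the boundary is tested with smooth functions; the identity passes to \<open>H\<^sup>1\<close> by density.
\<close>

lemma solenoidal_orthogonal_H1:
 fixes f :: "point => real"
 assumes u: "u : L2_sigma" and f: "f : Hs 1"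
 shows "(LINT z|\<mu>. (\<Sum>i\<in>Basis. (u z \<bullet> i) * weak_deriv [i] f z)) = 0"
proof -
 let ?M = "\<mu>"
 obtain F :: "nat => point => real" where F: "!!n. F n : test_functions UNIV"
  "!!i. i : Basis ==> (%n. L2_norm ?M (%z. partial i (F n) z - weak_deriv [i] f z)) ~~> 0"
  by (rule H1_density[OF f]) blast
 have uL: "u : L2 ?M" using u by (simp add: solenoidal_def)
 have ui: "(%z. u z \<bullet> i) : L2 ?M" for i by (rule L2_inner_component[OF uL])
 have gL: "weak_deriv [i] f : L2 ?M" if "i : Basis" for i by (rule Hs_1_weak_deriv(2)[OF f that])
 have FL: "partial i (F n) : L2 ?M" if "i : Basis" for i n
  by (rule L2_lborel_imp_half_plane[OF test_L2[OF test_partial[OF F(1) that]]])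
 have int: "integrable ?M (%z. (u z \<bullet> i) * h z)" if "h : L2 ?M" for i and h :: "point => real"
  using L2_scaleR_integrable[OF ui that] by simp
 have zero: "(\<Sum>i\<in>Basis. LINT z|?M. (u z \<bullet> i) * partial i (F n) z) = 0" for n
 proof -
  have "0 = (LINT z|?M. frechet_derivative (F n) (at z) (u z))"
   using u F(1)[of n] by (simp add: solenoidal_def tangent_to_boundary_def)
  also have "... = (LINT z|?M. (\<Sum>i\<in>Basis. (u z \<bullet> i) * partial i (F n) z))"
   by (simp add: frechet_derivative_partial[OF smooth_differentiable[OF test_smooth[OF F(1)]]])
  also have "... = (\<Sum>i\<in>Basis. LINT z|?M. (u z \<bullet> i) * partial i (F n) z)"
   by (intro Bochner_Integration.integral_sum int FL)
  finally show ?thesis by simp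
 qed
 have lim: "(%n. LINT z|?M. (u z \<bullet> i) * partial i (F n) z) ~~> (LINT z|?M. (u z \<bullet> i) * weak_deriv [i] f z)"
  if i: "i : Basis" for i
 proof -
  have "(%n. (LINT z|?M. (u z \<bullet> i) * partial i (F n) z) - (LINT z|?M. (u z \<bullet> i) * weak_deriv [i] f z)) ~~> 0"
  proof (rule Lim_null_comparison)
   have "norm ((LINT z|?M. (u z \<bullet> i) * partial i (F n) z) - (LINT z|?M. (u z \<bullet> i) * weak_deriv [i] f z))
     <= L2_norm ?M (%z. u z \<bullet> i) * L2_norm ?M (%z. partial i (F n) z - weak_deriv [i] f z)" for n
   proof -
    have "(LINT z|?M. (u z \<bullet> i) * partial i (F n) z) - (LINT z|?M. (u z \<bullet> i) * weak_deriv [i] f z)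
      = L2_inner ?M (%z. u z \<bullet> i) (%z. partial i (F n) z - weak_deriv [i] f z)"
     by (simp add: L2_inner_def right_diff_distrib int FL[OF i] gL[OF i])
    then show ?thesis using L2_inner_bound[OF ui L2_diff[OF FL[OF i] gL[OF i]]] by simp
   qed
   then show "\<forall>\<^sub>F n in sequentially. norm ((LINT z|?M. (u z \<bullet> i) * partial i (F n) z) - (LINT z|?M. (u z \<bullet> i) * weak_deriv [i] f z))
     <= L2_norm ?M (%z. u z \<bullet> i) * L2_norm ?M (%z. partial i (F n) z - weak_deriv [i] f z)"
    by (intro always_eventually allI)
   show "(%n. L2_norm ?M (%z. u z \<bullet> i) * L2_norm ?M (%z. partial i (F n) z - weak_deriv [i] f z)) ~~> 0"
    using tendsto_mult_right_zero[OF F(2)[OF i]] .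
  qed
  then show ?thesis by (simp add: LIM_zero_iff)
 qed
 have "(%n. \<Sum>i\<in>Basis. LINT z|?M. (u z \<bullet> i) * partial i (F n) z) ~~> (\<Sum>i\<in>Basis. LINT z|?M. (u z \<bullet> i) * weak_deriv [i] f z)"
  by (intro tendsto_sum lim)
 then have "(%n. 0) ~~> (\<Sum>i\<in>Basis. LINT z|?M. (u z \<bullet> i) * weak_deriv [i] f z)"
  by (simp only: zero)
 then have "(\<Sum>i\<in>Basis. LINT z|?M. (u z \<bullet> i) * weak_deriv [i] f z) = 0"
  by (rule LIMSEQ_unique[OF _ tendsto_const])
 then show ?thesis using gL by (subst Bochner_Integration.integral_sum) (auto intro: int)
qed

text \<open>The fundamental theorem of calculus and the Cauchy-Schwarz inequality.\<close>

lemma increment_square_le: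
 fixes \<phi> \<psi> :: "real => real"
 assumes ab: "a <= b" and der: "!!s. s : {a..b} ==> (\<phi> has_vector_derivative \<psi> s) (at s within {a..b})"
  and cont: "continuous_on {a..b} \<psi>"
 shows "ennreal ((\<phi> b - \<phi> a)^2) <= ennreal (b - a) * (NN s. ennreal (indicator {a..b} s * (\<psi> s)^2))"
proof -
 have B: "has_bochner_integral lborel (%s. indicator {a..b} s *. \<psi> s) (\<phi> b - \<phi> a)"
  using der cont ab by (intro has_bochner_integral_FTC_Icc) auto
 then have [measurable]: "(%s. indicator {a..b} s *. \<psi> s) : borel_measurable lborel"
  by (auto simp: has_bochner_integral_iff)
 have "ennreal (norm (\<phi> b - \<phi> a)) <= (NN s. ennreal (norm (indicator {a..b} s *. \<psi> s)))"
  using B integral_norm_bound_ennreal[of lborel "%s. indicator {a..b} s *. \<psi> s"] by (simp add: has_bochner_integral_iff)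
 also have "... = (NN s. indicator {a..b} s * ennreal (norm (indicator {a..b} s *. \<psi> s)))"
  by (intro nn_integral_cong) (auto simp: indicator_def)
 finally have "(ennreal (norm (\<phi> b - \<phi> a)))^2 <= (NN s. indicator {a..b} s * ennreal (norm (indicator {a..b} s *. \<psi> s)))^2"
  by (rule power_mono) simp
 also have "... <= (NN s. (indicator {a..b} s)^2) * (NN s. (ennreal (norm (indicator {a..b} s *. \<psi> s)))^2)"
  by (rule Cauchy_Schwarz_nn_integral) measurable
 also have "(NN s. (indicator {a..b} s)^2) = ennreal (b - a)"
 proof -
  have "(%s. (indicator {a..b} s :: ennreal)^2) = indicator {a..b}" by (auto simp: indicator_def)
  then show ?thesis using ab by simp
 qed
 also have "(NN s. (ennreal (norm (indicator {a..b} s *. \<psi> s)))^2) = (NN s. ennreal (indicator {a..b} s * (\<psi> s)^2))"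
  by (intro nn_integral_cong) (auto simp: indicator_def ennreal_power)
 finally show ?thesis by (simp add: ennreal_power)
qed

text \<open>
 A Poincare inequality on the rectangle \<open>[-R, R] \<times> [0, R]\<close>. The reference value is taken on
 a horizontal line along which the energy of the gradient is at most the average over all lines.
\<close>

lemma poincare_rectangle:
 fixes P :: "point => real"
 assumes P: "C1_up P (%z h. G z \<bullet> h)" and G: "G : L2 \<mu>" and R: "R > 0"
 obtains m where "(%z. indicat_real ({-R..R} \<times> {0<..R}) z * (P z - m)) : L2 lborel"
  "L2_norm lborel (%z. indicat_real ({-R..R} \<times> {0<..R}) z * (P z - m)) <= 3 * R * nrm G"
proof -
 define K :: "point set" where "K = {-R..R} \<times> {0<..R}"
 define Q where "Q = (nrm G)^2"
 have Q0: "Q \<ge> 0" by (simp add: Q_def)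
 have contG: "continuous_on (closure \<Omega>) (%z. G z \<bullet> i)" for i using P unfolding C1_up_def by blast
 have contP: "continuous_on (closure \<Omega>) P" by (rule C1_up_continuous[OF P])
 define g where "g i z = indicator \<Omega> z * (G z \<bullet> i)" for i z
 have g [measurable]: "g i : borel_measurable (borel \<Otimes>\<^sub>M borel)" for i
  using continuous_closure_measurable(1)[OF contG[of i]] by (simp add: g_def[abs_def] borel_prod)
 have gB [measurable]: "g i : borel_measurable borel" for i using g[of i] by (simp add: borel_prod)
 have K [measurable]: "K : sets (borel \<Otimes>\<^sub>M borel)" unfolding K_def by simp
 have gQ: "(NN z. ennreal ((g i z)^2)) <= ennreal Q" if i: "norm i <= 1" for i
 proof -
  have gi: "(%z. G z \<bullet> i) : L2 \<mu>" by (rule L2_inner_component[OF G])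
  have [measurable]: "g i : borel_measurable borel" using g[of i] by (simp add: borel_prod)
  have "integrable \<mu> (%z. (g i z)^2)"
   using L2_integrable_sq[OF gi] by (rule Bochner_Integration.integrable_cong[THEN iffD1, OF refl, rotated]) (simp add: g_def)
  then have int: "integrable lborel (%z. indicator \<Omega> z *. (g i z)^2)"
   by (subst (asm) integrable_half_plane_iff) auto
  have "(NN z. ennreal ((g i z)^2)) = (NN z. ennreal (indicator \<Omega> z *. (g i z)^2))"
   by (intro nn_integral_cong) (auto simp: g_def indicator_def)
  also have "... = ennreal (LINT z|lborel. indicator \<Omega> z *. (g i z)^2)"
   by (rule nn_integral_eq_integral[OF int]) auto
  also have "(LINT z|lborel. indicator \<Omega> z *. (g i z)^2) = (LINT z|\<mu>. (g i z)^2)"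
   by (rule integral_half_plane[symmetric]) auto
  also have "... = (LINT z|\<mu>. (norm (G z \<bullet> i))^2)"
   by (rule bochner_cong[OF refl]) (simp add: g_def)
  also have "... <= Q"
   unfolding Q_def L2_norm_sq
  proof (rule integral_mono[OF L2_integrable_sq[OF gi] L2_integrable_sq[OF G]])
   fix z
   have "norm (G z \<bullet> i) <= norm (G z) * norm i" using Cauchy_Schwarz_ineq2 by simp
   also have "... <= norm (G z)" using i by (simp add: mult_left_le)
   finally show "(norm (G z \<bullet> i))^2 <= (norm (G z))^2" by (rule power_mono) simp
  qed
  finally show ?thesis by (simp add: ennreal_leI)
 qed
 let ?e1 = "(1, 0) :: point" and ?e2 = "(0, 1) :: point"
 define a where "a y = (NN s. ennreal ((g ?e1 (s, y))^2))" for y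
 define b where "b x = (NN s. ennreal ((g ?e2 (x, s))^2))" for x
 have [measurable]: "a : borel_measurable borel" "b : borel_measurable borel"
  unfolding a_def b_def by measurable
 have IA: "(NN y. a y) <= ennreal Q"
  unfolding a_def using gQ[of ?e1] lborel_pair.nn_integral_snd[of "%(x, y). ennreal ((g ?e1 (x, y))^2)"]
  by (simp add: lborel_prod split_beta' norm_Pair gB)
 have IB: "(NN x. b x) <= ennreal Q"
  unfolding b_def using gQ[of ?e2] lborel.nn_integral_fst[of "%(x, y). ennreal ((g ?e2 (x, y))^2)" lborel]
  by (simp add: lborel_prod split_beta' norm_Pair gB)
 have "\<exists>y0\<in>{0<..R}. a y0 <= ennreal (Q / R)"
 proof (rule ccontr)
  assume "\<not> ?thesis"
  then have big: "ennreal (Q / R) < a y" if "y : {0<..R}" for y using that by (auto simp: not_le)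
  have "(NN y. ennreal (Q / R) * indicator {0<..R} y) < (NN y. a y * indicator {0<..R} y)"
  proof (rule nn_integral_less)
   show "(NN y. ennreal (Q / R) * indicator {0<..R} y) \<noteq> \<infinity>"
    using R by (subst nn_integral_cmult_indicator) (auto simp: ennreal_mult_eq_top_iff)
   show "AE y in lborel. ennreal (Q / R) * indicator {0<..R} y <= a y * indicator {0<..R} y"
    using big by (intro AE_I2) (auto simp: indicator_def less_imp_le)
   show "\<not> (AE y in lborel. a y * indicator {0<..R} y <= ennreal (Q / R) * indicator {0<..R} y)"
   proof
    assume "AE y in lborel. a y * indicator {0<..R} y <= ennreal (Q / R) * indicator {0<..R} y"
    then have "AE y in lborel. y \<notin> {0<..R}"
    proof eventually_elim
     case (elim y)
     then show ?case using big[of y] by (auto simp: indicator_def not_le[symmetric])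
    qed
    then have "emeasure lborel {0<..R} = 0" by (subst (asm) AE_iff_measurable[of "{0<..R}"]) auto
    then show False using R by simp
   qed
  qed auto
  also have "... <= (NN y. a y)" by (intro nn_integral_mono) (auto simp: indicator_def)
  also have "... <= ennreal Q" by (rule IA)
  also have "(NN y. ennreal (Q / R) * indicator {0<..R} y) = ennreal Q"
   using R Q0 by (subst nn_integral_cmult_indicator) (auto simp: ennreal_mult[symmetric])
  finally show False by simp
 qed
 then obtain y0 where y0: "0 < y0" "y0 <= R" "a y0 <= ennreal (Q / R)" by auto
 define m where "m = P (0, y0)"
 have seg_y: "ennreal ((P (x, t) - P (x, s))^2) <= ennreal R * b x" if st: "0 < s" "s <= t" "t <= R" for x s t
 proof -
  have l: "(x, 0) + r *. ?e2 : closure \<Omega>" if "r : {s..t}" for r using that st by (simp add: mem_closure_half_plane)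
  have "ennreal ((P (x, t) - P (x, s))^2) <= ennreal (t - s) * (NN r. ennreal (indicator {s..t} r * (G (x, r) \<bullet> ?e2)^2))"
  proof (rule increment_square_le[OF st(2)])
   show "((%y. P (x, y)) has_vector_derivative G (x, r) \<bullet> ?e2) (at r within {s..t})" if "r : {s..t}" for r
    using C1_up_line[OF P l that] by simp
   show "continuous_on {s..t} (%r. G (x, r) \<bullet> ?e2)"
    by (rule continuous_on_compose2[OF contG[of ?e2], of _ "%y. (x, y)"])
      (use st in \<open>auto simp: mem_closure_half_plane intro!: continuous_intros\<close>)
  qed
  also have "... <= ennreal R * b x"
   unfolding b_def using st
   by (intro mult_mono ennreal_leI nn_integral_mono) (auto simp: g_def indicator_def mem_half_plane)
  finally show ?thesis .
 qed
 have seg_x: "ennreal ((P (t, y0) - P (s, y0))^2) <= ennreal R * a y0" if st: "s <= t" "t - s <= R" for s t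
 proof -
  have l: "(0, y0) + r *. ?e1 : closure \<Omega>" for r using y0 by (simp add: mem_closure_half_plane)
  have "ennreal ((P (t, y0) - P (s, y0))^2) <= ennreal (t - s) * (NN r. ennreal (indicator {s..t} r * (G (r, y0) \<bullet> ?e1)^2))"
  proof (rule increment_square_le[OF st(1)])
   show "((%x. P (x, y0)) has_vector_derivative G (r, y0) \<bullet> ?e1) (at r within {s..t})" if "r : {s..t}" for r
    using C1_up_line[OF P l that] by simp
   show "continuous_on {s..t} (%r. G (r, y0) \<bullet> ?e1)"
    by (rule continuous_on_compose2[OF contG[of ?e1], of _ "%x. (x, y0)"])
      (use y0 in \<open>auto simp: mem_closure_half_plane intro!: continuous_intros\<close>)
  qed
  also have "... <= ennreal R * a y0"
   unfolding a_def using st y0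
   by (intro mult_mono ennreal_leI nn_integral_mono) (auto simp: g_def indicator_def mem_half_plane)
  finally show ?thesis .
 qed
 have pointwise: "ennreal ((P (x, y) - m)^2) <= 2 * (ennreal R * b x) + 2 * ennreal Q" if xy: "\<bar>x\<bar> <= R" "0 < y" "y <= R" for x y
 proof -
  have 1: "ennreal ((P (x, y) - P (x, y0))^2) <= ennreal R * b x"
  proof (cases "y0 <= y")
   case True then show ?thesis using seg_y[of y0 y x] y0 xy by auto
  next
   case False then show ?thesis using seg_y[of y y0 x] y0 xy by (auto simp: power2_commute)
  qed
  have "ennreal ((P (x, y0) - m)^2) <= ennreal R * a y0"
  proof (cases "0 <= x")
   case True then show ?thesis using seg_x[of 0 x] xy by (auto simp: m_def)
  next
   case False then show ?thesis using seg_x[of x 0] xy by (auto simp: m_def power2_commute)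
  qed
  also have "... <= ennreal R * ennreal (Q / R)" by (intro mult_left_mono y0) simp
  also have "... = ennreal Q" using R Q0 by (simp add: ennreal_mult[symmetric])
  finally have 2: "ennreal ((P (x, y0) - m)^2) <= ennreal Q" .
  have "(P (x, y) - m)^2 <= 2 * (P (x, y) - P (x, y0))^2 + 2 * (P (x, y0) - m)^2"
   using norm_add_sq_le[of "P (x, y) - P (x, y0)" "P (x, y0) - m"] by simp
  then have "ennreal ((P (x, y) - m)^2) <= ennreal (2 * (P (x, y) - P (x, y0))^2 + 2 * (P (x, y0) - m)^2)" by (rule ennreal_leI)
  also have "... = 2 * ennreal ((P (x, y) - P (x, y0))^2) + 2 * ennreal ((P (x, y0) - m)^2)"
   by (simp add: ennreal_plus ennreal_mult')
  also have "... <= 2 * (ennreal R * b x) + 2 * ennreal Q" by (intro add_mono mult_left_mono 1 2) auto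
  finally show ?thesis .
 qed
 let ?f = "%z. indicat_real K z * (P z - m)"
 have fm: "?f : borel_measurable lborel"
 proof -
  have 1: "(%z. indicator \<Omega> z *. (P z - m)) : borel_measurable borel"
   by (intro continuous_closure_measurable(1) continuous_intros contP)
  have "K : sets borel" by (rule K[unfolded borel_prod])
  then have 2: "indicat_real K : borel_measurable borel" by (rule borel_measurable_indicator)
  have "?f = (%z. indicat_real K z * (indicator \<Omega> z *. (P z - m)))"
   by (auto simp: fun_eq_iff indicator_def K_def mem_half_plane)
  then show ?thesis using borel_measurable_times[OF 2 1] by simp
 qed
 have "(NN z. ennreal ((norm (?f z))^2))
   <= (NN z. (case z of (x, y) => (2 * (ennreal R * b x) + 2 * ennreal Q) * (indicator {-R..R} x * indicator {0<..R} y)))"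
 proof (intro nn_integral_mono)
  fix z :: point
  obtain x y where z: "z = (x, y)" by (cases z)
  show "ennreal ((norm (?f z))^2) <= (case z of (x, y) => (2 * (ennreal R * b x) + 2 * ennreal Q) * (indicator {-R..R} x * indicator {0<..R} y))"
   using pointwise[of x y] by (auto simp: z K_def indicator_def)
 qed
 also have "... = (NN x. (NN y. (2 * (ennreal R * b x) + 2 * ennreal Q) * (indicator {-R..R} x * indicator {0<..R} y)))"
  unfolding lborel_prod[symmetric] by (subst lborel.nn_integral_fst[symmetric]) auto
 also have "... = (NN x. (2 * (ennreal R * b x) + 2 * ennreal Q) * indicator {-R..R} x * ennreal R)"
  using R by (intro nn_integral_cong) (simp add: mult.assoc[symmetric] nn_integral_cmult)
 also have "... <= (NN x. 2 * ennreal R * ennreal R * b x + 2 * ennreal Q * ennreal R * indicator {-R..R} x)"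
  by (intro nn_integral_mono) (auto simp: indicator_def distrib_left distrib_right mult_ac)
 also have "... = 2 * ennreal R * ennreal R * (NN x. b x) + 2 * ennreal Q * ennreal R * ennreal (2 * R)"
  using R by (simp add: nn_integral_add nn_integral_cmult)
 also have "... <= 2 * ennreal R * ennreal R * ennreal Q + 2 * ennreal Q * ennreal R * ennreal (2 * R)"
  by (intro add_mono mult_left_mono IB) auto
 also have "... = ennreal (2 * R * R * Q + 2 * Q * R * (2 * R))"
 proof -
  have "ennreal (2 * R * R * Q) = 2 * ennreal R * ennreal R * ennreal Q"
   using R Q0 by (subst ennreal_mult, simp, simp, subst ennreal_mult, simp, simp, subst ennreal_mult, simp_all)
  moreover have "ennreal (2 * Q * R * (2 * R)) = 2 * ennreal Q * ennreal R * ennreal (2 * R)"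
   using R Q0 by (subst ennreal_mult, simp, simp, subst ennreal_mult, simp, simp, subst ennreal_mult, simp_all)
  ultimately show ?thesis
   using R Q0 by (subst ennreal_plus) simp_all
 qed
 also have "... <= ennreal ((3 * R * nrm G)^2)"
  using R Q0 by (intro ennreal_leI) (simp add: power2_eq_square Q_def)
 finally have "(NN z. ennreal ((norm (?f z))^2)) <= ennreal ((3 * R * nrm G)^2)" .
 from L2_nn_integral_bound[OF fm this] R show ?thesis
  by (intro that[of m]) (auto simp: K_def)
qed

lemma cutoff_at_derivative:
 "frechet_derivative (cutoff_at n) (at z) h = (1 / real (Suc n)) * frechet_derivative cutoff (at ((1 / real (Suc n)) *. z)) h"
 using partial_cutoff_at[of h n z] by (simp add: partial_def)

text \<open>
 The pressure itself need not be square integrable, only its gradient. Cutting off at scale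
 \<open>R\<close> after subtracting a constant leaves an error term of size \<open>R / R\<close> by the Poincare inequality,
 so it is bounded, and it vanishes in the limit against the fixed field since the derivative of
 the cutoff vanishes at the origin.
\<close>

lemma gradient_orthogonal:
 fixes P :: "point => real"
 assumes u: "u : L2_sigma" and P: "C1_up P (%z h. G z \<bullet> h)" and G: "G : L2 \<mu>"
 shows "ip u G = 0"
proof -
 let ?M = "\<mu>"
 have uL: "u : L2 ?M" using u by (simp add: solenoidal_def)
 have um [measurable]: "u : borel_measurable ?M" "G : borel_measurable ?M" using uL G by (auto simp: L2_def)
 define R where "R n = real (Suc n)" for n
 have R0: "R n > 0" for n by (simp add: R_def)
 define K :: "nat => point set" where "K n = {- R n..R n} \<times> {0<..R n}" for n
 have "\<exists>m. \<forall>n. (%z. indicat_real (K n) z * (P z - m n)) : L2 lborel \<and>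
  L2_norm lborel (%z. indicat_real (K n) z * (P z - m n)) <= 3 * R n * L2_norm ?M G"
  unfolding K_def by (rule choice, rule allI, rule poincare_rectangle[OF P G R0]) blast
 then obtain m where m: "!!n. (%z. indicat_real (K n) z * (P z - m n)) : L2 lborel"
  "!!n. L2_norm lborel (%z. indicat_real (K n) z * (P z - m n)) <= 3 * R n * L2_norm ?M G" by auto
 define p where "p n z = indicat_real (K n) z * (P z - m n)" for n z
 have p: "p n : L2 ?M" "L2_norm ?M (p n) <= 3 * R n * L2_norm ?M G" for n
  using L2_lborel_imp_half_plane[OF m(1)[of n]] order_trans[OF L2_norm_half_plane_le[OF m(1)] m(2), of n] by (auto simp: p_def[abs_def])
 define d where "d n z h = frechet_derivative cutoff (at ((1 / R n) *. z)) h" for n :: nat and z h :: point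
 define D where "D n z h = cutoff_at n z *. (G z \<bullet> h) + ((1 / R n) * d n z h) *. (P z - m n)" for n z h
 have C: "C1_up (%z. cutoff_at n z *. (P z - m n)) (D n)" for n
  using C1_up_scaleR[OF C1_up_smooth[OF test_smooth[OF cutoff_at_test]] C1_up_diff_const[OF P], of n "m n"]
  by (simp add: D_def[abs_def] d_def cutoff_at_derivative R_def)
 have outside: "cutoff_at n z = 0 \<and> d n z h = 0" if z: "z : \<Omega>" "z \<notin> K n" for n z h
 proof -
  have "closure {w. cutoff w \<noteq> 0} \<subseteq> {w. \<bar>fst w\<bar> <= 1 \<and> \<bar>snd w\<bar> <= 1}"
   by (intro closure_minimal closed_Collect_conj closed_Collect_le continuous_intros) (auto simp: cutoff_nonzero)
  moreover have "(1 / R n) *. z \<notin> {w. \<bar>fst w\<bar> <= 1 \<and> \<bar>snd w\<bar> <= 1}"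
   using z R0[of n] by (cases z) (auto simp: K_def mem_half_plane field_simps abs_le_iff)
  ultimately have "(1 / R n) *. z \<notin> closure {w. cutoff w \<noteq> 0}" by blast
  then have "d n z h = 0" "cutoff ((1 / R n) *. z) = 0"
   using partial_zero_off_support[of "(1 / R n) *. z" cutoff h] closure_subset[of "{w. cutoff w \<noteq> 0}"] 
   by (auto simp: d_def partial_def)
  then show ?thesis by (simp add: cutoff_at_def R_def)
 qed
 have Deq: "D n z h = cutoff_at n z * (G z \<bullet> h) + (1 / R n) * (d n z h * p n z)" if "z : \<Omega>" for n z h
  using outside[OF that, of n h] by (cases "z : K n") (auto simp: D_def p_def)
 obtain B where B: "B > 0" "!!i z. i : Basis ==> \<bar>partial i cutoff z\<bar> <= B"
  using ex_partial_cutoff_bound by blast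
 have dlin: "d n z h = (\<Sum>i\<in>Basis. (h \<bullet> i) * partial i cutoff ((1 / R n) *. z))" for n z h
  unfolding d_def using frechet_derivative_partial[OF smooth_differentiable[OF smooth_cutoff]] by simp
 have dbound: "\<bar>d n z h\<bar> <= 2 * B * norm h" for n z h
 proof -
  have "\<bar>d n z h\<bar> <= (\<Sum>i\<in>(Basis::point set). norm h * B)"
   unfolding dlin
  proof (rule order_trans[OF sum_abs sum_mono])
   fix i :: point assume i: "i : Basis"
   show "\<bar>(h \<bullet> i) * partial i cutoff ((1 / R n) *. z)\<bar> <= norm h * B"
    unfolding abs_mult using Basis_le_norm[OF i, of h] B(2)[OF i] by (intro mult_mono) auto
  qed
  then show ?thesis by (simp add: mult_ac)
 qed
 have pc: "continuous_on UNIV (partial i cutoff)" if "i : Basis" for i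
  by (rule smooth_continuous[OF smooth_partial[OF smooth_cutoff that]])
 have dmeas: "(%z. d n z (h z)) : borel_measurable ?M" if [measurable]: "h : borel_measurable ?M" for n h
  unfolding dlin
 proof (intro borel_measurable_sum borel_measurable_times)
  fix i :: point assume i: "i : Basis"
  show "(%z. partial i cutoff ((1 / R n) *. z)) : borel_measurable ?M"
   by (intro measurable_lborel_imp_lebesgue_on borel_measurable_continuous_onI continuous_on_compose2[OF pc[OF i]] continuous_intros) auto
 qed measurable
 \<comment> \<open>the truncated potentials are admissible, so the orthogonality in \<open>H\<^sup>1\<close> applies\<close>
 have zero: "(LINT z|?M. cutoff_at n z * (u z \<bullet> G z)) + (1 / R n) * (LINT z|?M. d n z (u z) * p n z) = 0" for n
 proof -
  let ?f = "%z. cutoff_at n z *. (P z - m n)"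
  have cm: "cutoff_at n : borel_measurable ?M"
   by (rule measurable_lborel_imp_lebesgue_on[OF test_measurable[OF cutoff_at_test]])
  have fp: "?f z = cutoff_at n z *. p n z" if "z : \<Omega>" for z
   using outside[OF that, of n 0] by (cases "z : K n") (auto simp: p_def)
  have cp: "(%z. cutoff_at n z *. p n z) : L2 ?M"
   by (rule L2_bounded_mult[OF p(1) cm, where C=1]) (rule cutoff_at_bounds)
  have L2cong: "g : L2 ?M" if "h : L2 ?M" "!!z. z : \<Omega> ==> g z = h z" for g h :: "point => real"
  proof -
   have "g : borel_measurable ?M" using that by (subst measurable_cong[of _ _ h]) (auto simp: L2_def)
   moreover have "integrable ?M (%z. (norm (g z))^2)"
    using L2_integrable_sq[OF that(1)] by (rule Bochner_Integration.integrable_cong[THEN iffD1, OF refl, rotated]) (simp add: that(2))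
   ultimately show ?thesis by (simp add: L2_def)
  qed
  have f2: "?f : L2 ?M" by (rule L2cong[OF cp fp])
  have D2: "(%z. D n z i) : L2 ?M" for i
  proof (rule L2cong[OF _ Deq])
   have 1: "(%z. cutoff_at n z *. (G z \<bullet> i)) : L2 ?M"
    by (rule L2_bounded_mult[OF L2_inner_component[OF G] cm, where C=1]) (rule cutoff_at_bounds)
   have 2: "(%z. d n z i *. p n z) : L2 ?M"
    by (rule L2_bounded_mult[OF p(1), where C="2 * B * norm i"]) (auto intro: dbound dmeas)
   show "(%z. cutoff_at n z * (G z \<bullet> i) + (1 / R n) * (d n z i * p n z)) : L2 ?M"
    using L2_add[OF 1 L2_scaleR[OF 2, of "1 / R n"]] by simp
  qed
  have wd: "has_weak_deriv [i] ?f (%z. D n z i)" if "i : Basis" for i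
   by (rule classical_weak_deriv[OF C f2 D2 that])
  have fH: "?f : Hs 1" unfolding Hs_1_iff using f2 wd by blast
  have "AE z in ?M. \<forall>i\<in>Basis. weak_deriv [i] ?f z = D n z i"
   by (intro AE_finite_allI weak_deriv_eq[OF wd]) auto
  then have ae: "AE z in ?M. (\<Sum>i\<in>Basis. (u z \<bullet> i) * weak_deriv [i] ?f z) = cutoff_at n z * (u z \<bullet> G z) + (1 / R n) * (d n z (u z) * p n z)"
   using AE_space
  proof eventually_elim
   case (elim z)
   then have "(\<Sum>i\<in>Basis. (u z \<bullet> i) * weak_deriv [i] ?f z) = (\<Sum>i\<in>Basis. (u z \<bullet> i) * (cutoff_at n z * (G z \<bullet> i) + (1 / R n) * (d n z i * p n z)))"
    by (intro sum.cong refl) (simp add: Deq)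
   also have "... = cutoff_at n z * (\<Sum>i\<in>Basis. (u z \<bullet> i) * (G z \<bullet> i)) + (1 / R n) * ((\<Sum>i\<in>Basis. (u z \<bullet> i) * d n z i) * p n z)"
    by (simp add: distrib_left sum.distrib sum_distrib_left sum_distrib_right mult_ac)
   also have "(\<Sum>i\<in>Basis. (u z \<bullet> i) * (G z \<bullet> i)) = u z \<bullet> G z" by (simp add: euclidean_inner[symmetric])
   also have "(\<Sum>i\<in>Basis. (u z \<bullet> i) * d n z i) = d n z (u z)"
    unfolding dlin[of n z "u z"] by (simp add: d_def partial_def)
   finally show ?case .
  qed
  have i1: "integrable ?M (%z. cutoff_at n z * (u z \<bullet> G z))"
  proof (rule Bochner_Integration.integrable_bound[OF L2_inner_integrable[OF uL G]])
   show "AE z in ?M. norm (cutoff_at n z * (u z \<bullet> G z)) <= norm (u z \<bullet> G z)"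
    using cutoff_at_bounds(3) by (intro AE_I2) (simp add: abs_mult mult_left_le_one_le)
  qed (use cm in measurable)
  have du: "(%z. d n z (u z)) : L2 ?M"
  proof (rule L2_dominated)
   show "integrable ?M (%z. (2 * B)^2 * (norm (u z))^2)" by (intro integrable_mult_right L2_integrable_sq uL)
   show "AE z in ?M. (norm (d n z (u z)))^2 <= (2 * B)^2 * (norm (u z))^2"
    unfolding power_mult_distrib[symmetric] using dbound by (intro AE_I2 power_mono) auto
  qed (rule dmeas[OF um(1)])
  have i2: "integrable ?M (%z. d n z (u z) * p n z)" using L2_scaleR_integrable[OF du p(1)] by simp
  have "0 = (LINT z|?M. (\<Sum>i\<in>Basis. (u z \<bullet> i) * weak_deriv [i] ?f z))"
   by (rule solenoidal_orthogonal_H1[OF u fH, symmetric])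
  also have "... = (LINT z|?M. cutoff_at n z * (u z \<bullet> G z) + (1 / R n) * (d n z (u z) * p n z))"
  proof (rule integral_cong_AE[OF _ _ ae])
   show "(%z. \<Sum>i\<in>Basis. (u z \<bullet> i) * weak_deriv [i] ?f z) : borel_measurable ?M"
    using Hs_1_weak_deriv(2)[OF fH] by (intro borel_measurable_sum borel_measurable_times) (auto simp: L2_def)
  qed (use i1 i2 in measurable)
  also have "... = (LINT z|?M. cutoff_at n z * (u z \<bullet> G z)) + (1 / R n) * (LINT z|?M. d n z (u z) * p n z)"
   using i1 i2 by simp
  finally show ?thesis by simp
 qed
 have lim1: "(%n. LINT z|?M. cutoff_at n z * (u z \<bullet> G z)) ~~> (LINT z|?M. u z \<bullet> G z)"
 proof (rule integral_dominated_convergence)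
  show "integrable ?M (%z. norm (u z \<bullet> G z))" by (intro integrable_norm L2_inner_integrable uL G)
  show "AE z in ?M. (%n. cutoff_at n z * (u z \<bullet> G z)) ~~> u z \<bullet> G z"
  proof (rule AE_I2)
   fix z have "(%n. cutoff_at n z * (u z \<bullet> G z)) ~~> 1 * (u z \<bullet> G z)"
    by (intro tendsto_intros cutoff_at_tendsto)
   then show "(%n. cutoff_at n z * (u z \<bullet> G z)) ~~> u z \<bullet> G z" by simp
  qed
  show "AE z in ?M. norm (cutoff_at n z * (u z \<bullet> G z)) <= norm (u z \<bullet> G z)" for n
   using cutoff_at_bounds(3) by (intro AE_I2) (simp add: abs_mult mult_left_le_one_le)
  show "(%z. cutoff_at n z * (u z \<bullet> G z)) : borel_measurable ?M" for n
   using measurable_lborel_imp_lebesgue_on[OF test_measurable[OF cutoff_at_test]] by measurable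
 qed measurable
 have duL: "(%z. d n z (u z)) : L2 ?M" for n
 proof (rule L2_dominated)
  show "integrable ?M (%z. (2 * B)^2 * (norm (u z))^2)" by (intro integrable_mult_right L2_integrable_sq uL)
  show "AE z in ?M. (norm (d n z (u z)))^2 <= (2 * B)^2 * (norm (u z))^2"
   unfolding power_mult_distrib[symmetric] using dbound by (intro AE_I2 power_mono) auto
 qed (rule dmeas[OF um(1)])
 have "(%n. L2_norm ?M (%z. d n z (u z) - 0)) ~~> 0"
 proof (rule L2_dominated_convergence)
  show "integrable ?M (%z. (2 * B)^2 * (norm (u z))^2)" by (intro integrable_mult_right L2_integrable_sq uL)
  show "AE z in ?M. (norm (d n z (u z) - 0))^2 <= (2 * B)^2 * (norm (u z))^2" for n
   unfolding power_mult_distrib[symmetric] using dbound by (intro AE_I2 power_mono) auto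
  show "AE z in ?M. (%n. d n z (u z)) ~~> 0"
  proof (rule AE_I2)
   fix z :: point
   have "(%n. (1 / R n) *. z) ~~> 0 *. z" unfolding R_def by (rule tendsto_scaleR[OF inverse_Suc_tendsto tendsto_const])
   then have "(%n. (1 / R n) *. z) ~~> 0" by simp
   then have "(%n. \<Sum>i\<in>Basis. (u z \<bullet> i) * partial i cutoff ((1 / R n) *. z)) ~~> (\<Sum>i\<in>Basis. (u z \<bullet> i) * partial i cutoff 0)"
    by (intro tendsto_intros continuous_on_tendsto_compose[OF pc]) auto
   moreover have "partial i cutoff 0 = 0" for i by (simp add: partial_def cutoff_derivative_0)
   ultimately show "(%n. d n z (u z)) ~~> 0" unfolding dlin by simp
  qed
 qed (use dmeas in auto)
 then have e: "(%n. L2_norm ?M (%z. d n z (u z))) ~~> 0" by simp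
 have lim2: "(%n. (1 / R n) * (LINT z|?M. d n z (u z) * p n z)) ~~> 0"
 proof (rule Lim_null_comparison)
  show "\<forall>\<^sub>F n in sequentially. norm ((1 / R n) * (LINT z|?M. d n z (u z) * p n z)) <= L2_norm ?M (%z. d n z (u z)) * (3 * L2_norm ?M G)"
  proof (intro always_eventually allI)
   fix n
   have "\<bar>LINT z|?M. d n z (u z) * p n z\<bar> <= L2_norm ?M (%z. d n z (u z)) * L2_norm ?M (p n)"
    using L2_inner_bound[OF duL p(1)] by (simp add: L2_inner_def)
   also have "... <= L2_norm ?M (%z. d n z (u z)) * (3 * R n * L2_norm ?M G)"
    by (intro mult_left_mono p(2)) simp
   finally show "norm ((1 / R n) * (LINT z|?M. d n z (u z) * p n z)) <= L2_norm ?M (%z. d n z (u z)) * (3 * L2_norm ?M G)"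
    using R0[of n] by (simp add: abs_mult field_simps)
  qed
  show "(%n. L2_norm ?M (%z. d n z (u z)) * (3 * L2_norm ?M G)) ~~> 0"
   by (rule tendsto_mult_left_zero[OF e])
 qed
 have "(%n. 0 :: real) ~~> (LINT z|?M. u z \<bullet> G z) + 0"
  using tendsto_add[OF lim1 lim2] by (simp only: zero)
 then have "(LINT z|?M. u z \<bullet> G z) = 0" by (simp add: LIMSEQ_const_iff)
 then show ?thesis by (simp add: L2_inner_def)
qed

section \<open>Bounded gradients\<close>

lemma classical_parts:
 fixes f :: "point => 'b::euclidean_space" and \<psi> :: "point => real"
 assumes f: "C1_up f D" and \<psi>: "\<psi> : test_functions \<Omega>" and i: "i : Basis" and fL: "f : L2 \<mu>"
 shows "integrable lborel (%z. \<psi> z *. (indicator \<Omega> z *. D z i))"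
  and "(LINT z|\<mu>. partial i \<psi> z *. f z) = - (LINT z|lborel. \<psi> z *. (indicator \<Omega> z *. D z i))"
proof -
 obtain R where C: "C1_up (%z. \<psi> z *. f z) (%z h. \<psi> z *. D z h + frechet_derivative \<psi> (at z) h *. f z)"
  "!!z. norm z > R ==> \<psi> z *. f z = 0 \<and> (%h. \<psi> z *. D z h + frechet_derivative \<psi> (at z) h *. f z) = (%h. 0)"
  by (rule C1_up_test_product[OF \<psi> f]) blast
 obtain R' where R': "!!z. norm z > R' ==> \<psi> z = 0" using test_bounded_support[OF \<psi>] by blast
 have cD: "continuous_on (closure \<Omega>) (%z. D z i)" using f unfolding C1_up_def by blast
 have cpD: "continuous_on (closure \<Omega>) (%z. \<psi> z *. D z i)"
  by (intro continuous_intros cD smooth_continuous test_smooth[OF \<psi>])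
 have int: "integrable lborel (%z. indicator \<Omega> z *. (\<psi> z *. D z i))"
  by (rule compact_support_half_plane_integrable[OF cpD, of R']) (simp add: R')
 have eqf: "(%z. \<psi> z *. (indicator \<Omega> z *. D z i)) = (%z. indicator \<Omega> z *. (\<psi> z *. D z i))"
  by (simp add: mult.commute)
 show "integrable lborel (%z. \<psi> z *. (indicator \<Omega> z *. D z i))" unfolding eqf by (rule int)
 have m: "(%z. indicator \<Omega> z *. (\<psi> z *. D z i)) : borel_measurable borel"
  by (rule continuous_closure_measurable(1)[OF cpD])
 have int1: "integrable \<mu> (%z. \<psi> z *. D z i)"
  by (subst integrable_restrict_space, simp, subst integrable_completion) (use m int in auto)
 have int2: "integrable \<mu> (%z. partial i \<psi> z *. f z)"
  by (rule test_integrable_weak[OF fL test_partial[OF \<psi> i]])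
 have "\<psi> (x, 0) = 0" for x
  using \<psi> closure_subset[of "{z. \<psi> z \<noteq> 0}"] by (force simp: test_functions_def mem_half_plane)
 then have "(LINT z|\<mu>. \<psi> z *. D z i + frechet_derivative \<psi> (at z) i *. f z) = 0"
  using integral_partial_zero[OF C(1), of R] C(2) i unfolding Basis_point by auto
 then have "(LINT z|\<mu>. partial i \<psi> z *. f z) = - (LINT z|\<mu>. \<psi> z *. D z i)"
  using int1 int2 by (simp add: partial_def eq_neg_iff_add_eq_0 add.commute)
 also have "(LINT z|\<mu>. \<psi> z *. D z i) = (LINT z|lborel. indicator \<Omega> z *. (\<psi> z *. D z i))"
  by (subst integral_restrict_space, simp, subst integral_completion) (use m in auto)
 finally show "(LINT z|\<mu>. partial i \<psi> z *. f z) = - (LINT z|lborel. \<psi> z *. (indicator \<Omega> z *. D z i))"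
  unfolding eqf .
qed

text \<open>
 Mollified weak derivatives converge pointwise to continuous classical derivatives, up to the
 boundary.
\<close>

lemma mollify_pointwise_limit:
 fixes f :: "point => 'b::euclidean_space"
 assumes f: "C1_up f D" and h: "has_weak_deriv [i] f h" and i: "i : Basis" and z: "z : closure \<Omega>"
 shows "(%n. mollify (upward_kernel n) (rep h) z) ~~> D z i"
proof (rule LIMSEQ_I)
 fix e :: real assume e: "e > 0"
 have fL: "f : L2 \<mu>" and hL: "h : L2 \<mu>" using h by (auto simp: has_weak_deriv_def)
 have "continuous_on (closure \<Omega>) (%z. D z i)" using f unfolding C1_up_def by blast
 then obtain d where d: "d > 0" "!!w. w : closure \<Omega> ==> dist w z < d ==> dist (D w i) (D z i) < e / 2"
  using z e unfolding continuous_on_iff by (metis half_gt_zero)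
 obtain N where N: "4 / d < real N" using reals_Archimedean2 by blast
 show "\<exists>N. \<forall>n\<ge>N. norm (mollify (upward_kernel n) (rep h) z - D z i) < e"
 proof (intro exI allI impI)
  fix n assume n: "N <= n"
  let ?k = "%w. upward_kernel n (w - z)"
  note K = averaging_kernelD[OF averaging_upward_kernel[of n]]
  have kz: "?k : test_functions \<Omega>" by (rule upward_kernel_translate_test[OF z])
  have k1: "integrable lborel ?k" "(LINT w|lborel. ?k w) = 1"
   using lborel_integrable_translate[of "upward_kernel n" "-z"] lborel_integral_translate[of "upward_kernel n" "-z"]
    test_integrable[OF K(1)] K(4,5) by auto
  note parts = classical_parts[OF f kz i fL]
  have "mollify (upward_kernel n) (rep h) z = (LINT w|lborel. ?k w *. (indicator \<Omega> w *. D w i))"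
  proof -
   have "mollify (upward_kernel n) (rep h) z = (LINT w|\<mu>. ?k w *. h w)"
    unfolding mollify_def by (rule integral_rep[OF hL test_measurable[OF kz], symmetric])
   also have "... = - (LINT w|\<mu>. partial i ?k w *. f w)"
    using h kz by (auto simp: has_weak_deriv_def partials_def)
   finally show ?thesis using parts(2) by simp
  qed
  then have "mollify (upward_kernel n) (rep h) z - D z i
    = (LINT w|lborel. ?k w *. (indicator \<Omega> w *. D w i) - ?k w *. D z i)"
   using parts(1) k1 by simp
  also have "norm ... <= (LINT w|lborel. ?k w * (e / 2))"
  proof (rule Bochner_Integration.integral_norm_bound_integral)
   show "integrable lborel (%w. ?k w *. (indicator \<Omega> w *. D w i) - ?k w *. D z i)"
    using parts(1) k1 by simp
   show "integrable lborel (%w. ?k w * (e / 2))" using k1 by simp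
   fix w
   show "norm (?k w *. (indicator \<Omega> w *. D w i) - ?k w *. D z i) <= ?k w * (e / 2)"
   proof (cases "?k w = 0")
    case False
    have near: "norm (w - z) <= 4 / real (Suc n)" by (rule upward_kernel_support(2)[OF False])
    have up: "snd (w - z) > 1 / real (Suc n)" by (rule upward_kernel_support(1)[OF False])
    have "0 < 1 / real (Suc n)" by simp
    with up have "0 < snd (w - z)" by linarith
    then have w: "w : \<Omega>" using z by (simp add: mem_half_plane mem_closure_half_plane)
    have "4 / real (Suc n) < d"
    proof -
     have "4 / d < real (Suc n)" using N n by linarith
     then show ?thesis using d(1) by (simp add: field_simps)
    qed
    then have "dist (D w i) (D z i) < e / 2"
     using near w closure_subset[of \<Omega>] by (intro d(2)) (auto simp: dist_norm)
    moreover have "norm (?k w *. (indicator \<Omega> w *. D w i) - ?k w *. D z i) = ?k w * dist (D w i) (D z i)"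
     using w K(2)[of "w - z"] by (simp add: scaleR_diff_right[symmetric] dist_norm)
    moreover have "?k w * dist (D w i) (D z i) <= ?k w * (e / 2)"
     using calculation(1) K(2)[of "w - z"] by (intro mult_left_mono) auto
    ultimately show ?thesis by linarith
   qed simp
  qed
  also have "... = e / 2" using k1 by simp
  finally show "norm (mollify (upward_kernel n) (rep h) z - D z i) < e" using e by simp
 qed
qed

subsection \<open>The case of three derivatives\<close>

lemma norm_diff_sq_le: "(norm (a - b))^2 <= 2 * (norm a)^2 + 2 * (norm (b::'a::real_normed_vector))^2"
 using norm_add_sq_le[of a "- b"] by simp

text \<open>
 The left endpoint value is the integral of \<open>\<phi>(s) - (1 - (s - a)) \<psi>(s)\<close> over the interval, by the fundamental theorem
 of calculus for \<open>(1 - (s - a)) \<phi>(s)\<close>.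
\<close>

lemma endpoint_square_le:
 fixes \<phi> \<psi> :: "real => 'b::euclidean_space"
 assumes der: "!!s. s : {a..a + 1} ==> (\<phi> has_vector_derivative \<psi> s) (at s within {a..a + 1})"
  and cont: "continuous_on {a..a + 1} \<psi>"
 shows "ennreal ((norm (\<phi> a))^2) <= (NN s. indicator {a..a + 1} s * ennreal (2 * (norm (\<phi> s))^2 + 2 * (norm (\<psi> s))^2))"
proof -
 have c\<phi>: "continuous_on {a..a + 1} \<phi>" by (rule continuous_on_vector_derivative[OF der])
 let ?F = "%s. \<phi> s - (1 - (s - a)) *. \<psi> s"
 let ?G = "%s. indicat_real {a..a + 1} s *. ?F s"
 have B: "has_bochner_integral lborel ?G (- ((1 - ((a + 1) - a)) *. \<phi> (a + 1)) - - ((1 - (a - a)) *. \<phi> a))"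
 proof (rule has_bochner_integral_FTC_Icc)
  fix y :: real assume y: "a <= y" "y <= a + 1"
  have "((%y. - ((1 - (y - a)) *. \<phi> y)) has_vector_derivative
    - ((1 - (y - a)) *. \<psi> y + (0 - (1 - 0)) *. \<phi> y)) (at y within {a..a + 1})"
   using y by (intro has_vector_derivative_minus has_vector_derivative_scaleR der DERIV_diff DERIV_const DERIV_ident) auto
  then show "((%y. - ((1 - (y - a)) *. \<phi> y)) has_vector_derivative ?F y) (at y within {a..a + 1})" by simp
 qed (auto intro!: continuous_intros cont c\<phi>)
 have one: "(NN s. ennreal (indicat_real {a..a + 1} s)) = 1" by (simp add: ennreal_indicator)
 have [measurable]: "?G : borel_measurable lborel" using B by (auto simp: has_bochner_integral_iff)
 have \<phi>a: "\<phi> a = (LINT s|lborel. indicat_real {a..a + 1} s *. ?G s)"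
 proof -
  have "(LINT s|lborel. indicat_real {a..a + 1} s *. ?G s) = (LINT s|lborel. ?G s)"
   by (intro bochner_cong refl) (simp add: indicator_def)
  then show ?thesis using B by (simp add: has_bochner_integral_iff)
 qed
 have "ennreal ((norm (\<phi> a))^2)
   <= (NN s. ennreal (indicat_real {a..a + 1} s) * ennreal ((norm (?G s))^2))"
  unfolding \<phi>a by (rule average_square_le) (use one in auto)
 also have "... <= (NN s. indicator {a..a + 1} s * ennreal (2 * (norm (\<phi> s))^2 + 2 * (norm (\<psi> s))^2))"
 proof (intro nn_integral_mono)
  fix s
  show "ennreal (indicat_real {a..a + 1} s) * ennreal ((norm (?G s))^2)
    <= indicator {a..a + 1} s * ennreal (2 * (norm (\<phi> s))^2 + 2 * (norm (\<psi> s))^2)"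
  proof (cases "s : {a..a + 1}")
   case True
   have "(norm (?F s))^2 <= 2 * (norm (\<phi> s))^2 + 2 * (norm ((1 - (s - a)) *. \<psi> s))^2"
    by (rule norm_diff_sq_le)
   moreover have "(norm ((1 - (s - a)) *. \<psi> s))^2 <= (norm (\<psi> s))^2"
   proof (intro power_mono norm_ge_zero)
    have "\<bar>1 - (s - a)\<bar> <= 1" using True unfolding atLeastAtMost_iff by linarith
    then have "\<bar>1 - (s - a)\<bar> * norm (\<psi> s) <= 1 * norm (\<psi> s)" by (rule mult_right_mono) simp
    then show "norm ((1 - (s - a)) *. \<psi> s) <= norm (\<psi> s)" by simp
   qed
   ultimately have "(norm (?F s))^2 <= 2 * (norm (\<phi> s))^2 + 2 * (norm (\<psi> s))^2" by linarith
   then have "ennreal ((norm (1 *. ?F s))^2) <= ennreal (2 * (norm (\<phi> s))^2 + 2 * (norm (\<psi> s))^2)"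
    unfolding scaleR_one by (rule ennreal_leI)
   then show ?thesis using True by (simp only: indicator_simps ennreal_1 mult_1)
  next
   case False
   then show ?thesis by (simp only: indicator_simps not_False_eq_True ennreal_0 mult_zero_left order_refl)
  qed
 qed
 finally show ?thesis .
qed

lemma nn_integral_half_plane_sq:
 fixes g :: "point => 'b::euclidean_space"
 assumes g: "g : L2 \<mu>" and m [measurable]: "g : borel_measurable borel"
 shows "(NN z. indicator \<Omega> z * ennreal ((norm (g z))^2)) = ennreal ((nrm g)^2)"
proof -
 have int: "integrable lborel (%z. indicator \<Omega> z *. (norm (g z))^2)"
  using L2_integrable_sq[OF g] by (subst (asm) integrable_half_plane_iff) auto
 have "(NN z. indicator \<Omega> z * ennreal ((norm (g z))^2)) = (NN z. ennreal (indicator \<Omega> z *. (norm (g z))^2))"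
  by (intro nn_integral_cong) (auto simp: indicator_def)
 also have "... = ennreal (LINT z|lborel. indicator \<Omega> z *. (norm (g z))^2)"
  by (rule nn_integral_eq_integral[OF int]) auto
 also have "(LINT z|lborel. indicator \<Omega> z *. (norm (g z))^2) = (nrm g)^2"
  unfolding L2_norm_sq by (rule integral_half_plane[symmetric]) auto
 finally show ?thesis .
qed

lemma ennreal_double_sum: "0 <= X ==> 0 <= Y ==> 2 * ennreal X + 2 * ennreal Y = ennreal (2 * X + 2 * Y)"
 by (simp add: ennreal_plus ennreal_mult')

text \<open>
 With one mixed second derivative in \<open>L\<^sup>2\<close>, a pointwise bound follows by applying a
 one-dimensional estimate in each variable.
\<close>

lemma sup_bound_mixed:
 fixes g :: "point => 'b::euclidean_space"
 assumes sm: "smooth g" and z: "z : closure \<Omega>"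
  and L: "!!h. h : {g, partial (1, 0) g, partial (0, 1) g, partial (0, 1) (partial (1, 0) g)} ==>
   h : L2 \<mu> \<and> nrm h <= N"
 shows "norm (g z) <= 4 * N"
proof -
 let ?e1 = "(1, 0) :: point" and ?e2 = "(0, 1) :: point"
 have e: "?e1 : Basis" "?e2 : Basis" by (auto simp: Basis_point)
 have N: "0 <= N" using L[of g] order_trans[OF L2_norm_nonneg] by blast
 obtain x y where xy: "z = (x, y)" "0 <= y" using z by (cases z) (auto simp: mem_closure_half_plane)
 have sms: "smooth (partial ?e1 g)" "smooth (partial ?e2 g)" "smooth (partial ?e2 (partial ?e1 g))"
  by (intro smooth_partial sm e)+
 have vert: "ennreal ((norm (h (s, y)))^2) <= (NN t. indicator {y..y + 1} t * ennreal (2 * (norm (h (s, t)))^2 + 2 * (norm (partial ?e2 h (s, t)))^2))"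
  if h: "smooth h" for h :: "point => 'b" and s
 proof (rule endpoint_square_le)
  have l: "(s, 0) + r *. ?e2 : closure \<Omega>" if "r : {y..y + 1}" for r using that xy by (simp add: mem_closure_half_plane)
  show "((%t. h (s, t)) has_vector_derivative partial ?e2 h (s, t)) (at t within {y..y + 1})" if "t : {y..y + 1}" for t
   using C1_up_line[OF C1_up_smooth[OF h] l that] by (simp add: partial_def)
  show "continuous_on {y..y + 1} (%t. partial ?e2 h (s, t))"
   by (rule continuous_on_compose2[OF smooth_continuous[OF smooth_partial[OF h e(2)], of UNIV]]) (auto intro!: continuous_intros)
 qed
 have hor: "ennreal ((norm (g (x, y)))^2) <= (NN s. indicator {x..x + 1} s * ennreal (2 * (norm (g (s, y)))^2 + 2 * (norm (partial ?e1 g (s, y)))^2))"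
 proof (rule endpoint_square_le)
  have l: "(0, y) + r *. ?e1 : closure \<Omega>" for r using xy by (simp add: mem_closure_half_plane)
  show "((%t. g (t, y)) has_vector_derivative partial ?e1 g (t, y)) (at t within {x..x + 1})" if "t : {x..x + 1}" for t
   using C1_up_line[OF C1_up_smooth[OF sm] l that] by (simp add: partial_def)
  show "continuous_on {x..x + 1} (%t. partial ?e1 g (t, y))"
   by (rule continuous_on_compose2[OF smooth_continuous[OF sms(1), of UNIV]]) (auto intro!: continuous_intros)
 qed
 have m [measurable]: "(%s. h (s, t)) : borel_measurable borel" "(%t. h (s, t)) : borel_measurable borel"
   "h : borel_measurable (borel \<Otimes>\<^sub>M borel)"
  if "smooth h" for h :: "point => 'b" and s t
  using smooth_measurable[OF that] by (auto simp: borel_prod[symmetric])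
 note [measurable] = m[OF sm] m[OF sms(1)] m[OF sms(2)] m[OF sms(3)]
 define E where "E s t = 4 * (norm (g (s, t)))^2 + 4 * (norm (partial ?e2 g (s, t)))^2 + 4 * (norm (partial ?e1 g (s, t)))^2 + 4 * (norm (partial ?e2 (partial ?e1 g) (s, t)))^2" for s t
 have inner: "ennreal (2 * (norm (g (s, y)))^2 + 2 * (norm (partial ?e1 g (s, y)))^2) <= (NN t. indicator {y..y + 1} t * ennreal (E s t))" for s
 proof -
  have "ennreal (2 * (norm (g (s, y)))^2 + 2 * (norm (partial ?e1 g (s, y)))^2) = 2 * ennreal ((norm (g (s, y)))^2) + 2 * ennreal ((norm (partial ?e1 g (s, y)))^2)"
   by (simp add: ennreal_plus ennreal_mult')
  also have "... <= 2 * (NN t. indicator {y..y + 1} t * ennreal (2 * (norm (g (s, t)))^2 + 2 * (norm (partial ?e2 g (s, t)))^2))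
    + 2 * (NN t. indicator {y..y + 1} t * ennreal (2 * (norm (partial ?e1 g (s, t)))^2 + 2 * (norm (partial ?e2 (partial ?e1 g) (s, t)))^2))"
   by (intro add_mono mult_left_mono vert sm sms) auto
  also have "... = (NN t. indicator {y..y + 1} t * ennreal (E s t))"
  proof -
   have "2 * (indicator {y..y + 1} t * ennreal (2 * (norm (g (s, t)))^2 + 2 * (norm (partial ?e2 g (s, t)))^2))
     + 2 * (indicator {y..y + 1} t * ennreal (2 * (norm (partial ?e1 g (s, t)))^2 + 2 * (norm (partial ?e2 (partial ?e1 g) (s, t)))^2))
     = indicator {y..y + 1} t * ennreal (E s t)" for t
    using ennreal_double_sum[of "2 * (norm (g (s, t)))^2 + 2 * (norm (partial ?e2 g (s, t)))^2"
      "2 * (norm (partial ?e1 g (s, t)))^2 + 2 * (norm (partial ?e2 (partial ?e1 g) (s, t)))^2"]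
    by (cases "t : {y..y + 1}") (simp_all add: E_def)
   then show ?thesis
    by (subst (1 2) nn_integral_cmult[symmetric], measurable) (subst nn_integral_add[symmetric], measurable)
  qed
  finally show ?thesis .
 qed
 have "ennreal ((norm (g z))^2) <= (NN s. indicator {x..x + 1} s * (NN t. indicator {y..y + 1} t * ennreal (E s t)))"
  unfolding xy by (rule order_trans[OF hor]) (intro nn_integral_mono mult_left_mono inner, auto)
 also have "... <= (NN s. (NN t. indicator \<Omega> (s, t) * ennreal (E s t)))"
 proof (intro nn_integral_mono)
  fix s
  have "indicator {x..x + 1} s * (NN t. indicator {y..y + 1} t * ennreal (E s t)) <= (NN t. indicator {y..y + 1} t * ennreal (E s t))"
   by (auto simp: indicator_def)
  also have "... <= (NN t. indicator \<Omega> (s, t) * ennreal (E s t))"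
  proof (intro nn_integral_mono_AE)
   show "AE t in lborel. indicator {y..y + 1} t * ennreal (E s t) <= indicator \<Omega> (s, t) * ennreal (E s t)"
    using AE_lborel_singleton[of y]
   proof eventually_elim
    case (elim t)
    then show ?case using xy(2) by (auto simp: indicator_def mem_half_plane)
   qed
  qed
  finally show "indicator {x..x + 1} s * (NN t. indicator {y..y + 1} t * ennreal (E s t)) <= (NN t. indicator \<Omega> (s, t) * ennreal (E s t))" .
 qed
 also have "... = (NN z. indicator \<Omega> z * ennreal (E (fst z) (snd z)))"
 proof -
  have [measurable]: "\<Omega> : sets (borel \<Otimes>\<^sub>M borel)" unfolding borel_prod by (rule half_plane_borel)
  have "(%z. indicator \<Omega> z * ennreal (E (fst z) (snd z))) : borel_measurable (lborel \<Otimes>\<^sub>M lborel)"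
   unfolding E_def prod.collapse by measurable
  from lborel.nn_integral_fst[OF this] show ?thesis by (simp add: lborel_prod)
 qed
 also have "... = 4 * (NN z. indicator \<Omega> z * ennreal ((norm (g z))^2)) + 4 * (NN z. indicator \<Omega> z * ennreal ((norm (partial ?e2 g z))^2))
   + 4 * (NN z. indicator \<Omega> z * ennreal ((norm (partial ?e1 g z))^2)) + 4 * (NN z. indicator \<Omega> z * ennreal ((norm (partial ?e2 (partial ?e1 g) z))^2))"
 proof -
  note [measurable] = smooth_measurable[OF sm] smooth_measurable[OF sms(1)] smooth_measurable[OF sms(2)] smooth_measurable[OF sms(3)]
  have "indicator \<Omega> z * ennreal (E (fst z) (snd z)) = 4 * (indicator \<Omega> z * ennreal ((norm (g z))^2)) + 4 * (indicator \<Omega> z * ennreal ((norm (partial ?e2 g z))^2))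
   + 4 * (indicator \<Omega> z * ennreal ((norm (partial ?e1 g z))^2)) + 4 * (indicator \<Omega> z * ennreal ((norm (partial ?e2 (partial ?e1 g) z))^2))" for z
   by (auto simp: E_def indicator_def ennreal_mult' ennreal_plus)
  then show ?thesis by (simp add: nn_integral_add nn_integral_cmult)
 qed
 also have "... = ennreal (4 * (nrm g)^2 + 4 * (nrm (partial ?e2 g))^2
   + 4 * (nrm (partial ?e1 g))^2 + 4 * (nrm (partial ?e2 (partial ?e1 g)))^2)"
  using L by (simp add: nn_integral_half_plane_sq smooth_measurable sm sms ennreal_plus ennreal_mult')
 also have "... <= ennreal (4 * N\<^sup>2 + 4 * N\<^sup>2 + 4 * N\<^sup>2 + 4 * N\<^sup>2)"
  using L by (intro ennreal_leI add_mono mult_left_mono power_mono) auto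
 also have "... = ennreal ((4 * N)^2)" by (simp add: power_mult_distrib)
 finally have "(norm (g z))^2 <= (4 * N)^2" by simp
 then show ?thesis using N by (intro power2_le_imp_le[of "norm (g z)"]) auto
qed

subsection \<open>The case of a fractional derivative\<close>

definition unit_square :: "point set"
 where "unit_square = cbox (0, 0) (1, 1)"

text \<open>
 A signed weight on the unit square with mass one and vanishing first moments. The vanishing
 moments allow a constant to be subtracted from the gradient below.
\<close>

definition weight :: "point => real"
 where "weight w = (4 - 6 * fst w) * (4 - 6 * snd w)"

lemma mem_unit_square: "w : unit_square \<longleftrightarrow> 0 <= fst w \<and> fst w <= 1 \<and> 0 <= snd w \<and> snd w <= 1"
 by (cases w) (auto simp: unit_square_def cbox_Pair_eq)

lemma unit_square_borel [measurable]: "unit_square : sets borel"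
 by (simp add: unit_square_def)

lemma indicator_unit_square: "indicat_real unit_square w = indicat_real {0..1} (fst w) * indicat_real {0..1} (snd w)"
 by (auto simp: mem_unit_square indicator_def)

lemma lborel_product_integral:
 fixes u v :: "real => real"
 assumes u: "integrable lborel u" and v: "integrable lborel v"
 shows "integrable lborel (%w::point. u (fst w) * v (snd w))"
  "(LINT w|lborel. u (fst w) * v (snd w)) = (LINT x|lborel. u x) * (LINT y|lborel. v y)"
proof -
 have [measurable]: "u : borel_measurable borel" "v : borel_measurable borel" using u v by auto
 have i: "integrable (lborel \<Otimes>\<^sub>M lborel) (%w. u (fst w) * v (snd w))"
 proof (rule lborel_pair.Fubini_integrable)
  show "integrable lborel (%x. LINT y|lborel. norm (u (fst (x, y)) * v (snd (x, y))))"
   using u by (simp add: abs_mult)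
 qed (use u v in auto)
 then show "integrable lborel (%w::point. u (fst w) * v (snd w))" by (simp add: lborel_prod)
 show "(LINT w|lborel. u (fst w) * v (snd w)) = (LINT x|lborel. u x) * (LINT y|lborel. v y)"
  using lborel_pair.integral_fst'[OF i] by (simp add: lborel_prod)
qed

lemma weight_integrals_1D:
 "has_bochner_integral lborel (%x. indicat_real {0..1} x * (4 - 6 * x)) 1"
 "has_bochner_integral lborel (%x. indicat_real {0..1} x * ((4 - 6 * x) * x)) 0"
proof -
 have "has_bochner_integral lborel (%x. indicat_real {0..1} x *. (4 - 6 * x :: real)) ((4 * 1 - 3 * 1^2) - (4 * 0 - 3 * 0^2))"
  by (rule has_bochner_integral_FTC_Icc)
    (auto intro!: derivative_eq_intros continuous_intros simp: has_real_derivative_iff_has_vector_derivative[symmetric])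
 then show "has_bochner_integral lborel (%x. indicat_real {0..1} x * (4 - 6 * x)) 1" by simp
 have "has_bochner_integral lborel (%x. indicat_real {0..1} x *. ((4 - 6 * x) * x :: real)) ((2 * 1^2 - 2 * 1^3) - (2 * 0^2 - 2 * 0^3))"
  by (rule has_bochner_integral_FTC_Icc)
    (auto intro!: derivative_eq_intros continuous_intros simp: has_real_derivative_iff_has_vector_derivative[symmetric] algebra_simps power2_eq_square)
 then show "has_bochner_integral lborel (%x. indicat_real {0..1} x * ((4 - 6 * x) * x)) 0" by simp
qed

lemma weight_moments:
 "integrable lborel (%w. indicat_real unit_square w * weight w)"
 "(LINT w|lborel. indicat_real unit_square w * weight w) = 1"
 "i : Basis ==> integrable lborel (%w. indicat_real unit_square w * (weight w * (w \<bullet> i)))"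
 "i : Basis ==> (LINT w|lborel. indicat_real unit_square w * (weight w * (w \<bullet> i))) = 0"
proof -
 let ?u = "%x. indicat_real {0..1} x * (4 - 6 * x)" and ?v = "%x. indicat_real {0..1} x * ((4 - 6 * x) * x)"
 have u: "integrable lborel ?u" "(LINT x|lborel. ?u x) = 1" and v: "integrable lborel ?v" "(LINT x|lborel. ?v x) = 0"
  using weight_integrals_1D by (auto simp: has_bochner_integral_iff)
 have "(%w. indicat_real unit_square w * weight w) = (%w. ?u (fst w) * ?u (snd w))"
  by (auto simp: fun_eq_iff indicator_unit_square weight_def)
 then show "integrable lborel (%w. indicat_real unit_square w * weight w)"
  "(LINT w|lborel. indicat_real unit_square w * weight w) = 1"
  using lborel_product_integral[OF u(1) u(1)] u(2) by simp_all
 have 1: "(%w. indicat_real unit_square w * (weight w * (w \<bullet> (1, 0)))) = (%w. ?v (fst w) * ?u (snd w))"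
  by (auto simp: fun_eq_iff indicator_unit_square weight_def inner_Pair_0)
 have 2: "(%w. indicat_real unit_square w * (weight w * (w \<bullet> (0, 1)))) = (%w. ?u (fst w) * ?v (snd w))"
  by (auto simp: fun_eq_iff indicator_unit_square weight_def inner_Pair_0)
 assume "i : Basis"
 then have "i = (1, 0) \<or> i = (0, 1)" by (simp add: Basis_point)
 then show "integrable lborel (%w. indicat_real unit_square w * (weight w * (w \<bullet> i)))"
  "(LINT w|lborel. indicat_real unit_square w * (weight w * (w \<bullet> i))) = 0"
  using lborel_product_integral[OF v(1) u(1)] lborel_product_integral[OF u(1) v(1)] u(2) v(2)
  by (auto simp: 1 2)
qed

lemma weight_bound:
 assumes "w : unit_square"
 shows "\<bar>weight w\<bar> <= 16" "i : Basis ==> \<bar>weight w * (w \<bullet> i)\<bar> <= 16"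
proof -
 have "\<bar>4 - 6 * fst w\<bar> <= 4" "\<bar>4 - 6 * snd w\<bar> <= 4" using assms by (auto simp: mem_unit_square)
 then have "\<bar>4 - 6 * fst w\<bar> * \<bar>4 - 6 * snd w\<bar> <= 4 * 4" by (intro mult_mono) auto
 then show w: "\<bar>weight w\<bar> <= 16" by (simp add: weight_def abs_mult)
 assume "i : Basis"
 then have "\<bar>w \<bullet> i\<bar> <= 1" using assms by (cases w) (auto simp: Basis_point mem_unit_square)
 with w have "\<bar>weight w\<bar> * \<bar>w \<bullet> i\<bar> <= 16 * 1" by (intro mult_mono) auto
 then show "\<bar>weight w * (w \<bullet> i)\<bar> <= 16" by (simp add: abs_mult)
qed

lemma nn_integral_unit_square: "(NN w. ennreal (indicat_real unit_square w)) = 1"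
proof -
 have "emeasure lborel unit_square = 1"
  unfolding unit_square_def by (subst emeasure_lborel_cbox_eq) (auto simp: Basis_point)
 then show ?thesis by (simp add: ennreal_indicator)
qed

lemma lborel_nn_integral_affine:
 fixes f :: "'a::euclidean_space => ennreal"
 assumes [measurable]: "f : borel_measurable borel" and c: "c \<noteq> 0"
 shows "(NN x. f x) = ennreal (\<bar>c\<bar> ^ DIM('a)) * (NN x. f (t + c *. x))"
 by (subst lborel_affine[OF c, of t]) (simp add: nn_integral_density nn_integral_distr nn_integral_cmult)

text \<open>The Gagliardo kernel as a function of a Borel function on the whole plane.\<close>

definition slobodeckij_kernel :: "real => (point => 'b::euclidean_space) => point => point => ennreal"
 where "slobodeckij_kernel \<theta> h z w = ennreal (indicat_real \<Omega> z * indicat_real \<Omega> w * ((norm (h z - h w))^2 / dist z w powr (2 + 2 * \<theta>)))"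

definition slobodeckij :: "real => (point => 'b::euclidean_space) => ennreal"
 where "slobodeckij \<theta> h = (NN z. (NN w. slobodeckij_kernel \<theta> h z w))"

lemma slobodeckij_kernel_measurable:
 assumes "h : borel_measurable borel"
 shows "(%(z, w). slobodeckij_kernel \<theta> h z w) : borel_measurable (borel \<Otimes>\<^sub>M borel)"
proof -
 have [measurable]: "h : borel_measurable borel" by fact
 show ?thesis unfolding slobodeckij_kernel_def split_beta' by measurable
qed

lemma gagliardo_eq_slobodeckij:
 assumes h: "h : L2 \<mu>"
 shows "gagliardo \<theta> h = slobodeckij \<theta> (rep h)"
proof -
 note [measurable] = rep(4)[OF h]
 let ?K = "%h z w. ennreal ((norm (h z - h w))^2 / dist z w powr (2 + 2 * \<theta>))"
 have inner: "(\<integral>\<^sup>+w. ?K h z w \<partial>\<mu>) = (NN w. indicator \<Omega> w * ?K (rep h) z w)" if "h z = rep h z" for z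
 proof -
  have "(\<integral>\<^sup>+w. ?K h z w \<partial>\<mu>) = (\<integral>\<^sup>+w. ?K (rep h) z w \<partial>\<mu>)"
   using rep(3)[OF h] by (intro nn_integral_cong_AE) (auto simp: that)
  also have "... = (\<integral>\<^sup>+w. ?K (rep h) z w * indicator \<Omega> w \<partial>lebesgue)"
   by (rule nn_integral_restrict_space) simp
  also have "... = (NN w. ?K (rep h) z w * indicator \<Omega> w)"
   by (rule nn_integral_completion)
  finally show ?thesis by (simp add: mult.commute)
 qed
 have "gagliardo \<theta> h = (\<integral>\<^sup>+z. (NN w. indicator \<Omega> w * ?K (rep h) z w) \<partial>\<mu>)"
  unfolding gagliardo_def using rep(3)[OF h] by (intro nn_integral_cong_AE) (auto intro: inner)
 also have "... = (\<integral>\<^sup>+z. (NN w. indicator \<Omega> w * ?K (rep h) z w) * indicator \<Omega> z \<partial>lebesgue)"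
  by (rule nn_integral_restrict_space) simp
 also have "... = (NN z. (NN w. indicator \<Omega> w * ?K (rep h) z w) * indicator \<Omega> z)"
  by (rule nn_integral_completion)
 also have "... = slobodeckij \<theta> (rep h)"
  unfolding slobodeckij_def slobodeckij_kernel_def
  by (intro nn_integral_cong) (auto simp: indicator_def intro!: nn_integral_cong)
 finally show ?thesis .
qed

lemma slobodeckij_cong:
 assumes "!!z. z : \<Omega> ==> g z = h z"
 shows "slobodeckij \<theta> g = slobodeckij \<theta> h"
proof -
 have "slobodeckij_kernel \<theta> g z w = slobodeckij_kernel \<theta> h z w" for z w
  using assms by (auto simp: slobodeckij_kernel_def indicator_def)
 then show ?thesis by (simp add: slobodeckij_def)
qed

text \<open>Upward averaging does not increase the seminorm, by convexity and translation.\<close>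

lemma slobodeckij_mollify_le:
 fixes h :: "point => 'b::euclidean_space"
 assumes h: "h : L2 lborel"
 shows "slobodeckij \<theta> (mollify (upward_kernel n) h) <= slobodeckij \<theta> h"
proof -
 let ?k = "upward_kernel n" and ?S = "slobodeckij_kernel \<theta>"
 note k [measurable] = averaging_kernelD[OF averaging_upward_kernel[of n]]
 have hm [measurable]: "h : borel_measurable borel" using h by (auto simp: L2_def)
 note Sm [measurable] = slobodeckij_kernel_measurable[OF hm, of \<theta>]
 have point: "?S (mollify ?k h) z w <= (NN e. ennreal (?k e) * ?S h (z + e) (w + e))" for z w
 proof (cases "z : \<Omega> \<and> w : \<Omega>")
  case False
  then show ?thesis by (auto simp: slobodeckij_kernel_def indicator_def)
 next
  case True
  let ?d = "dist z w powr (2 + 2 * \<theta>)"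
  have up: "?k e \<noteq> 0 ==> z + e : \<Omega> \<and> w + e : \<Omega>" for e
  proof -
   assume "?k e \<noteq> 0"
   from upward_kernel_support(1)[OF this] have "snd e > 1 / real (Suc n)" .
   moreover have "0 < 1 / real (Suc n)" by simp
   ultimately have "snd e > 0" by linarith
   then show ?thesis using True by (simp add: mem_half_plane)
  qed
  have "mollify ?k h z - mollify ?k h w = (LINT e|lborel. ?k e *. (h (z + e) - h (w + e)))"
   using mollify_shift[OF k(1) h] by (simp add: scaleR_diff_right)
  then have "ennreal ((norm (mollify ?k h z - mollify ?k h w))^2) <= (NN e. ennreal (?k e) * ennreal ((norm (h (z + e) - h (w + e)))^2))"
   by (simp only:) (intro average_square_le k, measurable)
  then have "ennreal (1 / ?d) * ennreal ((norm (mollify ?k h z - mollify ?k h w))^2) <= ennreal (1 / ?d) * (NN e. ennreal (?k e) * ennreal ((norm (h (z + e) - h (w + e)))^2))"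
   by (rule mult_left_mono) simp
  also have "... = (NN e. ennreal (1 / ?d) * (ennreal (?k e) * ennreal ((norm (h (z + e) - h (w + e)))^2)))"
   by (rule nn_integral_cmult[symmetric]) measurable
  also have "... = (NN e. ennreal (?k e) * ?S h (z + e) (w + e))"
  proof (intro nn_integral_cong)
   fix e
   show "ennreal (1 / ?d) * (ennreal (?k e) * ennreal ((norm (h (z + e) - h (w + e)))^2)) = ennreal (?k e) * ?S h (z + e) (w + e)"
   proof (cases "?k e = 0")
    case False
    from up[OF this] show ?thesis
     using k(2)[of e] by (simp add: slobodeckij_kernel_def dist_norm ennreal_mult'[symmetric] mult_ac)
   qed simp
  qed
  finally show ?thesis using True by (simp add: slobodeckij_kernel_def ennreal_mult'[symmetric])
 qed
 have "slobodeckij \<theta> (mollify ?k h) <= (NN z. (NN w. (NN e. ennreal (?k e) * ?S h (z + e) (w + e))))"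
  unfolding slobodeckij_def by (intro nn_integral_mono point)
 also have "... = (NN z. (NN e. (NN w. ennreal (?k e) * ?S h (z + e) (w + e))))"
  by (intro nn_integral_cong lborel_pair.Fubini') measurable
 also have "... = (NN e. (NN z. (NN w. ennreal (?k e) * ?S h (z + e) (w + e))))"
  by (rule lborel_pair.Fubini') measurable
 also have "... = (NN e. ennreal (?k e) * slobodeckij \<theta> h)"
 proof (intro nn_integral_cong)
  fix e
  have m1: "(%w. ?S h z w) : borel_measurable borel" for z by measurable
  have m2: "(%z. NN w. ?S h z w) : borel_measurable borel" by measurable
  have "(NN z. (NN w. ennreal (?k e) * ?S h (z + e) (w + e)))
    = (NN z. ennreal (?k e) * (NN w. ?S h (z + e) w))"
  proof (intro nn_integral_cong)
   fix z
   have "(NN w. ennreal (?k e) * ?S h (z + e) (w + e)) = ennreal (?k e) * (NN w. ?S h (z + e) (w + e))"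
    by (rule nn_integral_cmult) measurable
   then show "(NN w. ennreal (?k e) * ?S h (z + e) (w + e)) = ennreal (?k e) * (NN w. ?S h (z + e) w)"
    by (simp only: lborel_nn_integral_translate[OF m1])
  qed
  also have "... = ennreal (?k e) * (NN z. (NN w. ?S h (z + e) w))"
   by (rule nn_integral_cmult) measurable
  also have "(NN z. (NN w. ?S h (z + e) w)) = slobodeckij \<theta> h"
   unfolding slobodeckij_def by (rule lborel_nn_integral_translate[OF m2])
  finally show "(NN z. (NN w. ennreal (?k e) * ?S h (z + e) (w + e))) = ennreal (?k e) * slobodeckij \<theta> h" .
 qed
 also have "... = slobodeckij \<theta> h" by (simp add: nn_integral_multc k(3))
 finally show ?thesis .
qed

lemma AE_snd_nonzero: "AE w :: point in lborel. snd w \<noteq> 0"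
proof -
 have "negligible {w :: point. (0, 1) \<bullet> w = 0}" by (rule negligible_hyperplane) (simp add: zero_prod_def)
 then have "{w :: point. (0, 1) \<bullet> w = 0} : null_sets lebesgue" by (simp add: negligible_iff_null_sets)
 then have "AE w :: point in lebesgue. w \<notin> {w. (0, 1) \<bullet> w = 0}" by (rule AE_not_in)
 then have "AE w :: point in lborel. w \<notin> {w. (0, 1) \<bullet> w = 0}" by (simp add: AE_completion_iff)
 then show ?thesis by eventually_elim (auto simp: inner_prod_def)
qed

text \<open>
 On a square of side \<open>r\<close> the Gagliardo kernel is at least a multiple of \<open>r\<^sup>-\<^sup>2\<^sup>-\<^sup>2\<^sup>\<theta>\<close>, and passing from the unit
 square to the square of side \<open>r\<close> in both variables costs a factor \<open>r\<^sup>-\<^sup>4\<close>.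
\<close>

lemma oscillation_square_le:
 fixes h :: "point => 'b::euclidean_space"
 assumes hm [measurable]: "h : borel_measurable borel" and z: "z : closure \<Omega>" and r: "0 < r" and \<theta>: "0 < \<theta>" "\<theta> < 1"
 shows "(NN w. indicator unit_square w * (NN w'. indicator unit_square w' * ennreal ((norm (h (z + r *. w) - h (z + r *. w')))^2)))
  <= ennreal (4 * r powr (2 * \<theta> - 2)) * slobodeckij \<theta> h"
proof -
 let ?S = "slobodeckij_kernel \<theta> h" and ?p = "2 + 2 * \<theta>"
 note Sm [measurable] = slobodeckij_kernel_measurable[OF hm, of \<theta>]
 note pos = AE_snd_nonzero
 have point: "ennreal ((norm (h (z + r *. w) - h (z + r *. w')))^2) <= ennreal (4 * r powr ?p) * ?S (z + r *. w) (z + r *. w')"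
  if w: "w : unit_square" "w' : unit_square" "snd w \<noteq> 0" "snd w' \<noteq> 0" for w w'
 proof (cases "w = w'")
  case True then show ?thesis by simp
 next
  case False
  let ?d = "dist (z + r *. w) (z + r *. w')"
  have "z + r *. w : \<Omega>" "z + r *. w' : \<Omega>"
   using w z r by (auto simp: mem_half_plane mem_closure_half_plane mem_unit_square intro!: add_nonneg_pos mult_pos_pos)
  then have S: "?S (z + r *. w) (z + r *. w') = ennreal ((norm (h (z + r *. w) - h (z + r *. w')))^2 / ?d powr ?p)"
   by (simp add: slobodeckij_kernel_def)
  have d: "?d = r * norm (w - w')" using r by (simp add: dist_norm scaleR_diff_right[symmetric])
  have d0: "?d > 0" using d r False by simp
  have "norm (w - w') <= sqrt 2"
  proof -
   have "\<bar>fst w - fst w'\<bar> <= 1" "\<bar>snd w - snd w'\<bar> <= 1" using w by (auto simp: mem_unit_square)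
   then have "(fst w - fst w')^2 <= 1" "(snd w - snd w')^2 <= 1" by (simp_all add: abs_square_le_1)
   then show ?thesis by (simp add: norm_prod_def)
  qed
  then have "?d <= r * sqrt 2" unfolding d using r by (intro mult_left_mono) auto
  then have "?d powr ?p <= (r * sqrt 2) powr ?p" using d0 \<theta> by (intro powr_mono2) auto
  also have "... = r powr ?p * sqrt 2 powr ?p" using r by (simp add: powr_mult)
  also have "sqrt 2 powr ?p <= sqrt 2 powr 4" using \<theta> by (intro powr_mono) auto
  also have "sqrt 2 powr 4 = (4::real)" by (simp add: powr_numeral power4_eq_xxxx)
  finally have "?d powr ?p <= 4 * r powr ?p" using r by (simp add: mult_left_mono mult.commute)
  then have "1 <= 4 * r powr ?p / ?d powr ?p" using d0 by simp
  then have "(norm (h (z + r *. w) - h (z + r *. w')))^2 * 1 <= (norm (h (z + r *. w) - h (z + r *. w')))^2 * (4 * r powr ?p / ?d powr ?p)"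
   by (intro mult_left_mono) auto
  then have "ennreal ((norm (h (z + r *. w) - h (z + r *. w')))^2) <= ennreal ((4 * r powr ?p) * ((norm (h (z + r *. w) - h (z + r *. w')))^2 / ?d powr ?p))"
   by (intro ennreal_leI) (simp add: mult_ac)
  also have "... = ennreal (4 * r powr ?p) * ?S (z + r *. w) (z + r *. w')" unfolding S by (rule ennreal_mult) auto
  finally show ?thesis .
 qed
 have "(NN w. indicator unit_square w * (NN w'. indicator unit_square w' * ennreal ((norm (h (z + r *. w) - h (z + r *. w')))^2)))
   <= (NN w. (NN w'. ennreal (4 * r powr ?p) * ?S (z + r *. w) (z + r *. w')))"
 proof (rule nn_integral_mono_AE)
  show "AE w in lborel. indicator unit_square w * (NN w'. indicator unit_square w' * ennreal ((norm (h (z + r *. w) - h (z + r *. w')))^2))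
    <= (NN w'. ennreal (4 * r powr ?p) * ?S (z + r *. w) (z + r *. w'))"
   using pos
  proof eventually_elim
   case (elim w)
   show ?case
   proof (cases "w : unit_square")
    case True
    have "(NN w'. indicator unit_square w' * ennreal ((norm (h (z + r *. w) - h (z + r *. w')))^2))
      <= (NN w'. ennreal (4 * r powr ?p) * ?S (z + r *. w) (z + r *. w'))"
    proof (rule nn_integral_mono_AE)
     show "AE w' in lborel. indicator unit_square w' * ennreal ((norm (h (z + r *. w) - h (z + r *. w')))^2) <= ennreal (4 * r powr ?p) * ?S (z + r *. w) (z + r *. w')"
      using pos
     proof eventually_elim
      case e: (elim w')
      then show ?case using point[OF True _ elim, of w'] by (cases "w' : unit_square") auto
     qed
    qed
    with True show ?thesis by simp
   qed simp
  qed
 qed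
 also have "... = ennreal (4 * r powr ?p) * (NN w. (NN w'. ?S (z + r *. w) (z + r *. w')))"
  by (simp add: nn_integral_cmult)
 also have "(NN w. (NN w'. ?S (z + r *. w) (z + r *. w'))) = ennreal (1 / r ^ 4) * slobodeckij \<theta> h"
 proof -
  have inv: "X = ennreal (1 / r\<^sup>2) * Y" if "Y = ennreal (\<bar>r\<bar> ^ DIM(point)) * X" for X Y
  proof -
   have "ennreal (1 / r\<^sup>2) * Y = (ennreal (1 / r\<^sup>2) * ennreal (r\<^sup>2)) * X" using that r by (simp add: mult.assoc power2_eq_square)
   also have "ennreal (1 / r\<^sup>2) * ennreal (r\<^sup>2) = 1" using r by (simp add: ennreal_mult[symmetric])
   finally show ?thesis by simp
  qed
  have m1: "(%w. ?S y w) : borel_measurable borel" for y by measurable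
  have m2: "(%y. NN w. ?S y w) : borel_measurable borel" by measurable
  have 1: "(NN w'. ?S y (z + r *. w')) = ennreal (1 / r\<^sup>2) * (NN w'. ?S y w')" for y
   by (rule inv, rule lborel_nn_integral_affine[OF m1]) (use r in simp)
  have 2: "(NN w. (NN w'. ?S (z + r *. w) w')) = ennreal (1 / r\<^sup>2) * slobodeckij \<theta> h"
   unfolding slobodeckij_def by (rule inv, rule lborel_nn_integral_affine[OF m2]) (use r in simp)
  have "(NN w. (NN w'. ?S (z + r *. w) (z + r *. w'))) = ennreal (1 / r\<^sup>2) * (ennreal (1 / r\<^sup>2) * slobodeckij \<theta> h)"
   unfolding 1 2[symmetric] by (rule nn_integral_cmult) measurable
  also have "... = ennreal (1 / r ^ 4) * slobodeckij \<theta> h"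
   using r by (simp add: mult.assoc[symmetric] ennreal_mult[symmetric] power_add[symmetric])
  finally show ?thesis .
 qed
 also have "ennreal (4 * r powr ?p) * (ennreal (1 / r ^ 4) * slobodeckij \<theta> h) = ennreal (4 * r powr (2 * \<theta> - 2)) * slobodeckij \<theta> h"
 proof -
  have "r ^ 4 = r powr 4" using r by (simp add: powr_numeral)
  then have "r powr ?p * (1 / r ^ 4) = r powr (?p - 4)" by (simp add: powr_diff[symmetric])
  then have e: "(4 * r powr ?p) * (1 / r ^ 4) = 4 * r powr (2 * \<theta> - 2)" by simp
  have "ennreal (4 * r powr ?p) * (ennreal (1 / r ^ 4) * slobodeckij \<theta> h) = (ennreal (4 * r powr ?p) * ennreal (1 / r ^ 4)) * slobodeckij \<theta> h"
   by (simp only: mult.assoc)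
  also have "ennreal (4 * r powr ?p) * ennreal (1 / r ^ 4) = ennreal ((4 * r powr ?p) * (1 / r ^ 4))"
   using r by (intro ennreal_mult[symmetric]) auto
  finally show ?thesis unfolding e .
 qed
 finally show ?thesis .
qed

lemma unit_square_integral:
 fixes F :: "point => 'b::euclidean_space"
 assumes "continuous_on UNIV F"
 shows "integrable lborel (%w. indicat_real unit_square w *. F w)"
  "(LINT w|lborel. indicat_real unit_square w *. F w) = integral (cbox (0, 0) (1, 1)) F"
proof -
 show i: "integrable lborel (%w. indicat_real unit_square w *. F w)"
  unfolding unit_square_def by (rule borel_integrable_compact) (auto intro: continuous_on_subset[OF assms])
 then have "set_integrable lborel (cbox (0, 0) (1, 1)) F" by (simp add: set_integrable_def unit_square_def)
 from set_borel_integral_eq_integral(2)[OF this]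
 show "(LINT w|lborel. indicat_real unit_square w *. F w) = integral (cbox (0, 0) (1, 1)) F"
  by (simp add: set_lebesgue_integral_def unit_square_def)
qed

lemma unit_square_average_square_le:
 fixes F :: "point => 'b::euclidean_space"
 assumes [measurable]: "F : borel_measurable borel"
 shows "ennreal ((norm (LINT w|lborel. indicat_real unit_square w *. F w))^2)
  <= (NN w. indicator unit_square w * ennreal ((norm (F w))^2))"
 using average_square_le[of "indicat_real unit_square" F] nn_integral_unit_square
 by (simp add: ennreal_indicator)

text \<open>
 A weighted average of the gradient at scale \<open>r\<close> is controlled by its oscillation, because the
 first moments of the weight vanish.
\<close>

lemma weighted_average_bound:
 fixes h :: "point => 'b::euclidean_space"
 assumes hc: "continuous_on UNIV h" and z: "z : closure \<Omega>" and r: "0 < r" and \<theta>: "0 < \<theta>" "\<theta> < 1" and i: "i : Basis"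
  and N: "slobodeckij \<theta> h <= ennreal (N\<^sup>2)" "0 <= N"
 shows "norm (LINT w|lborel. indicat_real unit_square w *. ((weight w * (w \<bullet> i)) *. h (z + r *. w))) <= 32 * r powr (\<theta> - 1) * N"
proof -
 let ?Q = unit_square
 have [measurable]: "h : borel_measurable borel" by (rule borel_measurable_continuous_onI[OF hc])
 have hr: "continuous_on UNIV (%w. h (z + r *. w))"
  by (rule continuous_on_compose2[OF hc]) (auto intro!: continuous_intros)
 have wc: "continuous_on UNIV weight" unfolding weight_def by (intro continuous_intros)
 have [measurable]: "weight : borel_measurable borel" by (rule borel_measurable_continuous_onI[OF wc])
 define c where "c = (LINT w|lborel. indicat_real ?Q w *. h (z + r *. w))"
 have int0: "integrable lborel (%w. indicat_real ?Q w *. ((weight w * (w \<bullet> i)) *. h (z + r *. w)))"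
  by (rule unit_square_integral) (intro continuous_intros wc hr)
 have "(LINT w|lborel. indicat_real ?Q w *. ((weight w * (w \<bullet> i)) *. h (z + r *. w)))
   = (LINT w|lborel. indicat_real ?Q w *. ((weight w * (w \<bullet> i)) *. h (z + r *. w))) - (LINT w|lborel. indicat_real ?Q w * (weight w * (w \<bullet> i))) *. c"
  using weight_moments(4)[OF i] by simp
 also have "... = (LINT w|lborel. indicat_real ?Q w *. ((weight w * (w \<bullet> i)) *. h (z + r *. w))) - (LINT w|lborel. (indicat_real ?Q w * (weight w * (w \<bullet> i))) *. c)"
  using weight_moments(3)[OF i] by simp
 also have "... = (LINT w|lborel. indicat_real ?Q w *. ((weight w * (w \<bullet> i)) *. h (z + r *. w)) - (indicat_real ?Q w * (weight w * (w \<bullet> i))) *. c)"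
  by (rule Bochner_Integration.integral_diff[symmetric, OF int0 integrable_scaleR_left[OF weight_moments(3)[OF i]]])
 also have "... = (LINT w|lborel. indicat_real ?Q w *. ((weight w * (w \<bullet> i)) *. (h (z + r *. w) - c)))"
  by (simp add: scaleR_diff_right)
 finally have eq: "(LINT w|lborel. indicat_real ?Q w *. ((weight w * (w \<bullet> i)) *. h (z + r *. w)))
   = (LINT w|lborel. indicat_real ?Q w *. ((weight w * (w \<bullet> i)) *. (h (z + r *. w) - c)))" .
 have osc: "ennreal ((norm (h (z + r *. w) - c))^2) <= (NN w'. indicator ?Q w' * ennreal ((norm (h (z + r *. w) - h (z + r *. w')))^2))" for w
 proof -
  have one: "integrable lborel (indicat_real ?Q)" "(LINT w|lborel. indicat_real ?Q w) = 1"
  proof -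
   show "integrable lborel (indicat_real ?Q)" using unit_square_integral(1)[of "%w. 1::real"] by simp
   have "emeasure lborel ?Q = 1" using nn_integral_unit_square by (simp add: ennreal_indicator)
   then show "(LINT w|lborel. indicat_real ?Q w) = 1" by (simp add: measure_def)
  qed
  have "h (z + r *. w) - c = (LINT w'|lborel. indicat_real ?Q w' *. (h (z + r *. w) - h (z + r *. w')))"
   using unit_square_integral(1)[OF hr] one by (simp add: scaleR_diff_right c_def)
  then show ?thesis using unit_square_average_square_le[of "%w'. h (z + r *. w) - h (z + r *. w')"] by simp
 qed
 have "ennreal ((norm (LINT w|lborel. indicat_real ?Q w *. ((weight w * (w \<bullet> i)) *. (h (z + r *. w) - c))))^2)
   <= (NN w. indicator ?Q w * ennreal ((norm ((weight w * (w \<bullet> i)) *. (h (z + r *. w) - c)))^2))"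
  by (rule unit_square_average_square_le) measurable
 also have "... <= (NN w. ennreal 256 * (indicator ?Q w * (NN w'. indicator ?Q w' * ennreal ((norm (h (z + r *. w) - h (z + r *. w')))^2))))"
 proof (rule nn_integral_mono)
  fix w
  show "indicator ?Q w * ennreal ((norm ((weight w * (w \<bullet> i)) *. (h (z + r *. w) - c)))^2)
   <= ennreal 256 * (indicator ?Q w * (NN w'. indicator ?Q w' * ennreal ((norm (h (z + r *. w) - h (z + r *. w')))^2)))"
  proof (cases "w : ?Q")
   case True
   have "\<bar>weight w * (w \<bullet> i)\<bar>\<^sup>2 <= 16\<^sup>2" using weight_bound(2)[OF True i] by (intro power_mono) auto
   then have "(norm ((weight w * (w \<bullet> i)) *. (h (z + r *. w) - c)))^2 <= 256 * (norm (h (z + r *. w) - c))^2"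
    unfolding norm_scaleR power_mult_distrib real_norm_def by (intro mult_right_mono) auto
   then have "ennreal ((norm ((weight w * (w \<bullet> i)) *. (h (z + r *. w) - c)))^2) <= ennreal (256 * (norm (h (z + r *. w) - c))^2)"
    by (rule ennreal_leI)
   also have "... = ennreal 256 * ennreal ((norm (h (z + r *. w) - c))^2)" by (rule ennreal_mult) auto
   also have "... <= ennreal 256 * (NN w'. indicator ?Q w' * ennreal ((norm (h (z + r *. w) - h (z + r *. w')))^2))"
    by (rule mult_left_mono[OF osc]) simp
   finally show ?thesis using True by simp
  qed simp
 qed
 also have "... = ennreal 256 * (NN w. indicator ?Q w * (NN w'. indicator ?Q w' * ennreal ((norm (h (z + r *. w) - h (z + r *. w')))^2)))"
  by (rule nn_integral_cmult) measurable
 also have "... <= ennreal 256 * (ennreal (4 * r powr (2 * \<theta> - 2)) * ennreal (N\<^sup>2))"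
 proof (rule mult_left_mono)
  have "(NN w. indicator ?Q w * (NN w'. indicator ?Q w' * ennreal ((norm (h (z + r *. w) - h (z + r *. w')))^2)))
    <= ennreal (4 * r powr (2 * \<theta> - 2)) * slobodeckij \<theta> h"
   by (rule oscillation_square_le[OF _ z r \<theta>]) measurable
  also have "... <= ennreal (4 * r powr (2 * \<theta> - 2)) * ennreal (N\<^sup>2)" by (rule mult_left_mono[OF N(1)]) simp
  finally show "(NN w. indicator ?Q w * (NN w'. indicator ?Q w' * ennreal ((norm (h (z + r *. w) - h (z + r *. w')))^2)))
    <= ennreal (4 * r powr (2 * \<theta> - 2)) * ennreal (N\<^sup>2)" .
 qed simp
 also have "... = ennreal ((32 * r powr (\<theta> - 1) * N)^2)"
 proof -
  have "(r powr (\<theta> - 1))^2 = r powr (2 * \<theta> - 2)"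
   by (simp add: power2_eq_square powr_add[symmetric])
  then have "(32 * r powr (\<theta> - 1) * N)^2 = 256 * ((4 * r powr (2 * \<theta> - 2)) * N\<^sup>2)"
   by (simp add: power_mult_distrib)
  also have "ennreal ... = ennreal 256 * (ennreal (4 * r powr (2 * \<theta> - 2)) * ennreal (N\<^sup>2))"
   by (subst ennreal_mult, simp, simp, subst ennreal_mult, simp_all)
  finally show ?thesis by simp
 qed
 finally have "ennreal ((norm (LINT w|lborel. indicat_real ?Q w *. ((weight w * (w \<bullet> i)) *. (h (z + r *. w) - c))))^2) <= ennreal ((32 * r powr (\<theta> - 1) * N)^2)" .
 then have "(norm (LINT w|lborel. indicat_real ?Q w *. ((weight w * (w \<bullet> i)) *. (h (z + r *. w) - c))))^2 <= (32 * r powr (\<theta> - 1) * N)^2"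
  by simp
 then show ?thesis unfolding eq by (rule power2_le_imp_le) (use N(2) in simp)
qed

text \<open>
 The weighted averages at scale \<open>r\<close> interpolate between the value at the point (\<open>r = 0\<close>) and an
 average over the unit square (\<open>r = 1\<close>). Their derivative in \<open>r\<close> is \<open>O(r\<^sup>\<theta>\<^sup>-\<^sup>1)\<close>, which is integrable.
\<close>

lemma sup_bound_fractional:
 fixes g :: "point => 'b::euclidean_space"
 assumes sm: "smooth g" and z: "z : closure \<Omega>" and \<theta>: "0 < \<theta>" "\<theta> < 1"
  and L: "g : L2 \<mu>" "nrm g <= N"
  and S: "!!i. i : Basis ==> slobodeckij \<theta> (partial i g) <= ennreal (N\<^sup>2)"
 shows "norm (g z) <= (16 + 64 / \<theta>) * N"
proof -
 let ?Q = unit_square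
 have N: "0 <= N" using L(2) L2_norm_nonneg order_trans by blast
 have gc: "continuous_on UNIV g" by (rule smooth_continuous[OF sm])
 have pc: "continuous_on UNIV (partial i g)" if "i : Basis" for i by (rule smooth_continuous[OF smooth_partial[OF sm that]])
 have wc: "continuous_on UNIV weight" unfolding weight_def by (intro continuous_intros)
 define A where "A r = integral (cbox (0, 0) (1, 1)) (%w. weight w *. g (z + r *. w))" for r
 define V where "V r = integral (cbox (0, 0) (1, 1)) (%w. weight w *. (\<Sum>i\<in>Basis. (w \<bullet> i) *. partial i g (z + r *. w)))" for r
 have gr: "continuous_on UNIV (%w. g (z + r *. w))" for r
  by (rule continuous_on_compose2[OF gc]) (auto intro!: continuous_intros)
 have pr: "continuous_on UNIV (%w. partial i g (z + r *. w))" if "i : Basis" for i r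
  by (rule continuous_on_compose2[OF pc[OF that]]) (auto intro!: continuous_intros)
 have A_L: "A r = (LINT w|lborel. indicat_real ?Q w *. (weight w *. g (z + r *. w)))" for r
  unfolding A_def by (rule unit_square_integral(2)[symmetric]) (intro continuous_intros wc gr)
 have V_L: "V r = (\<Sum>i\<in>Basis. (LINT w|lborel. indicat_real ?Q w *. ((weight w * (w \<bullet> i)) *. partial i g (z + r *. w))))" for r
 proof -
  have "V r = (LINT w|lborel. indicat_real ?Q w *. (weight w *. (\<Sum>i\<in>Basis. (w \<bullet> i) *. partial i g (z + r *. w))))"
   unfolding V_def by (rule unit_square_integral(2)[symmetric]) (intro continuous_intros wc pr)
  also have "... = (LINT w|lborel. (\<Sum>i\<in>Basis. indicat_real ?Q w *. ((weight w * (w \<bullet> i)) *. partial i g (z + r *. w))))"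
   by (simp only: scaleR_sum_right scaleR_scaleR)
  also have "... = (\<Sum>i\<in>Basis. (LINT w|lborel. indicat_real ?Q w *. ((weight w * (w \<bullet> i)) *. partial i g (z + r *. w))))"
   by (rule Bochner_Integration.integral_sum) (intro unit_square_integral(1) continuous_intros wc pr)
  finally show ?thesis .
 qed
 have der: "(A has_vector_derivative V r) (at r)" for r
  unfolding A_def V_def
 proof (rule leibniz_rule_vector_derivative[where U=UNIV, simplified])
  fix r :: real and w :: point
  have g': "(g has_derivative frechet_derivative g (at (z + r *. w))) (at (z + r *. w))"
   by (rule smooth_has_derivative[OF sm])
  have l: "((%r. z + r *. w) has_derivative (%s. s *. w)) (at r)" by (auto intro!: derivative_eq_intros)
  have "((%r. g (z + r *. w)) has_vector_derivative frechet_derivative g (at (z + r *. w)) w) (at r)"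
   using has_derivative_compose[OF l g'] has_derivative_linear[OF g']
   by (simp add: has_vector_derivative_def linear_cmul)
  then have "((%r. g (z + r *. w)) has_vector_derivative (\<Sum>i\<in>Basis. (w \<bullet> i) *. partial i g (z + r *. w))) (at r)"
   by (simp only: frechet_derivative_partial[OF smooth_differentiable[OF sm]])
  from has_vector_derivative_scaleR[OF DERIV_const[of "weight w"] this]
  show "((%r. weight w *. g (z + r *. w)) has_vector_derivative weight w *. (\<Sum>i\<in>Basis. (w \<bullet> i) *. partial i g (z + r *. w))) (at r)"
   by simp
 next
  show "(%w. weight w *. g (z + r *. w)) integrable_on cbox (0, 0) (1, 1)" for r
  proof (rule integrable_continuous)
   have "continuous_on UNIV (%w. weight w *. g (z + r *. w))" by (intro continuous_intros wc gr)
   then show "continuous_on (cbox (0, 0) (1, 1)) (%w. weight w *. g (z + r *. w))"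
    by (rule continuous_on_subset) simp
  qed
 next
  have w2: "continuous_on (UNIV \<times> cbox (0, 0) (1, 1)) (%x::real \<times> point. weight (snd x))"
   by (rule continuous_on_compose2[OF wc]) (auto intro!: continuous_intros)
  have p2: "continuous_on (UNIV \<times> cbox (0, 0) (1, 1)) (%x::real \<times> point. partial i g (z + fst x *. snd x))" if "i : Basis" for i
   by (rule continuous_on_compose2[OF pc[OF that]]) (auto intro!: continuous_intros)
  show "continuous_on (UNIV \<times> cbox (0, 0) (1, 1)) (%(r, w). weight w *. (\<Sum>i\<in>Basis. (w \<bullet> i) *. partial i g (z + r *. w)))"
   unfolding split_beta' by (intro continuous_intros w2 p2)
 qed
 have V_bound: "norm (V r) <= 64 * N * r powr (\<theta> - 1)" if r: "0 < r" for r
 proof -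
  have "norm (V r) <= (\<Sum>i\<in>(Basis::point set). 32 * r powr (\<theta> - 1) * N)"
   unfolding V_L
   by (rule order_trans[OF norm_sum sum_mono]) (intro weighted_average_bound pc z r \<theta> S N, auto)
  then show ?thesis by (simp add: mult_ac)
 qed
 have "norm (A 1 - A 0) <= 64 * N / \<theta> * 1 powr \<theta> - 64 * N / \<theta> * 0 powr \<theta>"
 proof (rule differentiable_bound_general[of 0 1 A "%r. 64 * N / \<theta> * r powr \<theta>" V "%r. 64 * N * r powr (\<theta> - 1)"])
  show "continuous_on {0..1} A"
   using der by (intro continuous_at_imp_continuous_on ballI has_vector_derivative_continuous) auto
  show "continuous_on {0..1} (%r. 64 * N / \<theta> * r powr \<theta>)"
   using \<theta> by (intro continuous_on_mult_left continuous_on_powr' continuous_intros) auto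
  show "((%r. 64 * N / \<theta> * r powr \<theta>) has_vector_derivative 64 * N * r powr (\<theta> - 1)) (at r)" if "0 < r" "r < 1" for r
   using that \<theta> by (auto intro!: derivative_eq_intros simp: has_real_derivative_iff_has_vector_derivative[symmetric])
 qed (use der V_bound in auto)
 then have diff: "norm (A 1 - A 0) <= 64 / \<theta> * N" using \<theta> by (simp add: mult.commute)
 have A0: "A 0 = g z"
 proof -
  have "A 0 = (LINT w|lborel. (indicat_real ?Q w * weight w) *. g z)" unfolding A_L by simp
  also have "... = (LINT w|lborel. indicat_real ?Q w * weight w) *. g z"
   by (rule integral_scaleR_left) (use weight_moments(1) in simp)
  finally show ?thesis using weight_moments(2) by simp
 qed
 have A1: "norm (A 1) <= 16 * N"
 proof -
  have [measurable]: "weight : borel_measurable borel" "g : borel_measurable borel"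
   by (rule borel_measurable_continuous_onI[OF wc], rule borel_measurable_continuous_onI[OF gc])
  have m: "(%w. indicator \<Omega> w * ennreal ((norm (g w))^2)) : borel_measurable borel" by measurable
  note pos = AE_snd_nonzero
  have "ennreal ((norm (A 1))^2) <= (NN w. indicator ?Q w * ennreal ((norm (weight w *. g (z + 1 *. w)))^2))"
   unfolding A_L by (rule unit_square_average_square_le) measurable
  also have "... <= (NN w. ennreal 256 * (indicator \<Omega> (w + z) * ennreal ((norm (g (w + z)))^2)))"
  proof (rule nn_integral_mono_AE)
   show "AE w in lborel. indicator ?Q w * ennreal ((norm (weight w *. g (z + 1 *. w)))^2) <= ennreal 256 * (indicator \<Omega> (w + z) * ennreal ((norm (g (w + z)))^2))"
    using pos
   proof eventually_elim
    case (elim w)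
    show ?case
    proof (cases "w : ?Q")
     case True
     then have O: "w + z : \<Omega>" using elim z by (auto simp: mem_half_plane mem_closure_half_plane mem_unit_square)
     have "\<bar>weight w\<bar>\<^sup>2 <= 16\<^sup>2" using weight_bound(1)[OF True] by (intro power_mono) auto
     then have "(norm (weight w *. g (w + z)))^2 <= 256 * (norm (g (w + z)))^2"
      unfolding norm_scaleR power_mult_distrib real_norm_def by (intro mult_right_mono) auto
     then have "ennreal ((norm (weight w *. g (w + z)))^2) <= ennreal (256 * (norm (g (w + z)))^2)" by (rule ennreal_leI)
     also have "... = ennreal 256 * ennreal ((norm (g (w + z)))^2)" by (rule ennreal_mult) auto
     finally show ?thesis using True O by (simp add: add.commute)
    qed simp
   qed
  qed
  also have "... = ennreal 256 * (NN w. indicator \<Omega> (w + z) * ennreal ((norm (g (w + z)))^2))"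
   by (rule nn_integral_cmult) measurable
  also have "... = ennreal 256 * ennreal ((nrm g)^2)"
   by (simp only: lborel_nn_integral_translate[OF m] nn_integral_half_plane_sq[OF L(1) smooth_measurable[OF sm]])
  also have "... = ennreal ((16 * nrm g)^2)"
   by (subst ennreal_mult[symmetric]) (auto simp: power_mult_distrib)
  finally have "(norm (A 1))^2 <= (16 * nrm g)^2" by simp
  then have "norm (A 1) <= 16 * nrm g" by (rule power2_le_imp_le) simp
  then show ?thesis using L(2) by linarith
 qed
 have "norm (g z) <= norm (A 1) + norm (A 1 - A 0)"
  using norm_triangle_ineq4[of "A 1" "A 1 - A 0"] by (simp add: A0)
 with A1 diff show ?thesis by (simp add: distrib_right)
qed

subsection \<open>The gradient bound\<close>

lemma finite_multi_indices: "finite (multi_indices k)"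
 unfolding multi_indices_def by (rule finite_lists_length_eq) simp

lemma Hs_weak_deriv:
 assumes f: "f : Hs s" and k: "k <= nat \<lfloor>s\<rfloor>" and ds: "ds : multi_indices k"
 shows "has_weak_deriv ds f (weak_deriv ds f)" "weak_deriv ds f : L2 \<mu>"
  "nrm (weak_deriv ds f) <= Hs_norm s f"
proof -
 show 1: "has_weak_deriv ds f (weak_deriv ds f)" using f k ds weak_deriv_works unfolding Hs_def by blast
 then show "weak_deriv ds f : L2 \<mu>" by (simp add: has_weak_deriv_def)
 let ?n = "%ds. (nrm (weak_deriv ds f))^2"
 have "?n ds <= (\<Sum>ds\<in>multi_indices k. ?n ds)" by (rule member_le_sum[OF ds]) (auto simp: finite_multi_indices)
 also have "... <= (\<Sum>k\<le>nat \<lfloor>s\<rfloor>. \<Sum>ds\<in>multi_indices k. ?n ds)"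
  using k by (intro member_le_sum[of k "{..nat \<lfloor>s\<rfloor>}" "%k. \<Sum>ds\<in>multi_indices k. ?n ds"]) (auto intro!: sum_nonneg)
 finally have "?n ds <= (\<Sum>k\<le>nat \<lfloor>s\<rfloor>. \<Sum>ds\<in>multi_indices k. ?n ds) +
  (if frac s > 0 then \<Sum>ds \<in> multi_indices (nat \<lfloor>s\<rfloor>). enn2real (gagliardo (frac s) (weak_deriv ds f)) else 0)"
  by (rule order_trans) (auto intro!: sum_nonneg)
 then show "nrm (weak_deriv ds f) <= Hs_norm s f"
  unfolding Hs_norm_def by (rule real_le_rsqrt)
qed

lemma Hs_gagliardo:
 assumes f: "f : Hs s" and s: "frac s > 0" and ds: "ds : multi_indices (nat \<lfloor>s\<rfloor>)"
 shows "gagliardo (frac s) (weak_deriv ds f) <= ennreal ((Hs_norm s f)^2)"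
proof -
 let ?g = "%ds. enn2real (gagliardo (frac s) (weak_deriv ds f))"
 have fin: "gagliardo (frac s) (weak_deriv ds f) < \<infinity>" using f s ds by (auto simp: Hs_def)
 have "?g ds <= (\<Sum>ds\<in>multi_indices (nat \<lfloor>s\<rfloor>). ?g ds)" by (rule member_le_sum[OF ds]) (auto simp: finite_multi_indices)
 also have "... <= (\<Sum>k\<le>nat \<lfloor>s\<rfloor>. \<Sum>ds\<in>multi_indices k. (nrm (weak_deriv ds f))^2) + (\<Sum>ds\<in>multi_indices (nat \<lfloor>s\<rfloor>). ?g ds)"
  by (simp add: sum_nonneg)
 also have "... = (Hs_norm s f)^2"
  unfolding Hs_norm_def using s by (simp add: sum_nonneg add_nonneg_nonneg)
 finally have "ennreal (?g ds) <= ennreal ((Hs_norm s f)^2)" by (rule ennreal_leI)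
 moreover have "ennreal (?g ds) = gagliardo (frac s) (weak_deriv ds f)" using fin by (intro ennreal_enn2real) simp
 ultimately show ?thesis by simp
qed

text \<open>
 The Sobolev embedding of \<open>H\<^sup>s(\<Omega>)\<close> into \<open>W\<^sup>1\<^sup>,\<^sup>\<infinity>(\<Omega>)\<close> for \<open>s > 2\<close>: apply the bounds for smooth functions to
 the mollifications and pass to the limit.
\<close>

lemma gradient_bound:
 assumes s: "s > 2"
 obtains C where "C > 0" "!!(f::field) D z i. f : Hs s ==> C1_up f D ==> z : closure \<Omega> ==> i : Basis ==>
  norm (D z i) <= C * Hs_norm s f"
proof -
 define \<theta> where "\<theta> = frac s"
 define C where "C = (if \<theta> > 0 then 16 + 64 / \<theta> else 4)"
 have \<theta>: "0 <= \<theta>" "\<theta> < 1" by (auto simp: \<theta>_def frac_lt_1)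
 have C0: "C > 0" using \<theta> by (auto simp: C_def intro!: add_pos_nonneg)
 have k2: "2 <= nat \<lfloor>s\<rfloor>" using s by linarith
 have main: "norm (D z i) <= (C + 4) * Hs_norm s f"
  if f: "f : Hs s" and D: "C1_up f D" and z: "z : closure \<Omega>" and i: "i : Basis" for f :: field and D z i
 proof -
  let ?N = "Hs_norm s f" and ?M = "\<mu>"
  have N0: "0 <= ?N" by (rule order_trans[OF L2_norm_nonneg Hs_weak_deriv(3)[OF f, of 0 "[]"]]) (auto simp: multi_indices_def)
  have fL: "f : L2 ?M" using f by (simp add: Hs_def)
  define F where "F n = mollify (upward_kernel n) (rep f)" for n
  have smF: "smooth (F n)" for n
   unfolding F_def by (rule smooth_mollify[OF averaging_kernelD(1)[OF averaging_upward_kernel] rep(1)[OF fL]])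
  have smp: "smooth (partials ds (F n))" if "set ds \<subseteq> Basis" for ds n
   using that smF by (induction ds) (auto simp: partials_def smooth_partial)
  have mem: "ds : multi_indices (length ds)" if "set ds \<subseteq> Basis" for ds :: "point list" using that by (simp add: multi_indices_def)
  have eq: "partials ds (F n) w = mollify (upward_kernel n) (rep (weak_deriv ds f)) w"
   if "set ds \<subseteq> Basis" "length ds <= nat \<lfloor>s\<rfloor>" "w : closure \<Omega>" for ds n w
   unfolding F_def by (rule mollify_weak_deriv[OF Hs_weak_deriv(1)[OF f that(2) mem[OF that(1)]] that(1) that(3)])
  have L: "partials ds (F n) : L2 ?M \<and> L2_norm ?M (partials ds (F n)) <= ?N"
   if ds: "set ds \<subseteq> Basis" "length ds <= nat \<lfloor>s\<rfloor>" for ds n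
  proof -
   let ?h = "weak_deriv ds f" and ?m = "mollify (upward_kernel n) (rep (weak_deriv ds f))"
   have h: "?h : L2 ?M" "L2_norm ?M ?h <= ?N" using Hs_weak_deriv[OF f ds(2) mem[OF ds(1)]] by auto
   have e: "partials ds (F n) w = ?m w" if "w : \<Omega>" for w
    using eq[OF ds, of w n] that closure_subset[of \<Omega>] by auto
   have m: "?m : L2 ?M" by (rule mollify_rep_L2[OF h(1)])
   have "partials ds (F n) : borel_measurable ?M"
    by (rule measurable_lborel_imp_lebesgue_on[OF smooth_measurable[OF smp[OF ds(1)]]])
   moreover have "integrable ?M (%w. (norm (partials ds (F n) w))^2)"
    using L2_integrable_sq[OF m] by (rule Bochner_Integration.integrable_cong[THEN iffD1, OF refl, rotated]) (simp add: e)
   moreover have "L2_norm ?M (partials ds (F n)) = L2_norm ?M ?m"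
    unfolding L2_norm_def by (intro arg_cong[where f=sqrt] bochner_cong refl) (simp add: e)
   moreover have "L2_norm ?M ?m <= ?N"
    using L2_norm_half_plane_le[OF mollify_L2(1)[OF averaging_upward_kernel[of n] rep(1)[OF h(1)]]]
     mollify_L2(2)[OF averaging_upward_kernel[of n] rep(1)[OF h(1)]] rep_L2_norm[OF h(1)] h(2) by linarith
   ultimately show ?thesis by (simp add: L2_def)
  qed
  have bound: "norm (partial i (F n) z) <= (C + 4) * ?N" for n
  proof (cases "\<theta> > 0 \<and> nat \<lfloor>s\<rfloor> = 2")
   case True
   have "norm (partial i (F n) z) <= (16 + 64 / \<theta>) * ?N"
   proof (rule sup_bound_fractional[OF _ z])
    show "smooth (partial i (F n))" by (rule smooth_partial[OF smF i])
    show "partial i (F n) : L2 ?M" "L2_norm ?M (partial i (F n)) <= ?N"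
     using L[of "[i]" n] i k2 by (auto simp: partials_def)
    show "slobodeckij \<theta> (partial j (partial i (F n))) <= ennreal (?N\<^sup>2)" if j: "j : Basis" for j
    proof -
     have ds: "set [j, i] \<subseteq> Basis" "length [j, i] <= nat \<lfloor>s\<rfloor>" using i j k2 by auto
     have hL: "weak_deriv [j, i] f : L2 ?M" by (rule Hs_weak_deriv(2)[OF f ds(2) mem[OF ds(1)]])
     have "slobodeckij \<theta> (partial j (partial i (F n))) = slobodeckij \<theta> (mollify (upward_kernel n) (rep (weak_deriv [j, i] f)))"
      using eq[OF ds, of _ n] closure_subset[of \<Omega>] by (intro slobodeckij_cong) (auto simp: partials_def)
     also have "... <= slobodeckij \<theta> (rep (weak_deriv [j, i] f))" by (rule slobodeckij_mollify_le[OF rep(1)[OF hL]])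
     also have "... = gagliardo \<theta> (weak_deriv [j, i] f)" by (rule gagliardo_eq_slobodeckij[OF hL, symmetric])
     also have "... <= ennreal (?N\<^sup>2)"
      unfolding \<theta>_def by (rule Hs_gagliardo[OF f]) (use True mem[OF ds(1)] in \<open>auto simp: \<theta>_def numeral_2_eq_2\<close>)
     finally show ?thesis .
    qed
   qed (use True \<theta> in auto)
   then show ?thesis using True N0 by (simp add: C_def algebra_simps)
  next
   case False
   have k3: "3 <= nat \<lfloor>s\<rfloor>"
   proof (rule ccontr)
    assume "\<not> ?thesis"
    then have k: "nat \<lfloor>s\<rfloor> = 2" using k2 by simp
    then have "\<lfloor>s\<rfloor> = 2" by simp
    then have "\<theta> > 0" using s by (simp add: \<theta>_def frac_def)
    with k False show False by simp
   qed
   have e: "(1, 0) : (Basis :: point set)" "(0, 1) : (Basis :: point set)" by (auto simp: Basis_point)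
   have "norm (partial i (F n) z) <= 4 * ?N"
   proof (rule sup_bound_mixed[OF smooth_partial[OF smF i] z])
    fix h assume "h : {partial i (F n), partial (1, 0) (partial i (F n)), partial (0, 1) (partial i (F n)), partial (0, 1) (partial (1, 0) (partial i (F n)))}"
    then have "h : {partials [i] (F n), partials [(1, 0), i] (F n), partials [(0, 1), i] (F n), partials [(0, 1), (1, 0), i] (F n)}"
     by (simp add: partials_def)
    then show "h : L2 ?M \<and> L2_norm ?M h <= ?N"
     using L[of "[i]" n] L[of "[(1, 0), i]" n] L[of "[(0, 1), i]" n] L[of "[(0, 1), (1, 0), i]" n] i e k2 k3 by auto
   qed
   then show ?thesis using C0 N0 by (simp add: distrib_right add_increasing)
  qed
  have "(%n. partial i (F n) z) ~~> D z i"
  proof -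
   have "set [i] \<subseteq> Basis" "length [i] <= nat \<lfloor>s\<rfloor>" using i k2 by auto
   note ds = this
   have "partial i (F n) z = mollify (upward_kernel n) (rep (weak_deriv [i] f)) z" for n
    using eq[OF ds z, of n] by (simp add: partials_def)
   then show ?thesis
    using mollify_pointwise_limit[OF D Hs_weak_deriv(1)[OF f ds(2) mem[OF ds(1)]] i z] by simp
  qed
  then have "(%n. norm (partial i (F n) z)) ~~> norm (D z i)" by (rule tendsto_norm)
  then show ?thesis by (rule LIMSEQ_le_const2) (use bound in auto)
 qed
 show ?thesis by (rule that[of "C + 4"]) (use C0 main in auto)
qed

section \<open>Bounded bilinear forms along a solution\<close>

text \<open>
 The boundary form, the strain form and, for a field with bounded gradient in the middle slot, the convective
 form are bounded bilinear forms on \<open>H\<^sup>1(\<Omega>)\<close>. This is what makes every term of the weak formulation measurable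
 and integrable in time.
\<close>

definition H1_form :: "(field => field => real) => bool"
 where "H1_form B \<longleftrightarrow>
  (\<exists>C\<ge>0. \<forall>f\<in>Hs 1. \<forall>g\<in>Hs 1. \<bar>B f g\<bar> <= C * (Hs_norm 1 f * Hs_norm 1 g)) \<and>
  (\<forall>f\<in>Hs 1. \<forall>g\<in>Hs 1. \<forall>h\<in>Hs 1. \<forall>a b. B (%z. a *. f z - b *. g z) h = a * B f h - b * B g h) \<and>
  (\<forall>f\<in>Hs 1. \<forall>g\<in>Hs 1. \<forall>h\<in>Hs 1. \<forall>a b. B h (%z. a *. f z - b *. g z) = a * B h f - b * B h g)"

lemma H1_formI:
 assumes "0 <= C" "!!f g. f : Hs 1 ==> g : Hs 1 ==> \<bar>B f g\<bar> <= C * (Hs_norm 1 f * Hs_norm 1 g)"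
  and "!!f g h a b. f : Hs 1 ==> g : Hs 1 ==> h : Hs 1 ==> B (%z. a *. f z - b *. g z) h = a * B f h - b * B g h"
  and "!!f g. f : Hs 1 ==> g : Hs 1 ==> B f g = B g f"
 shows "H1_form B"
 unfolding H1_form_def
proof (intro conjI ballI allI)
 show "\<exists>C\<ge>0. \<forall>f\<in>Hs 1. \<forall>g\<in>Hs 1. \<bar>B f g\<bar> <= C * (Hs_norm 1 f * Hs_norm 1 g)" using assms(1,2) by blast
 fix f g h :: field and a b :: real assume fgh: "f : Hs 1" "g : Hs 1" "h : Hs 1"
 show "B (%z. a *. f z - b *. g z) h = a * B f h - b * B g h" by (rule assms(3)[OF fgh])
 have "(%z. a *. f z - b *. g z) : Hs 1" by (intro Hs_1_diff Hs_1_scaleR fgh)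
 then show "B h (%z. a *. f z - b *. g z) = a * B h f - b * B h g"
  using assms(3)[OF fgh, of a b] assms(4)[of h] fgh by simp
qed

lemma H1_form_bound:
 assumes "H1_form B"
 obtains C where "0 <= C" "!!f g. f : Hs 1 ==> g : Hs 1 ==> \<bar>B f g\<bar> <= C * (Hs_norm 1 f * Hs_norm 1 g)"
proof -
 have "\<exists>C\<ge>0. \<forall>f\<in>Hs 1. \<forall>g\<in>Hs 1. \<bar>B f g\<bar> <= C * (Hs_norm 1 f * Hs_norm 1 g)"
  using assms unfolding H1_form_def by (rule conjunct1)
 then show thesis using that by blast
qed

lemma H1_form_diff:
 assumes "H1_form B" "f : Hs 1" "g : Hs 1" "h : Hs 1"
 shows "B (%z. f z - g z) h = B f h - B g h" "B h (%z. f z - g z) = B h f - B h g"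
proof -
 have "B (%z. 1 *. f z - 1 *. g z) h = 1 * B f h - 1 * B g h" "B h (%z. 1 *. f z - 1 *. g z) = 1 * B h f - 1 * B h g"
  using assms unfolding H1_form_def by blast+
 then show "B (%z. f z - g z) h = B f h - B g h" "B h (%z. f z - g z) = B h f - B h g" by simp_all
qed

lemma H1_form_scaleR_right:
 assumes "H1_form B" "f : Hs 1" "h : Hs 1"
 shows "B h (%z. a *. f z) = a * B h f"
proof -
 have "B h (%z. a *. f z - 0 *. f z) = a * B h f - 0 * B h f" using assms unfolding H1_form_def by blast
 then show ?thesis by simp
qed

lemma H1_form_boundary: "H1_form boundary_inner"
proof (rule H1_formI[of 4])
 fix f g :: field assume f: "f : Hs 1" and g: "g : Hs 1"
 have "\<bar>boundary_inner f g\<bar> <= L2_norm lebesgue (trace_bd f) * L2_norm lebesgue (trace_bd g)"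
  unfolding boundary_inner_def by (intro L2_inner_bound trace_bd f g)
 also have "... <= (2 * Hs_norm 1 f) * (2 * Hs_norm 1 g)"
  using Hs_norm_1_nonneg[OF f] by (intro mult_mono trace_bd_norm f g) auto
 finally show "\<bar>boundary_inner f g\<bar> <= 4 * (Hs_norm 1 f * Hs_norm 1 g)" by simp
next
 fix f g h :: field and a b :: real assume fgh: "f : Hs 1" "g : Hs 1" "h : Hs 1"
 have k: "(%z. a *. f z - b *. g z) : Hs 1" by (intro Hs_1_diff Hs_1_scaleR fgh)
 note L = trace_bd(1)[OF fgh(1)] trace_bd(1)[OF fgh(2)] trace_bd(1)[OF fgh(3)]
 have "boundary_inner (%z. a *. f z - b *. g z) h = L2_inner lebesgue (%x. a *. trace_bd f x - b *. trace_bd g x) (trace_bd h)"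
  unfolding boundary_inner_def
  by (rule L2_inner_cong_AE)
    (use L2_measurable[OF trace_bd(1)[OF k]] L2_measurable[OF L(3)] L2_measurable[OF L2_diff[OF L2_scaleR[OF L(1)] L2_scaleR[OF L(2)]]]
     trace_bd_lincomb[OF fgh(1,2)] in auto)
 also have "... = L2_inner lebesgue (%x. a *. trace_bd f x) (trace_bd h) - L2_inner lebesgue (%x. b *. trace_bd g x) (trace_bd h)"
  by (intro L2_inner_diff_left L2_scaleR L)
 finally show "boundary_inner (%z. a *. f z - b *. g z) h = a * boundary_inner f h - b * boundary_inner g h"
  by (simp add: boundary_inner_def L2_inner_def)
qed (auto simp: boundary_inner_def L2_inner_commute)

lemma strain_L2:
 assumes "f : Hs 1" "i : Basis" "j : Basis"
 shows "strain f i j : L2 \<mu>" "nrm (strain f i j) <= Hs_norm 1 f"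
proof -
 let ?M = "\<mu>"
 have L: "(%z. weak_deriv [i] f z \<bullet> j) : L2 ?M" "(%z. weak_deriv [j] f z \<bullet> i) : L2 ?M"
  by (intro L2_inner_component Hs_1_weak_deriv(2) assms)+
 have eq: "strain f i j = (%z. (1/2) *. (weak_deriv [i] f z \<bullet> j + weak_deriv [j] f z \<bullet> i))" by (simp add: strain_def fun_eq_iff)
 show "strain f i j : L2 ?M" unfolding eq by (intro L2_scaleR L2_add L)
 have n: "L2_norm ?M (%z. weak_deriv [k] f z \<bullet> l) <= Hs_norm 1 f" if k: "k : Basis" and l: "l : Basis" for k l
 proof -
  have "L2_norm ?M (%z. weak_deriv [k] f z \<bullet> l) <= L2_norm ?M (weak_deriv [k] f)"
   by (rule L2_norm_mono) (use Basis_le_norm[OF l] L2_measurable[OF L2_inner_component[OF Hs_1_weak_deriv(2)[OF assms(1) k]]] Hs_1_weak_deriv(2)[OF assms(1) k] in auto)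
  then show ?thesis using Hs_norm_1_ge(2)[OF assms(1) k] by linarith
 qed
 have "L2_norm ?M (strain f i j) = (1/2) * L2_norm ?M (%z. weak_deriv [i] f z \<bullet> j + weak_deriv [j] f z \<bullet> i)"
  unfolding eq L2_norm_scaleR by simp
 also have "... <= (1/2) * (L2_norm ?M (%z. weak_deriv [i] f z \<bullet> j) + L2_norm ?M (%z. weak_deriv [j] f z \<bullet> i))"
  by (intro mult_left_mono L2_norm_triangle L) simp
 also have "... <= Hs_norm 1 f" using n[OF assms(2,3)] n[OF assms(3,2)] by simp
 finally show "L2_norm ?M (strain f i j) <= Hs_norm 1 f" .
qed

lemma strain_inner_sum:
 assumes f: "f : Hs 1" and g: "g : Hs 1"
 shows "strain_inner f g = (\<Sum>i\<in>Basis. \<Sum>j\<in>Basis. ip (strain f i j) (strain g i j))"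
proof -
 have int: "integrable \<mu> (%z. strain f i j z * strain g i j z)" if "i : Basis" "j : Basis" for i j
  using L2_scaleR_integrable[OF strain_L2(1)[OF f that] strain_L2(1)[OF g that]] by simp
 show ?thesis
  unfolding strain_inner_def L2_inner_def
  by (simp add: Bochner_Integration.integral_sum int Bochner_Integration.integrable_sum)
qed

lemma H1_form_strain: "H1_form strain_inner"
proof (rule H1_formI[of 4])
 fix f g :: field assume f: "f : Hs 1" and g: "g : Hs 1"
 have "\<bar>strain_inner f g\<bar> <= (\<Sum>i\<in>(Basis::point set). \<Sum>j\<in>(Basis::point set). Hs_norm 1 f * Hs_norm 1 g)"
  unfolding strain_inner_sum[OF f g]
 proof (intro order_trans[OF sum_abs] sum_mono)
  fix i j :: point assume ij: "i : Basis" "j : Basis"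
  have "\<bar>ip (strain f i j) (strain g i j)\<bar> <= nrm (strain f i j) * nrm (strain g i j)"
   by (intro L2_inner_bound strain_L2 f g ij)
  also have "... <= Hs_norm 1 f * Hs_norm 1 g"
   by (intro mult_mono strain_L2 f g ij Hs_norm_1_nonneg) simp
  finally show "\<bar>ip (strain f i j) (strain g i j)\<bar> <= Hs_norm 1 f * Hs_norm 1 g" .
 qed
 then show "\<bar>strain_inner f g\<bar> <= 4 * (Hs_norm 1 f * Hs_norm 1 g)" by simp
next
 fix f g h :: field and a b :: real assume fgh: "f : Hs 1" "g : Hs 1" "h : Hs 1"
 let ?M = "\<mu>" and ?k = "%z. a *. f z - b *. g z"
 have k: "?k : Hs 1" by (intro Hs_1_diff Hs_1_scaleR fgh)
 have wd: "AE z in ?M. weak_deriv [i] ?k z = a *. weak_deriv [i] f z - b *. weak_deriv [i] g z" if i: "i : Basis" for i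
  using weak_deriv_diff[OF Hs_1_scaleR[OF fgh(1), of a] Hs_1_scaleR[OF fgh(2), of b] i]
   weak_deriv_scaleR[OF fgh(1) i, of a] weak_deriv_scaleR[OF fgh(2) i, of b]
  by eventually_elim simp
 have "L2_inner ?M (strain ?k i j) (strain h i j) = a * L2_inner ?M (strain f i j) (strain h i j) - b * L2_inner ?M (strain g i j) (strain h i j)"
  if ij: "i : Basis" "j : Basis" for i j
 proof -
  note L = strain_L2(1)[OF fgh(1) ij] strain_L2(1)[OF fgh(2) ij] strain_L2(1)[OF fgh(3) ij]
  have ae: "AE z in ?M. strain ?k i j z = a *. strain f i j z - b *. strain g i j z"
   using wd[OF ij(1)] wd[OF ij(2)]
  proof eventually_elim
   case (elim z)
   show ?case unfolding strain_def elim inner_diff_left inner_scaleR_left by (simp add: field_simps)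
  qed
  have "L2_inner ?M (strain ?k i j) (strain h i j) = L2_inner ?M (%z. a *. strain f i j z - b *. strain g i j z) (strain h i j)"
   by (rule L2_inner_cong_AE)
     (use ae L2_measurable[OF strain_L2(1)[OF k ij]] L2_measurable[OF L(3)] L2_measurable[OF L2_diff[OF L2_scaleR[OF L(1), of a] L2_scaleR[OF L(2), of b]]] in auto)
  also have "... = L2_inner ?M (%z. a *. strain f i j z) (strain h i j) - L2_inner ?M (%z. b *. strain g i j z) (strain h i j)"
   by (intro L2_inner_diff_left L2_scaleR L)
  finally show ?thesis by (simp add: L2_inner_def mult.assoc)
 qed
 then show "strain_inner ?k h = a * strain_inner f h - b * strain_inner g h"
  by (simp add: strain_inner_sum fgh k sum_subtractf sum_distrib_left)
next
 fix f g :: field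
 show "strain_inner f g = strain_inner g f"
  unfolding strain_inner_def by (intro bochner_cong sum.cong refl mult.commute)
qed simp

lemma strain_inner_self_nonneg: "0 <= strain_inner f f"
 unfolding strain_inner_def by (intro integral_nonneg_AE AE_I2 sum_nonneg) simp

lemma boundary_inner_self_nonneg: "0 <= boundary_inner f f"
 unfolding boundary_inner_def L2_inner_self by simp

text \<open>Young's inequality for a bilinear form that is nonnegative on the diagonal.\<close>

lemma H1_form_young:
 assumes B: "H1_form B" and sym: "B f g = B g f" and pos: "!!h. 0 <= B h h" and f: "f : Hs 1" and g: "g : Hs 1"
 shows "2 * B f g <= B f f + B g g"
proof -
 have d: "(%z. f z - g z) : Hs 1" by (rule Hs_1_diff[OF f g])
 have "B (%z. f z - g z) (%z. f z - g z) = B f f - 2 * B f g + B g g"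
  by (simp add: H1_form_diff[OF B f g d] H1_form_diff[OF B f g f] H1_form_diff[OF B f g g] sym)
 then show ?thesis using pos[of "%z. f z - g z"] by linarith
qed

lemma transport_norm_le:
 assumes "!!i. i : Basis ==> norm (D i) <= K"
 shows "norm (\<Sum>i\<in>Basis. ((a::point) \<bullet> i) *. (D i :: real \<times> real)) <= 2 * K * norm a"
proof -
 have "norm (\<Sum>i\<in>Basis. (a \<bullet> i) *. D i) <= (\<Sum>i\<in>(Basis::point set). norm a * K)"
 proof (intro order_trans[OF norm_sum] sum_mono)
  fix i :: point assume i: "i : Basis"
  show "norm ((a \<bullet> i) *. D i) <= norm a * K"
   unfolding norm_scaleR using Basis_le_norm[OF i, of a] assms[OF i] by (intro mult_mono) auto
 qed
 then show ?thesis by (simp add: mult_ac)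
qed

text \<open>
 A bounded gradient makes the convective form bounded even on \<open>L\<^sup>2\<close>, so that it can be evaluated on fields
 without weak derivatives.
\<close>

lemma trilinear_integrable:
 assumes w: "w : Hs 1" and K: "!!i. i : Basis ==> AE z in \<mu>. norm (weak_deriv [i] w z) <= K"
  and f: "f : L2 \<mu>" and g: "g : L2 \<mu>"
 shows "integrable \<mu> (%z. (\<Sum>i\<in>Basis. (f z \<bullet> i) *. weak_deriv [i] w z) \<bullet> g z)"
  "\<bar>trilinear f w g\<bar> <= 2 * K * (nrm f * nrm g)"
proof -
 let ?M = "\<mu>"
 let ?h = "%z. (\<Sum>i\<in>Basis. (f z \<bullet> i) *. weak_deriv [i] w z) \<bullet> g z"
 have [measurable]: "f : borel_measurable ?M" "g : borel_measurable ?M" using f g by (auto simp: L2_def)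
 have wm [measurable]: "weak_deriv [i] w : borel_measurable ?M" if "i : Basis" for i
  by (rule L2_measurable[OF Hs_1_weak_deriv(2)[OF w that]])
 have m: "?h : borel_measurable ?M" by (intro borel_measurable_inner borel_measurable_sum borel_measurable_scaleR wm) measurable
 have "AE z in ?M. \<forall>i\<in>Basis. norm (weak_deriv [i] w z) <= K" using K by (intro AE_finite_allI) auto
 then have ae: "AE z in ?M. norm (?h z) <= 2 * K * (norm (f z) * norm (g z))"
 proof eventually_elim
  case (elim z)
  have "norm (?h z) <= norm (\<Sum>i\<in>Basis. (f z \<bullet> i) *. weak_deriv [i] w z) * norm (g z)"
   by (simp add: Cauchy_Schwarz_ineq2)
  also have "... <= 2 * K * norm (f z) * norm (g z)"
   using elim by (intro mult_right_mono transport_norm_le) auto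
  finally show ?case by (simp add: mult.assoc)
 qed
 have i: "integrable ?M (%z. 2 * K * (norm (f z) * norm (g z)))" by (intro integrable_mult_right L2_norm_mult_integrable f g)
 show h: "integrable ?M ?h"
 proof (rule Bochner_Integration.integrable_bound[OF i m])
  show "AE z in ?M. norm (?h z) <= norm (2 * K * (norm (f z) * norm (g z)))"
   using ae by eventually_elim simp
 qed
 have "\<bar>trilinear f w g\<bar> <= (LINT z|?M. norm (?h z))" unfolding trilinear_def using integral_norm_bound[of ?M ?h] by simp
 also have "... <= (LINT z|?M. 2 * K * (norm (f z) * norm (g z)))"
  by (rule integral_mono_AE[OF integrable_norm[OF h] i ae])
 also have "... = 2 * K * (LINT z|?M. norm (f z) * norm (g z))" by simp
 also have "... <= 2 * K * (L2_norm ?M f * L2_norm ?M g)"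
 proof (rule mult_left_mono[OF L2_norm_mult_le[OF f g]])
  have "\<exists>z. norm (weak_deriv [(1, 0)] w z) <= K"
  proof (rule ccontr)
   assume "\<not> ?thesis"
   then have "AE z in ?M. False" using K[of "(1, 0)"] by (auto simp: Basis_point)
   then have "AE z :: point in lborel. z \<notin> \<Omega>" unfolding AE_lebesgue_on_half_plane by simp
   then have "AE z :: point in lborel. z : - \<Omega>" by simp
   moreover have "closed (- \<Omega>)" using open_half_plane by (simp add: closed_def)
   ultimately have "(0, 1) : - \<Omega>" using mem_closed_if_AE_lebesgue AE_completion by blast
   then show False by (simp add: mem_half_plane)
  qed
  then show "0 <= 2 * K" using norm_ge_zero order_trans by (metis mult_nonneg_nonneg zero_le_numeral)
 qed
 finally show "\<bar>trilinear f w g\<bar> <= 2 * K * (L2_norm ?M f * L2_norm ?M g)" .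
qed

lemma H1_form_trilinear:
 assumes w: "w : Hs 1" and K: "!!i. i : Basis ==> AE z in \<mu>. norm (weak_deriv [i] w z) <= K" and K0: "0 <= K"
 shows "H1_form (%f g. trilinear f w g)"
 unfolding H1_form_def
proof (intro conjI exI[of _ "2 * K"] ballI allI)
 fix f g :: field assume f: "f : Hs 1" and g: "g : Hs 1"
 have "\<bar>trilinear f w g\<bar> <= 2 * K * (nrm f * nrm g)"
  by (rule trilinear_integrable(2)[OF w K Hs_1_L2[OF f] Hs_1_L2[OF g]])
 also have "... <= 2 * K * (Hs_norm 1 f * Hs_norm 1 g)"
  using K0 by (intro mult_left_mono mult_mono Hs_norm_1_ge(1) f g Hs_norm_1_nonneg) auto
 finally show "\<bar>trilinear f w g\<bar> <= 2 * K * (Hs_norm 1 f * Hs_norm 1 g)" .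
next
 fix f g h :: field and a b :: real assume "f : Hs 1" "g : Hs 1" "h : Hs 1"
 then have L: "f : L2 \<mu>" "g : L2 \<mu>" "h : L2 \<mu>" by (auto intro: Hs_1_L2)
 have I: "integrable \<mu> (%z. (\<Sum>i\<in>Basis. (f z \<bullet> i) *. weak_deriv [i] w z) \<bullet> g z)"
  if "f : L2 \<mu>" "g : L2 \<mu>" for f g
  by (rule trilinear_integrable(1)[OF w _ that]) (rule K)
 show "trilinear (%z. a *. f z - b *. g z) w h = a * trilinear f w h - b * trilinear g w h"
 proof -
  have "trilinear (%z. a *. f z - b *. g z) w h = (LINT z|\<mu>.
    a * ((\<Sum>i\<in>Basis. (f z \<bullet> i) *. weak_deriv [i] w z) \<bullet> h z) - b * ((\<Sum>i\<in>Basis. (g z \<bullet> i) *. weak_deriv [i] w z) \<bullet> h z))"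
   unfolding trilinear_def
   by (intro bochner_cong refl) (simp add: sum_Basis_point inner_add_left inner_diff_left scaleR_diff_left algebra_simps)
  then show ?thesis using I[OF L(1,3)] I[OF L(2,3)] by (simp add: trilinear_def)
 qed
 show "trilinear h w (%z. a *. f z - b *. g z) = a * trilinear h w f - b * trilinear h w g"
  unfolding trilinear_def using I[OF L(3,1)] I[OF L(3,2)] by (simp add: inner_diff_right)
qed (use K0 in auto)

lemma borel_measurable_AE_limit:
 fixes f :: "real => real"
 assumes I: "I : sets lebesgue" and F: "!!n. F n : borel_measurable (lebesgue_on I)"
  and lim: "AE t in lebesgue_on I. (%n. F n t) ~~> f t"
 shows "f : borel_measurable (lebesgue_on I)"
proof -
 let ?g = "%t. if t : I then lim (%n. F n t) else 0"
 have "(%t. lim (%n. F n t)) : borel_measurable (lebesgue_on I)"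
  by (rule borel_measurable_lim_metric[OF F])
 then have g: "?g : borel_measurable lebesgue" by (rule borel_measurable_if_I[OF _ I])
 have "AE t in lebesgue. t : I \<longrightarrow> (%n. F n t) ~~> f t"
  using lim I by (subst (asm) AE_restrict_space_iff) auto
 then have "AE t in lebesgue. ?g t = (if t : I then f t else 0)"
  by eventually_elim (auto simp: limI)
 from borel_measurable_AE[OF g this] have "(%t. if t : I then f t else 0) : borel_measurable lebesgue" .
 then show ?thesis by (rule borel_measurable_if_D)
qed

lemma integral_AE_cong_time:
 fixes f g :: "real => real"
 assumes I: "I : sets lebesgue" and g: "g : borel_measurable (lebesgue_on I)" and eq: "AE t in lebesgue_on I. f t = g t"
 shows "(LINT t|lebesgue_on I. f t) = (LINT t|lebesgue_on I. g t)"
proof (rule integral_cong_AE[OF _ g eq])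
 show "f : borel_measurable (lebesgue_on I)"
 proof (rule borel_measurable_AE_limit[OF I g])
  show "AE t in lebesgue_on I. (%n. g t) ~~> f t" using eq by eventually_elim simp
 qed
qed

lemma H1_form_continuous:
 assumes B: "H1_form B" and f: "f : Hs 1" and F: "!!n. F n : Hs 1" and g: "g : Hs 1" and lim: "(%n. Hs_norm 1 (%z. F n z - f z)) ~~> 0"
 shows "(%n. B (F n) (F n)) ~~> B f f" "(%n. B (F n) g) ~~> B f g"
proof -
 obtain C where C: "0 <= C" "!!f g. f : Hs 1 ==> g : Hs 1 ==> \<bar>B f g\<bar> <= C * (Hs_norm 1 f * Hs_norm 1 g)"
  by (rule H1_form_bound[OF B]) blast
 let ?d = "%n z. F n z - f z" and ?e = "%n. Hs_norm 1 (%z. F n z - f z)"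
 have d: "?d n : Hs 1" for n by (rule Hs_1_diff[OF F f])
 have "(%n. B (F n) g - B f g) ~~> 0"
 proof (rule Lim_null_comparison)
  show "\<forall>\<^sub>F n in sequentially. norm (B (F n) g - B f g) <= C * (?e n * Hs_norm 1 g)"
   using C(2)[OF d g] H1_form_diff(1)[OF B F f g] by (intro always_eventually allI) simp
  have "(%n. C * (?e n * Hs_norm 1 g)) ~~> C * (0 * Hs_norm 1 g)" by (intro tendsto_intros lim)
  then show "(%n. C * (?e n * Hs_norm 1 g)) ~~> 0" by simp
 qed
 then show "(%n. B (F n) g) ~~> B f g" by (simp add: LIM_zero_iff)
 have "(%n. B (F n) (F n) - B f f) ~~> 0"
 proof (rule Lim_null_comparison)
  show "\<forall>\<^sub>F n in sequentially. norm (B (F n) (F n) - B f f) <= C * (?e n * ?e n) + C * (?e n * Hs_norm 1 f) + C * (Hs_norm 1 f * ?e n)"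
  proof (intro always_eventually allI)
   fix n
   have "B (F n) (F n) - B f f = B (?d n) (?d n) + B (?d n) f + B f (?d n)"
    by (simp add: H1_form_diff[OF B F f d] H1_form_diff[OF B F f f] H1_form_diff[OF B F f F])
   then show "norm (B (F n) (F n) - B f f) <= C * (?e n * ?e n) + C * (?e n * Hs_norm 1 f) + C * (Hs_norm 1 f * ?e n)"
    using C(2)[OF d d, of n n] C(2)[OF d f, of n] C(2)[OF f d, of n] unfolding real_norm_def by linarith
  qed
  have "(%n. C * (?e n * ?e n) + C * (?e n * Hs_norm 1 f) + C * (Hs_norm 1 f * ?e n)) ~~> C * (0 * 0) + C * (0 * Hs_norm 1 f) + C * (Hs_norm 1 f * 0)"
   by (intro tendsto_intros lim)
  then show "(%n. C * (?e n * ?e n) + C * (?e n * Hs_norm 1 f) + C * (Hs_norm 1 f * ?e n)) ~~> 0" by simp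
 qed
 then show "(%n. B (F n) (F n)) ~~> B f f" by (simp add: LIM_zero_iff)
qed

text \<open>
 Measurability is inherited from the simple functions that approximate \<open>u\<close> in \<open>H\<^sup>1\<close>, by continuity of the form.
\<close>

lemma H1_form_time_integrable:
 assumes B: "H1_form B" and u: "u : time_L2 {0..T} H1_sigma (Hs_norm 1)" and w: "w : Hs 1"
 shows "integrable (lebesgue_on {0..T}) (%r. B (u r) (u r))" "integrable (lebesgue_on {0..T}) (%r. B (u r) w)"
proof -
 let ?M = "lebesgue_on {0..T}"
 obtain C where C: "0 <= C" "!!f g. f : Hs 1 ==> g : Hs 1 ==> \<bar>B f g\<bar> <= C * (Hs_norm 1 f * Hs_norm 1 g)"
  by (rule H1_form_bound[OF B]) blast
 obtain S :: "nat => real => field" where S: "!!n. simple_function ?M (S n)" "!!n. S n ` {0..T} \<subseteq> H1_sigma"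
  and lim: "AE t in ?M. u t : H1_sigma \<and> (%n. Hs_norm 1 (%z. S n t z - u t z)) ~~> 0"
  using u unfolding time_L2_def strongly_measurable_def by blast
 have N: "integrable ?M (%t. (Hs_norm 1 (u t))^2)" using u by (simp add: time_L2_def)
 have uH: "AE t in ?M. u t : Hs 1" using lim by eventually_elim (simp add: solenoidal_def)
 have SH: "S n t : Hs 1" if "t : {0..T}" for n t
  using subsetD[OF S(2) imageI[OF that]] by (simp add: solenoidal_def)
 have "AE t in ?M. (%n. B (S n t) (S n t)) ~~> B (u t) (u t) \<and> (%n. B (S n t) w) ~~> B (u t) w"
  using lim uH AE_space
 proof eventually_elim
  case (elim t)
  then have t: "t : {0..T}" by simp
  show ?case using H1_form_continuous[where F="%n. S n t", OF B elim(2) SH[OF t] w] elim(1) by blast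
 qed
 then have l1: "AE t in ?M. (%n. B (S n t) (S n t)) ~~> B (u t) (u t)" and l2: "AE t in ?M. (%n. B (S n t) w) ~~> B (u t) w"
  by (auto elim: AE_mp)
 have m: "(%t. B (u t) (u t)) : borel_measurable ?M" "(%t. B (u t) w) : borel_measurable ?M"
  by (rule borel_measurable_AE_limit[OF _ _ l1]; simp add: borel_measurable_simple_function simple_function_compose1[OF S(1), of "%f. B f f"])
    (rule borel_measurable_AE_limit[OF _ _ l2]; simp add: borel_measurable_simple_function simple_function_compose1[OF S(1), of "%f. B f w"])
 show "integrable ?M (%r. B (u r) (u r))"
 proof (rule Bochner_Integration.integrable_bound[OF integrable_mult_right[OF N, of C] m(1)])
  show "AE t in ?M. norm (B (u t) (u t)) <= norm (C * (Hs_norm 1 (u t))^2)"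
   using uH by eventually_elim (use C in \<open>auto simp: power2_eq_square abs_mult intro: order_trans\<close>)
 qed
 have one: "integrable ?M (%t. 1 + (Hs_norm 1 (u t))^2)" using N by simp
 show "integrable ?M (%r. B (u r) w)"
 proof (rule Bochner_Integration.integrable_bound[OF integrable_mult_right[OF one, of "C * Hs_norm 1 w"] m(2)])
  show "AE t in ?M. norm (B (u t) w) <= norm (C * Hs_norm 1 w * (1 + (Hs_norm 1 (u t))^2))"
   using uH
  proof eventually_elim
   case (elim t)
   have "\<bar>B (u t) w\<bar> <= C * Hs_norm 1 w * Hs_norm 1 (u t)" using C(2)[OF elim w] by (simp add: mult_ac)
   also have "... <= C * Hs_norm 1 w * (1 + (Hs_norm 1 (u t))^2)"
   proof (rule mult_left_mono)
    have "0 <= (Hs_norm 1 (u t) - 1)^2" by simp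
    then show "Hs_norm 1 (u t) <= 1 + (Hs_norm 1 (u t))^2"
     using Hs_norm_1_nonneg[OF elim] unfolding power2_diff by simp
   qed (simp add: C(1) Hs_norm_1_nonneg[OF w])
   finally show ?case by simp
  qed
 qed
qed

section \<open>The weak formulation with a stationary test field\<close>

text \<open>A continuous time cutoff that is linear between \<open>a\<close> and \<open>a + h\<close>, and its derivative.\<close>

definition ramp :: "real => real => real => real"
 where "ramp a h t = max 0 (min 1 (1 + (a - t) / h))"

definition ramp' :: "real => real => real => real"
 where "ramp' a h t = (if a < t \<and> t < a + h then - 1 / h else 0)"

lemma ramp_bounds: "0 <= ramp a h t" "ramp a h t <= 1"
 by (auto simp: ramp_def)

lemma ramp_values:
 assumes "h > 0"
 shows "t <= a ==> ramp a h t = 1" "a + h <= t ==> ramp a h t = 0"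
 using assms by (auto simp: ramp_def field_simps)

lemma ramp_continuous: "h > 0 ==> continuous_on S (ramp a h)"
 unfolding ramp_def by (intro continuous_intros) auto

lemma ramp_measurable [measurable]: "ramp a h : borel_measurable borel" "ramp' a h : borel_measurable borel"
 unfolding ramp_def ramp'_def by measurable

lemma ramp_derivative:
 assumes h: "h > 0" and t: "t \<notin> {a, a + h}"
 shows "(ramp a h has_real_derivative ramp' a h t) (at t)"
proof -
 consider "t < a" | "a < t" "t < a + h" | "a + h < t" using t by force
 then show ?thesis
 proof cases
  case 1
  have "((%t. 1) has_real_derivative ramp' a h t) (at t)" using 1 h by (auto simp: ramp'_def)
  then show ?thesis
   by (rule DERIV_cong_ev[THEN iffD1, rotated 3])
    (use 1 h eventually_nhds_in_open[of "{..<a}" t] in \<open>auto simp: ramp_values elim!: eventually_mono\<close>)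
 next
  case 2
  have "((%t. 1 + (a - t) / h) has_real_derivative ramp' a h t) (at t)"
   using 2 h by (auto intro!: derivative_eq_intros simp: ramp'_def)
  then show ?thesis
   by (rule DERIV_cong_ev[THEN iffD1, rotated 3])
    (use 2 h eventually_nhds_in_open[of "{a<..<a + h}" t] in \<open>auto simp: ramp_def field_simps elim!: eventually_mono\<close>)
 next
  case 3
  have "((%t. 0) has_real_derivative ramp' a h t) (at t)" using 3 h by (auto simp: ramp'_def)
  then show ?thesis
   by (rule DERIV_cong_ev[THEN iffD1, rotated 3])
    (use 3 h eventually_nhds_in_open[of "{a + h<..}" t] in \<open>auto simp: ramp_values elim!: eventually_mono\<close>)
 qed
qed

lemma bounded_support_time_integrable:
 fixes f :: "real => real"
 assumes m: "f : borel_measurable (lebesgue_on {0..})" and b: "!!t. 0 <= t ==> \<bar>f t\<bar> <= C" and s: "!!t. t > R ==> f t = 0"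
 shows "integrable (lebesgue_on {0..}) f"
proof (rule Bochner_Integration.integrable_bound[OF _ m])
 have "integrable lebesgue (%t. C * indicat_real {0..R} t)"
  using lmeasurable_cbox[of 0 R] by (intro integrable_mult_right) (simp add: lmeasurable_iff_integrable)
 moreover have "(%t. indicat_real {0..} t *. (C * indicat_real {0..R} t)) = (%t. C * indicat_real {0..R} t)"
  by (auto simp: indicator_def fun_eq_iff)
 ultimately have "integrable lebesgue (%t. indicat_real {0..} t *. (C * indicat_real {0..R} t))"
  by (simp only:)
 then show "integrable (lebesgue_on {0..}) (%t. C * indicat_real {0..R} t)"
  by (subst integrable_restrict_space) auto
 show "AE t in lebesgue_on {0..}. norm (f t) <= norm (C * indicat_real {0..R} t)"
 proof (rule AE_I2)
  fix t assume "t : space (lebesgue_on {0::real..})"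
  then have t: "0 <= t" by simp
  show "norm (f t) <= norm (C * indicat_real {0..R} t)"
   using b[OF t] s[of t] t by (cases "t > R") auto
 qed
qed

lemma L2_sigma_scaleR:
 assumes "w : H1_sigma"
 shows "(%z. c *. w z) : H1_sigma"
proof -
 have *: "(LINT z|\<mu>. frechet_derivative \<psi> (at z) (c *. w z)) = c * (LINT z|\<mu>. frechet_derivative \<psi> (at z) (w z))"
  if "\<psi> : test_functions U" for \<psi> :: "point => real" and U
 proof -
  have "frechet_derivative \<psi> (at z) (c *. w z) = c * frechet_derivative \<psi> (at z) (w z)" for z
   using has_derivative_linear[OF smooth_has_derivative[OF test_smooth[OF that]]] by (simp add: linear_cmul)
  then show ?thesis by simp
 qed
 show ?thesis using assms by (auto simp: solenoidal_def divergence_free_def tangent_to_boundary_def Hs_1_scaleR *)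
qed

lemma time_profile_L2:
 assumes w: "w : H1_sigma" and m: "s : borel_measurable borel" and b: "!!t. \<bar>s t\<bar> <= C" and z: "!!t. t > R ==> s t = 0"
 shows "(%t z. s t *. w z) : time_L2 {0..} H1_sigma (Hs_norm 1)"
proof -
 let ?M = "lebesgue_on {0::real..}"
 have wH: "w : Hs 1" using w by (simp add: solenoidal_def)
 have sm: "s : borel_measurable ?M" by (rule measurable_lborel_imp_lebesgue_on[OF m])
 obtain F where F: "!!n. simple_function ?M (F n)" "!!t. t : space ?M ==> (%n. F n t) ~~> s t"
  using borel_measurable_implies_sequence_metric[OF sm, of 0] by blast
 have "strongly_measurable {0..} H1_sigma (Hs_norm 1) (%t z. s t *. w z)"
  unfolding strongly_measurable_def
 proof (intro exI conjI allI)
  show "simple_function ?M (%t z. F n t *. w z)" for n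
   by (rule simple_function_compose1[OF F(1), of "%c z. c *. w z"])
  show "(%t z. F n t *. w z) ` {0..} \<subseteq> H1_sigma" for n using L2_sigma_scaleR[OF w] by auto
  show "AE t in ?M. (%z. s t *. w z) : H1_sigma \<and> (%n. Hs_norm 1 (%z. F n t *. w z - s t *. w z)) ~~> 0"
  proof (intro AE_I2 conjI L2_sigma_scaleR[OF w])
   fix t assume "t : space ?M"
   from F(2)[OF this] have "(%n. \<bar>F n t - s t\<bar> * Hs_norm 1 w) ~~> \<bar>s t - s t\<bar> * Hs_norm 1 w" by (intro tendsto_intros)
   then show "(%n. Hs_norm 1 (%z. F n t *. w z - s t *. w z)) ~~> 0"
    by (simp add: scaleR_diff_left[symmetric] Hs_norm_1_scaleR[OF wH])
  qed
 qed
 moreover have "integrable ?M (%t. (s t)^2)"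
 proof (rule bounded_support_time_integrable[of _ "C\<^sup>2" R])
  show "(%t. (s t)^2) : borel_measurable ?M" using sm by measurable
  show "\<bar>(s t)^2\<bar> <= C\<^sup>2" for t using power_mono[OF b[of t], of 2] by simp
 qed (simp add: z)
 then have "integrable ?M (%t. (Hs_norm 1 (%z. s t *. w z))^2)"
  by (simp add: Hs_norm_1_scaleR[OF wH] power_mult_distrib)
 ultimately show ?thesis by (simp add: time_L2_def)
qed

text \<open>
 The product of the ramp with a test function is differentiable except at the two kinks of the ramp, which the
 fundamental theorem of calculus tolerates.
\<close>

lemma ramp_weak_derivative:
 assumes h: "h > 0" and a: "a \<ge> 0" and \<psi>: "\<psi> : test_functions {0<..}"
 shows "(LINT t|lebesgue_on {0..}. deriv \<psi> t * ramp a h t) = - (LINT t|lebesgue_on {0..}. \<psi> t * ramp' a h t)"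
proof -
 let ?M = "lebesgue_on {0::real..}"
 have sm: "smooth \<psi>" by (rule test_smooth[OF \<psi>])
 have d\<psi>: "(\<psi> has_real_derivative deriv \<psi> t) (at t)" for t
  using smooth_differentiable[OF sm, of t] by (simp add: DERIV_deriv_iff_real_differentiable)
 have pd: "partial 1 \<psi> = deriv \<psi>"
  using partial_eq[OF d\<psi>[unfolded has_field_derivative_def]] by auto
 have t': "deriv \<psi> : test_functions {0<..}" using test_partial[OF \<psi>, of 1] by (simp add: pd)
 obtain B where B: "!!t. \<bar>\<psi> t\<bar> <= B" using test_bounded[OF \<psi>] by (metis real_norm_def)
 obtain B' where B': "!!t. \<bar>deriv \<psi> t\<bar> <= B'" using test_bounded[OF t'] by (metis real_norm_def)
 define R where "R = a + h"
 have m: "\<psi> : borel_measurable ?M" "deriv \<psi> : borel_measurable ?M" "ramp a h : borel_measurable ?M" "ramp' a h : borel_measurable ?M"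
  by (intro measurable_lborel_imp_lebesgue_on test_measurable[OF \<psi>] test_measurable[OF t'] ramp_measurable)+
 have i1: "integrable ?M (%t. deriv \<psi> t * ramp a h t)"
 proof (rule bounded_support_time_integrable[of _ "B' * 1" R])
  show "\<bar>deriv \<psi> t * ramp a h t\<bar> <= B' * 1" for t
   unfolding abs_mult using B'[of t] order_trans[OF abs_ge_zero B'[of t]] ramp_bounds[of a h t] by (intro mult_mono) auto
  show "(%t. deriv \<psi> t * ramp a h t) : borel_measurable ?M" by (intro borel_measurable_times m)
 qed (use h in \<open>auto simp: ramp_values R_def\<close>)
 have i2: "integrable ?M (%t. \<psi> t * ramp' a h t)"
 proof (rule bounded_support_time_integrable[of _ "B * (1 / h)" R])
  show "\<bar>\<psi> t * ramp' a h t\<bar> <= B * (1 / h)" for t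
   unfolding abs_mult using B[of t] order_trans[OF abs_ge_zero B[of t]] h by (intro mult_mono) (auto simp: ramp'_def)
  show "(%t. \<psi> t * ramp' a h t) : borel_measurable ?M" by (intro borel_measurable_times m)
 qed (use h in \<open>auto simp: ramp'_def R_def\<close>)
 let ?F = "%t. deriv \<psi> t * ramp a h t + \<psi> t * ramp' a h t"
 have "(?F has_integral (\<psi> R * ramp a h R - \<psi> 0 * ramp a h 0)) {0..R}"
 proof (rule fundamental_theorem_of_calculus_interior_strong[of "{a, a + h}"])
  fix t assume "t : {0<..<R} - {a, a + h}"
  then have "((%t. \<psi> t * ramp a h t) has_real_derivative deriv \<psi> t * ramp a h t + ramp' a h t * \<psi> t) (at t)"
   by (intro DERIV_mult d\<psi> ramp_derivative h) auto
  then show "((%t. \<psi> t * ramp a h t) has_vector_derivative ?F t) (at t)"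
   by (simp add: has_real_derivative_iff_has_vector_derivative mult.commute)
 next
  show "continuous_on {0..R} (%t. \<psi> t * ramp a h t)"
   by (intro continuous_intros smooth_continuous sm ramp_continuous h)
 qed (use a h in \<open>auto simp: R_def\<close>)
 moreover have "\<psi> 0 = 0"
  using \<psi> closure_subset[of "{z. \<psi> z \<noteq> 0}"] by (force simp: test_functions_def)
 moreover have "ramp a h R = 0" using h by (simp add: ramp_values R_def)
 ultimately have "(?F has_integral 0) {0..R}" by simp
 then have "((%t. if t : {0..R} then ?F t else 0) has_integral 0) UNIV" by (simp only: has_integral_restrict_UNIV)
 moreover have "(%t. if t : {0..R} then ?F t else 0) = (%t. if t : {0..} then ?F t else 0)"
  using h by (auto simp: ramp_values ramp'_def R_def fun_eq_iff)
 ultimately have "((%t. if t : {0..} then ?F t else 0) has_integral 0) UNIV" by (simp only:)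
 then have "(?F has_integral 0) {0..}" by (simp only: has_integral_restrict_UNIV)
 moreover have "(?F has_integral (LINT t|?M. ?F t)) {0..}"
  using i1 i2 by (intro has_integral_integral_lebesgue_on) auto
 ultimately have "(LINT t|?M. ?F t) = 0" by (rule has_integral_unique[symmetric])
 then show ?thesis using i1 i2 by simp
qed

lemma ramp_test_field:
 assumes w: "w : H1_sigma" and h: "h > 0" and a: "a \<ge> 0"
 shows "has_time_deriv (%t z. ramp a h t *. w z) (%t z. ramp' a h t *. w z)"
 unfolding has_time_deriv_def
proof (intro conjI allI ballI impI)
 have wH: "w : Hs 1" using w by (simp add: solenoidal_def)
 show "(%t z. ramp a h t *. w z) : time_L2 {0..} H1_sigma (Hs_norm 1)"
  by (rule time_profile_L2[OF w ramp_measurable(1), of _ _ 1 "a + h"]) (use ramp_bounds[of a h] h in \<open>auto simp: ramp_values\<close>)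
 show "(%t z. ramp' a h t *. w z) : time_L2 {0..} H1_sigma (Hs_norm 1)"
  by (rule time_profile_L2[OF w ramp_measurable(2), of _ _ "1 / h" "a + h"]) (use h in \<open>auto simp: ramp'_def\<close>)
 fix t :: real assume "0 <= t"
 show "(%z. ramp a h t *. w z) : H1_sigma" by (rule L2_sigma_scaleR[OF w])
 have "(ramp a h \<longlongrightarrow> ramp a h t) (at t within {0..})"
  using ramp_continuous[OF h, of "{0..}" a] \<open>0 <= t\<close> by (simp add: continuous_on_def)
 then have "((%r. \<bar>ramp a h r - ramp a h t\<bar> * Hs_norm 1 w) \<longlongrightarrow> \<bar>ramp a h t - ramp a h t\<bar> * Hs_norm 1 w) (at t within {0..})"
  by (intro tendsto_intros)
 then show "((%r. Hs_norm 1 (%z. ramp a h r *. w z - ramp a h t *. w z)) \<longlongrightarrow> 0) (at t within {0..})"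
  by (simp add: scaleR_diff_left[symmetric] Hs_norm_1_scaleR[OF wH])
next
 fix \<psi> :: "real => real" and g :: field
 assume \<psi>: "\<psi> : test_functions {0<..}"
 have "ip (%z. c *. w z) g = c * ip w g" for c by (simp add: L2_inner_def)
 then show "(LINT t|lebesgue_on {0..}. deriv \<psi> t * ip (%z. ramp a h t *. w z) g) =
   - (LINT t|lebesgue_on {0..}. \<psi> t * ip (%z. ramp' a h t *. w z) g)"
  using ramp_weak_derivative[OF h a \<psi>] by (simp add: mult.assoc[symmetric])
qed

lemma integral_support_extend:
 fixes f :: "real => real"
 assumes "!!t. t > b ==> f t = 0" "b <= T"
 shows "(LINT t|lebesgue_on {0..T}. f t) = (LINT t|lebesgue_on {0..b}. f t)"
proof -
 have "(LINT t|lebesgue_on {0..b}. f t) = (LINT t|lebesgue_on {0..T}. (if t : {0..b} then f t else 0))"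
  using assms(2) by (intro integral_restrict[symmetric]) auto
 also have "... = (LINT t|lebesgue_on {0..T}. f t)"
  by (intro bochner_cong refl) (use assms(1) in auto)
 finally show ?thesis by simp
qed

text \<open>
 Testing against a ramp times a fixed field \<open>w\<close> and letting the ramp become a step gives the
 evolution of \<open>\<langle>u(t), w\<rangle>\<close>, by weak continuity.
\<close>

lemma leray_stationary_test:
 assumes ler: "leray_solution a \<epsilon> u0 u" and w: "w : H1_sigma" and K0: "0 <= K"
  and K: "!!i. i : Basis ==> AE z in \<mu>. norm (weak_deriv [i] w z) <= K"
  and t: "0 <= t"
 defines "E \<equiv> %r. 2 * a * sqrt \<epsilon> * boundary_inner (u r) w + 2 * \<epsilon> * strain_inner (u r) w - trilinear (u r) w (u r)"
 shows "integrable (lebesgue_on {0..T}) E"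
  and "ip (u t) w = ip (u 0) w - (LINT r|lebesgue_on {0..t}. E r)"
proof -
 have wH: "w : Hs 1" using w by (simp add: solenoidal_def)
 have u2: "u : time_L2 {0..T} H1_sigma (Hs_norm 1)" if "T > 0" for T using ler that by (simp add: leray_solution_def)
 have tri_form: "H1_form (%f g. trilinear f w g)" by (rule H1_form_trilinear[OF wH _ K0]) (rule K)
 have tri_int: "integrable \<mu> (%z. (\<Sum>i\<in>Basis. (f z \<bullet> i) *. weak_deriv [i] w z) \<bullet> f z)"
  if "f : L2 \<mu>" for f
  by (rule trilinear_integrable(1)[OF wH _ that that]) (rule K)
 define bb where "bb r = boundary_inner (u r) w" for r
 define ss where "ss r = strain_inner (u r) w" for r
 define tt where "tt r = trilinear (u r) w (u r)" for r
 define U where "U r = ip (u r) w" for r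
 have Edef: "E r = 2 * a * sqrt \<epsilon> * bb r + 2 * \<epsilon> * ss r - tt r" for r by (simp add: E_def bb_def ss_def tt_def)
 have int: "integrable (lebesgue_on {0..T}) bb" "integrable (lebesgue_on {0..T}) ss" "integrable (lebesgue_on {0..T}) tt" if T: "T > 0" for T
  unfolding bb_def[abs_def] ss_def[abs_def] tt_def[abs_def]
  by (rule H1_form_time_integrable(2)[OF H1_form_boundary u2[OF T] wH], rule H1_form_time_integrable(2)[OF H1_form_strain u2[OF T] wH],
   rule H1_form_time_integrable(1)[OF tri_form u2[OF T] wH])
 have intE': "integrable (lebesgue_on {0..T}) E" if T: "T > 0" for T
  unfolding Edef[abs_def] by (intro Bochner_Integration.integrable_add Bochner_Integration.integrable_diff integrable_mult_right int[OF T])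
 show intE: "integrable (lebesgue_on {0..T}) E" for T
 proof (cases "T > 0")
  case True then show ?thesis by (rule intE')
 next
  case False
  then have "{0..T} \<subseteq> {0..1}" by auto
  show ?thesis by (rule time_subinterval[OF intE'[OF zero_less_one] \<open>{0..T} \<subseteq> {0..1}\<close>])
 qed
 have Uc: "continuous_on {0..} U"
  using ler Hs_1_L2[OF wH] by (simp add: leray_solution_def weakly_continuous_def U_def[abs_def])
 \<comment> \<open>the weak formulation for a ramp of width \<open>h\<close>\<close>
 have ramp_id: "(LINT r|lebesgue_on {0..t + 1}. - ramp' t h r * U r) + (LINT r|lebesgue_on {0..t + 1}. ramp t h r * E r) = U 0"
  if h: "0 < h" "h <= 1" for h
 proof -
  let ?\<phi> = "%r z. ramp t h r *. w z" and ?\<phi>' = "%r z. ramp' t h r *. w z"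
  have td: "has_time_deriv ?\<phi> ?\<phi>'" by (rule ramp_test_field[OF w h(1) t])
  have rm: "ramp t h : borel_measurable (lebesgue_on {0..T})" "ramp' t h : borel_measurable (lebesgue_on {0..T})" for T
   by (intro measurable_lborel_imp_lebesgue_on ramp_measurable)+
  have uH: "AE r in lebesgue_on {0..T}. u r : Hs 1" if T: "T > 0" for T
  proof -
   obtain S :: "nat => real => field"
    where "AE r in lebesgue_on {0..T}. u r : H1_sigma \<and> (%n. Hs_norm 1 (%z. S n r z - u r z)) ~~> 0"
    using u2[OF T] unfolding time_L2_def strongly_measurable_def by blast
   then show ?thesis by eventually_elim (simp add: solenoidal_def)
  qed
  have mult_int: "integrable (lebesgue_on {0..T}) (%r. ramp t h r * f r)" if "integrable (lebesgue_on {0..T}) f" for f and T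
  proof (rule Bochner_Integration.integrable_bound[OF that])
   show "AE r in lebesgue_on {0..T}. norm (ramp t h r * f r) <= norm (f r)"
    using ramp_bounds[of t h] by (intro AE_I2) (simp add: abs_mult mult_left_le_one_le)
  qed (use rm that in auto)
  let ?X = "%T. - (LINT r|lebesgue_on {0..T}. ip (u r) (?\<phi>' r))
      + 2 * a * sqrt \<epsilon> * (LINT r|lebesgue_on {0..T}. boundary_inner (u r) (?\<phi> r))
      + 2 * \<epsilon> * (LINT r|lebesgue_on {0..T}. strain_inner (u r) (?\<phi> r))
      - (LINT r|lebesgue_on {0..T}. trilinear (u r) (?\<phi> r) (u r))"
  have lim: "(?X \<longlongrightarrow> ip (u 0) (?\<phi> 0)) at_top"
   using ler td unfolding leray_solution_def by blast
  have "?X T = (LINT r|lebesgue_on {0..t + 1}. - ramp' t h r * U r) + (LINT r|lebesgue_on {0..t + 1}. ramp t h r * E r)" if T: "T \<ge> t + 1" for T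
  proof -
   have T0: "T > 0" using t T by linarith
   note i = int[OF T0]
   have 1: "(LINT r|lebesgue_on {0..T}. ip (u r) (?\<phi>' r)) = (LINT r|lebesgue_on {0..T}. ramp' t h r * U r)"
    by (simp add: U_def L2_inner_def)
   have 2: "(LINT r|lebesgue_on {0..T}. boundary_inner (u r) (?\<phi> r)) = (LINT r|lebesgue_on {0..T}. ramp t h r * bb r)"
   proof (rule integral_AE_cong_time)
    show "AE r in lebesgue_on {0..T}. boundary_inner (u r) (?\<phi> r) = ramp t h r * bb r"
     using uH[OF T0] by eventually_elim (simp add: bb_def H1_form_scaleR_right[OF H1_form_boundary wH])
   qed (use i rm in auto)
   have 3: "(LINT r|lebesgue_on {0..T}. strain_inner (u r) (?\<phi> r)) = (LINT r|lebesgue_on {0..T}. ramp t h r * ss r)"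
   proof (rule integral_AE_cong_time)
    show "AE r in lebesgue_on {0..T}. strain_inner (u r) (?\<phi> r) = ramp t h r * ss r"
     using uH[OF T0] by eventually_elim (simp add: ss_def H1_form_scaleR_right[OF H1_form_strain wH])
   qed (use i rm in auto)
   have 4: "(LINT r|lebesgue_on {0..T}. trilinear (u r) (?\<phi> r) (u r)) = (LINT r|lebesgue_on {0..T}. ramp t h r * tt r)"
   proof (rule integral_AE_cong_time)
    show "AE r in lebesgue_on {0..T}. trilinear (u r) (?\<phi> r) (u r) = ramp t h r * tt r"
     using uH[OF T0]
    proof eventually_elim
     case (elim r)
     have fL: "u r : L2 \<mu>" by (rule Hs_1_L2[OF elim])
     let ?c = "ramp t h r"
     have "AE z in \<mu>. \<forall>i\<in>Basis. weak_deriv [i] (?\<phi> r) z = ?c *. weak_deriv [i] w z"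
      by (intro AE_finite_allI weak_deriv_scaleR[OF wH]) auto
     then have ae: "AE z in \<mu>. (\<Sum>i\<in>Basis. (u r z \<bullet> i) *. weak_deriv [i] (?\<phi> r) z) \<bullet> u r z
       = ?c * ((\<Sum>i\<in>Basis. (u r z \<bullet> i) *. weak_deriv [i] w z) \<bullet> u r z)"
      by eventually_elim (simp add: sum_Basis_point Basis_point inner_add_left distrib_left mult_ac)
     have m: "(%z. (\<Sum>i\<in>Basis. (u r z \<bullet> i) *. weak_deriv [i] (?\<phi> r) z) \<bullet> u r z) : borel_measurable \<mu>"
      using L2_measurable[OF fL] L2_measurable[OF Hs_1_weak_deriv(2)[OF Hs_1_scaleR[OF wH]]]
      by (intro borel_measurable_inner borel_measurable_sum borel_measurable_scaleR borel_measurable_const) auto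
     show ?case unfolding tt_def trilinear_def
      by (subst integral_cong_AE[OF m _ ae]) (use tri_int[OF fL] in auto)
    qed
   qed (use i rm in auto)
   have "?X T = (LINT r|lebesgue_on {0..T}. - ramp' t h r * U r) + (LINT r|lebesgue_on {0..T}. ramp t h r * E r)"
   proof -
    have "(LINT r|lebesgue_on {0..T}. ramp t h r * E r) = (LINT r|lebesgue_on {0..T}. 2 * a * sqrt \<epsilon> * (ramp t h r * bb r) + 2 * \<epsilon> * (ramp t h r * ss r) - ramp t h r * tt r)"
     by (simp add: Edef algebra_simps)
    also have "... = 2 * a * sqrt \<epsilon> * (LINT r|lebesgue_on {0..T}. ramp t h r * bb r) + 2 * \<epsilon> * (LINT r|lebesgue_on {0..T}. ramp t h r * ss r) - (LINT r|lebesgue_on {0..T}. ramp t h r * tt r)"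
     using mult_int[OF i(1)] mult_int[OF i(2)] mult_int[OF i(3)]
     by (subst Bochner_Integration.integral_diff, simp, simp, subst Bochner_Integration.integral_add) simp_all
    finally show ?thesis unfolding 1 2 3 4 by simp
   qed
   also have "(LINT r|lebesgue_on {0..T}. - ramp' t h r * U r) = (LINT r|lebesgue_on {0..t + 1}. - ramp' t h r * U r)"
    by (rule integral_support_extend) (use T h in \<open>auto simp: ramp'_def\<close>)
   also have "(LINT r|lebesgue_on {0..T}. ramp t h r * E r) = (LINT r|lebesgue_on {0..t + 1}. ramp t h r * E r)"
    by (rule integral_support_extend) (use T h in \<open>auto simp: ramp_values\<close>)
   finally show ?thesis .
  qed
  then have "\<forall>\<^sub>F T in at_top. ?X T = (LINT r|lebesgue_on {0..t + 1}. - ramp' t h r * U r) + (LINT r|lebesgue_on {0..t + 1}. ramp t h r * E r)"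
   unfolding eventually_at_top_linorder by blast
  then have "(?X \<longlongrightarrow> (LINT r|lebesgue_on {0..t + 1}. - ramp' t h r * U r) + (LINT r|lebesgue_on {0..t + 1}. ramp t h r * E r)) at_top"
   by (rule tendsto_eventually)
  from tendsto_unique[OF _ this lim] show ?thesis
   using h t by (simp add: U_def ramp_values)
 qed
 \<comment> \<open>shrink the ramp\<close>
 define h where "h n = 1 / real (Suc n)" for n
 have h: "0 < h n" "h n <= 1" for n by (auto simp: h_def divide_simps)
 have hl: "h ~~> 0" unfolding h_def by (rule inverse_Suc_tendsto)
 let ?M = "lebesgue_on {0..t + 1}"
 have mass: "integrable ?M (%r. - ramp' t (h n) r)" "(LINT r|?M. - ramp' t (h n) r) = 1" for n
 proof -
  have eq: "(%r. - ramp' t (h n) r) = (%r. (1 / h n) * indicat_real {t<..<t + h n} r)"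
   by (auto simp: ramp'_def indicator_def)
  have i: "integrable lebesgue (%r. indicat_real {0..t + 1} r *. ((1 / h n) * indicat_real {t<..<t + h n} r))"
   "(LINT r|lebesgue. indicat_real {0..t + 1} r *. ((1 / h n) * indicat_real {t<..<t + h n} r)) = 1"
  proof -
   have e: "(%r. indicat_real {0..t + 1} r *. ((1 / h n) * indicat_real {t<..<t + h n} r)) = (%r. (1 / h n) * indicat_real {t<..<t + h n} r)"
    using t h[of n] by (auto simp: indicator_def)
   show "integrable lebesgue (%r. indicat_real {0..t + 1} r *. ((1 / h n) * indicat_real {t<..<t + h n} r))"
    unfolding e using lmeasurable_box[of t "t + h n"] by (intro integrable_mult_right) (simp add: lmeasurable_iff_integrable)
   show "(LINT r|lebesgue. indicat_real {0..t + 1} r *. ((1 / h n) * indicat_real {t<..<t + h n} r)) = 1"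
    unfolding e using h[of n] by simp
  qed
  show "integrable ?M (%r. - ramp' t (h n) r)" unfolding eq using i(1) by (subst integrable_restrict_space) auto
  show "(LINT r|?M. - ramp' t (h n) r) = 1" unfolding eq using i(2) by (subst integral_restrict_space) auto
 qed
 have Um: "U : borel_measurable ?M"
  by (rule continuous_imp_measurable_on_sets_lebesgue[OF continuous_on_subset[OF Uc]]) auto
 have lim1: "(%n. LINT r|?M. - ramp' t (h n) r * U r) ~~> U t"
 proof (rule LIMSEQ_I)
  fix e :: real assume e: "e > 0"
  obtain d where d: "d > 0" "!!r. 0 <= r ==> dist r t < d ==> dist (U r) (U t) < e / 2"
   using Uc t e unfolding continuous_on_iff by (metis atLeast_iff half_gt_zero)
  obtain N where N: "!!n. n \<ge> N ==> h n < d" using LIMSEQ_D[OF hl d(1)] h(1) by (auto simp: abs_less_iff)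
  show "\<exists>N. \<forall>n\<ge>N. norm ((LINT r|?M. - ramp' t (h n) r * U r) - U t) < e"
  proof (intro exI allI impI)
   fix n assume n: "N <= n"
   have near: "norm (- ramp' t (h n) r * (U r - U t)) <= - ramp' t (h n) r * (e / 2)" for r
   proof (cases "t < r \<and> r < t + h n")
    case True
    then have "\<bar>U r - U t\<bar> <= e / 2" using d(2)[of r] N[OF n] t by (auto simp: dist_real_def)
    then show ?thesis using True h(1)[of n] by (simp add: ramp'_def abs_mult field_simps)
   next
    case False then show ?thesis by (auto simp: ramp'_def)
   qed
   have iD: "integrable ?M (%r. - ramp' t (h n) r * (U r - U t))"
   proof (rule Bochner_Integration.integrable_bound)
    show "integrable ?M (%r. - ramp' t (h n) r * (e / 2))" using mass(1) by (intro integrable_mult_left)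
    show "AE r in ?M. norm (- ramp' t (h n) r * (U r - U t)) <= norm (- ramp' t (h n) r * (e / 2))"
     using near by (intro AE_I2) (metis abs_ge_self order_trans real_norm_def)
    show "(%r. - ramp' t (h n) r * (U r - U t)) : borel_measurable ?M"
     using Um measurable_lborel_imp_lebesgue_on[OF ramp_measurable(2)] by measurable
   qed
   have "(LINT r|?M. - ramp' t (h n) r * U r) = (LINT r|?M. - ramp' t (h n) r * (U r - U t) + - ramp' t (h n) r * U t)"
    by (simp add: algebra_simps)
   also have "... = (LINT r|?M. - ramp' t (h n) r * (U r - U t)) + (LINT r|?M. - ramp' t (h n) r * U t)"
    by (rule Bochner_Integration.integral_add[OF iD integrable_mult_left[OF mass(1)]])
   also have "(LINT r|?M. - ramp' t (h n) r * U t) = (LINT r|?M. - ramp' t (h n) r) * U t"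
    by (rule Bochner_Integration.integral_mult_left) (rule mass(1))
   finally have "(LINT r|?M. - ramp' t (h n) r * U r) - U t = (LINT r|?M. - ramp' t (h n) r * (U r - U t))" using mass(2) by simp
   also have "norm ... <= (LINT r|?M. - ramp' t (h n) r * (e / 2))"
    by (rule Bochner_Integration.integral_norm_bound_integral[OF iD integrable_mult_left[OF mass(1)] near])
   also have "... = (LINT r|?M. - ramp' t (h n) r) * (e / 2)"
    by (rule Bochner_Integration.integral_mult_left) (rule mass(1))
   finally show "norm ((LINT r|?M. - ramp' t (h n) r * U r) - U t) < e" using mass(2) e by simp
  qed
 qed
 have lim2: "(%n. LINT r|?M. ramp t (h n) r * E r) ~~> (LINT r|?M. (if r : {0..t} then E r else 0))"
 proof (rule integral_dominated_convergence)
  have Em: "E : borel_measurable ?M" using intE by auto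
  show "integrable ?M (%r. norm (E r))" using intE by auto
  show "(%r. ramp t (h n) r * E r) : borel_measurable ?M" for n
   using Em measurable_lborel_imp_lebesgue_on[OF ramp_measurable(1)] by measurable
  have "(%r. indicat_real {0..t} r * E r) : borel_measurable ?M"
   by (intro borel_measurable_times Em measurable_lborel_imp_lebesgue_on) simp
  moreover have "(%r. indicat_real {0..t} r * E r) = (%r. if r : {0..t} then E r else 0)" by (auto simp: indicator_def)
  ultimately show "(%r. if r : {0..t} then E r else 0) : borel_measurable ?M" by simp
  show "AE r in ?M. norm (ramp t (h n) r * E r) <= norm (E r)" for n
   using ramp_bounds[of t "h n"] by (intro AE_I2) (simp add: abs_mult mult_left_le_one_le)
  show "AE r in ?M. (%n. ramp t (h n) r * E r) ~~> (if r : {0..t} then E r else 0)"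
  proof (rule AE_I2)
   fix r assume "r : space ?M"
   then have r: "0 <= r" by simp
   show "(%n. ramp t (h n) r * E r) ~~> (if r : {0..t} then E r else 0)"
   proof (cases "r <= t")
    case True then show ?thesis using r h by (simp add: ramp_values)
   next
    case False
    then have "r - t > 0" by simp
    from LIMSEQ_D[OF hl this] obtain N where N: "!!n. n \<ge> N ==> h n < r - t" using h(1) by (auto simp: abs_less_iff)
    then have "ramp t (h n) r = 0" if "n \<ge> N" for n using that h(1)[of n] by (force simp: ramp_values)
    then have "\<forall>\<^sub>F n in sequentially. ramp t (h n) r * E r = 0" by (auto intro: eventually_sequentiallyI[of N])
    then show ?thesis using False by (auto intro: tendsto_eventually)
   qed
  qed
 qed
 have "(%n. U 0) ~~> U t + (LINT r|?M. (if r : {0..t} then E r else 0))"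
  using tendsto_add[OF lim1 lim2] by (simp only: ramp_id[OF h])
 then have "U 0 = U t + (LINT r|?M. (if r : {0..t} then E r else 0))" by (simp add: LIMSEQ_const_iff)
 also have "(LINT r|?M. (if r : {0..t} then E r else 0)) = (LINT r|lebesgue_on {0..t}. E r)"
  by (rule integral_restrict) auto
 finally show "ip (u t) w = ip (u 0) w - (LINT r|lebesgue_on {0..t}. E r)"
  by (simp add: U_def)
qed

section \<open>Regularity of the Euler flow\<close>

lemma L2_cong: "(!!z. z : space M ==> f z = g z) ==> f : L2 M \<longleftrightarrow> g : L2 M"
 unfolding L2_def using measurable_cong[of M f g borel]
  Bochner_Integration.integrable_cong[of M M "%z. (norm (f z))^2" "%z. (norm (g z))^2"] by simp

text \<open>Bounds in \<open>L\<^sup>2\<close> survive pointwise limits, by Fatou's lemma.\<close>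

lemma L2_fatou:
 fixes f :: "'x => 'b::euclidean_space"
 assumes F: "!!n. F n : L2 M" "!!n. L2_norm M (F n) <= c" and lim: "!!z. z : space M ==> (%n. F n z) ~~> f z"
 shows "f : L2 M" "L2_norm M f <= c"
proof -
 have fm: "f : borel_measurable M" by (rule borel_measurable_LIMSEQ_metric[OF L2_measurable[OF F(1)] lim])
 have c: "0 <= c" by (rule order_trans[OF L2_norm_nonneg F(2)[of 0]])
 have "(\<integral>\<^sup>+z. ennreal ((norm (f z))^2) \<partial>M) = (\<integral>\<^sup>+z. liminf (%n. ennreal ((norm (F n z))^2)) \<partial>M)"
 proof (rule nn_integral_cong)
  fix z assume "z : space M"
  then have "(%n. ennreal ((norm (F n z))^2)) ~~> ennreal ((norm (f z))^2)" by (intro tendsto_ennrealI tendsto_intros lim)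
  then show "ennreal ((norm (f z))^2) = liminf (%n. ennreal ((norm (F n z))^2))" by (rule lim_imp_Liminf[symmetric, rotated]) simp
 qed
 also have "... <= liminf (%n. \<integral>\<^sup>+z. ennreal ((norm (F n z))^2) \<partial>M)"
  by (rule nn_integral_liminf) (use L2_measurable[OF F(1)] in measurable)
 also have "... <= limsup (%n. \<integral>\<^sup>+z. ennreal ((norm (F n z))^2) \<partial>M)"
  by (rule Liminf_le_Limsup) simp
 also have "... <= ennreal (c\<^sup>2)"
 proof (rule Limsup_bounded, rule always_eventually, rule allI)
  fix n
  have "(L2_norm M (F n))^2 <= c\<^sup>2" by (rule power_mono[OF F(2) L2_norm_nonneg])
  then show "(\<integral>\<^sup>+z. ennreal ((norm (F n z))^2) \<partial>M) <= ennreal (c\<^sup>2)"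
   unfolding nn_integral_sq_L2[OF F(1)] by (rule ennreal_leI)
 qed
 finally show "f : L2 M" "L2_norm M f <= c" using L2_nn_integral_bound[OF fm _ c] by auto
qed

text \<open>
 The Sobolev bound on the Euler flow holds at almost every time only. It is carried over to every time by
 approximation with good times.
\<close>

lemma AE_time_dense:
 assumes T: "0 < T" and P: "AE t in lebesgue_on {0..T}. P t" and t: "t : {0..T}"
 obtains x where "!!n. x n : {0..T}" "!!n. P (x n)" "x ~~> (t::real)"
proof -
 have "AE r in lebesgue. r : {0..T} \<longrightarrow> P r" using P by (subst (asm) AE_restrict_space_iff) auto
 then obtain N where N: "N : null_sets lebesgue" "{r : space lebesgue. \<not> (r : {0..T} \<longrightarrow> P r)} \<subseteq> N"
  unfolding eventually_ae_filter by blast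
 have ex: "\<exists>r. r : {0..T} \<and> P r \<and> dist r t < e" if e: "e > 0" for e
 proof (rule ccontr)
  assume no: "\<not> ?thesis"
  let ?J = "{max 0 (t - e)<..<min T (t + e)}"
  have "?J \<subseteq> N"
  proof
   fix r assume r: "r : ?J"
   then have "r : {0..T}" "dist r t < e" by (auto simp: dist_real_def)
   then show "r : N" using no N(2) by auto
  qed
  then have "negligible ?J" using N(1) negligible_iff_null_sets negligible_subset by blast
  moreover have "?J \<noteq> {}" using t T e by auto
  ultimately show False using open_not_negligible[of ?J] by auto
 qed
 have "\<forall>n. \<exists>r. r : {0..T} \<and> P r \<and> dist r t < 1 / real (Suc n)" by (intro allI ex) simp
 then obtain x where x: "!!n. x n : {0..T} \<and> P (x n) \<and> dist (x n) t < 1 / real (Suc n)" by metis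
 have "x ~~> t"
 proof (subst tendsto_dist_iff, rule Lim_null_comparison[OF _ inverse_Suc_tendsto])
  show "\<forall>\<^sub>F n in sequentially. norm (dist (x n) t) <= 1 / real (Suc n)"
   using x by (intro always_eventually allI) (simp add: less_imp_le del: of_nat_Suc)
 qed
 then show ?thesis using x by (intro that) auto
qed

lemma continuous_slices:
 assumes "continuous_on ({0..} \<times> S) (%(t, z). F t z)"
 shows "0 <= t ==> continuous_on S (F (t::real))" "z : S ==> continuous_on {0..} (%t. F t z)"
proof -
 show "continuous_on S (F t)" if "0 <= t"
 proof -
  have "continuous_on S (%z. (%(t, z). F t z) (t, z))"
   by (rule continuous_on_compose2[OF assms]) (use that in \<open>auto intro!: continuous_intros\<close>)
  then show ?thesis by simp
 qed
 show "continuous_on {0..} (%t. F t z)" if "z : S"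
 proof -
  have "continuous_on {0..} (%t. (%(t, z). F t z) (t, z))"
   by (rule continuous_on_compose2[OF assms]) (use that in \<open>auto intro!: continuous_intros\<close>)
  then show ?thesis by simp
 qed
qed

text \<open>
 The mollified weak derivatives converge pointwise to the classical one, and mollification does not increase
 the norm.
\<close>

lemma classical_gradient_L2:
 fixes f :: "point => 'b::euclidean_space"
 assumes f: "C1_up f D" and g: "has_weak_deriv [i] f g" and i: "i : Basis"
 shows "(%z. D z i) : L2 \<mu>" "nrm (%z. D z i) <= nrm g"
proof -
 have gL: "g : L2 \<mu>" using g by (simp add: has_weak_deriv_def)
 have n: "nrm (mollify (upward_kernel n) (rep g)) <= nrm g" for n
  using L2_norm_half_plane_le[OF mollify_L2(1)[OF averaging_upward_kernel[of n] rep(1)[OF gL]]]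
   mollify_L2(2)[OF averaging_upward_kernel[of n] rep(1)[OF gL]] rep_L2_norm[OF gL] by linarith
 have l: "(%n. mollify (upward_kernel n) (rep g) z) ~~> D z i" if "z : space \<mu>" for z
  by (rule mollify_pointwise_limit[OF f g i]) (use that closure_subset[of \<Omega>] in auto)
 show "(%z. D z i) : L2 \<mu>" by (rule L2_fatou(1)[OF mollify_rep_L2[OF gL] n l])
 show "nrm (%z. D z i) <= nrm g" by (rule L2_fatou(2)[OF mollify_rep_L2[OF gL] n l])
qed

lemma linear_point: "linear D ==> D (h::point) = (\<Sum>i\<in>Basis. (h \<bullet> i) *. D i)"
proof -
 assume l: "linear D"
 have "D (\<Sum>i\<in>Basis. (h \<bullet> i) *. i) = (\<Sum>i\<in>Basis. (h \<bullet> i) *. D i)"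
  by (simp only: linear_sum[OF l] linear_cmul[OF l])
 then show ?thesis by (simp only: euclidean_representation)
qed

lemma integral_time_lborel:
 fixes f :: "real => real"
 assumes f: "integrable lborel (%r. indicator {a..b} r *. f r)"
 shows "integrable (lebesgue_on {a..b}) f" "(LINT r|lebesgue_on {a..b}. f r) = (LINT r|lborel. indicator {a..b} r *. f r)"
proof -
 have m: "(%r. indicator {a..b} r *. f r) : borel_measurable lborel" using f by (rule borel_measurable_integrable)
 show "integrable (lebesgue_on {a..b}) f"
  using f integrable_completion[OF m] by (subst integrable_restrict_space) auto
 show "(LINT r|lebesgue_on {a..b}. f r) = (LINT r|lborel. indicator {a..b} r *. f r)"
  using integral_completion[OF m] by (subst integral_restrict_space) auto
qed

text \<open>
 Integrating the Euler equation in time and pairing with a field of \<open>L\<^sup>2\<^sub>\<sigma>(\<Omega>)\<close> eliminates the pressure, since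
 the time integral of its gradient is a gradient in \<open>L\<^sup>2(\<Omega>)\<close>.
\<close>

lemma pressure_elimination:
 fixes v A g :: "real => field" and q :: "real => point => real" and x :: field
 assumes t: "0 <= t1" "t1 <= t2" and C: "0 <= C"
  and contA: "continuous_on ({0..} \<times> closure \<Omega>) (%(r, z). A r z)"
  and contg: "continuous_on ({0..} \<times> closure \<Omega>) (%(r, z). g r z)"
  and deriv: "!!r z. 0 <= r ==> z : closure \<Omega> ==> ((%r. v r z) has_vector_derivative (- A r z - g r z)) (at r within {0..})"
  and q: "!!r z. 0 <= r ==> z : closure \<Omega> ==> (q r has_derivative (%h. g r z \<bullet> h)) (at z within closure \<Omega>)"
  and AL: "!!r. r : {t1..t2} ==> A r : L2 \<mu>" "!!r. r : {t1..t2} ==> nrm (A r) <= C"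
  and vL: "v t1 : L2 \<mu>" "v t2 : L2 \<mu>"
  and x: "x : L2_sigma"
 shows "integrable (lebesgue_on {t1..t2}) (%r. ip x (A r))"
  "ip x (%z. v t2 z - v t1 z) = - (LINT r|lebesgue_on {t1..t2}. ip x (A r))"
proof -
 let ?I = "{t1..t2}" and ?M = "\<mu>"
 let ?P = "lborel \<Otimes>\<^sub>M lborel :: (real \<times> point) measure"
 have xL: "x : L2 ?M" using x by (simp add: solenoidal_def)
 define X where "X = rep x"
 have X: "X : L2 lborel" "AE z in ?M. x z = X z" "X : borel_measurable borel"
  using rep[OF xL] by (simp_all add: X_def)
 note X(3) [measurable]
 have inI: "!!r. r : ?I ==> 0 <= r" using t by auto
 note Az = continuous_slices(1)[OF contA] and Ar = continuous_on_subset[OF continuous_slices(2)[OF contA], of _ ?I]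
 note gz = continuous_slices(1)[OF contg] and gr = continuous_on_subset[OF continuous_slices(2)[OF contg], of _ ?I]
 have I0: "?I \<subseteq> {0..}" using t by auto
 define Z where "Z z = integral ?I (%r. A r z)" for z
 define G where "G z = integral ?I (%r. g r z)" for z
 have swap: "continuous_on (closure \<Omega> \<times> cbox t1 t2) (%(z, r). F r z)"
  if "continuous_on ({0..} \<times> closure \<Omega>) (%(r, z). F r z)" for F :: "real => field"
 proof -
  have "continuous_on (closure \<Omega> \<times> cbox t1 t2) (%p. (%(r, z). F r z) (snd p, fst p))"
   by (rule continuous_on_compose2[OF that]) (use I0 in \<open>auto intro!: continuous_intros\<close>)
  then show ?thesis by (simp add: split_beta')
 qed
 have Zc: "continuous_on (closure \<Omega>) Z" and Gc: "continuous_on (closure \<Omega>) G"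
  using integral_continuous_on_param[OF swap[OF contA]] integral_continuous_on_param[OF swap[OF contg]]
  unfolding Z_def[abs_def] G_def[abs_def] by simp_all
 have balance: "v t2 z - v t1 z = - Z z - G z" if z: "z : closure \<Omega>" for z
 proof -
  have "((%r. - A r z - g r z) has_integral (v t2 z - v t1 z)) ?I"
  proof (rule fundamental_theorem_of_calculus[OF t(2)])
   fix r assume r: "r : ?I"
   show "((%r. v r z) has_vector_derivative - A r z - g r z) (at r within ?I)"
    by (rule has_vector_derivative_within_subset[OF deriv[OF inI[OF r] z] I0])
  qed
  moreover have "((%r. - A r z - g r z) has_integral (- Z z - G z)) ?I"
   unfolding Z_def G_def
   by (intro has_integral_diff has_integral_neg integrable_integral integrable_continuous_interval Ar gr z I0)
  ultimately show ?thesis by (rule has_integral_unique)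
 qed
 define a where "a p = indicator (?I \<times> \<Omega>) p *. A (fst p) (snd p)" for p :: "real \<times> point"
 have aA: "a (r, z) = indicator ?I r *. (indicator \<Omega> z *. A r z)" for r z by (simp add: a_def indicator_times)
 have am: "a : borel_measurable borel"
 proof -
  have "?I \<times> \<Omega> \<subseteq> {0..} \<times> closure \<Omega>" using I0 closure_subset[of \<Omega>] by auto
  from continuous_on_subset[OF contA this] have "continuous_on (?I \<times> \<Omega>) (%p. A (fst p) (snd p))" by (simp add: split_beta')
  moreover have "?I \<times> \<Omega> : sets borel" by (intro borel_Times) auto
  ultimately show ?thesis unfolding a_def[abs_def] by (intro borel_measurable_continuous_on_indicator)
 qed
 then have amP [measurable]: "a : borel_measurable ?P" unfolding lborel_prod by simp
 have prod_bound: "F : L2 ?P"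
  if F: "F : borel_measurable ?P" and N: "0 <= N"
   and s: "!!r. r : ?I ==> (NN z. ennreal ((norm (F (r, z)))^2)) <= ennreal (N\<^sup>2)"
   and o: "!!r z. r \<notin> ?I ==> F (r, z) = 0" for F :: "real \<times> point => real \<times> real" and N
 proof (rule L2_nn_integral_bound(1)[OF F, of "sqrt (t2 - t1) * N"])
  have "(\<integral>\<^sup>+p. ennreal ((norm (F p))^2) \<partial>?P) = (NN r. NN z. ennreal ((norm (F (r, z)))^2))"
   by (rule lborel.nn_integral_fst[symmetric]) (use F in measurable)
  also have "... <= (NN r. ennreal (N\<^sup>2) * indicator ?I r)"
  proof (rule nn_integral_mono)
   fix r :: real
   show "(NN z. ennreal ((norm (F (r, z)))^2)) <= ennreal (N\<^sup>2) * indicator ?I r"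
    using s[of r] o[of r] by (cases "r : ?I") auto
  qed
  also have "... = ennreal (N\<^sup>2) * ennreal (t2 - t1)" using t(2) by (subst nn_integral_cmult_indicator) auto
  also have "... = ennreal ((sqrt (t2 - t1) * N)^2)" using t(2)
   by (subst ennreal_mult[symmetric]) (auto simp: power_mult_distrib mult.commute)
  finally show "(\<integral>\<^sup>+p. ennreal ((norm (F p))^2) \<partial>?P) <= ennreal ((sqrt (t2 - t1) * N)^2)" .
  show "0 <= sqrt (t2 - t1) * N" using t(2) N by simp
 qed
 have aL: "a : L2 ?P"
 proof (rule prod_bound[OF amP C])
  fix r assume r: "r : ?I"
  let ?f = "%z. indicator \<Omega> z *. A r z"
  have fm: "?f : borel_measurable borel" by (rule continuous_closure_measurable(1)[OF Az[OF inI[OF r]]])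
  have fL: "?f : L2 ?M" using AL(1)[OF r] by (rule L2_cong[THEN iffD1, rotated]) simp
  have "(NN z. ennreal ((norm (a (r, z)))^2)) = (NN z. indicator \<Omega> z * ennreal ((norm (?f z))^2))"
   by (rule nn_integral_cong) (use r in \<open>auto simp: aA indicator_def\<close>)
  also have "... = ennreal ((L2_norm ?M ?f)^2)" by (rule nn_integral_half_plane_sq[OF fL fm])
  also have "L2_norm ?M ?f = L2_norm ?M (A r)"
   unfolding L2_norm_def by (intro arg_cong[where f=sqrt] bochner_cong refl) simp
  also have "ennreal ((L2_norm ?M (A r))^2) <= ennreal (C\<^sup>2)"
   by (intro ennreal_leI power_mono AL(2)[OF r] L2_norm_nonneg)
  finally show "(NN z. ennreal ((norm (a (r, z)))^2)) <= ennreal (C\<^sup>2)" .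
 qed (simp add: aA)
 let ?X = "%p::real \<times> point. indicator ?I (fst p) *. X (snd p)"
 have XL: "?X : L2 ?P"
 proof (rule prod_bound)
  show "?X : borel_measurable ?P" by measurable
  show "0 <= L2_norm lborel X" by simp
  show "(NN z. ennreal ((norm (?X (r, z)))^2)) <= ennreal ((L2_norm lborel X)^2)" if "r : ?I" for r
   using nn_integral_sq_L2[OF X(1)] that by simp
 qed simp
 have inner_lborel: "L2_inner ?M x F = (LINT z|lborel. indicator \<Omega> z *. (X z \<bullet> F z))"
  if F: "continuous_on (closure \<Omega>) F" for F :: field
 proof -
  let ?f = "%z. indicator \<Omega> z *. F z"
  have fm [measurable]: "?f : borel_measurable borel" by (rule continuous_closure_measurable(1)[OF F])
  have "L2_inner ?M x F = L2_inner ?M X ?f"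
  proof (rule L2_inner_cong_AE)
   show "AE z in ?M. F z = ?f z" by (rule AE_I2) simp
  qed (use L2_measurable[OF xL] X(2) continuous_closure_measurable(2)[OF F] measurable_lborel_imp_lebesgue_on[OF fm]
    measurable_lborel_imp_lebesgue_on[OF X(3)] in auto)
  also have "... = (LINT z|lborel. indicator \<Omega> z *. (X z \<bullet> ?f z))"
   unfolding L2_inner_def by (rule integral_half_plane) measurable
  also have "... = (LINT z|lborel. indicator \<Omega> z *. (X z \<bullet> F z))"
   by (intro bochner_cong refl) (simp add: indicator_def)
  finally show ?thesis .
 qed
 define k where "k r z = ?X (r, z) \<bullet> a (r, z)" for r z
 have kint: "integrable ?P (case_prod k)"
  using L2_inner_integrable[OF XL aL] by (simp add: k_def split_beta')
 have kz: "(LINT z|lborel. k r z) = indicator ?I r *. L2_inner ?M x (A r)" for r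
 proof (cases "r : ?I")
  case True
  have "(LINT z|lborel. k r z) = (LINT z|lborel. indicator \<Omega> z *. (X z \<bullet> A r z))"
   using True by (intro bochner_cong refl) (simp add: k_def aA)
  also have "... = L2_inner ?M x (A r)" by (rule inner_lborel[OF Az[OF inI[OF True]], symmetric])
  finally show ?thesis using True by simp
 qed (simp add: k_def)
 have time_int: "integrable lborel (%r. indicator ?I r *. A r z)" "(LINT r|lborel. indicator ?I r *. A r z) = Z z"
  if z: "z : closure \<Omega>" for z
  using borel_integrable_atLeastAtMost'[OF Ar[OF z I0]] set_borel_integral_eq_integral(2)[OF borel_integrable_atLeastAtMost'[OF Ar[OF z I0]]]
  by (simp_all add: set_integrable_def set_lebesgue_integral_def Z_def)
 have kr: "(LINT r|lborel. k r z) = indicator \<Omega> z *. (X z \<bullet> Z z)" for z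
 proof (cases "z : \<Omega>")
  case True
  then have z: "z : closure \<Omega>" using closure_subset[of \<Omega>] by auto
  have "(LINT r|lborel. k r z) = (LINT r|lborel. X z \<bullet> (indicator ?I r *. A r z))"
   using True by (intro bochner_cong refl) (simp add: k_def aA indicator_def)
  also have "... = X z \<bullet> Z z" using time_int[OF z] by (subst integral_inner_right) auto
  finally show ?thesis using True by simp
 qed (simp add: k_def aA)
 have fub: "(LINT z|lborel. (LINT r|lborel. k r z)) = (LINT r|lborel. (LINT z|lborel. k r z))"
  by (rule lborel_pair.Fubini_integral[OF kint])
 have it: "integrable lborel (%r. indicator ?I r *. L2_inner ?M x (A r))"
  using lborel_pair.integrable_fst[OF kint] unfolding kz .
 show "integrable (lebesgue_on ?I) (%r. L2_inner ?M x (A r))" by (rule integral_time_lborel(1)[OF it])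
 have xZ: "L2_inner ?M x Z = (LINT r|lebesgue_on ?I. L2_inner ?M x (A r))"
  using fub unfolding kz kr integral_time_lborel(2)[OF it] inner_lborel[OF Zc] .
 \<comment> \<open>the time integral of the transport term is square-integrable, by the Cauchy-Schwarz inequality in time\<close>
 have ZL: "Z : L2 ?M"
 proof (rule L2_dominated[OF continuous_closure_measurable(2)[OF Zc]])
  let ?h = "%z. (LINT r|lborel. (norm (a (r, z)))^2)"
  have "integrable ?P (case_prod (%r z. (norm (a (r, z)))^2))" using L2_integrable_sq[OF aL] by (simp add: split_beta')
  then have hi: "integrable lborel ?h" by (rule lborel_pair.integrable_snd)
  then have "integrable lebesgue ?h" using integrable_completion[OF borel_measurable_integrable[OF hi]] by simp
  then have "integrable lebesgue (%z. indicat_real \<Omega> z *. ?h z)" by (rule integrable_mult_indicator[OF half_plane_lebesgue])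
  then have "integrable ?M ?h" by (subst integrable_restrict_space) simp_all
  then show "integrable ?M (%z. (t2 - t1) * ?h z)" by (rule integrable_mult_right)
  show "AE z in ?M. (norm (Z z))^2 <= (t2 - t1) * ?h z"
  proof (rule AE_I2)
   fix z assume "z : space ?M"
   then have zO: "z : \<Omega>" by simp
   then have z: "z : closure \<Omega>" using closure_subset[of \<Omega>] by auto
   let ?az = "%r. indicator ?I r *. A r z"
   have azI: "a (r, z) = ?az r" for r using zO by (simp add: aA)
   have one: "indicat_real ?I : L2 lborel" "(L2_norm lborel (indicat_real ?I))^2 = t2 - t1"
   proof -
    have e: "(%r. (norm (indicat_real ?I r))^2) = indicat_real ?I" by (auto simp: indicator_def)
    have "integrable lborel (indicat_real ?I)" using t(2) by (intro integrable_real_indicator) auto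
    moreover have "(%r. (indicat_real ?I r)^2) = indicat_real ?I" by (auto simp: indicator_def)
    ultimately show "indicat_real ?I : L2 lborel" by (simp add: L2_def)
    show "(L2_norm lborel (indicat_real ?I))^2 = t2 - t1" unfolding L2_norm_sq e using t(2) by simp
   qed
   have azL: "?az : L2 lborel"
   proof -
    have c: "continuous_on ?I (%r. (norm (A r z))^2)" by (intro continuous_intros Ar z I0)
    have "(%r. (norm (?az r))^2) = (%r. indicator ?I r *. (norm (A r z))^2)" by (auto simp: indicator_def)
    then have "integrable lborel (%r. (norm (?az r))^2)"
     using borel_integrable_atLeastAtMost'[OF c] by (simp only: set_integrable_def)
    then show ?thesis using borel_measurable_integrable[OF time_int(1)[OF z]] unfolding L2_def by blast
   qed
   have "norm (Z z) <= (LINT r|lborel. norm (?az r))" unfolding time_int(2)[OF z, symmetric] by (rule integral_norm_bound)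
   also have "... = (LINT r|lborel. norm (indicat_real ?I r) * norm (?az r))"
    by (intro bochner_cong refl) (simp add: indicator_def)
   also have "... <= L2_norm lborel (indicat_real ?I) * L2_norm lborel ?az" by (rule L2_norm_mult_le[OF one(1) azL])
   finally have "(norm (Z z))^2 <= (L2_norm lborel (indicat_real ?I) * L2_norm lborel ?az)^2" by (rule power_mono) simp
   also have "... = (t2 - t1) * ?h z" unfolding power_mult_distrib one(2) L2_norm_sq[of lborel ?az] azI ..
   finally show "(norm (Z z))^2 <= (t2 - t1) * ?h z" .
  qed
 qed
 have GL: "G : L2 ?M"
 proof -
  have "(%z. - (v t2 z - v t1 z) - Z z) : L2 ?M" by (intro L2_diff L2_uminus vL ZL)
  then show ?thesis
  proof (rule L2_cong[THEN iffD1, rotated])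
   fix z assume "z : space ?M"
   then have "z : closure \<Omega>" using closure_subset[of \<Omega>] by auto
   from balance[OF this] show "- (v t2 z - v t1 z) - Z z = G z" by simp
  qed
 qed
 \<comment> \<open>subtracting the value at the origin makes the pressure continuous in time\<close>
 define p where "p z = integral ?I (%r. q r z - q r 0)" for z
 have o: "(0::point) : closure \<Omega>" by (simp add: mem_closure_half_plane)
 have qC1: "C1_up (q r) (%z h. g r z \<bullet> h)" if "0 <= r" for r
  unfolding C1_up_def using q[OF that] by (auto intro!: continuous_intros gz that)
 have seg: "0 + s *. z : closure \<Omega>" if "s : {0..1}" "z : closure \<Omega>" for s and z :: point
  using that by (simp add: mem_closure_half_plane)
 have qline: "q r z - q r 0 = integral (cbox 0 1) (%s. g r (s *. z) \<bullet> z)" if r: "0 <= r" and z: "z : closure \<Omega>" for r z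
 proof -
  have "((%s. g r (0 + s *. z) \<bullet> z) has_integral (q r (0 + 1 *. z) - q r (0 + 0 *. z))) {0..1}"
  proof (rule fundamental_theorem_of_calculus)
   fix s :: real assume s: "s : {0..1}"
   show "((%s. q r (0 + s *. z)) has_vector_derivative g r (0 + s *. z) \<bullet> z) (at s within {0..1})"
    by (rule C1_up_line[OF qC1[OF r] _ s]) (rule seg[OF _ z])
  qed simp
  then show ?thesis by (simp add: integral_unique)
 qed
 have qc: "continuous_on ?I (%r. q r z - q r 0)" if z: "z : closure \<Omega>" for z
 proof -
  have "continuous_on (?I \<times> cbox 0 1) (%y. (%(r, z). g r z) (fst y, snd y *. z) \<bullet> z)"
  proof (intro continuous_on_inner continuous_on_const continuous_on_compose2[OF contg])
   show "continuous_on (?I \<times> cbox 0 1) (%y. (fst y, snd y *. z))" by (intro continuous_intros)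
   show "(%y. (fst y, snd y *. z)) ` (?I \<times> cbox 0 1) \<subseteq> {0..} \<times> closure \<Omega>"
    using I0 seg[OF _ z] by auto
  qed
  then have "continuous_on (?I \<times> cbox 0 1) (%(r, s). g r (s *. z) \<bullet> z)" by (simp add: split_beta')
  from integral_continuous_on_param[OF this]
  show ?thesis by (rule continuous_on_cong[THEN iffD1, OF refl, rotated]) (simp add: qline[OF inI z])
 qed
 have p: "C1_up p (%z h. G z \<bullet> h)"
  unfolding C1_up_def
 proof (intro conjI ballI allI)
  fix z :: point assume z: "z : closure \<Omega>"
  have bc: "continuous_on (closure \<Omega> \<times> cbox t1 t2) (%(z, r). blinfun_inner_right (g r z))"
   using bounded_linear.continuous_on[OF bounded_linear_blinfun_inner_right swap[OF contg]] by (simp add: split_beta')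
  have "((%z. integral (cbox t1 t2) (%r. q r z - q r 0)) has_derivative
    blinfun_apply (integral (cbox t1 t2) (%r. blinfun_inner_right (g r z)))) (at z within closure \<Omega>)"
  proof (rule leibniz_rule[OF _ _ bc z convex_closure_half_plane])
   fix w :: point and r assume w: "w : closure \<Omega>" and "r : cbox t1 t2"
   then have "0 <= r" using t by simp
   have "((%z. q r z - q r 0) has_derivative (%h. g r w \<bullet> h - 0)) (at w within closure \<Omega>)"
    by (intro has_derivative_diff q \<open>0 <= r\<close> w has_derivative_const)
   then show "((%z. q r z - q r 0) has_derivative blinfun_apply (blinfun_inner_right (g r w))) (at w within closure \<Omega>)"
    by (simp add: blinfun_inner_right.rep_eq)
  next
   fix w :: point assume "w : closure \<Omega>"
   then show "(%r. q r w - q r 0) integrable_on cbox t1 t2" using qc by (simp add: integrable_continuous_interval)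
  qed
  moreover have "blinfun_apply (integral (cbox t1 t2) (%r. blinfun_inner_right (g r z))) = (%h. G z \<bullet> h)"
  proof
   fix h
   have "continuous_on ?I (%r. blinfun_inner_right (g r z))"
    by (rule bounded_linear.continuous_on[OF bounded_linear_blinfun_inner_right gr[OF z I0]])
   then have "(%r. blinfun_inner_right (g r z)) integrable_on ?I" by (rule integrable_continuous_interval)
   from blinfun_apply_integral[OF this, of h]
   have "blinfun_apply (integral ?I (%r. blinfun_inner_right (g r z))) h = integral ?I (%r. g r z \<bullet> h)"
    by (simp add: blinfun_inner_right.rep_eq)
   also have "... = G z \<bullet> h"
    using integral_linear[OF integrable_continuous_interval[OF gr[OF z I0]] bounded_linear_inner_left[of h]]
    by (simp add: o_def G_def)
   finally show "blinfun_apply (integral (cbox t1 t2) (%r. blinfun_inner_right (g r z))) h = G z \<bullet> h" by simp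
  qed
  ultimately show "(p has_derivative (%h. G z \<bullet> h)) (at z within closure \<Omega>)" by (simp add: p_def[abs_def])
 next
  show "continuous_on (closure \<Omega>) (%z. G z \<bullet> i)" for i by (intro continuous_intros Gc)
 qed
 have orth: "L2_inner ?M x G = 0" by (rule gradient_orthogonal[OF x p GL])
 have "L2_inner ?M x (%z. v t2 z - v t1 z) = L2_inner ?M x (%z. - Z z - G z)"
  unfolding L2_inner_def
 proof (intro bochner_cong refl)
  fix z assume "z : space ?M"
  then have "z : closure \<Omega>" using closure_subset[of \<Omega>] by auto
  then show "x z \<bullet> (v t2 z - v t1 z) = x z \<bullet> (- Z z - G z)" by (simp only: balance)
 qed
 also have "... = L2_inner ?M x (%z. - Z z) - L2_inner ?M x G"
  by (rule L2_inner_diff_right[OF L2_uminus[OF ZL] GL xL])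
 also have "L2_inner ?M x (%z. - Z z) = - L2_inner ?M x Z" by (simp add: L2_inner_def)
 finally show "L2_inner ?M x (%z. v t2 z - v t1 z) = - (LINT r|lebesgue_on ?I. L2_inner ?M x (A r))"
  using orth xZ by simp
qed

text \<open>
 What the comparison uses of the Euler flow on \<open>[0, T]\<close>: \<open>K\<close> bounds the gradient pointwise, \<open>C\<close> bounds the field and
 its gradient in \<open>L\<^sup>2\<close>, and the last clause is the momentum equation, integrated in time and tested against
 solenoidal fields.
\<close>

definition regular_flow :: "real => real => real => (real => field) => (real => point => point => real \<times> real) => bool"
 where "regular_flow T K C v D \<longleftrightarrow>
  (\<forall>t\<in>{0..T}. v t : H1_sigma \<and> nrm (v t) <= C \<and> C1_up (v t) (D t) \<and> (\<forall>z. linear (D t z)) \<and>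
   (\<forall>z\<in>closure \<Omega>. \<forall>i\<in>Basis. norm (D t z i) <= K) \<and>
   (\<forall>i\<in>Basis. has_weak_deriv [i] (v t) (%z. D t z i) \<and> nrm (%z. D t z i) <= C)) \<and>
  (\<forall>z\<in>closure \<Omega>. \<forall>i\<in>Basis. continuous_on {0..T} (%t. D t z i)) \<and>
  (\<forall>t1 t2. 0 <= t1 \<longrightarrow> t1 <= t2 \<longrightarrow> t2 <= T \<longrightarrow> (\<forall>x\<in>L2_sigma.
   integrable (lebesgue_on {t1..t2}) (%r. ip x (%z. D r z (v r z))) \<and>
   ip x (%z. v t2 z - v t1 z) =
    - (LINT r|lebesgue_on {t1..t2}. ip x (%z. D r z (v r z)))))"

lemma advection_L2:
 fixes f :: field and D :: "point => point => real \<times> real"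
 assumes f: "f : L2 \<mu>" and l: "!!z. linear (D z)" and K: "!!z i. z : \<Omega> ==> i : Basis ==> norm (D z i) <= K" "0 <= K"
  and m: "!!i. i : Basis ==> (%z. D z i) : borel_measurable \<mu>"
 shows "(%z. D z (f z)) : L2 \<mu>" "nrm (%z. D z (f z)) <= 2 * K * nrm f"
proof -
 let ?M = "\<mu>"
 have e: "(%z. D z (f z)) = (%z. \<Sum>i\<in>Basis. (f z \<bullet> i) *. D z i)" by (rule ext) (rule linear_point[OF l])
 have fm: "f : borel_measurable ?M" by (rule L2_measurable[OF f])
 have meas: "(%z. D z (f z)) : borel_measurable ?M"
  unfolding e by (intro borel_measurable_sum borel_measurable_scaleR borel_measurable_inner borel_measurable_const fm m)
 have b: "norm (D z (f z)) <= norm ((2 * K) *. f z)" if "z : \<Omega>" for z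
  using transport_norm_le[of "D z" K "f z"] K(1)[OF that] K(2) by (simp add: linear_point[OF l, of z "f z"] abs_mult)
 have gL: "(%z. (2 * K) *. f z) : L2 ?M" by (rule L2_scaleR[OF f])
 show "(%z. D z (f z)) : L2 ?M"
 proof (rule L2_dominated[OF meas L2_integrable_sq[OF gL]])
  show "AE z in ?M. (norm (D z (f z)))^2 <= (norm ((2 * K) *. f z))^2"
   using b by (intro AE_I2 power_mono) auto
 qed
 have "L2_norm ?M (%z. D z (f z)) <= L2_norm ?M (%z. (2 * K) *. f z)"
  by (rule L2_norm_mono[OF meas gL]) (use b in \<open>intro AE_I2; auto\<close>)
 then show "L2_norm ?M (%z. D z (f z)) <= 2 * K * L2_norm ?M f" using K(2) by (simp add: L2_norm_scaleR)
qed

text \<open>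
 The bounds are read off the Sobolev norm at almost every time, and extended to all times by continuity of
 \<open>v\<close> and of its gradient in time.
\<close>

lemma euler_regular_flow:
 assumes s: "s > 2" and e: "euler_solution s v0 v" and T: "T > 0"
 obtains K C D where "K > 0" "C \<ge> 0" "regular_flow T K C v D"
proof -
 let ?M = "\<mu>"
 obtain Cg where Cg: "Cg > 0" "!!(f::field) D z i. f : Hs s ==> C1_up f D ==> z : closure \<Omega> ==> i : Basis ==> norm (D z i) <= Cg * Hs_norm s f"
  by (rule gradient_bound[OF s]) blast
 have "v : time_Linf {0..T} (Hs s) (Hs_norm s)" using e T by (simp add: euler_solution_def)
 then obtain S :: "nat => real => field" and C0
  where S: "AE t in lebesgue_on {0..T}. v t : Hs s \<and> (%n. Hs_norm s (%z. S n t z - v t z)) ~~> 0"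
   and C0: "AE t in lebesgue_on {0..T}. Hs_norm s (v t) <= C0"
  unfolding time_Linf_def strongly_measurable_def by blast
 define C where "C = \<bar>C0\<bar>"
 \<comment> \<open>the summand 1 makes the bound positive\<close>
 define K where "K = Cg * C + 1"
 have C: "0 <= C" by (simp add: C_def)
 have K: "0 < K" using Cg(1) C by (simp add: K_def add_nonneg_pos)
 have good: "AE t in lebesgue_on {0..T}. v t : Hs s \<and> Hs_norm s (v t) <= C"
  using S C0 by eventually_elim (auto simp: C_def)
 obtain vt :: "real => field" and Dv :: "real => point => point \<Rightarrow>\<^sub>L (real \<times> real)" and q :: "real => point => real" and gq :: "real => field"
  where contv: "continuous_on ({0..} \<times> closure \<Omega>) (%(t, z). v t z)"
   and contDv: "continuous_on ({0..} \<times> closure \<Omega>) (%(t, z). Dv t z)"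
   and contg: "continuous_on ({0..} \<times> closure \<Omega>) (%(t, z). gq t z)"
   and eq: "\<forall>t \<ge> 0. \<forall>z \<in> closure \<Omega>.
     ((%r. v r z) has_vector_derivative vt t z) (at t within {0..}) \<and>
     (v t has_derivative blinfun_apply (Dv t z)) (at z within closure \<Omega>) \<and>
     (q t has_derivative (%h. gq t z \<bullet> h)) (at z within closure \<Omega>) \<and>
     vt t z + blinfun_apply (Dv t z) (v t z) + gq t z = 0 \<and>
     (\<Sum>i\<in>Basis. blinfun_apply (Dv t z) i \<bullet> i) = 0"
   and bd: "\<forall>t \<ge> 0. \<forall>x. snd (v t (x, 0)) = 0"
  using e unfolding euler_solution_def by blast
 define D where "D t z = blinfun_apply (Dv t z)" for t z
 have lin: "linear (D t z)" for t z unfolding D_def by (rule bounded_linear.linear[OF blinfun.bounded_linear_right])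
 have contD: "continuous_on ({0..} \<times> closure \<Omega>) (%(t, z). D t z h)" for h
  using bounded_linear.continuous_on[OF blinfun.bounded_linear_left contDv, of h] by (simp add: split_beta' D_def)
 have C1: "C1_up (v t) (D t)" if "0 <= t" for t
  unfolding C1_up_def
 proof (intro conjI ballI allI)
  show "(v t has_derivative D t z) (at z within closure \<Omega>)" if "z : closure \<Omega>" for z
   using eq that \<open>0 <= t\<close> unfolding D_def by blast
  show "continuous_on (closure \<Omega>) (%z. D t z i)" for i by (rule continuous_slices(1)[OF contD that])
 qed
 have k1: "Suc 0 <= nat \<lfloor>s\<rfloor>" using s by linarith
 have gd: "norm (D t z i) <= K" "v t : L2 ?M" "L2_norm ?M (v t) <= C"
   "(%z. D t z i) : L2 ?M" "L2_norm ?M (%z. D t z i) <= C"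
  if t: "0 <= t" and g: "v t : Hs s \<and> Hs_norm s (v t) <= C" and z: "z : closure \<Omega>" and i: "i : Basis" for t z i
 proof -
  have h: "v t : Hs s" "Hs_norm s (v t) <= C" using g by auto
  have "norm (D t z i) <= Cg * Hs_norm s (v t)" by (rule Cg(2)[OF h(1) C1[OF t] z i])
  also have "... <= Cg * C" using Cg(1) h(2) by (intro mult_left_mono) auto
  finally show "norm (D t z i) <= K" by (simp add: K_def)
  show vL: "v t : L2 ?M" using h by (simp add: Hs_def)
  have "has_weak_deriv [] (v t) (v t)" using vL by (simp add: has_weak_deriv_def partials_def)
  from weak_deriv_eq[OF this] have ae: "AE z in ?M. weak_deriv [] (v t) z = v t z" by simp
  have w0: "weak_deriv [] (v t) : L2 ?M" "L2_norm ?M (weak_deriv [] (v t)) <= Hs_norm s (v t)"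
   using Hs_weak_deriv(2,3)[OF h(1), of 0 "[]"] by (auto simp: multi_indices_def)
  have "L2_norm ?M (weak_deriv [] (v t)) = L2_norm ?M (v t)"
   by (rule L2_norm_cong_AE[OF L2_measurable[OF w0(1)] L2_measurable[OF vL] ae])
  then show "L2_norm ?M (v t) <= C" using w0(2) h(2) by linarith
  have mi: "[i] : multi_indices (Suc 0)" using i by (simp add: multi_indices_def)
  note cg = classical_gradient_L2[OF C1[OF t] Hs_weak_deriv(1)[OF h(1) k1 mi] i]
  show "(%z. D t z i) : L2 ?M" by (rule cg(1))
  show "L2_norm ?M (%z. D t z i) <= C" using cg(2) Hs_weak_deriv(3)[OF h(1) k1 mi] h(2) by linarith
 qed
 have all: "norm (D t z i) <= K" "v t : L2 ?M" "L2_norm ?M (v t) <= C"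
   "(%z. D t z i) : L2 ?M" "L2_norm ?M (%z. D t z i) <= C"
  if t: "t : {0..T}" and z: "z : closure \<Omega>" and i: "i : Basis" for t z i
 proof -
  obtain x where x: "!!n. x n : {0..T}" "!!n. v (x n) : Hs s \<and> Hs_norm s (v (x n)) <= C" "x ~~> t"
   by (rule AE_time_dense[OF T good t]) blast
  have x0: "0 <= x n" for n using x(1)[of n] by simp
  note G = gd[OF x0 x(2) z i]
  have lv: "(%n. v (x n) w) ~~> v t w" if w: "w : closure \<Omega>" for w
   by (rule continuous_on_tendsto_compose[OF continuous_slices(2)[OF contv w] x(3)]) (use t x0 in auto)
  have lD: "(%n. D (x n) w i) ~~> D t w i" if w: "w : closure \<Omega>" for w
   by (rule continuous_on_tendsto_compose[OF continuous_slices(2)[OF contD w] x(3)]) (use t x0 in auto)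
  have sp: "w : closure \<Omega>" if "w : space ?M" for w using that closure_subset[of \<Omega>] by auto
  show "norm (D t z i) <= K" by (rule LIMSEQ_le_const2[OF tendsto_norm[OF lD[OF z]]]) (use G(1) in auto)
  show "v t : L2 ?M" by (rule L2_fatou(1)[OF G(2,3) lv[OF sp]])
  show "L2_norm ?M (v t) <= C" by (rule L2_fatou(2)[OF G(2,3) lv[OF sp]])
  show "(%z. D t z i) : L2 ?M" by (rule L2_fatou(1)[OF G(4,5) lD[OF sp]])
  show "L2_norm ?M (%z. D t z i) <= C" by (rule L2_fatou(2)[OF G(4,5) lD[OF sp]])
 qed
 have o: "(0::point) : closure \<Omega>" by (simp add: mem_closure_half_plane)
 have b1: "(1, 0) : (Basis::point set)" "(0, 1) : (Basis::point set)" by (auto simp: Basis_point)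
 have vL: "v t : L2 ?M" "L2_norm ?M (v t) <= C" if "t : {0..T}" for t using all(2,3)[OF that o b1(1)] .
 have wd: "has_weak_deriv [i] (v t) (%z. D t z i)" if "t : {0..T}" "i : Basis" for t i
  by (rule classical_weak_deriv[OF C1 vL(1)[OF that(1)] all(4)[OF that(1) o that(2)] that(2)]) (use that in simp)
 have H1: "v t : H1_sigma" if t: "t : {0..T}" for t
 proof -
  have t0: "0 <= t" using t by simp
  have "v t : Hs 1" using vL(1)[OF t] wd[OF t] by (subst Hs_1_iff) blast
  moreover have "tangent_to_boundary (v t)"
  proof (rule classical_tangent[OF C1[OF t0] _ _ vL(1)[OF t]])
   show "(\<Sum>i\<in>Basis. D t z i \<bullet> i) = 0" if "z : \<Omega>" for z
    using eq t0 subsetD[OF closure_subset that] unfolding D_def by blast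
   show "snd (v t (x, 0)) = 0" for x using bd t0 by blast
   show "(%z. D t z h) : L2 ?M" for h
    unfolding linear_point[OF lin, of _ _ h] sum_Basis_point by (intro L2_add L2_scaleR all(4)[OF t o] b1)
  qed
  moreover from this have "divergence_free (v t)"
   unfolding divergence_free_def tangent_to_boundary_def test_functions_def by blast
  ultimately show ?thesis by (simp add: solenoidal_def)
 qed
 define A where "A r z = D r z (v r z)" for r z
 have contA: "continuous_on ({0..} \<times> closure \<Omega>) (%(r, z). A r z)"
  using bounded_bilinear.continuous_on[OF bounded_bilinear_blinfun_apply contDv contv] by (simp add: split_beta' A_def D_def)
 have AL: "A r : L2 ?M" "L2_norm ?M (A r) <= 2 * K * C" if r: "r : {0..T}" for r
 proof -
  have m: "(%z. D r z i) : borel_measurable ?M" if "i : Basis" for i by (rule L2_measurable[OF all(4)[OF r o that]])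
  have nb: "norm (D r z i) <= K" if "z : \<Omega>" "i : Basis" for z i
   by (rule all(1)[OF r subsetD[OF closure_subset that(1)] that(2)])
  note a = advection_L2[where D="D r", OF vL(1)[OF r] lin nb less_imp_le[OF K] m]
  show "A r : L2 ?M" using a(1) by (simp add: A_def[abs_def])
  have "2 * K * L2_norm ?M (v r) <= 2 * K * C" using K vL(2)[OF r] by (intro mult_left_mono) auto
  then show "L2_norm ?M (A r) <= 2 * K * C" using a(2) by (simp add: A_def[abs_def])
 qed
 have derv: "((%r. v r z) has_vector_derivative (- A r z - gq r z)) (at r within {0..})" if "0 <= r" "z : closure \<Omega>" for r z
 proof -
  have 1: "((%r. v r z) has_vector_derivative vt r z) (at r within {0..})" and 2: "vt r z + A r z + gq r z = 0"
   using eq that unfolding A_def D_def by blast+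
  have "vt r z = (vt r z + A r z + gq r z) - A r z - gq r z" by simp
  then have "vt r z = - A r z - gq r z" unfolding 2 by simp
  then show ?thesis using 1 by simp
 qed
 have derq: "(q r has_derivative (%h. gq r z \<bullet> h)) (at z within closure \<Omega>)" if "0 <= r" "z : closure \<Omega>" for r z
  using eq that by blast
 have KC: "0 <= 2 * K * C" using K C by simp
 have bal: "integrable (lebesgue_on {t1..t2}) (%r. L2_inner ?M x (A r)) \<and>
   L2_inner ?M x (%z. v t2 z - v t1 z) = - (LINT r|lebesgue_on {t1..t2}. L2_inner ?M x (A r))"
  if t: "0 <= t1" "t1 <= t2" "t2 <= T" and x: "x : L2_sigma" for t1 t2 x
 proof -
  have sub: "r : {0..T}" if "r : {t1..t2}" for r using that t by auto
  have "t1 : {0..T}" "t2 : {0..T}" using t by auto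
  note pe = pressure_elimination[OF t(1,2) KC contA contg derv derq AL(1)[OF sub] AL(2)[OF sub] vL(1)[OF this(1)] vL(1)[OF this(2)] x]
  show ?thesis using pe by blast
 qed
 have "regular_flow T K C v D"
  unfolding regular_flow_def
 proof (intro conjI ballI allI impI)
  show "v t : H1_sigma" "L2_norm ?M (v t) <= C" if "t : {0..T}" for t using H1[OF that] vL(2)[OF that] .
  show "C1_up (v t) (D t)" if "t : {0..T}" for t using C1 that by simp
  show "linear (D t z)" for t z by (rule lin)
  show "norm (D t z i) <= K" if "t : {0..T}" "z : closure \<Omega>" "i : Basis" for t z i by (rule all(1)[OF that])
  show "has_weak_deriv [i] (v t) (%z. D t z i)" "L2_norm ?M (%z. D t z i) <= C" if "t : {0..T}" "i : Basis" for t i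
   using wd[OF that] all(5)[OF that(1) o that(2)] .
  show "continuous_on {0..T} (%t. D t z i)" if "z : closure \<Omega>" for z i
   by (rule continuous_on_subset[OF continuous_slices(2)[OF contD that]]) auto
  fix t1 t2 x assume t: "0 <= t1" "t1 <= t2" "t2 <= T" and x: "x : L2_sigma"
  show "integrable (lebesgue_on {t1..t2}) (%r. L2_inner ?M x (%z. D r z (v r z)))"
   "L2_inner ?M x (%z. v t2 z - v t1 z) = - (LINT r|lebesgue_on {t1..t2}. L2_inner ?M x (%z. D r z (v r z)))"
   using bal[OF t x] unfolding A_def[abs_def] by blast+
 qed
 then show ?thesis by (rule that[OF K C])
qed

section \<open>The relative energy inequality\<close>

lemma lebesgue_on_interval_combine:
 fixes f :: "real => real"
 assumes f: "integrable (lebesgue_on {a..c}) f" and abc: "a <= b" "b <= c"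
 shows "(LINT r|lebesgue_on {a..c}. f r) = (LINT r|lebesgue_on {a..b}. f r) + (LINT r|lebesgue_on {b..c}. f r)"
proof -
 have i: "integrable (lebesgue_on {a..b}) f" "integrable (lebesgue_on {b..c}) f"
  by (rule time_subinterval[OF f]; use abc in auto)+
 have "integral {a..b} f + integral {b..c} f = integral {a..c} f"
  by (rule Henstock_Kurzweil_Integration.integral_combine[OF abc integrable_on_lebesgue_on[OF f]]) simp
 then show ?thesis by (simp add: lebesgue_integral_eq_integral f i)
qed

lemma lebesgue_on_interval_const:
 assumes "a <= b"
 shows "integrable (lebesgue_on {a..b}) (%r. c::real)" "(LINT r|lebesgue_on {a..b}. c) = (b - a) * c"
proof -
 have i: "integrable lborel (%r. indicat_real {a..b} r *. c)"
  using assms by (intro integrable_scaleR_left) (auto intro!: integrable_real_indicator)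
 show "integrable (lebesgue_on {a..b}) (%r. c::real)" by (rule integral_time_lborel(1)[OF i])
 show "(LINT r|lebesgue_on {a..b}. c) = (b - a) * c"
  unfolding integral_time_lborel(2)[OF i] using assms by simp
qed

text \<open>
 A one-sided discrete estimate whose integrand is frozen at the two ends of a time step becomes, along finer
 and finer subdivisions, an estimate with the integrand evaluated at the current time.
\<close>

lemma telescoping_limit:
 fixes F :: "real => real" and P Q :: "real => real => real"
 assumes t: "0 < t"
  and cP: "!!r. r : {0..t} ==> continuous_on {0..t} (%s. P s r)"
  and cQ: "!!r. r : {0..t} ==> continuous_on {0..t} (%s. Q s r)"
  and bP: "!!s r. s : {0..t} ==> r : {0..t} ==> \<bar>P s r\<bar> <= C"
  and bQ: "!!s r. s : {0..t} ==> r : {0..t} ==> \<bar>Q s r\<bar> <= C"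
  and int: "!!s1 s2. 0 <= s1 ==> s1 <= s2 ==> s2 <= t ==> integrable (lebesgue_on {s1..s2}) (%r. P s2 r + Q s1 r)"
  and step: "!!s1 s2. 0 <= s1 ==> s1 <= s2 ==> s2 <= t ==> F s2 - F s1 <= (LINT r|lebesgue_on {s1..s2}. P s2 r + Q s1 r)"
 shows "integrable (lebesgue_on {0..t}) (%r. P r r + Q r r)" "F t - F 0 <= (LINT r|lebesgue_on {0..t}. P r r + Q r r)"
proof -
 let ?M = "lebesgue_on {0..t}"
 define d where "d n = t / real (Suc n)" for n
 define node where "node n k = real k * d n" for n k
 have d0: "0 < d n" for n using t by (simp add: d_def del: of_nat_Suc)
 have dlim: "d ~~> 0"
  using tendsto_mult[OF tendsto_const[of t] inverse_Suc_tendsto] by (simp add: d_def[abs_def] del: of_nat_Suc)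
 have node: "node n 0 = 0" "node n (Suc n) = t" "node n k <= node n (Suc k)" "0 <= node n k" for n k
  using t d0[of n] by (simp_all add: node_def d_def algebra_simps divide_simps)
 have node_mono: "node n j <= node n k" if "j <= k" for n j k
  unfolding node_def using that d0[of n] by (intro mult_right_mono) auto
 have node_t: "node n k <= t" if "k <= Suc n" for n k using node_mono[OF that, of n] node(2) by simp
 let ?p = "%n k r. P (node n (Suc k)) r + Q (node n k) r"
 let ?f = "%n k r. if r : {node n k..node n (Suc k)} then ?p n k r else 0"
 define S where "S n r = (\<Sum>k<Suc n. ?f n k r)" for n r
 have fi: "integrable ?M (?f n k)" and fv: "(LINT r|?M. ?f n k r) = (LINT r|lebesgue_on {node n k..node n (Suc k)}. ?p n k r)"
  if k: "k < Suc n" for n k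
 proof -
  have sub: "{node n k..node n (Suc k)} \<subseteq> {0..t}" using node(4) node_t[of "Suc k" n] k by auto
  have "integrable (lebesgue_on {node n k..node n (Suc k)}) (?p n k)"
   by (rule int) (use node node_t[of "Suc k" n] k in auto)
  then have "integrable lebesgue (?f n k)" by (subst Lebesgue_Measure.integrable_restrict_UNIV) auto
  moreover have "?f n k = (%r. if r : {0..t} then ?f n k r else 0)" using sub by (auto simp: fun_eq_iff)
  ultimately have "integrable lebesgue (%r. if r : {0..t} then ?f n k r else 0)" by (rule back_subst[of "integrable lebesgue"])
  then show "integrable ?M (?f n k)" by (rule Lebesgue_Measure.integrable_restrict_UNIV[THEN iffD1, rotated]) simp
  show "(LINT r|?M. ?f n k r) = (LINT r|lebesgue_on {node n k..node n (Suc k)}. ?p n k r)"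
   by (rule Lebesgue_Measure.integral_restrict[OF sub]) auto
 qed
 have Si: "integrable ?M (S n)" for n unfolding S_def[abs_def] by (intro Bochner_Integration.integrable_sum fi) simp
 have FS: "F t - F 0 <= (LINT r|?M. S n r)" for n
 proof -
  have "F t - F 0 = (\<Sum>k<Suc n. F (node n (Suc k)) - F (node n k))"
   by (subst sum_lessThan_telescope) (simp only: node(1,2))
  also have "... <= (\<Sum>k<Suc n. LINT r|lebesgue_on {node n k..node n (Suc k)}. ?p n k r)"
   by (intro sum_mono step) (use node node_t in auto)
  also have "... = (\<Sum>k<Suc n. LINT r|?M. ?f n k r)" by (intro sum.cong refl fv[symmetric]) simp
  also have "... = (LINT r|?M. S n r)"
   unfolding S_def by (rule Bochner_Integration.integral_sum[symmetric]) (rule fi, simp)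
  finally show ?thesis .
 qed
 define N where "N = range (%(n, k). node n k)"
 have "countable N" unfolding N_def by (intro countable_image) simp
 then have "N : null_sets lebesgue" by (intro null_sets_completionI countable_imp_null_set_lborel)
 then have "AE r in lebesgue. r \<notin> N" by (rule AE_not_in)
 then have aeN: "AE r in ?M. r \<notin> N" by (subst AE_restrict_space_iff) auto
 have Sval: "\<exists>k<Suc n. node n k < r \<and> r < node n (Suc k) \<and> S n r = ?p n k r" if r: "r : {0..t}" "r \<notin> N" for n r
 proof -
  have nN: "r \<noteq> node n k" for k using r(2) by (auto simp: N_def)
  \<comment> \<open>the time step that contains \<open>r\<close>; nodes are excluded, as they form a countable set\<close>
  define k where "k = (LEAST k. r < node n (Suc k))"
  have "r < node n (Suc n)" using r(1) nN[of "Suc n"] node(2)[of n] by simp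
  then have k: "r < node n (Suc k)" "k <= n" unfolding k_def by (rule LeastI, rule Least_le)
  have lo: "node n k < r"
  proof (cases k)
   case 0 then show ?thesis using r(1) nN[of 0] node(1)[of n] by simp
  next
   case (Suc j)
   then have "\<not> r < node n (Suc j)" unfolding k_def using not_less_Least[of j] by (metis k_def lessI)
   then show ?thesis using nN[of k] Suc by simp
  qed
  have "S n r = (\<Sum>j<Suc n. if j = k then ?p n k r else 0)"
   unfolding S_def
  proof (intro sum.cong refl)
   fix j
   consider "j < k" | "j = k" | "k < j" by linarith
   then show "?f n j r = (if j = k then ?p n k r else 0)"
   proof cases
    case 1 then show ?thesis using node_mono[of "Suc j" k n] lo by auto
   next
    case 2 then show ?thesis using lo k by auto
   next
    case 3 then show ?thesis using node_mono[of "Suc k" j n] k by auto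
   qed
  qed
  also have "... = ?p n k r" using k(2) by (subst sum.delta) auto
  finally show ?thesis using lo k by (intro exI[of _ k]) simp
 qed
 have Sb: "AE r in ?M. norm (S n r) <= 2 * C" for n
  using aeN AE_space
 proof eventually_elim
  case (elim r)
  then have r: "r : {0..t}" by simp
  obtain k where k: "k < Suc n" "S n r = ?p n k r" using Sval[OF r elim(1), of n] by blast
  have nk: "node n k : {0..t}" "node n (Suc k) : {0..t}" using node(4) node_t[of k n] node_t[of "Suc k" n] k(1) by auto
  show ?case unfolding k(2) using bP[OF nk(2) r] bQ[OF nk(1) r] by simp
 qed
 have Slim: "AE r in ?M. (%n. S n r) ~~> P r r + Q r r"
  using aeN AE_space
 proof eventually_elim
  case (elim r)
  then have r: "r : {0..t}" by simp
  have "\<forall>n. \<exists>k. k < Suc n \<and> node n k < r \<and> r < node n (Suc k) \<and> S n r = ?p n k r" using Sval[OF r elim(1)] by blast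
  then obtain k where k: "!!n. k n < Suc n \<and> node n (k n) < r \<and> r < node n (Suc (k n)) \<and> S n r = ?p n (k n) r" by metis
  have gap: "node n (Suc j) = node n j + d n" for n j by (simp add: node_def algebra_simps)
  have l1: "(%n. node n (k n) - r) ~~> 0"
  proof (rule Lim_null_comparison[OF always_eventually dlim], rule allI)
   show "norm (node n (k n) - r) <= d n" for n using k[of n] gap[of n "k n"] by simp
  qed
  have l2: "(%n. node n (Suc (k n)) - r) ~~> 0"
  proof (rule Lim_null_comparison[OF always_eventually dlim], rule allI)
   show "norm (node n (Suc (k n)) - r) <= d n" for n using k[of n] gap[of n "k n"] by simp
  qed
  have m: "node n (k n) : {0..t}" "node n (Suc (k n)) : {0..t}" for n
   using node(4) node_t[of "k n" n] node_t[of "Suc (k n)" n] k[of n] by auto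
  have "(%n. ?p n (k n) r) ~~> P r r + Q r r"
   by (intro tendsto_add continuous_on_tendsto_compose[OF cP[OF r]] continuous_on_tendsto_compose[OF cQ[OF r]] r always_eventually allI m
    LIM_zero_cancel[OF l1] LIM_zero_cancel[OF l2])
  then show ?case using k by simp
 qed
 have Sm: "S n : borel_measurable ?M" for n using Si by auto
 have Lm: "(%r. P r r + Q r r) : borel_measurable ?M" by (rule borel_measurable_AE_limit[OF _ Sm Slim]) simp
 have ic: "integrable ?M (%r. 2 * C)" using t by (intro lebesgue_on_interval_const) simp
 show "integrable ?M (%r. P r r + Q r r)" by (rule integrable_dominated_convergence[OF Lm Sm ic Slim Sb])
 have "(%n. LINT r|?M. S n r) ~~> (LINT r|?M. P r r + Q r r)"
  by (rule integral_dominated_convergence[OF Lm Sm ic Slim Sb])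
 then show "F t - F 0 <= (LINT r|?M. P r r + Q r r)" by (rule LIMSEQ_le_const) (use FS in auto)
qed

lemma L2_sigma_diff:
 assumes u: "u : L2_sigma" and w: "w : L2_sigma"
 shows "(%z. u z - w z) : L2_sigma"
proof -
 let ?M = "\<mu>"
 have L: "u : L2 ?M" "w : L2 ?M" using u w by (auto simp: solenoidal_def)
 have int: "integrable ?M (%z. frechet_derivative \<psi> (at z) (f z))"
  if \<psi>: "\<psi> : test_functions UNIV" and f: "f : L2 ?M" for \<psi> :: "point => real" and f
 proof -
  have "frechet_derivative \<psi> (at z) (f z) = (\<Sum>i\<in>Basis. partial i \<psi> z * (f z \<bullet> i))" for z
   using frechet_derivative_partial[OF smooth_differentiable[OF test_smooth[OF \<psi>]], of z "f z"] by (simp add: mult.commute)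
  moreover have "integrable ?M (%z. partial i \<psi> z *. (f z \<bullet> i))" if "i : Basis" for i
   by (intro L2_scaleR_integrable L2_inner_component f L2_lborel_imp_half_plane test_L2[where U=UNIV] test_partial \<psi> that)
  ultimately show ?thesis by (simp add: sum_Basis_point Basis_point)
 qed
 have tb: "tangent_to_boundary (%z. u z - w z)"
  unfolding tangent_to_boundary_def
 proof
  fix \<psi> :: "point => real" assume \<psi>: "\<psi> : test_functions UNIV"
  have "frechet_derivative \<psi> (at z) (u z - w z) = frechet_derivative \<psi> (at z) (u z) - frechet_derivative \<psi> (at z) (w z)" for z
   using has_derivative_linear[OF smooth_has_derivative[OF test_smooth[OF \<psi>]]] by (simp add: linear_diff)
  then show "(LINT z|?M. frechet_derivative \<psi> (at z) (u z - w z)) = 0"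
   using int[OF \<psi> L(1)] int[OF \<psi> L(2)] u w \<psi> by (simp add: solenoidal_def tangent_to_boundary_def)
 qed
 moreover have "divergence_free (%z. u z - w z)"
  using tb unfolding divergence_free_def tangent_to_boundary_def test_functions_def by blast
 ultimately show ?thesis using L2_diff[OF L] by (simp add: solenoidal_def)
qed

lemma regular_flowD:
 assumes "regular_flow T K C v D" "t : {0..T}"
 shows "v t : H1_sigma" "v t : Hs 1" "v t : L2 \<mu>" "v t : L2_sigma" "nrm (v t) <= C"
  "C1_up (v t) (D t)" "linear (D t z)"
  "z : closure \<Omega> ==> i : Basis ==> norm (D t z i) <= K"
  "i : Basis ==> has_weak_deriv [i] (v t) (%z. D t z i)" "i : Basis ==> nrm (%z. D t z i) <= C"
  "i : Basis ==> (%z. D t z i) : borel_measurable \<mu>"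
proof -
 have all: "v t : H1_sigma \<and> nrm (v t) <= C \<and> C1_up (v t) (D t) \<and> (\<forall>z. linear (D t z)) \<and>
   (\<forall>z\<in>closure \<Omega>. \<forall>i\<in>Basis. norm (D t z i) <= K) \<and>
   (\<forall>i\<in>Basis. has_weak_deriv [i] (v t) (%z. D t z i) \<and> nrm (%z. D t z i) <= C)"
  using assms unfolding regular_flow_def by blast
 then show H: "v t : H1_sigma" and "nrm (v t) <= C" "C1_up (v t) (D t)" "linear (D t z)"
  "z : closure \<Omega> ==> i : Basis ==> norm (D t z i) <= K"
  "i : Basis ==> nrm (%z. D t z i) <= C" by blast+
 show wd: "i : Basis ==> has_weak_deriv [i] (v t) (%z. D t z i)" using all by blast
 then show "i : Basis ==> (%z. D t z i) : borel_measurable \<mu>"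
  by (intro L2_measurable) (simp add: has_weak_deriv_def)
 from H show h: "v t : Hs 1" by (simp add: solenoidal_def)
 then show "v t : L2 \<mu>" by (rule Hs_1_L2)
 then show "v t : L2_sigma" using H by (simp add: solenoidal_def)
qed

lemma regular_flow_balance:
 assumes "regular_flow T K C v D" "0 <= t1" "t1 <= t2" "t2 <= T" "x : L2_sigma"
 shows "integrable (lebesgue_on {t1..t2}) (%r. ip x (%z. D r z (v r z)))"
  "ip x (%z. v t2 z - v t1 z) = - (LINT r|lebesgue_on {t1..t2}. ip x (%z. D r z (v r z)))"
 using assms unfolding regular_flow_def by blast+

lemma flow_advection:
 assumes flow: "regular_flow T K C v D" and K: "0 <= K" and t: "t : {0..T}" and f: "f : L2 \<mu>"
 shows "(%z. D t z (f z)) : L2 \<mu>" "nrm (%z. D t z (f z)) <= 2 * K * nrm f"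
proof -
 note F = regular_flowD[OF flow t]
 have b: "norm (D t z i) <= K" if "z : \<Omega>" "i : Basis" for z i by (rule F(8)[OF subsetD[OF closure_subset that(1)] that(2)])
 note a = advection_L2[where D="D t", OF f F(7) b K F(11)]
 show "(%z. D t z (f z)) : L2 \<mu>" by (rule a(1))
 show "nrm (%z. D t z (f z)) <= 2 * K * nrm f" by (rule a(2))
qed

lemma flow_weak_deriv_bound:
 assumes flow: "regular_flow T K C v D" and t: "t : {0..T}" and i: "i : Basis"
 shows "AE z in \<mu>. weak_deriv [i] (v t) z = D t z i" "AE z in \<mu>. norm (weak_deriv [i] (v t) z) <= K"
proof -
 show e: "AE z in \<mu>. weak_deriv [i] (v t) z = D t z i"
  by (rule weak_deriv_eq[OF regular_flowD(9)[OF flow t i]]) (use i in simp)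
 have "AE z in \<mu>. z : closure \<Omega>" using closure_subset[of \<Omega>] by (intro AE_I2) auto
 with e show "AE z in \<mu>. norm (weak_deriv [i] (v t) z) <= K"
  by eventually_elim (use regular_flowD(8)[OF flow t _ i] in simp)
qed

lemma flow_trilinear:
 assumes flow: "regular_flow T K C v D" and K: "0 <= K" and t: "t : {0..T}"
  and f: "f : L2 \<mu>" and g: "g : L2 \<mu>"
 shows "trilinear f (v t) g = ip (%z. D t z (f z)) g"
  "\<bar>trilinear f (v t) g\<bar> <= 2 * K * (nrm f * nrm g)"
proof -
 let ?M = "\<mu>"
 note F = regular_flowD[OF flow t]
 have i: "integrable ?M (%z. (\<Sum>i\<in>Basis. (f z \<bullet> i) *. weak_deriv [i] (v t) z) \<bullet> g z)"
  by (rule trilinear_integrable(1)[OF F(2) _ f g]) (rule flow_weak_deriv_bound(2)[OF flow t])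
 show "\<bar>trilinear f (v t) g\<bar> <= 2 * K * (L2_norm ?M f * L2_norm ?M g)"
  by (rule trilinear_integrable(2)[OF F(2) _ f g]) (rule flow_weak_deriv_bound(2)[OF flow t])
 have "AE z in ?M. \<forall>i\<in>Basis. weak_deriv [i] (v t) z = D t z i"
  by (intro AE_finite_allI flow_weak_deriv_bound(1)[OF flow t]) auto
 then have ae: "AE z in ?M. (\<Sum>i\<in>Basis. (f z \<bullet> i) *. weak_deriv [i] (v t) z) \<bullet> g z = D t z (f z) \<bullet> g z"
 proof eventually_elim
  case (elim z)
  show ?case unfolding linear_point[OF F(7), of z "f z"] using elim by (simp cong: sum.cong)
 qed
 show "trilinear f (v t) g = L2_inner ?M (%z. D t z (f z)) g"
  unfolding trilinear_def L2_inner_def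
  by (rule integral_cong_AE[OF _ _ ae])
    (use i L2_inner_integrable[OF flow_advection(1)[OF flow K t f] g] in auto)
qed

text \<open>
 The advection of a solenoidal field against the kinetic energy vanishes, so that the error of the convective
 terms is quadratic in the difference of the two flows.
\<close>

lemma flow_convective_error:
 assumes flow: "regular_flow T K C v D" and K: "0 <= K" and t: "t : {0..T}" and u: "u : L2_sigma"
 shows "ip u (%z. D t z (v t z)) - trilinear u (v t) u <= 2 * K * (nrm (%z. u z - v t z))^2"
  "ip (v t) (%z. D t z (v t z)) = 0"
proof -
 let ?M = "\<mu>"
 note F = regular_flowD[OF flow t]
 have uL: "u : L2 ?M" using u by (simp add: solenoidal_def)
 define w where "w = v t"
 have wL: "w : L2 ?M" and ws: "w : L2_sigma" using F(3,4) by (simp_all add: w_def)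
 \<comment> \<open>the gradient of \<open>|w|\<^sup>2\<close>\<close>
 define G where "G z = 2 *. (\<Sum>i\<in>Basis. (D t z i \<bullet> w z) *. i)" for z
 have Gh: "G z \<bullet> h = 2 * (D t z h \<bullet> w z)" for z h
  unfolding linear_point[OF F(7), of z h] G_def
  by (cases h) (simp add: sum_Basis_point inner_add_left algebra_simps)
 have "C1_up (%z. w z \<bullet> w z) (%z h. w z \<bullet> D t z h + D t z h \<bullet> w z)"
  using C1_up_inner[OF F(6) F(6)] by (simp add: w_def)
 moreover have "(%z h. w z \<bullet> D t z h + D t z h \<bullet> w z) = (%z h. G z \<bullet> h)"
  by (intro ext, unfold Gh, simp add: inner_commute[of "w _"])
 ultimately have P: "C1_up (%z. w z \<bullet> w z) (%z h. G z \<bullet> h)" by simp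
 have Dc: "continuous_on (closure \<Omega>) (%z. D t z i)" for i using F(6) unfolding C1_up_def by blast
 have wc: "continuous_on (closure \<Omega>) w" using C1_up_continuous[OF F(6)] by (simp add: w_def)
 have GL: "G : L2 ?M"
 proof (rule L2_dominated)
  have "continuous_on (closure \<Omega>) G" unfolding G_def[abs_def] by (intro continuous_intros Dc wc)
  then show "G : borel_measurable ?M" by (rule continuous_closure_measurable(2))
  show "integrable ?M (%z. (norm ((4 * K) *. w z))^2)" by (rule L2_integrable_sq[OF L2_scaleR[OF wL]])
  show "AE z in ?M. (norm (G z))^2 <= (norm ((4 * K) *. w z))^2"
  proof (intro AE_I2 power_mono)
   fix z assume "z : space ?M"
   then have z: "z : closure \<Omega>" using closure_subset[of \<Omega>] by auto
   have "norm (\<Sum>i\<in>Basis. (D t z i \<bullet> w z) *. i) <= (\<Sum>i\<in>(Basis::point set). K * norm (w z))"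
   proof (intro order_trans[OF norm_sum] sum_mono)
    fix i :: point assume i: "i : Basis"
    have "\<bar>D t z i \<bullet> w z\<bar> <= norm (D t z i) * norm (w z)" by (rule Cauchy_Schwarz_ineq2)
    also have "... <= K * norm (w z)" by (intro mult_right_mono F(8)[OF z i]) simp
    finally show "norm ((D t z i \<bullet> w z) *. i) <= K * norm (w z)" using i by simp
   qed
   then show "norm (G z) <= norm ((4 * K) *. w z)" using K by (simp add: G_def)
  qed simp
 qed
 define I where "I f g = L2_inner ?M (%z. D t z (f z)) g" for f g :: field
 have Iw: "I x w = 0" if "x : L2_sigma" for x
 proof -
  have "L2_inner ?M x G = 2 * I x w" by (simp add: L2_inner_def I_def inner_commute[of "x _"] Gh)
  then show ?thesis using gradient_orthogonal[OF that P GL] by simp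
 qed
 have uD: "L2_inner ?M u (%z. D t z (v t z)) = I w u" by (simp add: I_def w_def L2_inner_commute)
 show "L2_inner ?M (v t) (%z. D t z (v t z)) = 0" using Iw[OF ws] by (simp add: I_def w_def L2_inner_commute)
 have dL: "(%z. u z - w z) : L2 ?M" by (rule L2_diff[OF uL wL])
 have Il: "I (%z. u z - w z) g = I u g - I w g" if "g : L2 ?M" for g
  unfolding I_def linear_diff[OF F(7)]
  by (rule L2_inner_diff_left) (intro flow_advection(1)[OF flow K t] uL wL that)+
 have Ir: "I f (%z. u z - w z) = I f u - I f w" if "f : L2 ?M" for f
  unfolding I_def by (rule L2_inner_diff_right) (intro flow_advection(1)[OF flow K t] uL wL that)+
 have "I (%z. u z - w z) (%z. u z - w z) = I u u - I w u"
  unfolding Il[OF dL] Ir[OF uL] Ir[OF wL] using Iw[OF u] Iw[OF ws] by simp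
 moreover have "\<bar>I (%z. u z - w z) (%z. u z - w z)\<bar> <= 2 * K * (L2_norm ?M (%z. u z - w z) * L2_norm ?M (%z. u z - w z))"
  using flow_trilinear[OF flow K t dL dL] by (simp add: I_def)
 ultimately show "L2_inner ?M u (%z. D t z (v t z)) - trilinear u (v t) u <= 2 * K * (L2_norm ?M (%z. u z - v t z))^2"
  unfolding uD flow_trilinear(1)[OF flow K t uL uL] by (simp add: I_def w_def power2_eq_square)
qed

text \<open>Dominated convergence, with the bound on the gradient as the dominating factor.\<close>

lemma flow_trilinear_continuous:
 assumes flow: "regular_flow T K C v D" and K: "0 <= K" and f: "f : L2 \<mu>"
 shows "continuous_on {0..T} (%s. trilinear f (v s) f)"
 unfolding continuous_on_sequentially
proof (intro allI ballI impI, elim conjE)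
 fix x :: "nat => real" and s assume s: "s : {0..T}" and x: "\<forall>n. x n : {0..T}" "x ~~> s"
 let ?M = "\<mu>"
 have xT: "x n : {0..T}" for n using x(1) by blast
 have m: "(%z. D r z (f z) \<bullet> f z) : borel_measurable ?M" if "r : {0..T}" for r
  using L2_inner_integrable[OF flow_advection(1)[OF flow K that f] f] by auto
 have "(%n. LINT z|?M. D (x n) z (f z) \<bullet> f z) ~~> (LINT z|?M. D s z (f z) \<bullet> f z)"
 proof (rule integral_dominated_convergence[OF m[OF s] m[OF xT]])
  show "integrable ?M (%z. 2 * K * (norm (f z) * norm (f z)))" by (intro integrable_mult_right L2_norm_mult_integrable f)
  show "AE z in ?M. (%n. D (x n) z (f z) \<bullet> f z) ~~> D s z (f z) \<bullet> f z"
  proof (rule AE_I2)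
   fix z assume "z : space ?M"
   then have z: "z : closure \<Omega>" using closure_subset[of \<Omega>] by auto
   have c: "continuous_on {0..T} (%t. D t z i)" if "i : Basis" for i using flow z that unfolding regular_flow_def by blast
   have l: "(%n. D (x n) z i) ~~> D s z i" if "i : Basis" for i
    by (rule continuous_on_tendsto_compose[OF c[OF that] x(2) s]) (use xT in auto)
   show "(%n. D (x n) z (f z) \<bullet> f z) ~~> D s z (f z) \<bullet> f z"
    unfolding linear_point[OF regular_flowD(7)[OF flow s], of z "f z"] linear_point[OF regular_flowD(7)[OF flow xT], of _ z "f z"]
    by (intro tendsto_intros l)
  qed
  show "AE z in ?M. norm (D (x n) z (f z) \<bullet> f z) <= 2 * K * (norm (f z) * norm (f z))" for n
  proof (rule AE_I2)
   fix z assume "z : space ?M"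
   then have z: "z : closure \<Omega>" using closure_subset[of \<Omega>] by auto
   have "norm (D (x n) z (f z)) <= 2 * K * norm (f z)"
    unfolding linear_point[OF regular_flowD(7)[OF flow xT], of n z "f z"]
    by (rule transport_norm_le) (rule regular_flowD(8)[OF flow xT z])
   then have "norm (D (x n) z (f z)) * norm (f z) <= 2 * K * norm (f z) * norm (f z)" by (rule mult_right_mono) simp
   then show "norm (D (x n) z (f z) \<bullet> f z) <= 2 * K * (norm (f z) * norm (f z))"
    using Cauchy_Schwarz_ineq2[of "D (x n) z (f z)" "f z"] by (simp add: mult.assoc)
  qed
 qed
 then show "((%s. trilinear f (v s) f) \<circ> x) ~~> trilinear f (v s) f"
  unfolding o_def flow_trilinear(1)[OF flow K s f f] flow_trilinear(1)[OF flow K xT f f] L2_inner_def .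
qed

text \<open>The momentum balance is tested against the increment itself, which is solenoidal.\<close>

lemma flow_lipschitz:
 assumes flow: "regular_flow T K C v D" and K: "0 <= K" and s: "0 <= s1" "s1 <= s2" "s2 <= T"
 shows "nrm (%z. v s2 z - v s1 z) <= (s2 - s1) * (2 * K * C)"
proof -
 let ?M = "\<mu>" and ?x = "%z. v s2 z - v s1 z"
 have m: "s1 : {0..T}" "s2 : {0..T}" using s by auto
 have x: "?x : L2_sigma" by (rule L2_sigma_diff[OF regular_flowD(4)[OF flow m(2)] regular_flowD(4)[OF flow m(1)]])
 then have xL: "?x : L2 ?M" by (simp add: solenoidal_def)
 note b = regular_flow_balance[OF flow s x]
 have "(L2_norm ?M ?x)^2 = (LINT r|lebesgue_on {s1..s2}. - L2_inner ?M ?x (%z. D r z (v r z)))"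
  using b(2) by (simp add: L2_inner_self)
 also have "... <= (LINT r|lebesgue_on {s1..s2}. L2_norm ?M ?x * (2 * K * C))"
 proof (rule integral_mono[OF _ lebesgue_on_interval_const(1)[OF s(2)]])
  show "integrable (lebesgue_on {s1..s2}) (%r. - L2_inner ?M ?x (%z. D r z (v r z)))" using b(1) by simp
  fix r assume "r : space (lebesgue_on {s1..s2})"
  then have r: "r : {0..T}" using s by auto
  note a = flow_advection[OF flow K r regular_flowD(3)[OF flow r]]
  have "- L2_inner ?M ?x (%z. D r z (v r z)) <= L2_norm ?M ?x * L2_norm ?M (%z. D r z (v r z))"
   using L2_inner_bound[OF xL a(1)] by linarith
  also have "... <= L2_norm ?M ?x * (2 * K * C)"
  proof (rule mult_left_mono)
   have "2 * K * L2_norm ?M (v r) <= 2 * K * C" using K regular_flowD(5)[OF flow r] by (intro mult_left_mono) auto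
   then show "L2_norm ?M (%z. D r z (v r z)) <= 2 * K * C" using a(2) by linarith
  qed simp
  finally show "- L2_inner ?M ?x (%z. D r z (v r z)) <= L2_norm ?M ?x * (2 * K * C)" .
 qed
 also have "... = L2_norm ?M ?x * ((s2 - s1) * (2 * K * C))" unfolding lebesgue_on_interval_const(2)[OF s(2)] by simp
 finally have le: "L2_norm ?M ?x * L2_norm ?M ?x <= L2_norm ?M ?x * ((s2 - s1) * (2 * K * C))" by (simp add: power2_eq_square)
 show ?thesis
 proof (cases "L2_norm ?M ?x = 0")
  case True
  have "0 <= C" using order_trans[OF L2_norm_nonneg regular_flowD(5)[OF flow m(1)]] .
  then show ?thesis using True K s by simp
 next
  case False
  then have "0 < L2_norm ?M ?x" using L2_norm_nonneg[of ?M ?x] by linarith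
  then show ?thesis using le by (rule mult_le_cancel_left_pos[THEN iffD1])
 qed
qed

text \<open>
 The increments of the energy are obtained by testing the momentum balance against both ends of a time step. In
 the limit the integrand is the advection of \<open>v\<close> tested against \<open>v\<close>, which vanishes.
\<close>

lemma flow_energy:
 assumes flow: "regular_flow T K C v D" and K: "0 <= K" and t: "t : {0..T}"
 shows "(nrm (v t))^2 <= (nrm (v 0))^2"
proof (cases "t = 0")
 case False
 let ?M = "\<mu>"
 define A where "A r z = D r z (v r z)" for r z
 have sub: "s : {0..T}" if "s : {0..t}" for s using t that by auto
 have AL: "A r : L2 ?M" "L2_norm ?M (A r) <= 2 * K * C" if "r : {0..t}" for r
 proof -
  note a = flow_advection[OF flow K sub[OF that] regular_flowD(3)[OF flow sub[OF that]]]
  show "A r : L2 ?M" using a(1) by (simp add: A_def[abs_def])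
  have "2 * K * L2_norm ?M (v r) <= 2 * K * C" using K regular_flowD(5)[OF flow sub[OF that]] by (intro mult_left_mono) auto
  then show "L2_norm ?M (A r) <= 2 * K * C" using a(2) by (simp add: A_def[abs_def])
 qed
 have C: "0 <= C" using order_trans[OF L2_norm_nonneg regular_flowD(5)[OF flow t]] .
 note vL = regular_flowD(3)[OF flow sub] and vs = regular_flowD(4)[OF flow sub]
 let ?P = "%s r. - L2_inner ?M (v s) (A r)"
 have cont: "continuous_on {0..t} (%s. ?P s r)" if r: "r : {0..t}" for r
 proof -
  have lip: "\<bar>?P s2 r - ?P s1 r\<bar> <= ((2 * K * C) * (2 * K * C)) * \<bar>s2 - s1\<bar>" if s: "s1 : {0..t}" "s2 : {0..t}" "s1 <= s2" for s1 s2
  proof -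
   have "\<bar>?P s2 r - ?P s1 r\<bar> = \<bar>L2_inner ?M (%z. v s2 z - v s1 z) (A r)\<bar>"
    unfolding L2_inner_diff_left[OF vL[OF s(2)] vL[OF s(1)] AL(1)[OF r]] by simp
   also have "... <= L2_norm ?M (%z. v s2 z - v s1 z) * L2_norm ?M (A r)"
    by (rule L2_inner_bound[OF L2_diff[OF vL[OF s(2)] vL[OF s(1)]] AL(1)[OF r]])
   also have "... <= ((s2 - s1) * (2 * K * C)) * (2 * K * C)"
    using s t K C by (intro mult_mono flow_lipschitz[OF flow K] AL(2)[OF r]) auto
   finally show ?thesis using s(3) by (simp add: mult_ac)
  qed
  have "((2 * K * C) * (2 * K * C))-lipschitz_on {0..t} (%s. ?P s r)"
  proof (rule lipschitz_onI)
   fix a b assume ab: "a : {0..t}" "b : {0..t}"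
   show "dist (?P a r) (?P b r) <= (2 * K * C) * (2 * K * C) * dist a b"
    using lip[OF ab] lip[OF ab(2,1)] unfolding dist_real_def by (cases "a <= b") (auto simp: abs_minus_commute)
  qed (use K C in simp)
  then show ?thesis by (rule lipschitz_on_continuous_on)
 qed
 have bound: "\<bar>?P s r\<bar> <= C * (2 * K * C)" if "s : {0..t}" "r : {0..t}" for s r
 proof -
  have "\<bar>?P s r\<bar> <= L2_norm ?M (v s) * L2_norm ?M (A r)" using L2_inner_bound[OF vL[OF that(1)] AL(1)[OF that(2)]] by simp
  also have "... <= C * (2 * K * C)" using C by (intro mult_mono regular_flowD(5)[OF flow sub[OF that(1)]] AL(2)[OF that(2)]) auto
  finally show ?thesis .
 qed
 have m: "s1 : {0..t}" "s2 : {0..t}" "s2 <= T" if "0 <= s1" "s1 <= s2" "s2 <= t" for s1 s2 using that t by auto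
 have bal: "integrable (lebesgue_on {s1..s2}) (?P x)" "L2_inner ?M (v x) (%z. v s2 z - v s1 z) = (LINT r|lebesgue_on {s1..s2}. ?P x r)"
  if s: "0 <= s1" "s1 <= s2" "s2 <= t" and x: "x : {0..t}" for s1 s2 x
  using regular_flow_balance[OF flow s(1,2) m(3)[OF s] vs[OF x]] by (simp_all add: A_def[abs_def])
 have "(L2_norm ?M (v t))^2 - (L2_norm ?M (v 0))^2 <= (LINT r|lebesgue_on {0..t}. ?P r r + ?P r r)"
 proof (rule telescoping_limit(2)[where F="%s. (L2_norm ?M (v s))^2" and P="?P" and Q="?P" and C="C * (2 * K * C)"])
  show "0 < t" using t False by simp
  fix s1 s2 assume s: "0 <= s1" "s1 <= s2" "s2 <= t"
  note m = m[OF s]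
  show "integrable (lebesgue_on {s1..s2}) (%r. ?P s2 r + ?P s1 r)"
   by (intro Bochner_Integration.integrable_add bal(1)[OF s] m)
  have "(L2_norm ?M (v s2))^2 - (L2_norm ?M (v s1))^2 = L2_inner ?M (v s2) (%z. v s2 z - v s1 z) + L2_inner ?M (v s1) (%z. v s2 z - v s1 z)"
   unfolding L2_inner_diff_right[OF vL[OF m(2)] vL[OF m(1)] vL[OF m(2)]] L2_inner_diff_right[OF vL[OF m(2)] vL[OF m(1)] vL[OF m(1)]]
   by (simp add: L2_inner_self L2_inner_commute[of _ "v s1" "v s2"])
  also have "... = (LINT r|lebesgue_on {s1..s2}. ?P s2 r + ?P s1 r)"
   unfolding bal(2)[OF s m(1)] bal(2)[OF s m(2)] by (rule Bochner_Integration.integral_add[symmetric]) (intro bal(1)[OF s] m)+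
  finally show "(L2_norm ?M (v s2))^2 - (L2_norm ?M (v s1))^2 <= (LINT r|lebesgue_on {s1..s2}. ?P s2 r + ?P s1 r)" by simp
 qed (use cont bound in auto)
 also have "... = (LINT r|lebesgue_on {0..t}. 0)"
 proof (intro bochner_cong refl)
  fix r assume "r : space (lebesgue_on {0..t})"
  then have r: "r : {0..t}" by simp
  have "L2_inner ?M (v r) (A r) = 0"
   using flow_convective_error(2)[OF flow K sub[OF r] vs[OF r]] by (simp add: A_def[abs_def])
  then show "?P r r + ?P r r = 0" by simp
 qed
 finally show ?thesis by simp
qed simp

text \<open>
 Over a time step the increment of \<open>\<langle>u, v\<rangle>\<close> is split into \<open>\<langle>u\<^sub>2, v\<^sub>2 - v\<^sub>1\<rangle>\<close>, given by the Euler equation, and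
 \<open>\<langle>u\<^sub>2 - u\<^sub>1, v\<^sub>1\<rangle>\<close>, given by the weak formulation with the stationary field \<open>v\<^sub>1\<close>. Young's inequality splits
 the mixed boundary and strain terms into half the dissipation of \<open>u\<close>, which the energy inequality pays for, and
 the same forms evaluated at \<open>v\<close>, which \<open>B\<close> bounds.
\<close>

lemma relative_energy_inequality:
 assumes flow: "regular_flow T K C v D" and K: "0 <= K" and ler: "leray_solution a \<epsilon> u0 u" and a: "0 <= a" and \<epsilon>: "0 <= \<epsilon>"
  and B: "!!r. r : {0..T} ==> boundary_inner (v r) (v r) <= B" "!!r. r : {0..T} ==> strain_inner (v r) (v r) <= B"
  and t: "0 < t" "t <= T"
 defines "L \<equiv> %r. 2 * (ip (u r) (%z. D r z (v r z)) - trilinear (u r) (v r) (u r))"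
 shows "integrable (lebesgue_on {0..t}) L"
  "(nrm (%z. u t z - v t z))^2 <= (nrm (%z. u 0 z - v 0 z))^2
   + t * ((2 * a * sqrt \<epsilon> + 2 * \<epsilon>) * B) + (LINT r|lebesgue_on {0..t}. L r)"
proof -
 let ?M = "\<mu>"
 have T: "0 < T" using t by linarith
 have sub: "s : {0..T}" if "s : {0..t}" for s using t that by auto
 define A where "A r z = D r z (v r z)" for r z
 have us: "u r : L2_sigma" if "0 <= r" for r using ler that by (simp add: leray_solution_def)
 have uL: "u r : L2 ?M" if "0 <= r" for r using us[OF that] by (simp add: solenoidal_def)
 note vL = regular_flowD(3)[OF flow sub] and vH = regular_flowD(2)[OF flow sub]
 have u2: "u : time_L2 {0..T} H1_sigma (Hs_norm 1)" using ler T by (simp add: leray_solution_def)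
 define \<alpha> where "\<alpha> = 2 * a * sqrt \<epsilon>"
 define \<beta> where "\<beta> = 2 * \<epsilon>"
 have ab: "0 <= \<alpha>" "0 <= \<beta>" using a \<epsilon> by (simp_all add: \<alpha>_def \<beta>_def)
 define bb where "bb r = boundary_inner (u r) (u r)" for r
 define ss where "ss r = strain_inner (u r) (u r)" for r
 define H where "H r = \<alpha> * bb r + \<beta> * ss r" for r
 define c where "c = \<alpha> * B + \<beta> * B"
 have tsub: "{s1..s2} \<subseteq> {0..T}" if "0 <= s1" "s2 <= t" for s1 s2 using that t by auto
 note isub = time_subinterval[OF _ tsub]
 have bi: "integrable (lebesgue_on {0..T}) bb" "integrable (lebesgue_on {0..T}) ss"
  unfolding bb_def[abs_def] ss_def[abs_def]
  by (rule H1_form_time_integrable(1)[OF H1_form_boundary u2 regular_flowD(2)[OF flow sub[of t]]],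
    use t in simp, rule H1_form_time_integrable(1)[OF H1_form_strain u2 regular_flowD(2)[OF flow sub[of t]]], use t in simp)
 have Hi: "integrable (lebesgue_on {0..T}) H"
  unfolding H_def[abs_def] by (intro Bochner_Integration.integrable_add integrable_mult_right bi)
 obtain S :: "nat => real => field"
  where "AE r in lebesgue_on {0..T}. u r : H1_sigma \<and> (%n. Hs_norm 1 (%z. S n r z - u r z)) ~~> 0"
  using u2 unfolding time_L2_def strongly_measurable_def by blast
 then have "AE r in lebesgue_on {0..T}. u r : Hs 1" by eventually_elim (simp add: solenoidal_def)
 then have uHl: "AE r in lebesgue. r : {0..T} \<longrightarrow> u r : Hs 1" by (subst (asm) AE_restrict_space_iff) auto
 have uH: "AE r in lebesgue_on {s1..s2}. u r : Hs 1" if "0 <= s1" "s2 <= t" for s1 s2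
 proof -
  have "AE r in lebesgue. r : {s1..s2} \<longrightarrow> u r : Hs 1"
   using uHl by eventually_elim (use tsub[OF that] in blast)
  then show ?thesis by (subst AE_restrict_space_iff) auto
 qed
 have en: "(L2_norm ?M (u r))^2 + 2 * (LINT r|lebesgue_on {0..r}. H r) <= (L2_norm ?M (u 0))^2" "0 <= (LINT r|lebesgue_on {0..r}. H r)"
  if r: "r : {0..t}" for r
 proof -
  have rt: "0 <= r" "r <= t" using r by auto
  have i: "integrable (lebesgue_on {0..r}) bb" "integrable (lebesgue_on {0..r}) ss" using isub[OF bi(1) order_refl rt(2)] isub[OF bi(2) order_refl rt(2)] .
  have HI: "(LINT r|lebesgue_on {0..r}. H r) = \<alpha> * (LINT r|lebesgue_on {0..r}. bb r) + \<beta> * (LINT r|lebesgue_on {0..r}. ss r)"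
   unfolding H_def using i by simp
  have "(L2_norm ?M (u r))^2 + 4 * a * sqrt \<epsilon> * (LINT r|lebesgue_on {0..r}. bb r) + 4 * \<epsilon> * (LINT r|lebesgue_on {0..r}. ss r) <= (L2_norm ?M (u 0))^2"
   using ler rt(1) unfolding leray_solution_def bb_def ss_def by blast
  then show "(L2_norm ?M (u r))^2 + 2 * (LINT r|lebesgue_on {0..r}. H r) <= (L2_norm ?M (u 0))^2"
   unfolding HI \<alpha>_def \<beta>_def by simp
  show "0 <= (LINT r|lebesgue_on {0..r}. H r)"
   unfolding H_def bb_def ss_def using ab
   by (intro integral_nonneg_AE AE_I2 add_nonneg_nonneg mult_nonneg_nonneg boundary_inner_self_nonneg strain_inner_self_nonneg)
 qed
 define U where "U = L2_norm ?M (u 0)"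
 have uU: "L2_norm ?M (u r) <= U" if "r : {0..t}" for r
  unfolding U_def
 proof (rule power2_le_imp_le)
  show "(L2_norm ?M (u r))^2 <= (L2_norm ?M (u 0))^2" using en[OF that] by linarith
 qed simp
 have U0: "0 <= U" by (simp add: U_def)
 have C: "0 <= C" using order_trans[OF L2_norm_nonneg regular_flowD(5)[OF flow sub[of t]]] t by simp
 have AL: "A r : L2 ?M" "L2_norm ?M (A r) <= 2 * K * C" if "r : {0..t}" for r
 proof -
  note a = flow_advection[OF flow K sub[OF that] vL[OF that]]
  show "A r : L2 ?M" using a(1) by (simp add: A_def[abs_def])
  have "2 * K * L2_norm ?M (v r) <= 2 * K * C" using K regular_flowD(5)[OF flow sub[OF that]] by (intro mult_left_mono) auto
  then show "L2_norm ?M (A r) <= 2 * K * C" using a(2) by (simp add: A_def[abs_def])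
 qed
 let ?P = "%s r. 2 * L2_inner ?M (u s) (A r)" and ?Q = "%s r. - 2 * trilinear (u r) (v s) (u r)"
 \<comment> \<open>a common bound for the two frozen integrands\<close>
 define R where "R = max (2 * (U * (2 * K * C))) (2 * (2 * K * (U * U)))"
 define F where "F s = - 2 * L2_inner ?M (u s) (v s) - (LINT r|lebesgue_on {0..s}. H r) - s * c" for s
 have Lpq: "L = (%r. ?P r r + ?Q r r)" by (simp add: L_def A_def[abs_def] fun_eq_iff)
 have tri_int: "integrable (lebesgue_on {s1..s2}) (%r. trilinear (u r) (v x) (u r))"
  if s: "0 <= s1" "s2 <= t" and x: "x : {0..t}" for s1 s2 x
 proof -
  have "H1_form (%f g. trilinear f (v x) g)"
   by (rule H1_form_trilinear[OF vH[OF x] _ K]) (rule flow_weak_deriv_bound(2)[OF flow sub[OF x]])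
  from H1_form_time_integrable(1)[OF this u2 vH[OF x]] show ?thesis by (rule isub) (use s in auto)
 qed
 have adv_int: "integrable (lebesgue_on {s1..s2}) (%r. L2_inner ?M (u x) (A r))"
  "L2_inner ?M (u x) (%z. v s2 z - v s1 z) = - (LINT r|lebesgue_on {s1..s2}. L2_inner ?M (u x) (A r))"
  if s: "0 <= s1" "s1 <= s2" "s2 <= t" and x: "0 <= x" for s1 s2 x
  using regular_flow_balance[OF flow s(1,2) order_trans[OF s(3) t(2)] us[OF x]] by (simp_all add: A_def[abs_def])
 have tele: "integrable (lebesgue_on {0..t}) (%r. ?P r r + ?Q r r) \<and> F t - F 0 <= (LINT r|lebesgue_on {0..t}. ?P r r + ?Q r r)"
 \<comment> \<open>the two conclusions have the same premises, so each premise is established twice\<close>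
 proof (rule conjI; rule telescoping_limit[where F=F and P="?P" and Q="?Q" and C=R])
  show "0 < t" "0 < t" by (rule t(1))+
  fix r assume r: "r : {0..t}"
  have r0: "0 <= r" using r by simp
  have "continuous_on {0..} (%s. L2_inner ?M (u s) (A r))"
   using ler AL(1)[OF r] by (simp add: leray_solution_def weakly_continuous_def)
  then show cP: "continuous_on {0..t} (%s. ?P s r)"
   by (intro continuous_on_mult_left) (rule continuous_on_subset, auto)
  then show "continuous_on {0..t} (%s. ?P s r)" .
  have "continuous_on {0..t} (%s. trilinear (u r) (v s) (u r))"
   by (rule continuous_on_subset[OF flow_trilinear_continuous[OF flow K uL[OF r0]]]) (use t in auto)
  then show cQ: "continuous_on {0..t} (%s. ?Q s r)" by (rule continuous_on_mult_left)
  then show "continuous_on {0..t} (%s. ?Q s r)" .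
  fix s assume s: "s : {0..t}"
  have s0: "0 <= s" using s by simp
  have "\<bar>L2_inner ?M (u s) (A r)\<bar> <= L2_norm ?M (u s) * L2_norm ?M (A r)" by (rule L2_inner_bound[OF uL[OF s0] AL(1)[OF r]])
  also have "... <= U * (2 * K * C)" by (intro mult_mono uU[OF s] AL(2)[OF r] U0 L2_norm_nonneg)
  finally show bP: "\<bar>?P s r\<bar> <= R" by (simp add: R_def abs_mult)
  then show "\<bar>?P s r\<bar> <= R" .
  have "\<bar>trilinear (u r) (v s) (u r)\<bar> <= 2 * K * (L2_norm ?M (u r) * L2_norm ?M (u r))"
   by (rule flow_trilinear(2)[OF flow K sub[OF s] uL[OF r0] uL[OF r0]])
  also have "... <= 2 * K * (U * U)" using K by (intro mult_left_mono mult_mono uU[OF r] U0 L2_norm_nonneg) auto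
  finally show bQ: "\<bar>?Q s r\<bar> <= R" by (simp add: R_def abs_mult)
  then show "\<bar>?Q s r\<bar> <= R" .
 next
  fix s1 s2 assume s: "0 <= s1" "s1 <= s2" "s2 <= t"
  have m: "s1 : {0..t}" "s2 : {0..t}" "0 <= s2" "s1 <= t" using s by auto
  have PQi: "integrable (lebesgue_on {s1..s2}) (%r. ?P s2 r + ?Q s1 r)"
   by (intro Bochner_Integration.integrable_add integrable_mult_right adv_int(1)[OF s m(3)] tri_int[OF s(1,3) m(1)])
  show "integrable (lebesgue_on {s1..s2}) (%r. ?P s2 r + ?Q s1 r)" "integrable (lebesgue_on {s1..s2}) (%r. ?P s2 r + ?Q s1 r)"
   by (rule PQi)+
  let ?w = "v s1"
  define E where "E r = \<alpha> * boundary_inner (u r) ?w + \<beta> * strain_inner (u r) ?w - trilinear (u r) ?w (u r)" for r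
  have wK: "AE z in ?M. norm (weak_deriv [i] ?w z) <= K" if "i : Basis" for i
   by (rule flow_weak_deriv_bound(2)[OF flow sub[OF m(1)] that])
  have Ei: "integrable (lebesgue_on {0..T'}) E" for T'
   unfolding E_def[abs_def] \<alpha>_def \<beta>_def
   by (rule leray_stationary_test(1)[OF ler regular_flowD(1)[OF flow sub[OF m(1)]] K _ order_refl]) (rule wK)
  have test: "L2_inner ?M (u r) ?w = L2_inner ?M (u 0) ?w - (LINT r|lebesgue_on {0..r}. E r)" if "0 <= r" for r
   unfolding E_def \<alpha>_def \<beta>_def
   by (rule leray_stationary_test(2)[OF ler regular_flowD(1)[OF flow sub[OF m(1)]] K _ that]) (rule wK)
  have "{s1..s2} \<subseteq> {0..s2}" using s by auto
  note Es = time_subinterval[OF Ei this]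
  note Hs' = isub[OF Hi s(1,3)] and ci = lebesgue_on_interval_const[OF s(2), of c]
  have uw: "L2_inner ?M (u s2) ?w - L2_inner ?M (u s1) ?w = - (LINT r|lebesgue_on {s1..s2}. E r)"
   using test[OF m(3)] test[OF s(1)] lebesgue_on_interval_combine[OF Ei s(1,2)] by simp
  have uv: "L2_inner ?M (u s2) (v s2) - L2_inner ?M (u s2) ?w = - (LINT r|lebesgue_on {s1..s2}. L2_inner ?M (u s2) (A r))"
   using adv_int(2)[OF s m(3)] unfolding L2_inner_diff_right[OF vL[OF m(2)] vL[OF m(1)] uL[OF m(3)]] .
  have HH: "(LINT r|lebesgue_on {0..s2}. H r) - (LINT r|lebesgue_on {0..s1}. H r) = (LINT r|lebesgue_on {s1..s2}. H r)"
   using lebesgue_on_interval_combine[OF isub[OF Hi order_refl s(3)] s(1,2)] by simp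
  have "F s2 - F s1 = 2 * (LINT r|lebesgue_on {s1..s2}. L2_inner ?M (u s2) (A r)) + 2 * (LINT r|lebesgue_on {s1..s2}. E r)
    - (LINT r|lebesgue_on {s1..s2}. H r) - (LINT r|lebesgue_on {s1..s2}. c)"
   unfolding F_def ci(2) left_diff_distrib using uw uv HH by linarith
  also have "... = (LINT r|lebesgue_on {s1..s2}. ?P s2 r + 2 * E r - H r - c)"
   using adv_int(1)[OF s m(3)] Es Hs' ci(1) by simp
  also have "... <= (LINT r|lebesgue_on {s1..s2}. ?P s2 r + ?Q s1 r)"
  proof (rule integral_mono_AE[OF _ PQi])
   show "integrable (lebesgue_on {s1..s2}) (%r. ?P s2 r + 2 * E r - H r - c)"
    by (intro Bochner_Integration.integrable_add Bochner_Integration.integrable_diff integrable_mult_right adv_int(1)[OF s m(3)] Es Hs' ci(1))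
   show "AE r in lebesgue_on {s1..s2}. ?P s2 r + 2 * E r - H r - c <= ?P s2 r + ?Q s1 r"
    using uH[OF s(1,3)]
   proof eventually_elim
    case (elim r)
    have "2 * boundary_inner (u r) ?w <= bb r + boundary_inner ?w ?w" unfolding bb_def
     by (rule H1_form_young[OF H1_form_boundary _ boundary_inner_self_nonneg elim vH[OF m(1)]]) (simp add: boundary_inner_def L2_inner_commute)
    then have "2 * boundary_inner (u r) ?w <= bb r + B" using B(1)[OF sub[OF m(1)]] by linarith
    then have 1: "\<alpha> * (2 * boundary_inner (u r) ?w) <= \<alpha> * (bb r + B)" by (rule mult_left_mono[OF _ ab(1)])
    have "2 * strain_inner (u r) ?w <= ss r + strain_inner ?w ?w" unfolding ss_def
     by (rule H1_form_young[OF H1_form_strain _ strain_inner_self_nonneg elim vH[OF m(1)]]) (simp add: strain_inner_sum elim vH[OF m(1)] L2_inner_commute)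
    then have "2 * strain_inner (u r) ?w <= ss r + B" using B(2)[OF sub[OF m(1)]] by linarith
    then have 2: "\<beta> * (2 * strain_inner (u r) ?w) <= \<beta> * (ss r + B)" by (rule mult_left_mono[OF _ ab(2)])
    show ?case using 1 2 unfolding E_def H_def c_def by (simp add: algebra_simps)
   qed
  qed
  finally show st: "F s2 - F s1 <= (LINT r|lebesgue_on {s1..s2}. ?P s2 r + ?Q s1 r)" .
  then show "F s2 - F s1 <= (LINT r|lebesgue_on {s1..s2}. ?P s2 r + ?Q s1 r)" .
 qed
 then show Li: "integrable (lebesgue_on {0..t}) L" unfolding Lpq by (rule conjunct1)
 have "(LINT r|lebesgue_on {0..0}. H r) = (LINT r|lebesgue_on {0..0}. H r) + (LINT r|lebesgue_on {0..0}. H r)"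
  by (rule lebesgue_on_interval_combine[OF isub[OF Hi order_refl]]) (use t in auto)
 then have F0: "F 0 = - 2 * L2_inner ?M (u 0) (v 0)" by (simp add: F_def)
 have "F t - F 0 <= (LINT r|lebesgue_on {0..t}. L r)" using tele unfolding Lpq by (rule conjunct2)
 then have "- 2 * L2_inner ?M (u t) (v t) + 2 * L2_inner ?M (u 0) (v 0) <= (LINT r|lebesgue_on {0..t}. H r) + t * c + (LINT r|lebesgue_on {0..t}. L r)"
  unfolding F0 by (simp add: F_def)
 moreover have tt: "t : {0..t}" "0 : {0..t}" "0 <= t" using t by auto
 note en[OF tt(1)] flow_energy[OF flow K sub[OF tt(1)]]
 moreover have "(L2_norm ?M (%z. u t z - v t z))^2 = (L2_norm ?M (u t))^2 - 2 * L2_inner ?M (u t) (v t) + (L2_norm ?M (v t))^2"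
  by (rule L2_norm_diff_sq[OF uL[OF tt(3)] vL[OF tt(1)]])
 moreover have "(L2_norm ?M (%z. u 0 z - v 0 z))^2 = (L2_norm ?M (u 0))^2 - 2 * L2_inner ?M (u 0) (v 0) + (L2_norm ?M (v 0))^2"
  by (rule L2_norm_diff_sq[OF uL[OF order_refl] vL[OF tt(2)]])
 moreover have ceq: "(2 * a * sqrt \<epsilon> + 2 * \<epsilon>) * B = c" by (simp add: c_def \<alpha>_def \<beta>_def distrib_right)
 ultimately show "(L2_norm ?M (%z. u t z - v t z))^2 <= (L2_norm ?M (%z. u 0 z - v 0 z))^2
   + t * ((2 * a * sqrt \<epsilon> + 2 * \<epsilon>) * B) + (LINT r|lebesgue_on {0..t}. L r)" unfolding ceq by linarith
qed

text \<open>
 Gronwall's inequality for a bounded function that need not be measurable: it is compared with its supremum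
 against an exponential weight.
\<close>

lemma gronwall_weighted_supremum:
 fixes y :: "real => real"
 assumes T: "0 < T" and k: "0 < k" and y: "!!r. r : {0..T} ==> 0 <= y r" "!!r. r : {0..T} ==> y r <= m0" and Y: "y 0 <= Y"
  and ineq: "!!t. 0 < t ==> t <= T ==>
   \<exists>L. integrable (lebesgue_on {0..t}) L \<and> (\<forall>r\<in>{0..t}. L r <= k * y r) \<and> y t <= Y + (LINT r|lebesgue_on {0..t}. L r)"
  and t: "t : {0..T}"
 shows "y t <= 2 * exp (2 * k * T) * Y"
proof -
 let ?z = "%r. exp (- (2 * k * r)) * y r"
 define m where "m = (SUP r\<in>{0..T}. ?z r)"
 have Y0: "0 <= Y" using y(1)[of 0] Y T by simp
 have zb: "?z r <= m0" if r: "r : {0..T}" for r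
 proof -
  have "exp (- (2 * k * r)) <= 1" using r k by simp
  then have "?z r <= 1 * y r" by (intro mult_right_mono y(1)[OF r])
  then show ?thesis using y(2)[OF r] by simp
 qed
 have bdd: "bdd_above (?z ` {0..T})" using zb by (intro bdd_aboveI2[where M=m0]) auto
 have zm: "?z r <= m" if "r : {0..T}" for r unfolding m_def by (rule cSUP_upper[OF that bdd])
 have ym: "y r <= m * exp (2 * k * r)" if "r : {0..T}" for r
 proof -
  have "exp (2 * k * r) * ?z r <= exp (2 * k * r) * m" by (intro mult_left_mono zm[OF that]) simp
  moreover have e: "exp (2 * k * r) * ?z r = y r" by (simp add: exp_minus)
  ultimately show ?thesis unfolding e by (simp add: mult.commute)
 qed
 have m0: "0 <= m" using zm[of 0] y(1)[of 0] T by simp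
 have "?z r <= Y + m / 2" if r: "r : {0..T}" for r
 proof (cases "r = 0")
  case True then show ?thesis using Y m0 by simp
 next
  case False
  then have r': "0 < r" "r <= T" using r by auto
  obtain L where L: "integrable (lebesgue_on {0..r}) L" "!!q. q : {0..r} ==> L q <= k * y q" "y r <= Y + (LINT q|lebesgue_on {0..r}. L q)"
   using ineq[OF r'] by blast
  let ?g = "%q. k * (m * exp (2 * k * q))"
  have gc: "continuous_on {0..r} ?g" by (intro continuous_intros)
  have gi: "integrable (lebesgue_on {0..r}) ?g"
   by (rule integral_time_lborel(1)) (use borel_integrable_atLeastAtMost'[OF gc] in \<open>simp only: set_integrable_def\<close>)
  have "(?g has_integral (m / 2 * exp (2 * k * r) - m / 2 * exp (2 * k * 0))) {0..r}"
  proof (rule fundamental_theorem_of_calculus)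
   show "((%q. m / 2 * exp (2 * k * q)) has_vector_derivative ?g q) (at q within {0..r})" for q
    unfolding has_real_derivative_iff_has_vector_derivative[symmetric]
    by (auto intro!: derivative_eq_intros)
  qed (use r' in simp)
  then have "integral {0..r} ?g = m / 2 * exp (2 * k * r) - m / 2 * exp (2 * k * 0)" by (rule integral_unique)
  moreover have "(LINT q|lebesgue_on {0..r}. ?g q) = integral {0..r} ?g" by (rule lebesgue_integral_eq_integral[OF gi]) simp
  ultimately have gv: "(LINT q|lebesgue_on {0..r}. ?g q) = m / 2 * exp (2 * k * r) - m / 2"
   by (simp only: mult_zero_right exp_zero mult_1_right)
  have "(LINT q|lebesgue_on {0..r}. L q) <= (LINT q|lebesgue_on {0..r}. ?g q)"
  proof (rule integral_mono[OF L(1) gi])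
   fix q assume "q : space (lebesgue_on {0..r})"
   then have q: "q : {0..r}" "q : {0..T}" using r' by auto
   show "L q <= ?g q" using L(2)[OF q(1)] mult_left_mono[OF ym[OF q(2)], of k] k by linarith
  qed
  then have "y r <= Y + m / 2 * exp (2 * k * r)" using L(3) m0 unfolding gv by linarith
  then have "?z r <= exp (- (2 * k * r)) * (Y + m / 2 * exp (2 * k * r))" by (intro mult_left_mono) auto
  also have "... = exp (- (2 * k * r)) * Y + m / 2" by (simp add: distrib_left exp_minus)
  also have "... <= 1 * Y + m / 2" using r' k Y0 by (intro add_right_mono mult_right_mono) auto
  finally show ?thesis by simp
 qed
 then have "m <= Y + m / 2" unfolding m_def using T by (intro cSUP_least) auto
 then have "m <= 2 * Y" by simp
 have "y t <= m * exp (2 * k * t)" by (rule ym[OF t])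
 also have "... <= (2 * Y) * exp (2 * k * T)" using \<open>m <= 2 * Y\<close> t k Y0 by (intro mult_mono) auto
 finally show ?thesis by (simp add: mult_ac)
qed

text \<open>
 The exponent is twice the constant \<open>4 K\<close> of the differential inequality, the price of the weighted supremum.
\<close>

lemma inviscid_error_bound:
 assumes flow: "regular_flow T K C v D" and K: "0 < K" and T: "0 < T" and ler: "leray_solution a \<epsilon> u0 u" and a: "0 <= a" and \<epsilon>: "0 <= \<epsilon>"
  and B: "!!r. r : {0..T} ==> boundary_inner (v r) (v r) <= B" "!!r. r : {0..T} ==> strain_inner (v r) (v r) <= B"
  and t: "t : {0..T}"
 shows "(nrm (%z. u t z - v t z))^2 <= 2 * exp (8 * K * T) *
   ((nrm (%z. u 0 z - v 0 z))^2 + T * ((2 * a * sqrt \<epsilon> + 2 * \<epsilon>) * B))"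
proof -
 let ?M = "\<mu>"
 define y where "y r = (L2_norm ?M (%z. u r z - v r z))^2" for r
 define c where "c = (2 * a * sqrt \<epsilon> + 2 * \<epsilon>) * B"
 have K0: "0 <= K" using K by simp
 have us: "u r : L2_sigma" if "r : {0..T}" for r using ler that by (simp add: leray_solution_def)
 have uL: "u r : L2 ?M" if "r : {0..T}" for r using us[OF that] by (simp add: solenoidal_def)
 note vL = regular_flowD(3)[OF flow]
 have B0: "0 <= B" using order_trans[OF boundary_inner_self_nonneg B(1)[OF t]] .
 have c0: "0 <= c" using a \<epsilon> B0 by (simp add: c_def)
 have uU: "L2_norm ?M (u r) <= L2_norm ?M (u 0)" if r: "r : {0..T}" for r
 proof (rule power2_le_imp_le)
  have n: "0 <= 4 * a * sqrt \<epsilon> * (LINT q|lebesgue_on {0..r}. boundary_inner (u q) (u q))"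
   "0 <= 4 * \<epsilon> * (LINT q|lebesgue_on {0..r}. strain_inner (u q) (u q))"
   using a \<epsilon> by (intro mult_nonneg_nonneg integral_nonneg_AE AE_I2 boundary_inner_self_nonneg strain_inner_self_nonneg; simp)+
  have "(L2_norm ?M (u r))^2 + 4 * a * sqrt \<epsilon> * (LINT q|lebesgue_on {0..r}. boundary_inner (u q) (u q))
    + 4 * \<epsilon> * (LINT q|lebesgue_on {0..r}. strain_inner (u q) (u q)) <= (L2_norm ?M (u 0))^2"
   using ler r unfolding leray_solution_def by simp
  then show "(L2_norm ?M (u r))^2 <= (L2_norm ?M (u 0))^2" using n by linarith
 qed simp
 have "y t <= 2 * exp (2 * (4 * K) * T) * (y 0 + T * c)"
 proof (rule gronwall_weighted_supremum[OF T, of "4 * K" y "(L2_norm ?M (u 0) + C)^2"])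
  show "0 < 4 * K" using K by simp
  show "0 <= y r" for r by (simp add: y_def)
  show "y r <= (L2_norm ?M (u 0) + C)^2" if r: "r : {0..T}" for r
   unfolding y_def
  proof (rule power_mono)
   have "L2_norm ?M (%z. u r z - v r z) <= L2_norm ?M (u r) + L2_norm ?M (v r)"
    using L2_norm_triangle[OF uL[OF r] L2_uminus[OF vL[OF r]]] L2_norm_scaleR[of ?M "-1" "v r"] by simp
   then show "L2_norm ?M (%z. u r z - v r z) <= L2_norm ?M (u 0) + C" using uU[OF r] regular_flowD(5)[OF flow r] by linarith
  qed simp
  show "y 0 <= y 0 + T * c" using T c0 by simp
  fix s assume s: "0 < s" "s <= T"
  let ?L = "%r. 2 * (L2_inner ?M (u r) (%z. D r z (v r z)) - trilinear (u r) (v r) (u r))"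
  note re = relative_energy_inequality[OF flow K0 ler a \<epsilon> B s]
  show "\<exists>L. integrable (lebesgue_on {0..s}) L \<and> (\<forall>r\<in>{0..s}. L r <= 4 * K * y r) \<and> y s <= y 0 + T * c + (LINT r|lebesgue_on {0..s}. L r)"
  proof (intro exI[of _ ?L] conjI ballI)
   show "integrable (lebesgue_on {0..s}) ?L" by (rule re(1))
   fix r assume "r : {0..s}"
   then have r: "r : {0..T}" using s by auto
   show "?L r <= 4 * K * y r" using flow_convective_error(1)[OF flow K0 r us[OF r]] by (simp add: y_def)
  next
   have "s * c <= T * c" using s c0 by (intro mult_right_mono) auto
   then show "y s <= y 0 + T * c + (LINT r|lebesgue_on {0..s}. ?L r)" using re(2) unfolding y_def c_def by linarith
  qed
 qed (rule t)
 then show ?thesis by (simp add: y_def c_def)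
qed

text \<open>
 Both quantities are controlled by the norm of \<open>v(t)\<close> in \<open>H\<^sup>1\<close>.
\<close>

lemma flow_boundary_strain_bound:
 assumes flow: "regular_flow T K C v D" and T: "0 <= T"
 obtains B where "!!r. r : {0..T} ==> boundary_inner (v r) (v r) <= B" "!!r. r : {0..T} ==> strain_inner (v r) (v r) <= B"
proof -
 let ?M = "\<mu>"
 have C: "0 <= C" using order_trans[OF L2_norm_nonneg regular_flowD(5)[OF flow, of 0]] T by simp
 obtain Cb where Cb: "0 <= Cb" "!!f g. f : Hs 1 ==> g : Hs 1 ==> \<bar>boundary_inner f g\<bar> <= Cb * (Hs_norm 1 f * Hs_norm 1 g)"
  by (rule H1_form_bound[OF H1_form_boundary]) blast
 obtain Cs where Cs: "0 <= Cs" "!!f g. f : Hs 1 ==> g : Hs 1 ==> \<bar>strain_inner f g\<bar> <= Cs * (Hs_norm 1 f * Hs_norm 1 g)"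
  by (rule H1_form_bound[OF H1_form_strain]) blast
 have N: "Hs_norm 1 (v r) * Hs_norm 1 (v r) <= 3 * C\<^sup>2" if r: "r : {0..T}" for r
 proof -
  note F = regular_flowD[OF flow r]
  have w: "(L2_norm ?M (weak_deriv [i] (v r)))^2 <= C\<^sup>2" if i: "i : Basis" for i
  proof -
   have "L2_norm ?M (weak_deriv [i] (v r)) = L2_norm ?M (%z. D r z i)"
    by (rule L2_norm_cong_AE[OF L2_measurable[OF Hs_1_weak_deriv(2)[OF F(2) i]] F(11)[OF i] flow_weak_deriv_bound(1)[OF flow r i]])
   then show ?thesis using F(10)[OF i] by (intro power_mono) auto
  qed
  have "(L2_norm ?M (v r))^2 <= C\<^sup>2" using F(5) by (intro power_mono) auto
  then have "(Hs_norm 1 (v r))^2 <= C\<^sup>2 + (C\<^sup>2 + C\<^sup>2)"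
   unfolding Hs_norm_1_sq[OF F(2)] sum_Basis_point by (intro add_mono w) (auto simp: Basis_point)
  then show ?thesis by (simp add: power2_eq_square)
 qed
 show ?thesis
 proof (rule that[of "(Cb + Cs) * (3 * C\<^sup>2)"])
  fix r assume r: "r : {0..T}"
  note vH = regular_flowD(2)[OF flow r]
  have "boundary_inner (v r) (v r) <= Cb * (3 * C\<^sup>2)"
   using Cb(2)[OF vH vH] mult_left_mono[OF N[OF r] Cb(1)] by linarith
  also have "... <= (Cb + Cs) * (3 * C\<^sup>2)" using Cs(1) by (intro mult_right_mono) auto
  finally show "boundary_inner (v r) (v r) <= (Cb + Cs) * (3 * C\<^sup>2)" .
  have "strain_inner (v r) (v r) <= Cs * (3 * C\<^sup>2)"
   using Cs(2)[OF vH vH] mult_left_mono[OF N[OF r] Cs(1)] by linarith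
  also have "... <= (Cb + Cs) * (3 * C\<^sup>2)" using Cb(1) by (intro mult_right_mono) auto
  finally show "strain_inner (v r) (v r) <= (Cb + Cs) * (3 * C\<^sup>2)" .
 qed
qed

theorem theorem1p1:
  fixes a s :: real
    and u0 :: "real \<Rightarrow> field" and u :: "real \<Rightarrow> real \<Rightarrow> field"
    and v0 :: field and v :: "real \<Rightarrow> field"
  assumes "a > 0"
    and "\<And>\<epsilon>. \<epsilon> > 0 \<Longrightarrow> u0 \<epsilon> \<in> L2_sigma"
    and "\<And>\<epsilon>. \<epsilon> > 0 \<Longrightarrow> leray_solution a \<epsilon> (u0 \<epsilon>) (u \<epsilon>)"
    and "s > 2"
    and "v0 \<in> Hs s"
    and "euler_solution s v0 v"
    and "((\<lambda>\<epsilon>. L2_norm (lebesgue_on \<Omega>) (\<lambda>z. u0 \<epsilon> z - v0 z)) \<longlongrightarrow> 0) (at_right 0)"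
  shows "\<forall>T > 0. ((\<lambda>\<epsilon>. SUP t\<in>{0..T}. L2_norm (lebesgue_on \<Omega>) (\<lambda>z. u \<epsilon> t z - v t z))
           \<longlongrightarrow> 0) (at_right 0)"
proof (intro allI impI)
 fix T :: real assume T: "T > 0"
 let ?M = "\<mu>"
 obtain K C D where K: "K > 0" and flow: "regular_flow T K C v D"
  by (rule euler_regular_flow[OF assms(4,6) T]) blast
 obtain B where B: "!!r. r : {0..T} ==> boundary_inner (v r) (v r) <= B" "!!r. r : {0..T} ==> strain_inner (v r) (v r) <= B"
  by (rule flow_boundary_strain_bound[OF flow less_imp_le[OF T]]) blast
 define N where "N \<epsilon> = L2_norm ?M (%z. u0 \<epsilon> z - v0 z)" for \<epsilon>
 define R where "R \<epsilon> = sqrt (2 * exp (8 * K * T) * ((N \<epsilon>)^2 + T * ((2 * a * sqrt \<epsilon> + 2 * \<epsilon>) * B)))" for \<epsilon>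
 have T0: "0 : {0..T}" using T by simp
 have bound: "L2_norm ?M (%z. u \<epsilon> t z - v t z) <= R \<epsilon>" if \<epsilon>: "\<epsilon> > 0" and t: "t : {0..T}" for \<epsilon> t
 proof -
  note ler = assms(3)[OF \<epsilon>]
  have uL: "u \<epsilon> 0 : L2 ?M" "u0 \<epsilon> : L2 ?M"
   using ler assms(2)[OF \<epsilon>] by (simp_all add: leray_solution_def solenoidal_def)
  have vL: "v 0 : L2 ?M" "v0 : L2 ?M" using regular_flowD(3)[OF flow T0] assms(5) by (simp_all add: Hs_def)
  have "AE z in ?M. u \<epsilon> 0 z = u0 \<epsilon> z" "AE z in ?M. v 0 z = v0 z"
   using ler assms(6) unfolding leray_solution_def euler_solution_def by blast+
  then have ae: "AE z in ?M. u \<epsilon> 0 z - v 0 z = u0 \<epsilon> z - v0 z" by eventually_elim simp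
  have N: "L2_norm ?M (%z. u \<epsilon> 0 z - v 0 z) = N \<epsilon>"
   unfolding N_def by (rule L2_norm_cong_AE[OF L2_measurable[OF L2_diff[OF uL(1) vL(1)]] L2_measurable[OF L2_diff[OF uL(2) vL(2)]] ae])
  have "(L2_norm ?M (%z. u \<epsilon> t z - v t z))^2 <= 2 * exp (8 * K * T) * ((N \<epsilon>)^2 + T * ((2 * a * sqrt \<epsilon> + 2 * \<epsilon>) * B))"
   unfolding N[symmetric]
   by (rule inviscid_error_bound[OF flow K T ler less_imp_le[OF assms(1)] less_imp_le[OF \<epsilon>] B t])
  then show ?thesis unfolding R_def by (rule real_le_rsqrt)
 qed
 have "(R \<longlongrightarrow> sqrt (2 * exp (8 * K * T) * (0\<^sup>2 + T * ((2 * a * sqrt 0 + 2 * 0) * B)))) (at_right 0)"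
  unfolding R_def[abs_def] N_def by (intro tendsto_intros assms(7))
 then have R: "(R \<longlongrightarrow> 0) (at_right 0)" by simp
 have pos: "\<forall>\<^sub>F \<epsilon> in at_right 0. (0::real) < \<epsilon>" by (rule eventually_at_right_less)
 show "((%\<epsilon>. SUP t\<in>{0..T}. L2_norm ?M (%z. u \<epsilon> t z - v t z)) \<longlongrightarrow> 0) (at_right 0)"
 proof (rule tendsto_sandwich[OF _ _ tendsto_const R])
  show "\<forall>\<^sub>F \<epsilon> in at_right 0. 0 <= (SUP t\<in>{0..T}. L2_norm ?M (%z. u \<epsilon> t z - v t z))"
   using pos
  proof eventually_elim
   case (elim \<epsilon>)
   have "bdd_above ((%t. L2_norm ?M (%z. u \<epsilon> t z - v t z)) ` {0..T})"
    by (rule bdd_aboveI2[where M="R \<epsilon>"]) (rule bound[OF elim])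
   from cSUP_upper[OF T0 this] show ?case using L2_norm_nonneg order_trans by blast
  qed
  show "\<forall>\<^sub>F \<epsilon> in at_right 0. (SUP t\<in>{0..T}. L2_norm ?M (%z. u \<epsilon> t z - v t z)) <= R \<epsilon>"
   using pos
  proof eventually_elim
   case (elim \<epsilon>)
   show ?case by (rule cSUP_least) (use T bound[OF elim] in auto)
  qed
 qed
qed

end
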